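(* Assume the Elliott–Halberstam conjecture. Then for every sufficiently small fixed $\eta>0$, \[ \liminf_{N\to\infty} \frac{\#\{j : N < p_j \le 2N,\ p_{j+2}-p_j \le \eta\log N\}}{N/\log N} \ \ge\ e^{c_7\eta^{-2}\log \eta}, \] where $c_7=5$ is admissible (for $\eta$ small enough).
   Context: $p_j$ denotes the $j$-th prime. The Elliott–Halberstam conjecture asserts that for every $A>0$ and every $\epsilon>0$, with $Q=N^{1-\epsilon}$, \[ \sum_{q\le Q}\max_{a:\,(a,q)=1}\Big|\sum_{\substack{p\le N \text{ prime}\\ p\equiv a \ (\mathrm{mod}\ q)}}\log p - \frac{N}{\phi(q)}\Big| \ll_{\epsilon,A} \frac{N}{(\log N)^A}. \] *)

theory Defs
  imports
    "HOL-Analysis.Analysis"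
    "HOL-Library.Landau_Symbols"
    "HOL-Number_Theory.Number_Theory"
begin

text \<open>Primes are numbered from 1, so \<open>nth_prime 1 = 2\<close>; the value at 0 is meaningless.\<close>

definition nth_prime :: "nat \<Rightarrow> nat" where
  "nth_prime j = enumerate {p. prime p} (j - 1)"

definition theta_progression :: "nat \<Rightarrow> nat \<Rightarrow> nat \<Rightarrow> real" where
  "theta_progression N q a = (\<Sum>p | prime p \<and> p \<le> N \<and> [p = a] (mod q). ln (real p))"

text \<open>The set \<open>totatives q\<close> is a system of representatives of the reduced residue
  classes modulo \<open>q\<close>, so the maximum is over all residue classes coprime to \<open>q\<close>.\<close>

definition Elliott_Halberstam :: bool where
  "Elliott_Halberstam \<longleftrightarrow>
    (\<forall>A>0. \<forall>\<epsilon>>0.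
      (\<lambda>N::nat. \<Sum>q | 1 \<le> q \<and> real q \<le> real N powr (1 - \<epsilon>).
         MAX a\<in>totatives q. \<bar>theta_progression N q a - real N / real (totient q)\<bar>)
      \<in> O(\<lambda>N. real N / ln (real N) powr A))"

end

theory Submission
  imports Defs "HOL-Real_Asymp.Real_Asymp"
begin

text \<open>
  Since \<open>5 / \<eta>\<^sup>2\<close> eventually exceeds any constant exponent, it suffices to find one fixed \<open>k\<close> such
  that a proportion \<open>c * \<eta> ^ (2 * k)\<close> of the \<open>n \<in> (N, 2 * N]\<close> has three primes in
  \<open>(n, n + \<eta> * ln N]\<close>: each pair of close prime gaps arises from at most \<open>\<eta> * ln N\<close> such \<open>n\<close>.

  Under the Elliott-Halberstam hypothesis Maynard's multidimensional sieve shows, for \<open>k\<close> large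
  and every tuple \<open>H\<close> of \<open>k\<close> shifts without unusually many small prime factors in its
  differences, that at least \<open>c * N / (ln N) ^ k\<close> of the \<open>n\<close> have three primes among the
  \<open>n + h\<close>, with all \<open>n + h\<close> free of prime factors below \<open>N powr \<xi>\<close>. Restricting to such rough
  \<open>n\<close> bounds the sieve weight, so that a weighted lower bound becomes a count. Summing over all
  \<open>H\<close> in a grid of about \<open>\<eta> * ln N\<close> shifts and applying the Cauchy-Schwarz inequality reduces the claim
  to an upper bound for the number of \<open>n\<close> that are rough for both \<open>H\<close> and \<open>H'\<close>, which the
  Selberg sieve applied to \<open>H \<union> H'\<close> and an average of the singular series provide.

  The quadratic forms of the sieve are tensor products over the primes, so inequalities between
  them are proved one prime at a time; no identity with exact constants is needed.
\<close>

subsection \<open>Tensor products of quadratic forms\<close>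

text \<open>Every comparison of forms loses a constant factor. This is harmless because the losses
  do not depend on \<open>k\<close>, whereas the expected number of primes among the
  \<open>n + h\<close> grows like \<open>ln k\<close>: it is of order
  \<open>k * L0^2 / (GG * L)\<close> divided by \<open>totient W / W\<close>, and \<open>A\<close>
  and \<open>k\<close> can be balanced so that this passes any bound while the mass of
  \<open>g^2\<close> still sits at small arguments. Fixing \<open>n\<close> modulo the primorial
  \<open>W\<close> pushes all arithmetic irregularity beyond \<open>D\<close>; what remains are sums
  of \<open>1 / p^2\<close> over \<open>p > D\<close> and sums of \<open>1 / p\<close> over the few
  primes dividing a difference of shifts. Passing to rough \<open>n\<close> is affordable because
  \<open>y\<close> varies slowly with \<open>ln siz\<close>: the integers with
  \<open>p dvd n + h\<close> carry a share of the weight of about \<open>(ln p / L)^2 / p\<close>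
  instead of \<open>1 / p\<close>, and over \<open>p \<le> z\<close> these shares add up to about
  \<open>(ln z / L)^2\<close>, which is small when \<open>\<xi>\<close> is small.\<close>

lemma sum_PiE_insert:
  fixes F :: "('a \<Rightarrow> 's) \<Rightarrow> 'b::comm_monoid_add"
  assumes "p \<notin> I"
  shows "(\<Sum>f\<in>insert p I \<rightarrow>\<^sub>E S. F f) = (\<Sum>s\<in>S. \<Sum>f\<in>I \<rightarrow>\<^sub>E S. F (f(p := s)))"
proof -
  have "(\<Sum>f\<in>insert p I \<rightarrow>\<^sub>E S. F f)
      = sum F ((\<lambda>(y, g). g(p := y)) ` (S \<times> (I \<rightarrow>\<^sub>E S)))"
    by (simp only: PiE_insert_eq)
  also have "\<dots> = (\<Sum>x\<in>S \<times> (I \<rightarrow>\<^sub>E S). F ((\<lambda>(y, g). g(p := y)) x))"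
    using inj_combinator[OF assms, of "\<lambda>_. S"] by (subst sum.reindex) (auto simp: o_def)
  also have "\<dots> = (\<Sum>s\<in>S. \<Sum>f\<in>I \<rightarrow>\<^sub>E S. F (f(p := s)))"
    by (simp add: sum.cartesian_product case_prod_unfold)
  finally show ?thesis .
qed

lemma prod_fun_upd_insert:
  assumes "finite I" "p \<notin> I"
  shows "(\<Prod>q\<in>insert p I. K q ((f(p := s)) q)) = K p s * (\<Prod>q\<in>I. (K q (f q) :: 'b::comm_monoid_mult))"
proof -
  have "(\<Prod>q\<in>I. K q ((f(p := s)) q)) = (\<Prod>q\<in>I. K q (f q))"
    using assms by (intro prod.cong) auto
  thus ?thesis using assms by simp
qed

lemma prod_fun_upd_insert2:
  assumes "finite I" "p \<notin> I"
  shows "(\<Prod>q\<in>insert p I. K q ((f(p := s)) q) ((g(p := t)) q))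
      = K p s t * (\<Prod>q\<in>I. (K q (f q) (g q) :: 'b::comm_monoid_mult))"
proof -
  have "(\<Prod>q\<in>I. K q ((f(p := s)) q) ((g(p := t)) q)) = (\<Prod>q\<in>I. K q (f q) (g q))"
    using assms by (intro prod.cong) auto
  thus ?thesis using assms by simp
qed

text \<open>An inequality between diagonalised quadratic forms survives tensor products; the diagonal
  weights \<open>P\<close> and \<open>D\<close> being nonnegative is what makes the induction over the factors work.\<close>

lemma tensor_quadratic_form_le:
  fixes P D :: "'a \<Rightarrow> 's \<Rightarrow> real" and A B :: "'a \<Rightarrow> 's \<Rightarrow> 's \<Rightarrow> real"
  assumes "finite I" "finite S"
    and "\<And>p s. p \<in> I \<Longrightarrow> s \<in> S \<Longrightarrow> 0 \<le> P p s" "\<And>p s. p \<in> I \<Longrightarrow> s \<in> S \<Longrightarrow> 0 \<le> D p s"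
    and "\<And>p x. p \<in> I \<Longrightarrow> (\<Sum>s\<in>S. P p s * (\<Sum>t\<in>S. B p s t * x t)\<^sup>2)
            \<le> (\<Sum>s\<in>S. D p s * (\<Sum>t\<in>S. A p s t * x t)\<^sup>2)"
  shows "(\<Sum>u\<in>I \<rightarrow>\<^sub>E S. (\<Prod>p\<in>I. P p (u p)) * (\<Sum>d\<in>I \<rightarrow>\<^sub>E S. (\<Prod>p\<in>I. B p (u p) (d p)) * l d)\<^sup>2)
      \<le> (\<Sum>u\<in>I \<rightarrow>\<^sub>E S. (\<Prod>p\<in>I. D p (u p)) * (\<Sum>d\<in>I \<rightarrow>\<^sub>E S. (\<Prod>p\<in>I. A p (u p) (d p)) * l d)\<^sup>2)"
  using assms(1,3-5)
proof (induction I arbitrary: l rule: finite_induct)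
  case empty
  thus ?case by simp
next
  case (insert p I)
  define X where "X u t = (\<Sum>d\<in>I \<rightarrow>\<^sub>E S. (\<Prod>q\<in>I. B q (u q) (d q)) * l (d(p := t)))" for u t
  have expand: "(\<Sum>d\<in>insert p I \<rightarrow>\<^sub>E S. (\<Prod>q\<in>insert p I. K q ((u(p := s)) q) (d q)) * l d)
      = (\<Sum>t\<in>S. K p s t * (\<Sum>d\<in>I \<rightarrow>\<^sub>E S. (\<Prod>q\<in>I. K q (u q) (d q)) * l (d(p := t))))"
    for K :: "'a \<Rightarrow> 's \<Rightarrow> 's \<Rightarrow> real" and u s
    unfolding sum_PiE_insert[OF insert.hyps(2)] prod_fun_upd_insert2[OF insert.hyps]
    by (simp add: sum_distrib_left mult.assoc)
  have "(\<Sum>u\<in>insert p I \<rightarrow>\<^sub>E S. (\<Prod>q\<in>insert p I. P q (u q)) *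
           (\<Sum>d\<in>insert p I \<rightarrow>\<^sub>E S. (\<Prod>q\<in>insert p I. B q (u q) (d q)) * l d)\<^sup>2)
      = (\<Sum>s\<in>S. \<Sum>u\<in>I \<rightarrow>\<^sub>E S. P p s * (\<Prod>q\<in>I. P q (u q)) * (\<Sum>t\<in>S. B p s t * X u t)\<^sup>2)"
    unfolding sum_PiE_insert[OF insert.hyps(2), where F = "\<lambda>u. (\<Prod>q\<in>insert p I. P q (u q)) * _ u"]
      expand prod_fun_upd_insert[OF insert.hyps, of P] X_def ..
  also have "\<dots> = (\<Sum>u\<in>I \<rightarrow>\<^sub>E S. (\<Prod>q\<in>I. P q (u q)) * (\<Sum>s\<in>S. P p s * (\<Sum>t\<in>S. B p s t * X u t)\<^sup>2))"
    by (subst sum.swap) (simp add: sum_distrib_left mult_ac)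
  \<comment> \<open>The coordinate \<open>p\<close> is compared first, with the others frozen in
    \<open>X u\<close>. The induction hypothesis is then needed for a modified \<open>l\<close>,
    which is why \<open>l\<close> is arbitrary in the induction.\<close>
  also have "\<dots> \<le> (\<Sum>u\<in>I \<rightarrow>\<^sub>E S. (\<Prod>q\<in>I. P q (u q)) * (\<Sum>s\<in>S. D p s * (\<Sum>t\<in>S. A p s t * X u t)\<^sup>2))"
  proof (rule sum_mono, rule mult_left_mono)
    fix u assume "u \<in> I \<rightarrow>\<^sub>E S"
    thus "0 \<le> (\<Prod>q\<in>I. P q (u q))" using insert.prems(1) by (intro prod_nonneg) (auto simp: PiE_iff)
  qed (use insert.prems(3) in auto)
  also have "\<dots> = (\<Sum>s\<in>S. D p s * (\<Sum>u\<in>I \<rightarrow>\<^sub>E S. (\<Prod>q\<in>I. P q (u q)) *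
      (\<Sum>d\<in>I \<rightarrow>\<^sub>E S. (\<Prod>q\<in>I. B q (u q) (d q)) * (\<Sum>t\<in>S. A p s t * l (d(p := t))))\<^sup>2))"
  proof -
    have *: "(\<Sum>d\<in>I \<rightarrow>\<^sub>E S. (\<Prod>q\<in>I. B q (u q) (d q)) * (\<Sum>t\<in>S. A p s t * l (d(p := t))))
        = (\<Sum>t\<in>S. A p s t * X u t)" for u s
      unfolding X_def sum_distrib_left by (subst sum.swap) (simp add: mult_ac)
    show ?thesis unfolding *
      by (simp only: sum_distrib_left, subst sum.swap) (simp add: mult_ac)
  qed
  also have "\<dots> \<le> (\<Sum>s\<in>S. D p s * (\<Sum>u\<in>I \<rightarrow>\<^sub>E S. (\<Prod>q\<in>I. D q (u q)) *
      (\<Sum>d\<in>I \<rightarrow>\<^sub>E S. (\<Prod>q\<in>I. A q (u q) (d q)) * (\<Sum>t\<in>S. A p s t * l (d(p := t))))\<^sup>2))"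
    by (rule sum_mono, rule mult_left_mono, rule insert.IH) (use insert.prems in auto)
  also have "\<dots> = (\<Sum>s\<in>S. \<Sum>u\<in>I \<rightarrow>\<^sub>E S. D p s * (\<Prod>q\<in>I. D q (u q)) *
      (\<Sum>t\<in>S. A p s t * (\<Sum>d\<in>I \<rightarrow>\<^sub>E S. (\<Prod>q\<in>I. A q (u q) (d q)) * l (d(p := t))))\<^sup>2)"
  proof -
    have *: "(\<Sum>d\<in>I \<rightarrow>\<^sub>E S. (\<Prod>q\<in>I. A q (u q) (d q)) * (\<Sum>t\<in>S. A p s t * l (d(p := t))))
        = (\<Sum>t\<in>S. A p s t * (\<Sum>d\<in>I \<rightarrow>\<^sub>E S. (\<Prod>q\<in>I. A q (u q) (d q)) * l (d(p := t))))" for u s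
      unfolding sum_distrib_left by (subst sum.swap) (simp add: mult_ac)
    show ?thesis unfolding * by (simp add: sum_distrib_left mult_ac)
  qed
  also have "\<dots> = (\<Sum>u\<in>insert p I \<rightarrow>\<^sub>E S. (\<Prod>q\<in>insert p I. D q (u q)) *
           (\<Sum>d\<in>insert p I \<rightarrow>\<^sub>E S. (\<Prod>q\<in>insert p I. A q (u q) (d q)) * l d)\<^sup>2)"
    unfolding sum_PiE_insert[OF insert.hyps(2), where F = "\<lambda>u. (\<Prod>q\<in>insert p I. D q (u q)) * _ u"]
      expand prod_fun_upd_insert[OF insert.hyps, of D] ..
  finally show ?case .
qed

lemma tensor_product_compose:
  fixes A B :: "'a \<Rightarrow> 's \<Rightarrow> 's \<Rightarrow> real"
  assumes "finite I" "finite S"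
  shows "(\<Sum>d\<in>I \<rightarrow>\<^sub>E S. (\<Prod>p\<in>I. A p (r p) (d p)) * (\<Sum>s\<in>I \<rightarrow>\<^sub>E S. (\<Prod>p\<in>I. B p (d p) (s p)) * y s))
       = (\<Sum>s\<in>I \<rightarrow>\<^sub>E S. (\<Prod>p\<in>I. \<Sum>t\<in>S. A p (r p) t * B p t (s p)) * y s)"
proof -
  have "(\<Sum>d\<in>I \<rightarrow>\<^sub>E S. (\<Prod>p\<in>I. A p (r p) (d p)) * (\<Sum>s\<in>I \<rightarrow>\<^sub>E S. (\<Prod>p\<in>I. B p (d p) (s p)) * y s))
      = (\<Sum>s\<in>I \<rightarrow>\<^sub>E S. \<Sum>d\<in>I \<rightarrow>\<^sub>E S. (\<Prod>p\<in>I. A p (r p) (d p) * B p (d p) (s p)) * y s)"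
    unfolding sum_distrib_left by (subst sum.swap) (simp add: prod.distrib mult_ac)
  also have "\<dots> = (\<Sum>s\<in>I \<rightarrow>\<^sub>E S. (\<Prod>p\<in>I. \<Sum>t\<in>S. A p (r p) t * B p t (s p)) * y s)"
    using assms by (simp add: prod_sum_PiE sum_distrib_right)
  finally show ?thesis .
qed

lemma tensor_diagonal:
  fixes M :: "'a \<Rightarrow> 's \<Rightarrow> 's \<Rightarrow> real"
  assumes "finite I" "finite S" "r \<in> I \<rightarrow>\<^sub>E S" "\<And>p s t. p \<in> I \<Longrightarrow> s \<noteq> t \<Longrightarrow> M p s t = 0"
  shows "(\<Sum>s\<in>I \<rightarrow>\<^sub>E S. (\<Prod>p\<in>I. M p (r p) (s p)) * y s) = (\<Prod>p\<in>I. M p (r p) (r p)) * y r"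
proof -
  have "(\<Sum>s\<in>I \<rightarrow>\<^sub>E S. (\<Prod>p\<in>I. M p (r p) (s p)) * y s)
      = (\<Sum>s\<in>I \<rightarrow>\<^sub>E S. if s = r then (\<Prod>p\<in>I. M p (r p) (r p)) * y r else 0)"
  proof (rule sum.cong[OF refl])
    fix s assume s: "s \<in> I \<rightarrow>\<^sub>E S"
    show "(\<Prod>p\<in>I. M p (r p) (s p)) * y s = (if s = r then (\<Prod>p\<in>I. M p (r p) (r p)) * y r else 0)"
    proof (cases "s = r")
      case False
      then obtain p where "p \<in> I" "s p \<noteq> r p"
        using PiE_ext[OF s assms(3)] by blast
      hence "(\<Prod>p\<in>I. M p (r p) (s p)) = 0" using assms(1,4) by (intro prod_zero) metis+
      thus ?thesis using False by simp
    qed simp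
  qed
  also have "\<dots> = (\<Prod>p\<in>I. M p (r p) (r p)) * y r"
    using assms by (simp add: finite_PiE)
  finally show ?thesis .
qed

subsection \<open>The quadratic forms of the sieve\<close>

text \<open>Since the shifts are distinct modulo every sieving prime, such a prime divides at most
  one \<open>n + h\<close>; one option value per prime can therefore replace a tuple of divisors.
  The factor 10 keeps all local densities and their lower bounds positive, in particular
  \<open>1 - 5 * card H / p\<close>.\<close>

locale tuple_sieve =
  fixes PP H :: "nat set"
  assumes finite_PP: "finite PP" and prime_PP: "\<And>p. p \<in> PP \<Longrightarrow> prime p"
    and finite_H: "finite H"
    and distinct_mod: "\<And>p h h'. p \<in> PP \<Longrightarrow> h \<in> H \<Longrightarrow> h' \<in> H \<Longrightarrow> [h = h'] (mod p) \<Longrightarrow> h = h'"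
    and large_PP: "\<And>p. p \<in> PP \<Longrightarrow> 10 * (card H + 1) \<le> p"
begin

definition St :: "nat option set" where "St = insert None (Some ` H)"

definition Om :: "(nat \<Rightarrow> nat option) set" where "Om = (PP \<rightarrow>\<^sub>E St)"

text \<open>An element \<open>d\<close> of \<open>Om\<close> encodes the tuple of pairwise coprime squarefree numbers
  \<open>part d h\<close>, \<open>h \<in> H\<close>, by listing for each prime the component it divides.\<close>

definition siz :: "(nat \<Rightarrow> nat option) \<Rightarrow> nat" where
  "siz d = (\<Prod>p\<in>PP. case d p of None \<Rightarrow> 1 | Some _ \<Rightarrow> p)"

definition part :: "(nat \<Rightarrow> nat option) \<Rightarrow> nat \<Rightarrow> nat" where
  "part d h = \<Prod>{p \<in> PP. d p = Some h}"

definition dvs :: "(nat \<Rightarrow> nat option) \<Rightarrow> nat \<Rightarrow> bool" where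
  "dvs d n \<longleftrightarrow> (\<forall>p\<in>PP. \<forall>h. d p = Some h \<longrightarrow> p dvd n + h)"

text \<open>Equals 1 exactly when a prime in state \<open>u\<close> meets the divisibility condition
  demanded by \<open>t\<close>; \<open>None\<close> demands nothing.\<close>

definition inc :: "nat option \<Rightarrow> nat option \<Rightarrow> real" where
  "inc u t = (if t = None \<or> t = u then 1 else 0)"

text \<open>If \<open>u p\<close> records which \<open>n + h\<close>, if any, the prime \<open>p\<close> divides, for random independent residues with
  distribution \<open>P p\<close>, then \<open>form P l\<close> is the expected value of \<open>weight l n\<close>.\<close>

definition form :: "(nat \<Rightarrow> nat option \<Rightarrow> real) \<Rightarrow> ((nat \<Rightarrow> nat option) \<Rightarrow> real) \<Rightarrow> real" where
  "form P l = (\<Sum>u\<in>Om. (\<Prod>p\<in>PP. P p (u p)) * (\<Sum>d\<in>Om. (\<Prod>p\<in>PP. inc (u p) (d p)) * l d)\<^sup>2)"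

text \<open>Mass under \<open>P p\<close> of the states that meet both \<open>s\<close> and
  \<open>t\<close>: the joint density of two divisors at one prime.\<close>

definition kap :: "(nat \<Rightarrow> nat option \<Rightarrow> real) \<Rightarrow> nat \<Rightarrow> nat option \<Rightarrow> nat option \<Rightarrow> real" where
  "kap P p s t = (\<Sum>u\<in>St. P p u * inc u s * inc u t)"

text \<open>Inverse to \<open>A1\<close> up to a sign on each \<open>Some h\<close> (see
  \<open>A1_Bt\<close>), so that the upper bound for uniform \<open>n\<close> becomes diagonal in
  \<open>y\<close>.\<close>

definition Bt :: "nat \<Rightarrow> nat option \<Rightarrow> nat option \<Rightarrow> real" where
  "Bt p s t = (case s of None \<Rightarrow> (case t of None \<Rightarrow> 1 | Some _ \<Rightarrow> 1 / real p)
     | Some h \<Rightarrow> if t = Some h then -1 else 0)"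

text \<open>Maynard's change of variables from \<open>y\<close> to \<open>\<lambda>\<close>, one prime at a time.\<close>

definition lam :: "((nat \<Rightarrow> nat option) \<Rightarrow> real) \<Rightarrow> (nat \<Rightarrow> nat option) \<Rightarrow> real" where
  "lam y d = (\<Sum>r\<in>Om. (\<Prod>p\<in>PP. Bt p (d p) (r p)) * y r)"

definition weight :: "((nat \<Rightarrow> nat option) \<Rightarrow> real) \<Rightarrow> nat \<Rightarrow> real" where
  "weight l n = (\<Sum>d\<in>Om. of_bool (dvs d n) * l d)\<^sup>2"

lemma finite_St [simp]: "finite St" by (simp add: St_def finite_H)

lemma finite_Om [simp]: "finite Om" by (simp add: Om_def finite_PP finite_PiE)

lemma sum_St: "(\<Sum>s\<in>St. f s) = f None + (\<Sum>h\<in>H. f (Some h) :: 'b::comm_monoid_add)"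
proof -
  have "(\<Sum>s\<in>St. f s) = f None + (\<Sum>s\<in>Some ` H. f s)"
    unfolding St_def by (subst sum.insert) (auto simp: finite_H)
  also have "(\<Sum>s\<in>Some ` H. f s) = (\<Sum>h\<in>H. f (Some h))"
    by (subst sum.reindex) auto
  finally show ?thesis .
qed

lemma weight_nonneg: "weight l n \<ge> 0" by (simp add: weight_def)

lemma form_expand: "form P l = (\<Sum>d\<in>Om. \<Sum>e\<in>Om. l d * l e * (\<Prod>p\<in>PP. kap P p (d p) (e p)))"
proof -
  have "form P l = (\<Sum>u\<in>Om. \<Sum>d\<in>Om. \<Sum>e\<in>Om.
      l d * l e * (\<Prod>p\<in>PP. P p (u p) * inc (u p) (d p) * inc (u p) (e p)))"
    unfolding form_def power2_eq_square sum_product sum_distrib_left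
    by (intro sum.cong refl) (simp add: prod.distrib sum_distrib_left mult_ac)
  also have "\<dots> = (\<Sum>d\<in>Om. \<Sum>e\<in>Om. \<Sum>u\<in>Om.
      l d * l e * (\<Prod>p\<in>PP. P p (u p) * inc (u p) (d p) * inc (u p) (e p)))"
    by (subst sum.swap, rule sum.cong[OF refl], rule sum.swap)
  also have "\<dots> = (\<Sum>d\<in>Om. \<Sum>e\<in>Om. l d * l e * (\<Prod>p\<in>PP. kap P p (d p) (e p)))"
    unfolding kap_def by (simp add: prod_sum_PiE finite_PP sum_distrib_left Om_def)
  finally show ?thesis .
qed

lemma weight_expand: "weight l n = (\<Sum>d\<in>Om. \<Sum>e\<in>Om. l d * l e * of_bool (dvs d n \<and> dvs e n))"
  unfolding weight_def power2_eq_square sum_product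
  by (intro sum.cong refl) (auto simp: of_bool_def)

text \<open>Bridge from counting to forms: once every joint condition \<open>d\<close>,
  \<open>e\<close> is counted with density \<open>kap\<close>, the whole weighted sum is compared
  with \<open>form\<close>. Only pairs in the support of \<open>l\<close> need an estimate.\<close>

lemma weighted_sum_approx:
  assumes "\<And>d e. d \<in> Om \<Longrightarrow> e \<in> Om \<Longrightarrow> l d \<noteq> 0 \<Longrightarrow> l e \<noteq> 0 \<Longrightarrow>
    \<bar>(\<Sum>n\<in>X. v n * of_bool (dvs d n \<and> dvs e n)) - Y * (\<Prod>p\<in>PP. kap P p (d p) (e p))\<bar> \<le> Err d e"
  shows "\<bar>(\<Sum>n\<in>X. v n * weight l n) - Y * form P l\<bar> \<le> (\<Sum>d\<in>Om. \<Sum>e\<in>Om. \<bar>l d\<bar> * \<bar>l e\<bar> * Err d e)"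
proof -
  have "(\<Sum>n\<in>X. v n * weight l n) = (\<Sum>d\<in>Om. \<Sum>n\<in>X. \<Sum>e\<in>Om. l d * l e * (v n * of_bool (dvs d n \<and> dvs e n)))"
    unfolding weight_expand sum_distrib_left
    by (subst sum.swap) (simp add: mult_ac)
  also have "\<dots> = (\<Sum>d\<in>Om. \<Sum>e\<in>Om. l d * l e * (\<Sum>n\<in>X. v n * of_bool (dvs d n \<and> dvs e n)))"
    unfolding sum_distrib_left by (intro sum.cong refl sum.swap)
  finally have "(\<Sum>n\<in>X. v n * weight l n) - Y * form P l = (\<Sum>d\<in>Om. \<Sum>e\<in>Om. l d * l e *
      ((\<Sum>n\<in>X. v n * of_bool (dvs d n \<and> dvs e n)) - Y * (\<Prod>p\<in>PP. kap P p (d p) (e p))))"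
    unfolding form_expand by (simp add: sum_distrib_left sum_subtractf right_diff_distrib mult_ac)
  also have "\<bar>\<dots>\<bar> \<le> (\<Sum>d\<in>Om. \<Sum>e\<in>Om. \<bar>l d * l e *
      ((\<Sum>n\<in>X. v n * of_bool (dvs d n \<and> dvs e n)) - Y * (\<Prod>p\<in>PP. kap P p (d p) (e p)))\<bar>)"
    by (rule order.trans[OF sum_abs], intro sum_mono sum_abs)
  also have "\<dots> \<le> (\<Sum>d\<in>Om. \<Sum>e\<in>Om. \<bar>l d\<bar> * \<bar>l e\<bar> * Err d e)"
  proof (intro sum_mono)
    fix d e assume "d \<in> Om" "e \<in> Om"
    thus "\<bar>l d * l e * ((\<Sum>n\<in>X. v n * of_bool (dvs d n \<and> dvs e n)) - Y * (\<Prod>p\<in>PP. kap P p (d p) (e p)))\<bar>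
        \<le> \<bar>l d\<bar> * \<bar>l e\<bar> * Err d e"
      using assms[of d e]
      by (cases "l d = 0 \<or> l e = 0") (force, simp add: abs_mult mult_left_mono)
  qed
  finally show ?thesis .
qed

text \<open>The local comparison may be with any matrix \<open>A\<close>. Substituting
  \<open>lam y\<close> multiplies \<open>A\<close> by \<open>Bt\<close> at each prime, so only
  products of matrices indexed by \<open>St\<close> remain to be computed.\<close>

lemma form_mono_tensor:
  assumes "\<And>p s. p \<in> PP \<Longrightarrow> s \<in> St \<Longrightarrow> 0 \<le> P p s" "\<And>p s. p \<in> PP \<Longrightarrow> s \<in> St \<Longrightarrow> 0 \<le> D p s"
    and "\<And>p x. p \<in> PP \<Longrightarrow> (\<Sum>s\<in>St. P p s * (\<Sum>t\<in>St. inc s t * x t)\<^sup>2)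
            \<le> (\<Sum>s\<in>St. D p s * (\<Sum>t\<in>St. A p s t * x t)\<^sup>2)"
  shows "form P (lam y) \<le> (\<Sum>r\<in>Om. (\<Prod>p\<in>PP. D p (r p)) *
      (\<Sum>s\<in>Om. (\<Prod>p\<in>PP. \<Sum>t\<in>St. A p (r p) t * Bt p t (s p)) * y s)\<^sup>2)"
  using tensor_quadratic_form_le[where P = P and D = D and A = A and B = "\<lambda>_. inc" and l = "lam y", OF finite_PP finite_St assms]
  unfolding form_def Om_def[symmetric] lam_def
  using tensor_product_compose[OF finite_PP finite_St, of A _ Bt y, folded Om_def] by simp

lemma form_mono_tensor':
  assumes "\<And>p s. p \<in> PP \<Longrightarrow> s \<in> St \<Longrightarrow> 0 \<le> P p s" "\<And>p s. p \<in> PP \<Longrightarrow> s \<in> St \<Longrightarrow> 0 \<le> D p s"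
    and "\<And>p x. p \<in> PP \<Longrightarrow> (\<Sum>s\<in>St. D p s * (\<Sum>t\<in>St. A p s t * x t)\<^sup>2)
            \<le> (\<Sum>s\<in>St. P p s * (\<Sum>t\<in>St. inc s t * x t)\<^sup>2)"
  shows "(\<Sum>r\<in>Om. (\<Prod>p\<in>PP. D p (r p)) *
      (\<Sum>s\<in>Om. (\<Prod>p\<in>PP. \<Sum>t\<in>St. A p (r p) t * Bt p t (s p)) * y s)\<^sup>2) \<le> form P (lam y)"
  using tensor_quadratic_form_le[where P = D and D = P and B = A and A = "\<lambda>_. inc" and l = "lam y", OF finite_PP finite_St assms(2,1,3)]
  unfolding form_def Om_def[symmetric] lam_def
  using tensor_product_compose[OF finite_PP finite_St, of A _ Bt y, folded Om_def] by simp

lemma sum_inc: "s \<in> St \<Longrightarrow> (\<Sum>t\<in>St. inc s t * x t) = (case s of None \<Rightarrow> x None | Some h \<Rightarrow> x None + x (Some h))"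
  unfolding sum_St
  by (cases s) (auto simp: inc_def St_def finite_H if_distrib[of "\<lambda>c. c * _"] sum.delta sum.delta' cong: if_cong)

text \<open>One computation serves two densities: \<open>J = H\<close>, \<open>q = p\<close> gives
  \<open>P1\<close>, and \<open>J = H - {h0}\<close>, \<open>q = p - 1\<close> gives
  \<open>P2\<close>.\<close>

lemma local_form:
  assumes "J \<subseteq> H" "q > 0"
    "P None = 1 - real (card J) / q" "\<And>h. h \<in> H \<Longrightarrow> P (Some h) = (if h \<in> J then 1 / q else 0)"
  shows "(\<Sum>s\<in>St. P s * (\<Sum>t\<in>St. inc s t * x t)\<^sup>2)
     = (x None)\<^sup>2 + 2 * x None * (\<Sum>h\<in>J. x (Some h)) / q + (\<Sum>h\<in>J. (x (Some h))\<^sup>2) / q"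
proof -
  have fJ: "finite J" using assms(1) finite_H finite_subset by blast
  have "(\<Sum>s\<in>St. P s * (\<Sum>t\<in>St. inc s t * x t)\<^sup>2)
      = (\<Sum>s\<in>St. P s * (case s of None \<Rightarrow> x None | Some h \<Rightarrow> x None + x (Some h))\<^sup>2)"
    by (intro sum.cong refl) (simp add: sum_inc)
  also have "\<dots> = (1 - real (card J) / q) * (x None)\<^sup>2
      + (\<Sum>h\<in>H. if h \<in> J then 1 / q * (x None + x (Some h))\<^sup>2 else 0)"
    unfolding sum_St using assms(3,4) by (auto intro!: sum.cong)
  also have "(\<Sum>h\<in>H. if h \<in> J then 1 / q * (x None + x (Some h))\<^sup>2 else 0)
      = (\<Sum>h\<in>J. 1 / q * (x None + x (Some h))\<^sup>2)"
    using assms(1) finite_H by (simp add: sum.inter_restrict[symmetric] Int_absorb1)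
  also have "\<dots> = (\<Sum>h\<in>J. 1 / q * (x None)\<^sup>2 + 2 * x None / q * x (Some h) + 1 / q * (x (Some h))\<^sup>2)"
    by (intro sum.cong refl) (simp add: power2_sum algebra_simps add_divide_distrib)
  also have "\<dots> = real (card J) / q * (x None)\<^sup>2 + 2 * x None / q * (\<Sum>h\<in>J. x (Some h))
      + 1 / q * (\<Sum>h\<in>J. (x (Some h))\<^sup>2)"
    by (simp add: sum.distrib sum_distrib_left)
  finally show ?thesis by (simp add: algebra_simps)
qed

lemma real_card_less: "p \<in> PP \<Longrightarrow> 10 * (real (card H) + 1) \<le> real p"
  using of_nat_mono[OF large_PP[of p], where ?'a = real] by simp

text \<open>The local densities \<open>P1\<close> belong to uniformly distributed \<open>n\<close>, \<open>P1c\<close> to those with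
  \<open>p0 dvd n + h0\<close>, and \<open>P2\<close> to those with \<open>n + h0\<close> prime.\<close>

definition P1 :: "nat \<Rightarrow> nat option \<Rightarrow> real" where
  "P1 p s = (case s of None \<Rightarrow> 1 - real (card H) / real p | Some h \<Rightarrow> 1 / real p)"

definition D1 :: "nat \<Rightarrow> nat option \<Rightarrow> real" where
  "D1 p s = (case s of None \<Rightarrow> 1 | Some h \<Rightarrow> 1 / real p)"

definition A1 :: "nat \<Rightarrow> nat option \<Rightarrow> nat option \<Rightarrow> real" where
  "A1 p s t = (case s of None \<Rightarrow> (case t of None \<Rightarrow> 1 | Some _ \<Rightarrow> 1 / real p)
     | Some h \<Rightarrow> if t = Some h then 1 else 0)"

lemma prod_D1: "(\<Prod>p\<in>PP. D1 p (r p)) = 1 / real (siz r)"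
proof -
  have "(\<Prod>p\<in>PP. D1 p (r p)) = (\<Prod>p\<in>PP. 1 / real (case r p of None \<Rightarrow> 1 | Some _ \<Rightarrow> p))"
    by (intro prod.cong refl) (auto simp: D1_def split: option.splits)
  thus ?thesis by (simp add: prod_dividef siz_def)
qed

lemma A1_Bt:
  assumes "s \<in> St" "u \<in> St"
  shows "(\<Sum>t\<in>St. A1 p s t * Bt p t u) = (if s = u then (case s of None \<Rightarrow> 1 | Some _ \<Rightarrow> -1) else 0)"
proof -
  have "u = None \<or> (\<exists>h\<in>H. u = Some h)" using assms by (auto simp: St_def)
  thus ?thesis using assms(1) finite_H
    unfolding sum_St
    by (cases s) (auto simp: A1_def Bt_def St_def if_distrib[of "\<lambda>c. c * _"] if_distrib[of "\<lambda>c. _ * c"] sum.delta sum.delta'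
             cong: if_cong split: if_splits)
qed

lemma P1_nonneg: "p \<in> PP \<Longrightarrow> 0 \<le> P1 p s"
  using real_card_less[of p] by (auto simp: P1_def field_simps split: option.splits)

text \<open>Completing the square in \<open>x None\<close> overshoots by \<open>(B / p)^2\<close>,
  where \<open>B\<close> is the sum of the other variables. Accepting this loss yields a
  diagonalisation with simple coefficients.\<close>

lemma local_upper:
  assumes "p \<in> PP"
  shows "(\<Sum>s\<in>St. P1 p s * (\<Sum>t\<in>St. inc s t * x t)\<^sup>2) \<le> (\<Sum>s\<in>St. D1 p s * (\<Sum>t\<in>St. A1 p s t * x t)\<^sup>2)"
proof -
  define B where "B = (\<Sum>h\<in>H. x (Some h))"
  have p: "real p > 0" using prime_gt_0_nat[OF prime_PP[OF assms]] by simp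
  have A1N: "(\<Sum>t\<in>St. A1 p None t * x t) = x None + B / real p"
    by (simp add: sum_St A1_def B_def sum_divide_distrib)
  have A1S: "(\<Sum>t\<in>St. A1 p (Some h) t * x t) = x (Some h)" if "h \<in> H" for h
    using that finite_H by (simp add: sum_St A1_def if_distrib[of "\<lambda>c. c * _"] sum.delta cong: if_cong)
  have "(\<Sum>s\<in>St. P1 p s * (\<Sum>t\<in>St. inc s t * x t)\<^sup>2)
      = (x None)\<^sup>2 + 2 * x None * B / real p + (\<Sum>h\<in>H. (x (Some h))\<^sup>2) / real p"
    unfolding B_def using p by (intro local_form) (auto simp: P1_def)
  also have "\<dots> \<le> (x None + B / real p)\<^sup>2 + (\<Sum>h\<in>H. (x (Some h))\<^sup>2) / real p"
    by (simp add: power2_sum mult.assoc)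
  also have "\<dots> = (\<Sum>s\<in>St. D1 p s * (\<Sum>t\<in>St. A1 p s t * x t)\<^sup>2)"
    by (subst sum_St) (simp add: D1_def A1N A1S sum_divide_distrib cong: sum.cong)
  finally show ?thesis .
qed

text \<open>\<open>A1\<close> times \<open>Bt\<close> is a diagonal matrix of signs, and squaring
  removes the signs, so each \<open>y r\<close> stands alone.\<close>

theorem form_P1_le: "form P1 (lam y) \<le> (\<Sum>r\<in>Om. (y r)\<^sup>2 / real (siz r))"
proof -
  have "form P1 (lam y) \<le> (\<Sum>r\<in>Om. (\<Prod>p\<in>PP. D1 p (r p)) *
      (\<Sum>s\<in>Om. (\<Prod>p\<in>PP. \<Sum>t\<in>St. A1 p (r p) t * Bt p t (s p)) * y s)\<^sup>2)"
    by (rule form_mono_tensor[OF P1_nonneg _ local_upper]) (auto simp: D1_def split: option.splits)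
  also have "\<dots> = (\<Sum>r\<in>Om. (y r)\<^sup>2 / real (siz r))"
  proof (rule sum.cong[OF refl])
    fix r assume r: "r \<in> Om"
    define M where "M p s t = (if s = t then (case s of None \<Rightarrow> 1 | Some _ \<Rightarrow> -1) else (0::real))"
      for p :: nat and s t :: "nat option"
    have "(\<Sum>s\<in>Om. (\<Prod>p\<in>PP. \<Sum>t\<in>St. A1 p (r p) t * Bt p t (s p)) * y s)
        = (\<Sum>s\<in>Om. (\<Prod>p\<in>PP. M p (r p) (s p)) * y s)"
      unfolding M_def using r
      by (intro sum.cong refl arg_cong2[of _ _ _ _ "(*)"] prod.cong A1_Bt) (auto simp: Om_def)
    also have "\<dots> = (\<Prod>p\<in>PP. M p (r p) (r p)) * y r"
      unfolding Om_def using r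
      by (intro tensor_diagonal finite_PP finite_St) (auto simp: Om_def M_def)
    finally have "(\<Sum>s\<in>Om. (\<Prod>p\<in>PP. \<Sum>t\<in>St. A1 p (r p) t * Bt p t (s p)) * y s)
        = (\<Prod>p\<in>PP. M p (r p) (r p)) * y r" .
    moreover have "(\<Prod>p\<in>PP. M p (r p) (r p))\<^sup>2 = 1"
      unfolding prod_power_distrib by (intro prod.neutral) (auto simp: M_def split: option.splits)
    ultimately show "(\<Prod>p\<in>PP. D1 p (r p)) *
      (\<Sum>s\<in>Om. (\<Prod>p\<in>PP. \<Sum>t\<in>St. A1 p (r p) t * Bt p t (s p)) * y s)\<^sup>2 = (y r)\<^sup>2 / real (siz r)"
      by (simp add: power_mult_distrib prod_D1)
  qed
  finally show ?thesis .
qed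

definition P1c :: "nat \<Rightarrow> nat \<Rightarrow> nat \<Rightarrow> nat option \<Rightarrow> real" where
  "P1c p0 h0 p s = (if p = p0 then (if s = Some h0 then 1 / real p0 else 0) else P1 p s)"

text \<open>At \<open>p0\<close> the local form is the single square of
  \<open>x None + x (Some h0)\<close>. In terms of \<open>y\<close> this becomes a difference of
  \<open>y\<close> at \<open>r\<close> and at \<open>r\<close> extended by \<open>p0\<close>, up to
  a term with factor \<open>1 / p0\<close>; for slowly varying \<open>y\<close> the two nearly
  cancel, which is the source of the saving at small primes.\<close>

theorem form_P1c_le:
  assumes p0: "p0 \<in> PP" and h0: "h0 \<in> H"
  shows "form (P1c p0 h0) (lam y) \<le> (\<Sum>r\<in>{r\<in>Om. r p0 = None}. 1 / real p0 / real (siz r) *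
     (y r + (\<Sum>h\<in>H. y (r(p0 := Some h))) / real p0 - y (r(p0 := Some h0)))\<^sup>2)"
proof -
  define D where "D p s = (if p = p0 then (if s = None then 1 / real p0 else 0) else D1 p s)" for p s
  define A where "A p s t = (if p = p0 then (if s = None \<and> (t = None \<or> t = Some h0) then 1 else 0) else A1 p s t)" for p s t
  define C where "C p s u = (\<Sum>t\<in>St. A p s t * Bt p t u)" for p s u
  have pos: "real p0 > 0" using prime_gt_0_nat[OF prime_PP[OF p0]] by simp
  have loc: "(\<Sum>s\<in>St. P1c p0 h0 p s * (\<Sum>t\<in>St. inc s t * x t)\<^sup>2)
      \<le> (\<Sum>s\<in>St. D p s * (\<Sum>t\<in>St. A p s t * x t)\<^sup>2)" if "p \<in> PP" for p x
  proof (cases "p = p0")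
    case False
    thus ?thesis using local_upper[OF that] by (simp add: P1c_def D_def A_def)
  next
    case True
    have 1: "(\<Sum>t\<in>St. inc (Some h0) t * x t) = x None + x (Some h0)"
      using h0 by (subst sum_inc) (auto simp: St_def)
    have 2: "(\<Sum>t\<in>St. A p None t * x t) = x None + x (Some h0)"
      using h0 True finite_H by (simp add: A_def sum_St if_distrib[of "\<lambda>c. c * _"] sum.delta cong: if_cong)
    have "(\<Sum>s\<in>St. P1c p0 h0 p s * (\<Sum>t\<in>St. inc s t * x t)\<^sup>2) = 1 / real p0 * (x None + x (Some h0))\<^sup>2"
      using h0 True finite_H unfolding sum_St[where f = "\<lambda>s. P1c p0 h0 p s * _ s"]
      by (simp add: P1c_def 1 if_distrib[of "\<lambda>c. c * _"] sum.delta cong: if_cong)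
    also have "\<dots> = (\<Sum>s\<in>St. D p s * (\<Sum>t\<in>St. A p s t * x t)\<^sup>2)"
      unfolding sum_St[where f = "\<lambda>s. D p s * _ s"] 2 using True by (simp add: D_def)
    finally show ?thesis by simp
  qed
  have "form (P1c p0 h0) (lam y) \<le> (\<Sum>r\<in>Om. (\<Prod>p\<in>PP. D p (r p)) *
      (\<Sum>s\<in>Om. (\<Prod>p\<in>PP. C p (r p) (s p)) * y s)\<^sup>2)"
    unfolding C_def
    by (rule form_mono_tensor[OF _ _ loc]) (auto simp: P1c_def D_def D1_def P1_nonneg split: option.splits)
  also have "\<dots> = (\<Sum>r\<in>{r\<in>Om. r p0 = None}. (\<Prod>p\<in>PP. D p (r p)) *
      (\<Sum>s\<in>Om. (\<Prod>p\<in>PP. C p (r p) (s p)) * y s)\<^sup>2)"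
  proof (rule sum.mono_neutral_right)
    show "\<forall>r\<in>Om - {r \<in> Om. r p0 = None}. (\<Prod>p\<in>PP. D p (r p)) *
      (\<Sum>s\<in>Om. (\<Prod>p\<in>PP. C p (r p) (s p)) * y s)\<^sup>2 = 0"
    proof
      fix r assume "r \<in> Om - {r \<in> Om. r p0 = None}"
      hence "(\<Prod>p\<in>PP. D p (r p)) = 0" using p0 finite_PP by (intro prod_zero) (auto simp: D_def intro!: bexI[of _ p0])
      thus "(\<Prod>p\<in>PP. D p (r p)) * (\<Sum>s\<in>Om. (\<Prod>p\<in>PP. C p (r p) (s p)) * y s)\<^sup>2 = 0" by simp
    qed
  qed auto
  also have "\<dots> = (\<Sum>r\<in>{r\<in>Om. r p0 = None}. 1 / real p0 / real (siz r) *
     (y r + (\<Sum>h\<in>H. y (r(p0 := Some h))) / real p0 - y (r(p0 := Some h0)))\<^sup>2)"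
  proof (rule sum.cong[OF refl])
    fix r assume "r \<in> {r\<in>Om. r p0 = None}"
    hence r: "r \<in> Om" "r p0 = None" by auto
    \<comment> \<open>Away from \<open>p0\<close> the matrix is diagonal. After splitting off that
      coordinate only its row \<open>None\<close> survives, and this row mixes \<open>y r\<close>
      with the extensions of \<open>r\<close> by \<open>p0\<close>.\<close>
    define I where "I = PP - {p0}"
    have I: "PP = insert p0 I" "p0 \<notin> I" "finite I" using p0 finite_PP by (auto simp: I_def)
    define r' where "r' = restrict r I"
    have r': "r' \<in> I \<rightarrow>\<^sub>E St" using r by (auto simp: r'_def I_def Om_def)
    have ext: "r p = undefined" if "p \<notin> PP" for p
      using r that by (auto simp: Om_def PiE_def extensional_def)
    have upd: "r'(p0 := s) = r(p0 := s)" if "s \<in> St" for s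
    proof
      fix p show "(r'(p0 := s)) p = (r(p0 := s)) p"
        using ext[of p] I(2) by (cases "p \<in> I") (auto simp: r'_def I(1))
    qed
    define M where "M p s t = (if s = t then (case s of None \<Rightarrow> 1 | Some _ \<Rightarrow> -1) else (0::real))"
      for p :: nat and s t :: "nat option"
    have CM: "C p s t = M p s t" if "p \<in> I" "s \<in> St" "t \<in> St" for p s t
    proof -
      have "p \<noteq> p0" using that(1) I by auto
      thus ?thesis using A1_Bt[OF that(2,3), of p] by (simp add: C_def M_def A_def)
    qed
    have rr: "(\<Prod>p\<in>PP. C p (r p) ((s(p0 := t)) p)) = C p0 None t * (\<Prod>p\<in>I. M p (r' p) (s p))"
      if "s \<in> I \<rightarrow>\<^sub>E St" "t \<in> St" for s t
    proof -
      have "(\<Prod>p\<in>I. C p (r p) ((s(p0 := t)) p)) = (\<Prod>p\<in>I. M p (r' p) (s p))"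
        using that r' I by (intro prod.cong refl) (auto simp: r'_def CM PiE_iff)
      thus ?thesis unfolding I(1) using I r by simp
    qed
    have "(\<Sum>s\<in>Om. (\<Prod>p\<in>PP. C p (r p) (s p)) * y s)
        = (\<Sum>t\<in>St. \<Sum>s\<in>I \<rightarrow>\<^sub>E St. (\<Prod>p\<in>PP. C p (r p) ((s(p0 := t)) p)) * y (s(p0 := t)))"
      unfolding Om_def by (subst I(1), subst sum_PiE_insert[OF I(2)]) simp
    also have "\<dots> = (\<Sum>t\<in>St. C p0 None t * (\<Sum>s\<in>I \<rightarrow>\<^sub>E St. (\<Prod>p\<in>I. M p (r' p) (s p)) * y (s(p0 := t))))"
      unfolding sum_distrib_left by (intro sum.cong refl) (simp add: rr del: fun_upd_apply)
    also have "\<dots> = (\<Sum>t\<in>St. C p0 None t * ((\<Prod>p\<in>I. M p (r' p) (r' p)) * y (r'(p0 := t))))"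
      by (intro sum.cong refl arg_cong2[of _ _ _ _ "(*)"] tensor_diagonal I(3) finite_St r') (auto simp: M_def)
    also have "\<dots> = (\<Prod>p\<in>I. M p (r' p) (r' p)) * (\<Sum>t\<in>St. C p0 None t * y (r(p0 := t)))"
      unfolding sum_distrib_left by (intro sum.cong refl) (simp add: upd mult_ac)
    also have "(\<Sum>t\<in>St. C p0 None t * y (r(p0 := t)))
      = y r + (\<Sum>h\<in>H. y (r(p0 := Some h))) / real p0 - y (r(p0 := Some h0))"
    proof -
      have C0: "C p0 None None = 1" using h0 finite_H
        by (simp add: C_def A_def sum_St Bt_def if_distrib[of "\<lambda>c. c * _"] sum.delta cong: if_cong)
      have C1: "C p0 None (Some h) = 1 / real p0 - (if h = h0 then 1 else 0)" for h using h0 finite_H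
        by (simp add: C_def A_def sum_St Bt_def if_distrib[of "\<lambda>c. c * _"] sum.delta cong: if_cong)
      have rn: "r(p0 := None) = r" using r by auto
      show ?thesis unfolding sum_St C0 C1 rn using h0 finite_H
        by (simp add: left_diff_distrib sum_subtractf sum_divide_distrib if_distrib[of "\<lambda>c. c * _"] sum.delta cong: if_cong)
    qed
    finally have e: "(\<Sum>s\<in>Om. (\<Prod>p\<in>PP. C p (r p) (s p)) * y s) = (\<Prod>p\<in>I. M p (r' p) (r' p)) *
      (y r + (\<Sum>h\<in>H. y (r(p0 := Some h))) / real p0 - y (r(p0 := Some h0)))" .
    have s: "(\<Prod>p\<in>I. M p (r' p) (r' p))\<^sup>2 = 1"
      unfolding prod_power_distrib by (intro prod.neutral) (auto simp: M_def split: option.splits)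
    have "(\<Prod>p\<in>PP. D p (r p)) = 1 / real p0 * (\<Prod>p\<in>I. D1 p (r p))"
      unfolding I(1) using I r by (auto simp: D_def intro!: prod.cong)
    also have "(\<Prod>p\<in>I. D1 p (r p)) = (\<Prod>p\<in>PP. D1 p (r p))"
      unfolding I(1) using I r by (simp add: D1_def)
    finally show "(\<Prod>p\<in>PP. D p (r p)) * (\<Sum>s\<in>Om. (\<Prod>p\<in>PP. C p (r p) (s p)) * y s)\<^sup>2 =
      1 / real p0 / real (siz r) * (y r + (\<Sum>h\<in>H. y (r(p0 := Some h))) / real p0 - y (r(p0 := Some h0)))\<^sup>2"
      unfolding e power_mult_distrib s by (simp add: prod_D1)
  qed
  finally show ?thesis .
qed

section \<open>The form attached to prime values, bounded from below\<close>

definition P2 :: "nat \<Rightarrow> nat \<Rightarrow> nat option \<Rightarrow> real" where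
  "P2 h0 p s = (case s of None \<Rightarrow> 1 - real (card (H - {h0})) / (real p - 1)
     | Some h \<Rightarrow> if h = h0 then 0 else 1 / (real p - 1))"

text \<open>The factors \<open>1 - 1 / p^2\<close> and \<open>1 - 5 * card H / p\<close> pay for
  replacing the density \<open>1 / (p - 1)\<close> of reduced classes by \<open>1 / p\<close> and
  for completing the square from below. \<open>Some h0\<close> has weight zero because a sieving
  prime does not divide the larger prime \<open>n + h0\<close>.\<close>

definition D2 :: "nat \<Rightarrow> nat \<Rightarrow> nat option \<Rightarrow> real" where
  "D2 h0 p s = (case s of None \<Rightarrow> 1 - 1 / (real p)\<^sup>2
     | Some h \<Rightarrow> if h = h0 then 0 else 1 / real p * (1 - 5 * real (card H) / real p))"

text \<open>Product with \<open>Bt\<close> of the variant of \<open>A1\<close> whose row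
  \<open>None\<close> omits \<open>h0\<close>. The entry \<open>1 / p\<close> that survives at
  \<open>h0\<close> sums \<open>y\<close> over all ways of filling the component \<open>h0\<close>:
  this is Maynard's passage from \<open>y\<close> to the variables attached to one prime
  position.\<close>

definition C2 :: "nat \<Rightarrow> nat \<Rightarrow> nat option \<Rightarrow> nat option \<Rightarrow> real" where
  "C2 h0 p s t = (case s of None \<Rightarrow> (case t of None \<Rightarrow> 1 | Some h \<Rightarrow> if h = h0 then 1 / real p else 0)
     | Some h \<Rightarrow> if t = Some h then -1 else 0)"

text \<open>The mismatch \<open>2 * a * B * c\<close> of the cross terms is absorbed by completing a
  square with the spare \<open>a^2 / p^2\<close>, at a cost of at most \<open>4 * B^2 / p^2\<close>.
  The square of \<open>B / p\<close> itself costs one more, so 5 in all, and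
  \<open>B^2 \<le> k * B2\<close> moves this onto the diagonal.\<close>

lemma local_lower_real:
  fixes p a B B2 k :: real
  assumes "p \<ge> 10" "B\<^sup>2 \<le> k * B2" "B2 \<ge> 0"
  shows "(1 - 1 / p\<^sup>2) * (a + B / p)\<^sup>2 + 1 / p * (1 - 5 * k / p) * B2 \<le> a\<^sup>2 + 2 * a * B / (p - 1) + B2 / (p - 1)"
proof -
  \<comment> \<open>\<open>2 * c\<close> is the difference between the coefficients of
    \<open>a * B\<close> on the two sides.\<close>
  define c where "c = 1 / (p - 1) - 1 / p + 1 / p ^ 3"
  have "1 / p \<le> 1 / (p - 1)" using assms(1) by (intro frac_le) auto
  hence c0: "c \<ge> 0" using assms(1) by (simp add: c_def)
  have c2: "c * p \<le> 2 / p"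
  proof -
    have "c * p = 1 / (p - 1) + 1 / p\<^sup>2" using assms(1) by (simp add: c_def field_simps power2_eq_square power3_eq_cube)
    also have "1 / p\<^sup>2 \<le> 1 / (10 * p)" using assms(1) by (simp add: power2_eq_square frac_le)
    also have "1 / (p - 1) \<le> 1 / (9 / 10 * p)" using assms(1) by (intro frac_le) auto
    also have "1 / (9 / 10 * p) + 1 / (10 * p) \<le> 2 / p" using assms(1) by (simp add: field_simps)
    finally show ?thesis by simp
  qed
  have "(c * p)\<^sup>2 \<le> (2 / p)\<^sup>2" using c2 c0 assms(1) by (intro power_mono) auto
  hence 1: "(c * p)\<^sup>2 * B\<^sup>2 \<le> 4 * B\<^sup>2 / p\<^sup>2" by (auto simp: power_divide dest: mult_right_mono[of _ _ "B\<^sup>2"])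
  have 2: "a\<^sup>2 / p\<^sup>2 + 2 * a * B * c \<ge> - ((c * p)\<^sup>2 * B\<^sup>2)"
  proof -
    have "0 \<le> (a / p + c * p * B)\<^sup>2" by simp
    also have "\<dots> = a\<^sup>2 / p\<^sup>2 + 2 * a * B * c + (c * p)\<^sup>2 * B\<^sup>2"
      using assms(1) by (simp add: power2_sum power_divide power_mult_distrib)
    finally show ?thesis by linarith
  qed
  have 3: "5 * B\<^sup>2 / p\<^sup>2 \<le> 5 * k * B2 / p\<^sup>2" using assms by (intro divide_right_mono) auto
  have 4: "B2 / (p - 1) \<ge> B2 / p" using assms by (intro divide_left_mono) auto
  have "a\<^sup>2 + 2 * a * B / (p - 1) + B2 / (p - 1) - ((1 - 1 / p\<^sup>2) * (a + B / p)\<^sup>2 + 1 / p * (1 - 5 * k / p) * B2)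
     = a\<^sup>2 / p\<^sup>2 + 2 * a * B * c - (1 - 1 / p\<^sup>2) * (B\<^sup>2 / p\<^sup>2) + (B2 / (p - 1) - B2 / p) + 5 * k * B2 / p\<^sup>2"
  proof -
    define v w where "v = 1 / p" and "w = 1 / (p - 1)"
    have e: "x / p = x * v" "x / (p - 1) = x * w" "x / p\<^sup>2 = x * v\<^sup>2" "x / p ^ 3 = x * v ^ 3" for x
      by (simp_all add: v_def w_def power_divide)
    have cw: "c = w - v + v ^ 3" unfolding c_def e by simp
    show ?thesis unfolding e cw by (simp add: algebra_simps power2_eq_square power3_eq_cube)
  qed
  moreover have "(1 - 1 / p\<^sup>2) * (B\<^sup>2 / p\<^sup>2) \<le> 1 * (B\<^sup>2 / p\<^sup>2)" by (intro mult_right_mono) auto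
  ultimately show ?thesis using 1 2 3 4 by (simp add: field_simps)
qed

theorem form_P2_ge:
  assumes h0: "h0 \<in> H"
  shows "(\<Sum>r\<in>Om. (\<Prod>p\<in>PP. D2 h0 p (r p)) * (\<Sum>s\<in>Om. (\<Prod>p\<in>PP. C2 h0 p (r p) (s p)) * y s)\<^sup>2)
    \<le> form (P2 h0) (lam y)"
proof -
  define A where "A p s t = (case s of None \<Rightarrow> (case t of None \<Rightarrow> 1 | Some h \<Rightarrow> if h = h0 then 0 else 1 / real p)
     | Some h \<Rightarrow> if t = Some h then 1 else (0::real))" for p :: nat and s t
  define J where "J = H - {h0}"
  have fJ: "finite J" "J \<subseteq> H" "h0 \<notin> J" "H = insert h0 J" using finite_H h0 by (auto simp: J_def)
  have ABt: "(\<Sum>t\<in>St. A p s t * Bt p t u) = C2 h0 p s u" if "s \<in> St" "u \<in> St" for p s u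
  proof -
    have "u = None \<or> (\<exists>h\<in>H. u = Some h)" using that by (auto simp: St_def)
    thus ?thesis using that(1) finite_H
      unfolding sum_St
      by (cases s) (auto simp: A_def Bt_def C2_def St_def if_distrib[of "\<lambda>c. c * _"] if_distrib[of "\<lambda>c. _ * c"] sum.delta sum.delta'
             cong: if_cong split: if_splits)
  qed
  have loc: "(\<Sum>s\<in>St. D2 h0 p s * (\<Sum>t\<in>St. A p s t * x t)\<^sup>2)
      \<le> (\<Sum>s\<in>St. P2 h0 p s * (\<Sum>t\<in>St. inc s t * x t)\<^sup>2)" if "p \<in> PP" for p x
  proof -
    define B where "B = (\<Sum>h\<in>J. x (Some h))"
    define B2 where "B2 = (\<Sum>h\<in>J. (x (Some h))\<^sup>2)"
    have "p \<ge> 10" using large_PP[OF that] by simp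
    hence p: "real p \<ge> 10" by simp
    have "B\<^sup>2 \<le> real (card J) * B2"
      unfolding B_def B2_def using sum_squared_le_sum_of_squares[of "\<lambda>h. x (Some h)" J] by (simp add: mult.commute)
    also have "\<dots> \<le> real (card H) * B2"
      unfolding B2_def using card_mono[OF finite_H fJ(2)] by (intro mult_right_mono sum_nonneg) auto
    finally have BB: "B\<^sup>2 \<le> real (card H) * B2" .
    have AN: "(\<Sum>t\<in>St. A p None t * x t) = x None + B / real p"
    proof -
      have "(\<Sum>h\<in>H. A p None (Some h) * x (Some h)) = (\<Sum>h\<in>J. x (Some h) / real p)"
        unfolding fJ(4) using fJ by (simp add: A_def) (auto intro!: sum.cong)
      thus ?thesis by (simp add: sum_St B_def sum_divide_distrib) (simp add: A_def)
    qed
    have AS: "(\<Sum>t\<in>St. A p (Some h) t * x t) = x (Some h)" if "h \<in> H" for h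
      using that finite_H by (simp add: sum_St A_def if_distrib[of "\<lambda>c. c * _"] sum.delta cong: if_cong)
    have "(\<Sum>s\<in>St. D2 h0 p s * (\<Sum>t\<in>St. A p s t * x t)\<^sup>2)
        = (1 - 1 / (real p)\<^sup>2) * (x None + B / real p)\<^sup>2 + (\<Sum>h\<in>H. D2 h0 p (Some h) * (x (Some h))\<^sup>2)"
      by (simp add: sum_St[where f = "\<lambda>s. D2 h0 p s * _ s"] AN AS) (simp add: D2_def)
    also have "(\<Sum>h\<in>H. D2 h0 p (Some h) * (x (Some h))\<^sup>2) = 1 / real p * (1 - 5 * real (card H) / real p) * B2"
    proof -
      have "(\<Sum>h\<in>H. D2 h0 p (Some h) * (x (Some h))\<^sup>2) = (\<Sum>h\<in>J. D2 h0 p (Some h) * (x (Some h))\<^sup>2)"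
        by (subst sum.remove[OF finite_H h0]) (simp add: D2_def J_def)
      also have "\<dots> = 1 / real p * (1 - 5 * real (card H) / real p) * B2"
        unfolding B2_def sum_distrib_left by (intro sum.cong refl) (auto simp: D2_def J_def)
      finally show ?thesis .
    qed
    also have "(1 - 1 / (real p)\<^sup>2) * (x None + B / real p)\<^sup>2 + 1 / real p * (1 - 5 * real (card H) / real p) * B2
        \<le> (x None)\<^sup>2 + 2 * x None * B / (real p - 1) + B2 / (real p - 1)"
      by (rule local_lower_real[OF p BB]) (simp add: B2_def sum_nonneg)
    also have "\<dots> = (\<Sum>s\<in>St. P2 h0 p s * (\<Sum>t\<in>St. inc s t * x t)\<^sup>2)"
      unfolding B_def B2_def
      by (rule local_form[symmetric]) (use p in \<open>auto simp: P2_def J_def\<close>)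
    finally show ?thesis .
  qed
  have "(\<Sum>r\<in>Om. (\<Prod>p\<in>PP. D2 h0 p (r p)) * (\<Sum>s\<in>Om. (\<Prod>p\<in>PP. \<Sum>t\<in>St. A p (r p) t * Bt p t (s p)) * y s)\<^sup>2)
    \<le> form (P2 h0) (lam y)"
  proof (rule form_mono_tensor'[OF _ _ loc])
    fix p s assume "p \<in> PP" "s \<in> St"
    have p: "real p \<ge> 10 * (real (card H) + 1)" using real_card_less[OF \<open>p \<in> PP\<close>] by linarith
    have c: "real (card (H - {h0})) \<le> real (card H)" using finite_H by (simp add: card_mono)
    have "real (card (H - {h0})) / (real p - 1) \<le> 1" using p c by (subst divide_le_eq_1_pos) auto
    thus "0 \<le> P2 h0 p s" using p by (auto simp: P2_def split: option.splits)
    have "1 ^ 2 \<le> (real p)\<^sup>2" using p by (intro power_mono) auto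
    hence "1 / (real p)\<^sup>2 \<le> 1" using p by (subst divide_le_eq_1_pos) auto
    moreover have "5 * real (card H) / real p \<le> 1" using p by (subst divide_le_eq_1_pos) auto
    ultimately show "0 \<le> D2 h0 p s" by (auto simp: D2_def split: option.splits)
  qed
  moreover have "(\<Sum>s\<in>Om. (\<Prod>p\<in>PP. \<Sum>t\<in>St. A p (r p) t * Bt p t (s p)) * y s)
      = (\<Sum>s\<in>Om. (\<Prod>p\<in>PP. C2 h0 p (r p) (s p)) * y s)" if "r \<in> Om" for r
    using that by (intro sum.cong refl arg_cong2[of _ _ _ _ "(*)"] prod.cong ABt) (auto simp: Om_def)
  ultimately show ?thesis by simp
qed

end

subsection \<open>Weighted counts in residue classes\<close>

lemma crt_class:
  fixes a W :: nat and f :: "nat \<Rightarrow> nat"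
  assumes "finite F" "\<And>p. p \<in> F \<Longrightarrow> prime p" "\<And>p. p \<in> F \<Longrightarrow> coprime p W"
  shows "\<exists>b. \<forall>n. ([n = a] (mod W) \<and> (\<forall>p\<in>F. p dvd n + f p)) \<longleftrightarrow> [n = b] (mod (W * \<Prod>F))"
  using assms
proof (induction F rule: finite_induct)
  case empty
  show ?case by (intro exI[of _ a]) simp
next
  case (insert q F)
  then obtain b where b: "\<And>n. ([n = a] (mod W) \<and> (\<forall>p\<in>F. p dvd n + f p)) \<longleftrightarrow> [n = b] (mod (W * \<Prod>F))"
    by auto
  \<comment> \<open>This represents \<open>- f q\<close> modulo \<open>q\<close> without leaving the
    naturals, since \<open>c + f q = f q * q\<close>.\<close>
  define c where "c = f q * (q - 1)"
  have q: "prime q" using insert by auto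
  have cop: "coprime (W * \<Prod>F) q"
  proof -
    have "coprime (\<Prod>F) q"
      using insert by (intro prod_coprime_left) (metis insertCI primes_coprime)
    moreover have "coprime W q" using insert.prems(2)[of q] by (simp add: coprime_commute)
    ultimately show ?thesis by simp
  qed
  have c: "q dvd n + f q \<longleftrightarrow> [n = c] (mod q)" for n
  proof -
    have "c + f q = f q * q" using prime_gt_0_nat[OF q] by (cases q) (auto simp: c_def)
    hence "[c + f q = 0] (mod q)" by (simp add: cong_0_iff)
    moreover have "q dvd n + f q \<longleftrightarrow> [n + f q = 0] (mod q)" by (simp add: cong_0_iff)
    ultimately have "q dvd n + f q \<longleftrightarrow> [n + f q = c + f q] (mod q)"
      by (metis cong_sym cong_trans)
    thus ?thesis by (simp add: cong_add_rcancel_nat)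
  qed
  obtain x where x: "[x = b] (mod (W * \<Prod>F))" "[x = c] (mod q)"
    using binary_chinese_remainder_nat[OF cop] by blast
  have "([n = a] (mod W) \<and> (\<forall>p\<in>insert q F. p dvd n + f p)) \<longleftrightarrow> [n = x] (mod (W * \<Prod>(insert q F)))" for n
  proof -
    have "([n = a] (mod W) \<and> (\<forall>p\<in>insert q F. p dvd n + f p)) \<longleftrightarrow> [n = b] (mod (W * \<Prod>F)) \<and> [n = c] (mod q)"
      using b[of n] c[of n] by auto
    also have "\<dots> \<longleftrightarrow> [n = x] (mod (W * \<Prod>F)) \<and> [n = x] (mod q)"
      using x by (metis cong_sym cong_trans)
    also have "\<dots> \<longleftrightarrow> [n = x] (mod (W * \<Prod>F * q))"
      using coprime_cong_mult_nat[OF _ _ cop] cong_modulus_mult_nat[of n x "W * \<Prod>F" q]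
        cong_modulus_mult_nat[of n x q "W * \<Prod>F"] by (auto simp: mult.commute[of q])
    finally show ?thesis using insert.hyps by (simp add: mult_ac)
  qed
  thus ?case by blast
qed

lemma card_residue_class:
  fixes M N q b :: nat
  assumes "q > 0"
  shows "\<bar>real (card {n\<in>{M<..M+N}. [n = b] (mod q)}) - real N / real q\<bar> \<le> 1"
proof -
  define c where "c = b mod q"
  have c: "c < q" using assms by (simp add: c_def)
  define lo hi where "lo = \<lfloor>(real M - real c) / real q\<rfloor>" and "hi = \<lfloor>(real M + real N - real c) / real q\<rfloor>"
  have lohi: "lo \<le> hi" unfolding lo_def hi_def by (intro floor_mono divide_right_mono) auto
  \<comment> \<open>The least quotient that occurs may be 0. Hence every \<open>t\<close> above
    \<open>lo\<close> is nonnegative and the conversions to \<open>nat\<close> are exact.\<close>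
  have lo1: "lo \<ge> -1"
  proof -
    have "(real M - real c) / real q \<ge> -1" using c by (simp add: field_simps)
    thus ?thesis unfolding lo_def by (simp add: le_floor_iff)
  qed
  have iff: "t \<in> {lo<..hi} \<longleftrightarrow> int M < int q * t + int c \<and> int q * t + int c \<le> int M + int N" for t :: int
  proof -
    have "lo < t \<longleftrightarrow> (real M - real c) / real q < real_of_int t" by (simp add: lo_def floor_less_iff)
    also have "\<dots> \<longleftrightarrow> real M < real q * real_of_int t + real c" using assms by (simp add: field_simps)
    also have "\<dots> \<longleftrightarrow> real_of_int (int M) < real_of_int (int q * t + int c)" by simp
    finally have 1: "lo < t \<longleftrightarrow> int M < int q * t + int c" by (simp only: of_int_less_iff)
    have "t \<le> hi \<longleftrightarrow> real_of_int t \<le> (real M + real N - real c) / real q" by (simp add: hi_def le_floor_iff)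
    also have "\<dots> \<longleftrightarrow> real q * real_of_int t + real c \<le> real M + real N" using assms by (simp add: field_simps)
    also have "\<dots> \<longleftrightarrow> real_of_int (int q * t + int c) \<le> real_of_int (int M + int N)" by simp
    finally have 2: "t \<le> hi \<longleftrightarrow> int q * t + int c \<le> int M + int N" by (simp only: of_int_le_iff)
    show ?thesis using 1 2 by simp
  qed
  have "bij_betw (\<lambda>n. int (n div q)) {n\<in>{M<..M+N}. [n = b] (mod q)} {lo<..hi}"
  proof (rule bij_betw_byWitness[where f' = "\<lambda>t. nat (int q * t + int c)"])
    have split: "n = q * (n div q) + c" if "[n = b] (mod q)" for n
      using that div_mult_mod_eq[of n q] by (simp add: c_def cong_def mult.commute)
    show "\<forall>n\<in>{n\<in>{M<..M+N}. [n = b] (mod q)}. nat (int q * int (n div q) + int c) = n"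
      using split by (metis (no_types, lifting) mem_Collect_eq nat_int of_nat_add of_nat_mult)
    show "\<forall>t\<in>{lo<..hi}. int (nat (int q * t + int c) div q) = t"
    proof
      fix t assume t: "t \<in> {lo<..hi}"
      hence t0: "t \<ge> 0" using lo1 by auto
      then obtain u where u: "t = int u" by (metis nonneg_int_cases)
      have "nat (int q * t + int c) = q * u + c" by (simp add: u nat_add_distrib nat_mult_distrib)
      thus "int (nat (int q * t + int c) div q) = t" using c by (simp add: u)
    qed
    show "(\<lambda>n. int (n div q)) ` {n\<in>{M<..M+N}. [n = b] (mod q)} \<subseteq> {lo<..hi}"
    proof (intro image_subsetI)
      fix n assume n: "n \<in> {n\<in>{M<..M+N}. [n = b] (mod q)}"
      have "int q * int (n div q) + int c = int n" using split[of n] n by (metis (no_types, lifting) mem_Collect_eq of_nat_add of_nat_mult)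
      thus "int (n div q) \<in> {lo<..hi}" unfolding iff using n by auto
    qed
    show "(\<lambda>t. nat (int q * t + int c)) ` {lo<..hi} \<subseteq> {n\<in>{M<..M+N}. [n = b] (mod q)}"
    proof (intro image_subsetI)
      fix t assume t: "t \<in> {lo<..hi}"
      hence t0: "t \<ge> 0" using lo1 by auto
      then obtain u where u: "t = int u" by (metis nonneg_int_cases)
      have e: "nat (int q * t + int c) = q * u + c" by (simp add: u nat_add_distrib nat_mult_distrib)
      have "[q * u + c = b] (mod q)" by (simp add: cong_def c_def)
      moreover have "int M < int (q * u + c)" "int (q * u + c) \<le> int (M + N)" using t unfolding iff by (auto simp: u)
      hence "M < q * u + c" "q * u + c \<le> M + N" by (simp_all only: of_nat_less_iff of_nat_le_iff)
      ultimately show "nat (int q * t + int c) \<in> {n\<in>{M<..M+N}. [n = b] (mod q)}" unfolding e by auto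
    qed
  qed
  hence "card {n\<in>{M<..M+N}. [n = b] (mod q)} = card {lo<..hi}" by (rule bij_betw_same_card)
  also have "real \<dots> = real_of_int hi - real_of_int lo" using lohi by simp
  finally have "real (card {n\<in>{M<..M+N}. [n = b] (mod q)}) = real_of_int hi - real_of_int lo" .
  moreover have "(real M + real N - real c) / real q = (real M - real c) / real q + real N / real q"
    by (simp add: add_divide_distrib diff_divide_distrib)
  ultimately show ?thesis unfolding lo_def hi_def by linarith
qed

definition EH_error :: "nat \<Rightarrow> nat \<Rightarrow> real" where
  "EH_error N q = (MAX a\<in>totatives q. \<bar>theta_progression N q a - real N / real (totient q)\<bar>)"

lemma theta_progression_cong: "[a = b] (mod q) \<Longrightarrow> theta_progression N q a = theta_progression N q b"
  unfolding theta_progression_def by (rule sum.cong) (auto intro: cong_trans cong_sym)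

lemma EH_error_ge:
  assumes "coprime a q" "q > 1"
  shows "\<bar>theta_progression N q a - real N / real (totient q)\<bar> \<le> EH_error N q"
proof -
  have "[a mod q = a] (mod q)" by simp
  hence "theta_progression N q (a mod q) = theta_progression N q a" by (rule theta_progression_cong)
  moreover have "a mod q \<in> totatives q"
  proof -
    \<comment> \<open>\<open>totatives q\<close> does not contain 0; the assumption
      \<open>q > 1\<close> excludes this residue.\<close>
    have "a mod q \<noteq> 0"
    proof
      assume "a mod q = 0"
      hence "q dvd a" by (simp add: dvd_eq_mod_eq_0)
      hence "q dvd 1" using assms(1) by (metis coprime_common_divisor dvd_refl)
      thus False using assms(2) by simp
    qed
    moreover have "a mod q \<le> q" using assms(2) by (intro less_imp_le) simp
    moreover have "coprime (a mod q) q" using assms by (simp add: coprime_mod_left_iff)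
    ultimately show ?thesis by (simp add: totatives_def)
  qed
  ultimately show ?thesis unfolding EH_error_def by (metis (no_types, lifting) Max_ge finite_imageI finite_totatives imageI)
qed

lemma totient_mult_primes:
  assumes "finite F" "\<And>p. p \<in> F \<Longrightarrow> prime p" "\<And>p. p \<in> F \<Longrightarrow> coprime p W"
  shows "totient (W * \<Prod>F) = totient W * (\<Prod>p\<in>F. p - 1)"
  using assms
proof (induction F rule: finite_induct)
  case (insert q F)
  have q: "prime q" using insert by auto
  have "coprime (\<Prod>F) q"
    using insert by (intro prod_coprime_left) (metis insertCI primes_coprime)
  moreover have "coprime W q" using insert.prems(2)[of q] by (simp add: coprime_commute)
  ultimately have "coprime (W * \<Prod>F) q" by simp
  hence "totient (W * \<Prod>F * q) = totient (W * \<Prod>F) * (q - 1)"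
    by (simp add: totient_mult_coprime totient_prime[OF q])
  thus ?case using insert by (simp add: mult_ac)
qed simp

section \<open>From counts in residue classes to sieve-weighted sums\<close>

context tuple_sieve
begin

definition compat :: "(nat \<Rightarrow> nat option) \<Rightarrow> (nat \<Rightarrow> nat option) \<Rightarrow> bool" where
  "compat d e \<longleftrightarrow> (\<forall>p\<in>PP. d p = None \<or> e p = None \<or> d p = e p)"

text \<open>For compatible \<open>d\<close> and \<open>e\<close> this encodes the componentwise lcm
  of the two tuples of divisors.\<close>

definition join :: "(nat \<Rightarrow> nat option) \<Rightarrow> (nat \<Rightarrow> nat option) \<Rightarrow> nat \<Rightarrow> nat option" where
  "join d e = (\<lambda>p\<in>PP. if d p = None then e p else d p)"

definition supp :: "(nat \<Rightarrow> nat option) \<Rightarrow> nat set" where "supp d = {p\<in>PP. d p \<noteq> None}"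

lemma siz_supp: "siz d = \<Prod>(supp d)"
proof -
  have "siz d = (\<Prod>p\<in>PP. if d p \<noteq> None then p else 1)"
    unfolding siz_def by (intro prod.cong) (auto split: option.splits)
  also have "\<dots> = \<Prod>(supp d)" unfolding supp_def using finite_PP by (simp add: prod.inter_filter[symmetric])
  finally show ?thesis .
qed

lemma finite_supp [simp]: "finite (supp d)" by (simp add: supp_def finite_PP)

lemma Om_cases: "d \<in> Om \<Longrightarrow> p \<in> PP \<Longrightarrow> d p = None \<or> (\<exists>h\<in>H. d p = Some h)"
  by (auto simp: Om_def St_def PiE_iff)

lemma join_in_Om: "d \<in> Om \<Longrightarrow> e \<in> Om \<Longrightarrow> join d e \<in> Om"
  by (auto simp: Om_def join_def)

lemma dvs_unique:
  assumes "p \<in> PP" "h \<in> H" "h' \<in> H" "p dvd n + h" "p dvd n + h'"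
  shows "h = h'"
proof -
  have "[n + h = n + h'] (mod p)" using assms(4,5) by (simp add: cong_def dvd_eq_mod_eq_0)
  hence "[h = h'] (mod p)" by (simp add: cong_add_lcancel_nat)
  thus ?thesis using distinct_mod assms by blast
qed

lemma dvs_join:
  assumes "d \<in> Om" "e \<in> Om"
  shows "dvs d n \<and> dvs e n \<longleftrightarrow> compat d e \<and> dvs (join d e) n"
proof
  assume *: "dvs d n \<and> dvs e n"
  have "compat d e" unfolding compat_def
  proof
    fix p assume p: "p \<in> PP"
    show "d p = None \<or> e p = None \<or> d p = e p"
      using Om_cases[OF assms(1) p] Om_cases[OF assms(2) p] * p dvs_unique[OF p, of _ _ n]
      unfolding dvs_def by metis
  qed
  moreover have "dvs (join d e) n" using * by (auto simp: dvs_def join_def split: if_splits)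
  ultimately show "compat d e \<and> dvs (join d e) n" by blast
next
  assume *: "compat d e \<and> dvs (join d e) n"
  thus "dvs d n \<and> dvs e n" unfolding dvs_def compat_def join_def
    by (smt (verit, ccfv_SIG) option.distinct(1) restrict_apply')
qed

lemma dvs_class:
  assumes "f \<in> Om" "\<And>p. p \<in> PP \<Longrightarrow> coprime p W"
  obtains b where "\<And>n. ([n = a] (mod W) \<and> dvs f n) \<longleftrightarrow> [n = b] (mod (W * siz f))"
proof -
  obtain b where b: "\<And>n. ([n = a] (mod W) \<and> (\<forall>p\<in>supp f. p dvd n + the (f p))) \<longleftrightarrow> [n = b] (mod (W * \<Prod>(supp f)))"
    using crt_class[of "supp f" W a "\<lambda>p. the (f p)"] assms(2) prime_PP finite_supp[of f]
    unfolding supp_def by auto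
  have "dvs f n \<longleftrightarrow> (\<forall>p\<in>supp f. p dvd n + the (f p))" for n
    unfolding dvs_def supp_def by auto
  thus ?thesis using b that[of b] siz_supp by simp
qed

lemma siz_pos [simp]: "siz f > 0"
  unfolding siz_def using prime_gt_0_nat[OF prime_PP] by (intro prod_pos) (auto split: option.splits)

lemma card_dvs:
  assumes "f \<in> Om" "\<And>p. p \<in> PP \<Longrightarrow> coprime p W" "W > 0"
  shows "\<bar>real (card {n\<in>{N<..2*N}. [n = a] (mod W) \<and> dvs f n}) - real N / real W / real (siz f)\<bar> \<le> 1"
proof -
  obtain b where "\<And>n. ([n = a] (mod W) \<and> dvs f n) \<longleftrightarrow> [n = b] (mod (W * siz f))"
    using dvs_class[OF assms(1,2)] by metis
  thus ?thesis using card_residue_class[of "W * siz f" N N b] assms(3) by (simp add: mult_2)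
qed

lemma kap_eq:
  assumes "s \<in> St" "t \<in> St"
  shows "kap P p s t = (if s \<noteq> None \<and> t \<noteq> None \<and> s \<noteq> t then 0
     else case (if s = None then t else s) of None \<Rightarrow> P p None + (\<Sum>h\<in>H. P p (Some h)) | Some h \<Rightarrow> P p (Some h))"
proof -
  have *: "(\<Sum>h\<in>H. P p (Some h) * (if h = x then c else 0)) = (if x \<in> H then P p (Some x) * c else 0)" for x c
    using finite_H by (simp add: if_distrib[of "\<lambda>c. _ * c"] sum.delta cong: if_cong)
  have "s = None \<or> (\<exists>h\<in>H. s = Some h)" "t = None \<or> (\<exists>h\<in>H. t = Some h)" using assms by (auto simp: St_def)
  thus ?thesis unfolding kap_def sum_St inc_def using finite_H
    by (auto simp: if_distrib[of "\<lambda>c. _ * c"] if_distrib[of "\<lambda>c. c * _"] sum.delta sum.delta' cong: if_cong split: if_splits)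
qed

lemma prod_kap_eq:
  assumes d: "d \<in> Om" and e: "e \<in> Om" and one: "\<And>p. p \<in> PP \<Longrightarrow> P p None + (\<Sum>h\<in>H. P p (Some h)) = 1"
  shows "(\<Prod>p\<in>PP. kap P p (d p) (e p)) = (if compat d e then \<Prod>p\<in>supp (join d e). P p (join d e p) else 0)"
proof (cases "compat d e")
  case True
  have "(\<Prod>p\<in>PP. kap P p (d p) (e p)) = (\<Prod>p\<in>PP. if join d e p \<noteq> None then P p (join d e p) else 1)"
  proof (rule prod.cong[OF refl])
    fix p assume p: "p \<in> PP"
    have s: "d p \<in> St" "e p \<in> St" using d e p by (auto simp: Om_def)
    show "kap P p (d p) (e p) = (if join d e p \<noteq> None then P p (join d e p) else 1)"
      unfolding kap_eq[OF s] using True p one[OF p] by (auto simp: compat_def join_def split: option.splits)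
  qed
  also have "\<dots> = (\<Prod>p\<in>supp (join d e). P p (join d e p))"
    unfolding supp_def using finite_PP by (simp add: prod.inter_filter[symmetric])
  finally show ?thesis using True by simp
next
  case False
  then obtain p where p: "p \<in> PP" "d p \<noteq> None" "e p \<noteq> None" "d p \<noteq> e p" by (auto simp: compat_def)
  have s: "d p \<in> St" "e p \<in> St" using d e p by (auto simp: Om_def)
  have "kap P p (d p) (e p) = 0" unfolding kap_eq[OF s] using p by simp
  hence "(\<Prod>p\<in>PP. kap P p (d p) (e p)) = 0" using p(1) finite_PP by (intro prod_zero) auto
  thus ?thesis using False by simp
qed

lemma P1_total: "p \<in> PP \<Longrightarrow> P1 p None + (\<Sum>h\<in>H. P1 p (Some h)) = 1"
  using prime_gt_0_nat[OF prime_PP[of p]] by (simp add: P1_def)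

lemma prod_P1: "(\<Prod>p\<in>supp f. P1 p (f p)) = 1 / real (siz f)"
proof -
  have "(\<Prod>p\<in>supp f. P1 p (f p)) = (\<Prod>p\<in>supp f. 1 / real p)"
    by (intro prod.cong) (auto simp: supp_def P1_def)
  thus ?thesis by (simp add: prod_dividef siz_supp)
qed

theorem sum_weight_approx:
  assumes "\<And>p. p \<in> PP \<Longrightarrow> coprime p W" "W > 0"
  shows "\<bar>(\<Sum>n | n \<in> {N<..2*N} \<and> [n = a] (mod W). weight l n) - real N / real W * form P1 l\<bar> \<le> (\<Sum>d\<in>Om. \<bar>l d\<bar>)\<^sup>2"
proof -
  define X where "X = {n. n \<in> {N<..2*N} \<and> [n = a] (mod W)}"
  have fX: "finite X" unfolding X_def by simp
  have "\<bar>(\<Sum>n\<in>X. 1 * weight l n) - real N / real W * form P1 l\<bar> \<le> (\<Sum>d\<in>Om. \<Sum>e\<in>Om. \<bar>l d\<bar> * \<bar>l e\<bar> * 1)"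
  proof (rule weighted_sum_approx)
    fix d e assume de: "d \<in> Om" "e \<in> Om"
    have "(\<Sum>n\<in>X. 1 * of_bool (dvs d n \<and> dvs e n)) = (if compat d e then
        real (card {n\<in>{N<..2*N}. [n = a] (mod W) \<and> dvs (join d e) n}) else 0)"
    proof -
      have "(\<Sum>n\<in>X. 1 * of_bool (dvs d n \<and> dvs e n)) = real (card (X \<inter> {n. dvs d n \<and> dvs e n}))"
        using fX by simp
      also have "X \<inter> {n. dvs d n \<and> dvs e n} = (if compat d e then {n\<in>{N<..2*N}. [n = a] (mod W) \<and> dvs (join d e) n} else {})"
        using dvs_join[OF de] by (auto simp: X_def)
      finally show ?thesis by simp
    qed
    thus "\<bar>(\<Sum>n\<in>X. 1 * of_bool (dvs d n \<and> dvs e n)) - real N / real W * (\<Prod>p\<in>PP. kap P1 p (d p) (e p))\<bar> \<le> 1"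
      using card_dvs[OF join_in_Om[OF de] assms] prod_kap_eq[where P = P1, OF de P1_total] by (simp add: prod_P1 mult.commute)
  qed
  also have "(\<Sum>d\<in>Om. \<Sum>e\<in>Om. \<bar>l d\<bar> * \<bar>l e\<bar> * 1) = (\<Sum>d\<in>Om. \<bar>l d\<bar>)\<^sup>2"
    by (simp add: power2_eq_square sum_product)
  finally show ?thesis by (simp add: X_def)
qed

text \<open>If the joint condition makes some \<open>p\<close> divide \<open>n + h0\<close>, both
  the sum and the main term vanish, because the prime \<open>n + h0\<close> exceeds \<open>N\<close>
  and so cannot be divisible by \<open>p \<le> N\<close>. Otherwise \<open>n + h0\<close> runs
  through one reduced class modulo \<open>W * siz (join d e)\<close>, and the sum is a difference of
  two values of \<open>theta_progression\<close>.\<close>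

theorem sum_weight_prime_approx:
  assumes cop: "\<And>p. p \<in> PP \<Longrightarrow> coprime p W" and W: "W > 1" and h0: "h0 \<in> H"
    and a: "coprime (a + h0) W" and small: "\<And>p. p \<in> PP \<Longrightarrow> p \<le> N"
  shows "\<bar>(\<Sum>n | n \<in> {N<..2*N} \<and> [n = a] (mod W) \<and> prime (n + h0). ln (real (n + h0)) * weight l n)
      - real N / real (totient W) * form (P2 h0) l\<bar>
    \<le> (\<Sum>d\<in>Om. \<Sum>e\<in>Om. \<bar>l d\<bar> * \<bar>l e\<bar> * (if compat d e then
        EH_error (2 * N + h0) (W * siz (join d e)) + EH_error (N + h0) (W * siz (join d e)) else 0))"
proof (rule weighted_sum_approx)
  fix d e assume de: "d \<in> Om" "e \<in> Om"
  define X where "X = {n. n \<in> {N<..2*N} \<and> [n = a] (mod W) \<and> prime (n + h0)}"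
  define j where "j = join d e"
  have j: "j \<in> Om" unfolding j_def by (rule join_in_Om[OF de])
  have P2_total: "P2 h0 p None + (\<Sum>h\<in>H. P2 h0 p (Some h)) = 1" if "p \<in> PP" for p
  proof -
    have "(\<Sum>h\<in>H. P2 h0 p (Some h)) = (\<Sum>h\<in>H - {h0}. 1 / (real p - 1))"
      using h0 finite_H by (subst sum.remove[OF finite_H h0]) (auto simp: P2_def intro!: sum.cong)
    thus ?thesis by (simp add: P2_def)
  qed
  show "\<bar>(\<Sum>n | n \<in> {N<..2*N} \<and> [n = a] (mod W) \<and> prime (n + h0). ln (real (n + h0)) * of_bool (dvs d n \<and> dvs e n)) -
         real N / real (totient W) * (\<Prod>p\<in>PP. kap (P2 h0) p (d p) (e p))\<bar>
        \<le> (if compat d e then EH_error (2 * N + h0) (W * siz (join d e)) + EH_error (N + h0) (W * siz (join d e)) else 0)"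
  proof (cases "compat d e")
    case False
    hence z: "of_bool (dvs d n \<and> dvs e n) = (0::real)" for n using dvs_join[OF de, of n] by simp
    show ?thesis unfolding z using False prod_kap_eq[where P = "P2 h0", OF de P2_total] by simp
  next
    case True
    define q where "q = W * siz j"
    have q1: "q > 1" using W siz_pos[of j] unfolding q_def
      by (metis One_nat_def Suc_leI less_le_trans mult.right_neutral mult_le_mono2)
    have L: "(\<Sum>n\<in>X. ln (real (n + h0)) * of_bool (dvs d n \<and> dvs e n)) = (\<Sum>n\<in>X. ln (real (n + h0)) * of_bool (dvs j n))"
      using dvs_join[OF de] True by (simp add: j_def)
    have K: "(\<Prod>p\<in>PP. kap (P2 h0) p (d p) (e p)) = (\<Prod>p\<in>supp j. P2 h0 p (j p))"
      using prod_kap_eq[where P = "P2 h0", OF de P2_total] True by (simp add: j_def)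
    obtain b where b: "\<And>n. ([n = a] (mod W) \<and> dvs j n) \<longleftrightarrow> [n = b] (mod q)"
      using dvs_class[of j W a, OF j cop] unfolding q_def by metis
    have En: "EH_error m q \<ge> 0" for m using EH_error_ge[of 1 q m] q1 by (meson abs_ge_zero coprime_1_left order_trans)
    show ?thesis
    proof (cases "\<exists>p\<in>PP. j p = Some h0")
      case True
      then obtain p where p: "p \<in> PP" "j p = Some h0" by blast
      have K0: "(\<Prod>p\<in>PP. kap (P2 h0) p (d p) (e p)) = 0"
        unfolding K using p finite_PP by (intro prod_zero) (auto simp: supp_def P2_def)
      have z: "of_bool (dvs j n) = (0::real)" if "n \<in> X" for n
      proof -
        have "\<not> p dvd n + h0"
          using that prime_nat_iff[of "n + h0"] small[OF p(1)] prime_gt_1_nat[OF prime_PP[OF p(1)]] by (auto simp: X_def)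
        thus ?thesis using p by (auto simp: dvs_def)
      qed
      have "(\<Sum>n\<in>X. ln (real (n + h0)) * of_bool (dvs j n)) = 0" using z by (intro sum.neutral) auto
      thus ?thesis using \<open>compat d e\<close> En unfolding X_def[symmetric] L K0 j_def[symmetric] q_def[symmetric]
        by (simp add: add_nonneg_nonneg)
    next
      case False
      have tot: "real (totient q) = real (totient W) * (\<Prod>p\<in>supp j. real p - 1)"
      proof -
        have "totient q = totient W * (\<Prod>p\<in>supp j. p - 1)"
          unfolding q_def siz_supp using cop prime_PP finite_PP by (intro totient_mult_primes) (auto simp: supp_def)
        moreover have "real (\<Prod>p\<in>supp j. p - 1) = (\<Prod>p\<in>supp j. real p - 1)"
          unfolding of_nat_prod using prime_gt_0_nat[OF prime_PP]
          by (intro prod.cong refl) (auto simp: supp_def of_nat_diff Suc_leI)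
        ultimately show ?thesis by simp
      qed
      have "(\<Prod>p\<in>supp j. P2 h0 p (j p)) = (\<Prod>p\<in>supp j. 1 / (real p - 1))"
        using False by (intro prod.cong refl) (auto simp: supp_def P2_def)
      hence M: "real N / real (totient W) * (\<Prod>p\<in>PP. kap (P2 h0) p (d p) (e p)) = real N / real (totient q)"
        unfolding K tot by (simp add: prod_dividef)
      have cq: "coprime (b + h0) q"
      proof -
        have b': "[b = a] (mod W)" "dvs j b" using b[of b] by auto
        have "[b + h0 = a + h0] (mod W)" using b'(1) by (simp add: cong_add_rcancel_nat)
        hence 1: "coprime (b + h0) W" using a cong_imp_coprime cong_sym by blast
        have "coprime (b + h0) p" if p: "p \<in> supp j" for p
        proof -
          obtain h where h: "j p = Some h" "h \<in> H" "p \<in> PP" using p Om_cases[OF j, of p] by (auto simp: supp_def)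
          have "p dvd b + h" using b'(2) h by (auto simp: dvs_def)
          hence "\<not> p dvd b + h0" using dvs_unique[OF h(3,2) h0, of b] h False by auto
          thus ?thesis using prime_PP[OF h(3)] by (simp add: coprime_commute prime_imp_coprime)
        qed
        hence "coprime (b + h0) (\<Prod>(supp j))" by (intro prod_coprime_right) auto
        thus ?thesis using 1 by (simp add: q_def siz_supp)
      qed
      have "(\<Sum>n\<in>X. ln (real (n + h0)) * of_bool (dvs j n))
          = (\<Sum>n\<in>{n\<in>{N<..2*N}. prime (n + h0) \<and> [n = b] (mod q)}. ln (real (n + h0)))"
      proof -
        have "{n\<in>{N<..2*N}. prime (n + h0) \<and> [n = b] (mod q)} = X \<inter> {n. dvs j n}"
          using b by (auto simp: X_def)
        thus ?thesis by (simp add: X_def sum.inter_restrict of_bool_def if_distrib[of "\<lambda>c. _ * c"] cong: if_cong)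
      qed
      also have "\<dots> = (\<Sum>m\<in>{m. prime m \<and> m \<le> 2 * N + h0 \<and> [m = b + h0] (mod q)} -
          {m. prime m \<and> m \<le> N + h0 \<and> [m = b + h0] (mod q)}. ln (real m))"
      proof (rule sum.reindex_bij_witness[where i = "\<lambda>m. m - h0" and j = "\<lambda>n. n + h0"])
        fix m assume m: "m \<in> {m. prime m \<and> m \<le> 2 * N + h0 \<and> [m = b + h0] (mod q)} -
          {m. prime m \<and> m \<le> N + h0 \<and> [m = b + h0] (mod q)}"
        hence "m > N + h0" by auto
        then obtain n where n: "m = n + h0" by (metis add.commute le_add_diff_inverse le_trans less_imp_le_nat le_add2)
        show "m - h0 + h0 = m" "m - h0 \<in> {n \<in> {N<..2 * N}. prime (n + h0) \<and> [n = b] (mod q)}"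
          using m by (auto simp: n cong_add_rcancel_nat)
      qed (auto simp: cong_add_rcancel_nat)
      also have "\<dots> = theta_progression (2 * N + h0) q (b + h0) - theta_progression (N + h0) q (b + h0)"
        unfolding theta_progression_def
        by (rule sum_diff) (auto intro: finite_subset[of _ "{..2 * N + h0}"])
      finally have L': "(\<Sum>n\<in>X. ln (real (n + h0)) * of_bool (dvs j n))
          = theta_progression (2 * N + h0) q (b + h0) - theta_progression (N + h0) q (b + h0)" .
      have "real (2 * N + h0) / real (totient q) - real (N + h0) / real (totient q) = real N / real (totient q)"
        by (simp add: diff_divide_distrib[symmetric])
      thus ?thesis using EH_error_ge[OF cq q1, of "2 * N + h0"] EH_error_ge[OF cq q1, of "N + h0"] \<open>compat d e\<close>
        unfolding X_def[symmetric] L L' M j_def[symmetric] q_def[symmetric] by auto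
    qed
  qed
qed

end

text \<open>By telescoping. All sieving primes exceed \<open>D\<close>, so this tail bound is what
  makes the losses from repeated or shared prime factors small.\<close>

lemma sum_inverse_squares_le:
  assumes "finite S" "\<And>n. n \<in> S \<Longrightarrow> D < n" "D \<ge> 1"
  shows "(\<Sum>n\<in>S. 1 / (real n)\<^sup>2) \<le> 1 / real D"
proof -
  have *: "(\<Sum>n\<in>{D<..D+m}. 1 / (real n)\<^sup>2) \<le> 1 / real D - 1 / real (D + m)" for m
  proof (induction m)
    case (Suc m)
    have "{D<..D + Suc m} = insert (D + Suc m) {D<..D+m}" by auto
    hence "(\<Sum>n\<in>{D<..D + Suc m}. 1 / (real n)\<^sup>2) = 1 / (real (D + Suc m))\<^sup>2 + (\<Sum>n\<in>{D<..D+m}. 1 / (real n)\<^sup>2)" by simp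
    also have "\<dots> \<le> 1 / (real (D + Suc m))\<^sup>2 + (1 / real D - 1 / real (D + m))" using Suc by simp
    also have "1 / (real (D + Suc m))\<^sup>2 \<le> 1 / real (D + m) - 1 / real (D + Suc m)"
    proof -
      have x: "real (D + Suc m) = real (D + m) + 1" by simp
      define y where "y = real (D + m)"
      have y: "y \<ge> 1" using assms(3) by (simp add: y_def)
      have "1 / y - 1 / (y + 1) = 1 / (y * (y + 1))" using y by (simp add: field_simps)
      moreover have "1 / (y + 1)\<^sup>2 \<le> 1 / (y * (y + 1))"
        using y by (intro divide_left_mono) (auto simp: power2_eq_square)
      ultimately show ?thesis unfolding x y_def[symmetric] by simp
    qed
    finally show ?case by simp
  qed simp
  define m where "m = Max (insert 0 S)"
  have "S \<subseteq> {D<..D+m}"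
  proof
    fix n assume "n \<in> S"
    hence "n \<le> m" unfolding m_def using assms(1) by (intro Max_ge) auto
    thus "n \<in> {D<..D+m}" using assms(2)[OF \<open>n \<in> S\<close>] by auto
  qed
  hence "(\<Sum>n\<in>S. 1 / (real n)\<^sup>2) \<le> (\<Sum>n\<in>{D<..D+m}. 1 / (real n)\<^sup>2)" by (intro sum_mono2) auto
  also have "\<dots> \<le> 1 / real D" using *[of m] by (smt (verit) divide_nonneg_nonneg of_nat_0_le_iff)
  finally show ?thesis .
qed

subsection \<open>Sums over integers coprime to a modulus\<close>

text \<open>A full period of length \<open>P\<close> contributes exactly \<open>totient P\<close>,
  so only one incomplete period produces an error.\<close>

lemma card_coprime_initial:
  assumes "P > 0"
  shows "\<bar>real (card {j\<in>{1..m}. coprime j P}) - real (totient P) / real P * real m\<bar> \<le> real P"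
proof (induction m rule: less_induct)
  case (less m)
  define \<kappa> where "\<kappa> = real (totient P) / real P"
  have \<kappa>: "0 \<le> \<kappa>" "\<kappa> \<le> 1" using assms totient_le[of P] by (auto simp: \<kappa>_def)
  show ?case
  proof (cases "m < P")
    case True
    have "card {j\<in>{1..m}. coprime j P} \<le> card {1..m}" by (intro card_mono) auto
    hence "card {j\<in>{1..m}. coprime j P} \<le> P" using True by simp
    moreover have "\<kappa> * real m \<le> 1 * real P" using \<kappa> True by (intro mult_mono) auto
    moreover have "\<kappa> * real m \<ge> 0" using \<kappa> by simp
    ultimately show ?thesis unfolding \<kappa>_def[symmetric] by linarith
  next
    case False
    then obtain n where n: "m = n + P" by (metis add.commute le_add_diff_inverse not_less)
    have cop: "coprime (i + P) P \<longleftrightarrow> coprime i P" for i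
      by (metis coprime_iff_gcd_eq_1 gcd_add1)
    have "{j\<in>{1..m}. coprime j P} = {j\<in>{1..P}. coprime j P} \<union> (\<lambda>j. j + P) ` {j\<in>{1..n}. coprime j P}" (is "_ = ?A \<union> ?B")
    proof (intro equalityI subsetI)
      fix j assume j: "j \<in> {j\<in>{1..m}. coprime j P}"
      show "j \<in> ?A \<union> ?B"
      proof (cases "j \<le> P")
        case False
        then obtain i where i: "j = i + P" by (metis add.commute le_add_diff_inverse not_less less_imp_le)
        have "coprime i P" using j i cop by auto
        thus ?thesis using j i False by (auto simp: n)
      qed (use j in auto)
    next
      fix j assume "j \<in> ?A \<union> ?B"
      thus "j \<in> {j\<in>{1..m}. coprime j P}" using n cop by auto
    qed
    moreover have "?A \<inter> ?B = {}" by auto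
    ultimately have "card {j\<in>{1..m}. coprime j P} = card ?A + card ?B" by (simp add: card_Un_disjoint)
    also have "card ?B = card {j\<in>{1..n}. coprime j P}" by (intro card_image) auto
    also have "?A = totatives P" by (auto simp: totatives_def)
    finally have "real (card {j\<in>{1..m}. coprime j P}) = real (totient P) + real (card {j\<in>{1..n}. coprime j P})"
      by (simp add: totient_def)
    moreover have "real (totient P) / real P * real m = real (totient P) + real (totient P) / real P * real n"
      using assms by (simp add: n field_simps)
    ultimately show ?thesis using less[of n] assms n by simp
  qed
qed

text \<open>Each step from \<open>m\<close> to \<open>m + 1\<close> is bounded by the mean value
  theorem for the antiderivative \<open>F\<close>; no integral has to be formed.\<close>

lemma sum_antimono_integral:
  fixes f F :: "real \<Rightarrow> real"
  assumes mono: "\<And>x y. 1 \<le> x \<Longrightarrow> x \<le> y \<Longrightarrow> f y \<le> f x"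
    and der: "\<And>x. 1 \<le> x \<Longrightarrow> (F has_real_derivative f x) (at x)" and n: "1 \<le> (n::nat)"
  shows "F n - F 1 + f n \<le> (\<Sum>m=1..n. f (real m))" "(\<Sum>m=1..n. f (real m)) \<le> F n - F 1 + f 1"
proof -
  have step: "f (real m + 1) \<le> F (real m + 1) - F (real m) \<and> F (real m + 1) - F (real m) \<le> f (real m)" if "m \<ge> 1" for m :: nat
  proof -
    have "\<exists>z>real m. z < real m + 1 \<and> F (real m + 1) - F (real m) = (real m + 1 - real m) * f z"
      using that by (intro MVT2 der) auto
    then obtain z where z: "z > real m" "z < real m + 1" "F (real m + 1) - F (real m) = (real m + 1 - real m) * f z"
      by blast
    thus ?thesis using mono[of z "real m + 1"] mono[of "real m" z] that by auto
  qed
  have "F n - F 1 + f n \<le> (\<Sum>m=1..n. f (real m)) \<and> (\<Sum>m=1..n. f (real m)) \<le> F n - F 1 + f 1"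
    using n
  proof (induction n rule: nat_induct_at_least)
    case (Suc n)
    thus ?case using step[of n] by (auto simp: add.commute[of 1])
  qed auto
  thus "F n - F 1 + f n \<le> (\<Sum>m=1..n. f (real m))" "(\<Sum>m=1..n. f (real m)) \<le> F n - F 1 + f 1" by auto
qed

text \<open>Partial summation against \<open>b\<close>, the deviation of the coprimality indicator
  from its mean, whose partial sums are bounded by \<open>P\<close>.\<close>

lemma sum_coprime_antimono:
  fixes f :: "real \<Rightarrow> real"
  assumes mono: "\<And>x y. 1 \<le> x \<Longrightarrow> x \<le> y \<Longrightarrow> f y \<le> f x" and nonneg: "\<And>x. 1 \<le> x \<Longrightarrow> 0 \<le> f x"
    and P: "P > 0" and n: "1 \<le> (n::nat)"
  shows "\<bar>(\<Sum>m | m \<in> {1..n} \<and> coprime m P. f (real m)) - real (totient P) / real P * (\<Sum>m=1..n. f (real m))\<bar> \<le> real P * f 1"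
proof -
  define \<kappa> where "\<kappa> = real (totient P) / real P"
  define b where "b m = of_bool (coprime m P) - \<kappa>" for m :: nat
  define B where "B m = (\<Sum>j=1..m. b j)" for m
  have B: "\<bar>B m\<bar> \<le> real P" for m
  proof -
    have "B m = real (card {j\<in>{1..m}. coprime j P}) - \<kappa> * real m"
      by (simp add: B_def b_def sum_subtractf Int_def mult.commute)
    thus ?thesis using card_coprime_initial[OF P, of m] by (simp add: \<kappa>_def)
  qed
  \<comment> \<open>The boundary term \<open>B n * f n\<close> is kept apart during the induction.
    The variation of \<open>f\<close> up to \<open>n\<close> is \<open>f 1 - f n\<close>, and the
    bounds for the two pieces add up to \<open>P * f 1\<close>.\<close>
  have "\<bar>(\<Sum>m=1..n. b m * f (real m)) - B n * f (real n)\<bar> \<le> real P * (f 1 - f (real n))"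
    using n
  proof (induction n rule: nat_induct_at_least)
    case base
    show ?case by (simp add: B_def)
  next
    case (Suc n)
    have BS: "B (Suc n) = B n + b (Suc n)" by (simp add: B_def)
    have le: "0 \<le> f (real n) - f (real (Suc n))" using mono[of "real n" "real (Suc n)"] Suc.hyps by auto
    have "(\<Sum>m=1..Suc n. b m * f (real m)) - B (Suc n) * f (real (Suc n))
        = ((\<Sum>m=1..n. b m * f (real m)) - B n * f (real n)) + B n * (f (real n) - f (real (Suc n)))"
      unfolding BS by (simp add: algebra_simps)
    moreover have "\<bar>B n * (f (real n) - f (real (Suc n)))\<bar> \<le> real P * (f (real n) - f (real (Suc n)))"
      unfolding abs_mult using B[of n] le by (simp add: mult_right_mono)
    ultimately show ?case using Suc.IH by (simp add: right_diff_distrib)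
  qed
  moreover have "\<bar>B n * f (real n)\<bar> \<le> real P * f (real n)"
    unfolding abs_mult using B[of n] nonneg[of "real n"] n by (simp add: mult_right_mono)
  ultimately have "\<bar>\<Sum>m=1..n. b m * f (real m)\<bar> \<le> real P * f 1" by (simp add: right_diff_distrib)
  moreover have "(\<Sum>m=1..n. b m * f (real m)) = (\<Sum>m | m \<in> {1..n} \<and> coprime m P. f (real m)) - \<kappa> * (\<Sum>m=1..n. f (real m))"
  proof -
    have "(\<Sum>m=1..n. of_bool (coprime m P) * f (real m)) = (\<Sum>m | m \<in> {1..n} \<and> coprime m P. f (real m))"
      by (simp add: Int_def)
    thus ?thesis by (simp add: b_def left_diff_distrib sum_subtractf sum_distrib_left)
  qed
  ultimately show ?thesis by (simp add: \<kappa>_def)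
qed

definition cops :: "nat \<Rightarrow> real \<Rightarrow> nat set" where
  "cops P x = {m. 1 \<le> m \<and> real m \<le> x \<and> coprime m P}"

lemma finite_cops [simp]: "finite (cops P x)"
  by (rule finite_subset[of _ "{..nat \<lfloor>x\<rfloor>}"]) (auto simp: cops_def le_nat_floor)

lemma sum_cops_approx:
  fixes f F :: "real \<Rightarrow> real"
  assumes mono: "\<And>x y. 1 \<le> x \<Longrightarrow> x \<le> y \<Longrightarrow> f y \<le> f x" and nonneg: "\<And>x. 1 \<le> x \<Longrightarrow> 0 \<le> f x"
    and der: "\<And>x. 1 \<le> x \<Longrightarrow> (F has_real_derivative f x) (at x)"
    and P: "P > 0" and x: "1 \<le> x"
  shows "\<bar>(\<Sum>m\<in>cops P x. f (real m)) - real (totient P) / real P * (F x - F 1)\<bar> \<le> (real P + 2) * f 1"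
proof -
  define \<kappa> where "\<kappa> = real (totient P) / real P"
  have \<kappa>: "0 \<le> \<kappa>" "\<kappa> \<le> 1" using P totient_le[of P] by (auto simp: \<kappa>_def)
  define n where "n = nat \<lfloor>x\<rfloor>"
  have n: "1 \<le> n" "real n \<le> x" "x < real n + 1" using x by (auto simp: n_def le_nat_floor)
  have e: "cops P x = {m. m \<in> {1..n} \<and> coprime m P}"
    using x by (auto simp: cops_def n_def le_nat_floor) linarith
  have F: "0 \<le> F x - F n \<and> F x - F n \<le> f 1"
  proof (cases "x = n")
    case True
    thus ?thesis using nonneg[of 1] by simp
  next
    case False
    hence "\<exists>z>real n. z < x \<and> F x - F n = (x - real n) * f z"
      using n by (intro MVT2 der) auto
    then obtain z where z: "z > real n" "z < x" "F x - F n = (x - real n) * f z" by blast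
    have "(x - real n) * f z \<le> 1 * f 1" using z n mono[of 1 z] nonneg[of z] by (intro mult_mono) auto
    moreover have "(x - real n) * f z \<ge> 0" using z n nonneg[of z] by simp
    ultimately show ?thesis using z by simp
  qed
  have S: "\<bar>(\<Sum>m=1..n. f (real m)) - (F x - F 1)\<bar> \<le> 2 * f 1"
    using sum_antimono_integral[of f F n] mono der n(1) F nonneg[of "real n"] nonneg[of 1] by force
  have "\<bar>\<kappa> * (\<Sum>m=1..n. f (real m)) - \<kappa> * (F x - F 1)\<bar> = \<kappa> * \<bar>(\<Sum>m=1..n. f (real m)) - (F x - F 1)\<bar>"
    using \<kappa> by (simp add: right_diff_distrib[symmetric] abs_mult)
  also have "\<dots> \<le> 1 * (2 * f 1)" using \<kappa> S by (intro mult_mono) auto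
  finally have "\<bar>\<kappa> * (\<Sum>m=1..n. f (real m)) - \<kappa> * (F x - F 1)\<bar> \<le> 2 * f 1" by simp
  moreover have "\<bar>(\<Sum>m\<in>cops P x. f (real m)) - \<kappa> * (\<Sum>m=1..n. f (real m))\<bar> \<le> real P * f 1"
    using sum_coprime_antimono[of f P n] mono nonneg P n(1) unfolding e \<kappa>_def by blast
  ultimately show ?thesis unfolding \<kappa>_def[symmetric] by (simp add: algebra_simps)
qed

text \<open>Write \<open>m = p * k\<close>: the weight does not decrease when \<open>m\<close> is
  replaced by \<open>k\<close>, and \<open>k\<close> lies in the same range. Multiples of
  \<open>p\<close> thus carry at most a share \<open>1 / p\<close> of the sum, with no error term,
  which is the form needed for union bounds over many \<open>p\<close>.\<close>

lemma sum_cops_multiples_le: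
  fixes w :: "nat \<Rightarrow> real"
  assumes w: "\<And>m n. 1 \<le> m \<Longrightarrow> m \<le> n \<Longrightarrow> w n \<le> w m" "\<And>m. 1 \<le> m \<Longrightarrow> 0 \<le> w m" and p: "p \<ge> 1"
  shows "(\<Sum>m | m \<in> cops P x \<and> p dvd m. w m / real m) \<le> 1 / real p * (\<Sum>m\<in>cops P x. w m / real m)"
proof -
  have inj: "inj_on (\<lambda>m. m div p) {m. m \<in> cops P x \<and> p dvd m}"
    by (auto simp: inj_on_def dvd_def)
  have sub: "(\<lambda>m. m div p) ` {m. m \<in> cops P x \<and> p dvd m} \<subseteq> cops P x"
  proof (intro image_subsetI)
    fix m assume m: "m \<in> {m. m \<in> cops P x \<and> p dvd m}"
    then obtain k where k: "m = p * k" by (auto simp: dvd_def)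
    have "real k \<le> real m" using mult_le_mono1[OF p, of k] by (simp only: k of_nat_le_iff)
    hence "real k \<le> x" using m by (auto simp: cops_def)
    moreover have "k \<ge> 1" using m k by (cases k) (auto simp: cops_def)
    ultimately show "m div p \<in> cops P x" using m p by (auto simp: k cops_def)
  qed
  have "(\<Sum>m | m \<in> cops P x \<and> p dvd m. w m / real m)
      \<le> (\<Sum>m | m \<in> cops P x \<and> p dvd m. 1 / real p * (w (m div p) / real (m div p)))"
  proof (rule sum_mono)
    fix m assume m: "m \<in> {m. m \<in> cops P x \<and> p dvd m}"
    then obtain k where k: "m = p * k" by (auto simp: dvd_def)
    have k1: "k \<ge> 1" using m k by (cases k) (auto simp: cops_def)
    have "w m \<le> w k" using w(1)[of k m] k1 p by (simp add: k)
    hence "w m / real m \<le> w k / real m" by (intro divide_right_mono) auto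
    thus "w m / real m \<le> 1 / real p * (w (m div p) / real (m div p))" using p by (simp add: k)
  qed
  also have "\<dots> = 1 / real p * (\<Sum>m\<in>(\<lambda>m. m div p) ` {m. m \<in> cops P x \<and> p dvd m}. w m / real m)"
    using inj by (simp add: sum.reindex sum_distrib_left)
  also have "\<dots> \<le> 1 / real p * (\<Sum>m\<in>cops P x. w m / real m)"
    using sub w(2) by (intro mult_left_mono sum_mono2 finite_cops) (auto simp: cops_def)
  finally show ?thesis .
qed

lemma harmonic_le: "x \<ge> 1 \<Longrightarrow> (\<Sum>m\<in>cops 1 x. 1 / real m) \<le> ln x + 3"
  using sum_cops_approx[of "\<lambda>x. 1 / x" ln 1 x]
  by (force simp: frac_le intro!: derivative_eq_intros)

subsection \<open>Sums over primes\<close>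

lemma prod_primes_dvd:
  fixes m :: nat
  assumes "finite S" "\<And>p. p \<in> S \<Longrightarrow> prime p" "\<And>p. p \<in> S \<Longrightarrow> p dvd m"
  shows "\<Prod>S dvd m"
  using assms
proof (induction S rule: finite_induct)
  case (insert p S)
  have "coprime p (\<Prod>S)"
    using insert by (intro prod_coprime_right) (metis insertCI primes_coprime)
  thus ?case using insert by (simp add: divides_mult)
qed simp

text \<open>Chebyshev's argument: the primes dividing one \<open>m \<le> n\<close> have product at
  most \<open>n\<close>, so summing \<open>ln p\<close> over pairs \<open>p dvd m\<close> gives at
  most \<open>n * ln n\<close>. The factor 2 comes from \<open>n div p \<ge> n / (2 * p)\<close>,
  valid for \<open>p \<le> n\<close>.\<close>

lemma sum_ln_div_primes_le:
  assumes "n \<ge> 1"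
  shows "(\<Sum>p | prime p \<and> p \<le> n. ln (real p) / real p) \<le> 2 * ln (real n)"
proof -
  define S where "S = {p. prime p \<and> p \<le> n}"
  have fS: "finite S" by (rule finite_subset[of _ "{..n}"]) (auto simp: S_def)
  have div: "real n / (2 * real p) \<le> real (card {m\<in>{1..n}. p dvd m})" if "p \<in> S" for p
  proof -
    have p: "p > 0" "p \<le> n" using that prime_gt_0_nat by (auto simp: S_def)
    have "{m\<in>{1..n}. p dvd m} = (\<lambda>k. p * k) ` {1..n div p}"
    proof (intro equalityI subsetI)
      fix m assume m: "m \<in> {m\<in>{1..n}. p dvd m}"
      then obtain k where k: "m = p * k" by (auto simp: dvd_def)
      have "k \<ge> 1" using m k by (cases k) auto
      moreover have "k \<le> n div p" using m k p by (simp add: less_eq_div_iff_mult_less_eq mult.commute)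
      ultimately show "m \<in> (\<lambda>k. p * k) ` {1..n div p}" using k by auto
    next
      fix m assume "m \<in> (\<lambda>k. p * k) ` {1..n div p}"
      then obtain k where "k \<in> {1..n div p}" "m = p * k" by blast
      hence k: "m = p * k" "1 \<le> k" "k \<le> n div p" by auto
      have "p * k \<le> n" using k(3) p by (simp add: less_eq_div_iff_mult_less_eq mult.commute)
      moreover have "p * k \<ge> 1" using k p by (simp add: Suc_leI)
      ultimately show "m \<in> {m\<in>{1..n}. p dvd m}" using k by auto
    qed
    hence "card {m\<in>{1..n}. p dvd m} = n div p" using p by (simp add: card_image inj_on_def)
    moreover have "n \<le> 2 * p * (n div p)"
    proof -
      have "n = p * (n div p) + n mod p" by simp
      moreover have "n mod p < p" using p by simp
      moreover have "1 \<le> n div p" using p by (simp add: less_eq_div_iff_mult_less_eq)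
      hence "p * 1 \<le> p * (n div p)" by (intro mult_le_mono2)
      ultimately show ?thesis by linarith
    qed
    hence "real n \<le> real (2 * p * (n div p))" by (simp only: of_nat_le_iff)
    ultimately show ?thesis using p by (simp add: field_simps)
  qed
  have "real n / 2 * (\<Sum>p\<in>S. ln (real p) / real p) = (\<Sum>p\<in>S. ln (real p) * (real n / (2 * real p)))"
    by (simp add: sum_distrib_left mult_ac)
  also have "\<dots> \<le> (\<Sum>p\<in>S. ln (real p) * real (card {m\<in>{1..n}. p dvd m}))"
    using div prime_ge_1_nat by (intro sum_mono mult_left_mono) (auto simp: S_def)
  also have "\<dots> = (\<Sum>p\<in>S. \<Sum>m=1..n. if p dvd m then ln (real p) else 0)"
    by (intro sum.cong refl) (simp add: sum.If_cases Int_def mult.commute)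
  also have "\<dots> = (\<Sum>m=1..n. \<Sum>p\<in>S. if p dvd m then ln (real p) else 0)" by (rule sum.swap)
  also have "\<dots> \<le> (\<Sum>m=1..n. ln (real n))"
  proof (rule sum_mono)
    fix m assume m: "m \<in> {1..n}"
    define T where "T = {p\<in>S. p dvd m}"
    have T: "finite T" "\<And>p. p \<in> T \<Longrightarrow> prime p" using fS by (auto simp: T_def S_def)
    have "(\<Sum>p\<in>S. if p dvd m then ln (real p) else 0) = (\<Sum>p\<in>T. ln (real p))"
      unfolding T_def using fS by (simp add: sum.inter_filter)
    also have "\<dots> = ln (real (\<Prod>T))"
      using T prime_gt_0_nat by (simp add: ln_prod)
    also have "\<dots> \<le> ln (real n)"
    proof -
      have "\<Prod>T dvd m" using T by (intro prod_primes_dvd) (auto simp: T_def)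
      hence "\<Prod>T \<le> n" using m by (meson atLeastAtMost_iff dvd_imp_le le_trans less_le_trans zero_less_one)
      moreover have "\<Prod>T > 0" using T prime_gt_0_nat by (intro prod_pos) auto
      ultimately show ?thesis by (simp del: of_nat_prod)
    qed
    finally show "(\<Sum>p\<in>S. if p dvd m then ln (real p) else 0) \<le> ln (real n)" .
  qed
  finally have "real n / 2 * (\<Sum>p\<in>S. ln (real p) / real p) \<le> real n * ln (real n)" by simp
  thus ?thesis unfolding S_def using assms by (simp add: field_simps)
qed

lemma inj_on_prod_primes: "inj_on (\<lambda>B. \<Prod>B) {B. finite B \<and> (\<forall>p\<in>B. prime (p::nat))}"
proof (rule inj_onI)
  have *: "B = {p. prime p \<and> p dvd \<Prod>B}" if B: "finite B" "\<forall>p\<in>B. prime p" for B :: "nat set"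
  proof (intro equalityI subsetI)
    fix p assume "p \<in> {p. prime p \<and> p dvd \<Prod>B}"
    then obtain q where "prime p" "q \<in> B" "p dvd q" using B prime_dvd_prod_iff[of B p "\<lambda>x. x"] by auto
    thus "p \<in> B" using B primes_dvd_imp_eq[of p q] by auto
  next
    fix p assume "p \<in> B"
    thus "p \<in> {p. prime p \<and> p dvd \<Prod>B}" using B dvd_prodI[of B p "\<lambda>x. x"] by auto
  qed
  fix B C :: "nat set" assume B: "B \<in> {B. finite B \<and> (\<forall>p\<in>B. prime p)}" and C: "C \<in> {B. finite B \<and> (\<forall>p\<in>B. prime p)}"
    and eq: "\<Prod>B = \<Prod>C"
  have "B = {p. prime p \<and> p dvd \<Prod>B}" by (rule *) (use B in auto)
  also have "\<dots> = {p. prime p \<and> p dvd \<Prod>C}" unfolding eq ..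
  also have "\<dots> = C" by (rule *[symmetric]) (use C in auto)
  finally show "B = C" .
qed

text \<open>Squarefree moduli are indexed by their sets of prime factors, so that multiplicative
  weights become powers of a cardinality.\<close>

definition prime_sets :: "nat set \<Rightarrow> real \<Rightarrow> nat set set" where
  "prime_sets PP Q = {B. B \<subseteq> PP \<and> real (\<Prod>B) \<le> Q}"

text \<open>Induction on \<open>M\<close> through
  \<open>(M + 1) ^ card B = (\<Sum>C\<in>Pow B. M ^ card C)\<close>, the convolution identity for
  divisor functions. Splitting \<open>B\<close> into \<open>C\<close> and \<open>B - C\<close> and
  forgetting that they are disjoint splits off one harmonic sum.\<close>

lemma sum_prime_sets_le:
  assumes PP: "finite PP" "\<And>p. p \<in> PP \<Longrightarrow> prime p" and Q: "Q \<ge> 1"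
  shows "(\<Sum>B\<in>prime_sets PP Q. real M ^ card B / real (\<Prod>B)) \<le> (ln Q + 3) ^ M"
proof (induction M)
  case 0
  have "(\<Sum>B\<in>prime_sets PP Q. real 0 ^ card B / real (\<Prod>B)) = (\<Sum>B\<in>{{}}. real 0 ^ card B / real (\<Prod>B))"
  proof (rule sum.mono_neutral_right)
    show "\<forall>B\<in>prime_sets PP Q - {{}}. real 0 ^ card B / real (\<Prod>B) = 0"
    proof
      fix B assume "B \<in> prime_sets PP Q - {{}}"
      hence "finite B" "B \<noteq> {}" using PP(1) by (auto simp: prime_sets_def intro: finite_subset)
      hence "card B > 0" by (simp add: card_gt_0_iff)
      thus "real 0 ^ card B / real (\<Prod>B) = 0" by simp
    qed
  qed (use PP Q in \<open>auto simp: prime_sets_def\<close>)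
  thus ?case by simp
next
  case (Suc M)
  define T where "T = prime_sets PP Q"
  have fT: "finite T" using PP(1) by (auto simp: T_def prime_sets_def)
  have fB: "finite B" if "B \<in> T" for B using that PP(1) finite_subset by (auto simp: T_def prime_sets_def)
  have pos: "\<Prod>B > 0" if "B \<subseteq> PP" for B using that PP prime_gt_0_nat by (intro prod_pos) auto
  have down: "C \<in> T" if "B \<in> T" "C \<subseteq> B" for B C
  proof -
    have "\<Prod>C dvd \<Prod>B" using that fB by (intro prod_dvd_prod_subset) auto
    hence "\<Prod>C \<le> \<Prod>B" using pos[of B] that(1) by (intro dvd_imp_le) (auto simp: T_def prime_sets_def)
    hence "real (\<Prod>C) \<le> real (\<Prod>B)" by (simp only: of_nat_le_iff)
    thus ?thesis using that unfolding T_def prime_sets_def by auto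
  qed
  have "(\<Sum>B\<in>T. real (Suc M) ^ card B / real (\<Prod>B)) = (\<Sum>B\<in>T. \<Sum>C\<in>Pow B. real M ^ card C / real (\<Prod>C) * (1 / real (\<Prod>(B - C))))"
  proof (rule sum.cong[OF refl])
    fix B assume B: "B \<in> T"
    have "real (Suc M) ^ card B = (\<Prod>i\<in>B. real M + 1)" by (simp add: add.commute)
    also have "\<dots> = (\<Sum>C\<in>Pow B. real M ^ card C)" using prod_add[OF fB[OF B], of "\<lambda>_. real M" "\<lambda>_. 1"] by simp
    finally have "real (Suc M) ^ card B / real (\<Prod>B) = (\<Sum>C\<in>Pow B. real M ^ card C / real (\<Prod>B))"
      by (simp add: sum_divide_distrib)
    also have "\<dots> = (\<Sum>C\<in>Pow B. real M ^ card C / real (\<Prod>C) * (1 / real (\<Prod>(B - C))))"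
    proof (rule sum.cong[OF refl])
      fix C assume "C \<in> Pow B"
      hence "\<Prod>B = \<Prod>(B - C) * \<Prod>C" using fB[OF B] by (intro prod.subset_diff) auto
      thus "real M ^ card C / real (\<Prod>B) = real M ^ card C / real (\<Prod>C) * (1 / real (\<Prod>(B - C)))" by (simp add: mult.commute)
    qed
    finally show "real (Suc M) ^ card B / real (\<Prod>B) = (\<Sum>C\<in>Pow B. real M ^ card C / real (\<Prod>C) * (1 / real (\<Prod>(B - C))))" .
  qed
  also have "\<dots> = (\<Sum>(B, C)\<in>Sigma T Pow. real M ^ card C / real (\<Prod>C) * (1 / real (\<Prod>(B - C))))"
    using fT fB by (simp add: sum.Sigma)
  also have "\<dots> = (\<Sum>(C, E)\<in>(\<lambda>(B, C). (C, B - C)) ` Sigma T Pow. real M ^ card C / real (\<Prod>C) * (1 / real (\<Prod>E)))"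
    by (subst sum.reindex) (auto simp: inj_on_def case_prod_unfold)
  also have "\<dots> \<le> (\<Sum>(C, E)\<in>T \<times> T. real M ^ card C / real (\<Prod>C) * (1 / real (\<Prod>E)))"
    using fT down
    by (intro sum_mono2) (auto simp: case_prod_unfold intro!: divide_nonneg_nonneg mult_nonneg_nonneg prod_nonneg)
  also have "\<dots> = (\<Sum>C\<in>T. real M ^ card C / real (\<Prod>C)) * (\<Sum>E\<in>T. 1 / real (\<Prod>E))"
    by (simp add: sum_product sum.cartesian_product)
  also have "\<dots> \<le> (ln Q + 3) ^ M * (ln Q + 3)"
  proof (rule mult_mono)
    have inj: "inj_on (\<lambda>B. \<Prod>B) T"
      by (rule inj_on_subset[OF inj_on_prod_primes]) (use fB PP in \<open>auto simp: T_def prime_sets_def\<close>)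
    have "(\<Sum>E\<in>T. 1 / real (\<Prod>E)) = (\<Sum>m\<in>(\<lambda>B. \<Prod>B) ` T. 1 / real m)" using inj by (simp add: sum.reindex)
    also have "\<dots> \<le> (\<Sum>m\<in>cops 1 Q. 1 / real m)"
      using pos by (intro sum_mono2 finite_cops) (auto simp: cops_def T_def prime_sets_def Suc_le_eq simp del: of_nat_prod)
    also have "\<dots> \<le> ln Q + 3" by (rule harmonic_le[OF Q])
    finally show "(\<Sum>E\<in>T. 1 / real (\<Prod>E)) \<le> ln Q + 3" .
    show "(\<Sum>C\<in>T. real M ^ card C / real (\<Prod>C)) \<le> (ln Q + 3) ^ M" using Suc.IH by (simp add: T_def)
    show "0 \<le> (ln Q + 3) ^ M" using Q by simp
  qed (intro sum_nonneg, simp del: of_nat_prod)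
  finally show ?case by (simp add: T_def mult.commute)
qed

section \<open>Errors in the distribution of primes, averaged with divisor weights\<close>

lemma EH_error_nonneg:
  assumes "q \<ge> 1"
  shows "EH_error N q \<ge> 0"
proof -
  have "1 \<in> totatives q" using assms by (simp add: totatives_def)
  hence "\<bar>theta_progression N q 1 - real N / real (totient q)\<bar> \<le> EH_error N q"
    unfolding EH_error_def by (intro Max_ge finite_imageI finite_totatives) blast
  thus ?thesis by linarith
qed

text \<open>Counting all integers of the class in place of the primes costs a logarithm, which is
  affordable because it will be balanced against an arbitrary power saved on average.\<close>

lemma EH_error_trivial:
  assumes "1 \<le> q" "q \<le> N"
  shows "EH_error N q \<le> 2 * ln (real N) * real N / real q + real N / real (totient q)"
proof -
  have ne: "totatives q \<noteq> {}" using assms by (auto simp: totatives_def intro!: exI[of _ 1])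
  have "\<bar>theta_progression N q a - real N / real (totient q)\<bar> \<le> 2 * ln (real N) * real N / real q + real N / real (totient q)" for a
  proof -
    have "theta_progression N q a \<le> (\<Sum>p | prime p \<and> p \<le> N \<and> [p = a] (mod q). ln (real N))"
      unfolding theta_progression_def
    proof (rule sum_mono)
      fix p assume "p \<in> {p. prime p \<and> p \<le> N \<and> [p = a] (mod q)}"
      hence "p > 0" "p \<le> N" using prime_gt_0_nat by auto
      thus "ln (real p) \<le> ln (real N)" by simp
    qed
    also have "\<dots> = real (card {p. prime p \<and> p \<le> N \<and> [p = a] (mod q)}) * ln (real N)" by simp
    also have "\<dots> \<le> real (card {n\<in>{0<..0+N}. [n = a] (mod q)}) * ln (real N)"
      using assms prime_gt_0_nat by (intro mult_right_mono of_nat_mono card_mono) auto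
    also have "\<dots> \<le> (real N / real q + 1) * ln (real N)"
      using card_residue_class[of q 0 N a] assms by (intro mult_right_mono) auto
    also have "\<dots> \<le> (2 * (real N / real q)) * ln (real N)"
      using assms by (intro mult_right_mono) (auto simp: field_simps)
    finally have "theta_progression N q a \<le> 2 * ln (real N) * real N / real q" by (simp add: mult_ac)
    moreover have "theta_progression N q a \<ge> 0"
      unfolding theta_progression_def using prime_ge_1_nat by (intro sum_nonneg) auto
    moreover have "real N / real (totient q) \<ge> 0" by simp
    ultimately show ?thesis by linarith
  qed
  thus ?thesis unfolding EH_error_def using ne by (subst Max_le_iff) auto
qed

lemma EH_weighted_pointwise:
  assumes PP: "finite PP" "\<And>p. p \<in> PP \<Longrightarrow> prime p" "\<And>p. p \<in> PP \<Longrightarrow> coprime p W" and W: "W \<ge> 1"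
    and B: "B \<subseteq> PP" and N: "W * \<Prod>B \<le> N" "ln (real N) \<ge> 1"
  shows "EH_error N (W * \<Prod>B) \<le> 3 * real N * ln (real N) * 2 ^ card B / real (\<Prod>B)"
proof -
  have fB: "finite B" using B PP(1) finite_subset by blast
  have pos: "\<Prod>B > 0" using B PP prime_gt_0_nat by (intro prod_pos) auto
  have tot: "totient (W * \<Prod>B) = totient W * (\<Prod>p\<in>B. p - 1)"
    using fB B PP by (intro totient_mult_primes) auto
  have "\<Prod>B \<le> 2 ^ card B * (\<Prod>p\<in>B. p - 1)"
  proof -
    have "\<Prod>B \<le> (\<Prod>p\<in>B. 2 * (p - 1))"
    proof (rule prod_mono)
      fix p assume "p \<in> B"
      hence "p \<ge> 2" using B PP(2) prime_ge_2_nat by blast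
      thus "0 \<le> p \<and> p \<le> 2 * (p - 1)" by linarith
    qed
    thus ?thesis by (simp add: prod.distrib)
  qed
  also have "\<dots> \<le> 2 ^ card B * totient (W * \<Prod>B)"
    unfolding tot using W by (intro mult_le_mono2) (cases "totient W"; auto)
  finally have "real (\<Prod>B) \<le> real (2 ^ card B * totient (W * \<Prod>B))" by (simp only: of_nat_le_iff)
  hence 1: "real (\<Prod>B) \<le> 2 ^ card B * real (totient (W * \<Prod>B))" by simp
  have tpos: "real (totient (W * \<Prod>B)) > 0" using W pos by simp
  have rpos: "real (\<Prod>B) > 0" using pos by (simp only: of_nat_0_less_iff)
  have "real N / real (totient (W * \<Prod>B)) \<le> real N * 2 ^ card B / real (\<Prod>B)"
    using 1 tpos rpos by (simp add: divide_le_eq pos_le_divide_eq mult_left_mono mult_ac del: of_nat_prod)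
  also have "\<dots> \<le> real N * ln (real N) * 2 ^ card B / real (\<Prod>B)"
    using N(2) rpos by (intro divide_right_mono mult_right_mono) (auto simp: mult_le_cancel_left1)
  finally have a: "real N / real (totient (W * \<Prod>B)) \<le> real N * ln (real N) * 2 ^ card B / real (\<Prod>B)" .
  have "2 * ln (real N) * real N / real (W * \<Prod>B) \<le> 2 * ln (real N) * real N / real (\<Prod>B)"
    using N(2) rpos W by (intro divide_left_mono) (auto simp: mult_le_cancel_right1 simp del: of_nat_prod)
  also have "\<dots> \<le> 2 * ln (real N) * real N * 2 ^ card B / real (\<Prod>B)"
  proof (rule divide_right_mono)
    have "2 * ln (real N) * real N * 1 \<le> 2 * ln (real N) * real N * 2 ^ card B"
      using N(2) by (intro mult_left_mono) auto
    thus "2 * ln (real N) * real N \<le> 2 * ln (real N) * real N * 2 ^ card B" by simp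
  qed (use rpos in simp)
  finally have b: "2 * ln (real N) * real N / real (W * \<Prod>B) \<le> 2 * (real N * ln (real N) * 2 ^ card B / real (\<Prod>B))" by (simp add: mult_ac)
  have "EH_error N (W * \<Prod>B) \<le> 2 * ln (real N) * real N / real (W * \<Prod>B) + real N / real (totient (W * \<Prod>B))"
    using W pos N(1) by (intro EH_error_trivial) (auto simp: Suc_le_eq)
  also have "\<dots> \<le> 2 * (real N * ln (real N) * 2 ^ card B / real (\<Prod>B)) + real N * ln (real N) * 2 ^ card B / real (\<Prod>B)"
    by (rule add_mono[OF b a])
  finally show ?thesis by (simp only: times_divide_eq_right add_divide_distrib[symmetric]) (simp add: mult_ac)
qed

text \<open>By Cauchy-Schwarz the square of the weighted sum is at most the unweighted sum of
  errors, small by hypothesis, times the sum with squared weights, for which the trivial bound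
  suffices.\<close>

theorem EH_weighted:
  assumes EH: Elliott_Halberstam and W: "W \<ge> 1" and b: "b > 0"
  obtains C N0 where "C > 0" "\<And>N PP Q. N \<ge> N0 \<Longrightarrow> finite PP \<Longrightarrow> (\<And>p. p \<in> PP \<Longrightarrow> prime p) \<Longrightarrow>
     (\<And>p. p \<in> PP \<Longrightarrow> coprime p W) \<Longrightarrow> 1 \<le> Q \<Longrightarrow> real W * Q \<le> real N powr (1/2) \<Longrightarrow>
     (\<Sum>B\<in>prime_sets PP Q. real M ^ card B * EH_error N (W * \<Prod>B)) \<le> C * real N / ln (real N) powr b"
proof -
  \<comment> \<open>Squaring the weight gives \<open>M^2\<close>, and the factor
    \<open>2 ^ card B\<close> that bounds the quotient of \<open>\<Prod>B\<close> by the totient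
    doubles it. The exponent \<open>A\<close> is then such that
    \<open>L ^ (M2 + 1) / L powr A\<close> is the square of \<open>1 / L powr b\<close>.\<close>
  define M2 where "M2 = 2 * M ^ 2"
  define A where "A = 2 * b + real M2 + 1"
  have A: "A > 0" using b by (simp add: A_def)
  have "(\<lambda>N::nat. \<Sum>q | 1 \<le> q \<and> real q \<le> real N powr (1 - 1/2). EH_error N q) \<in> O(\<lambda>N. real N / ln (real N) powr A)"
    unfolding EH_error_def by (rule EH[unfolded Elliott_Halberstam_def, rule_format, OF A]) simp
  then obtain c where c: "c > 0" "\<forall>\<^sub>F N::nat in at_top.
      norm (\<Sum>q | 1 \<le> q \<and> real q \<le> real N powr (1 - 1/2). EH_error N q) \<le> c * norm (real N / ln (real N) powr A)"
    by (elim landau_o.bigE)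
  have "\<forall>\<^sub>F N::nat in at_top. ln (real N) \<ge> 3" by real_asymp
  with c(2) have "\<forall>\<^sub>F N::nat in at_top. norm (\<Sum>q | 1 \<le> q \<and> real q \<le> real N powr (1 - 1/2). EH_error N q) \<le> c * norm (real N / ln (real N) powr A) \<and> ln (real N) \<ge> 3"
    by eventually_elim auto
  then obtain N0 where N0: "\<And>N. N \<ge> N0 \<Longrightarrow> norm (\<Sum>q | 1 \<le> q \<and> real q \<le> real N powr (1 - 1/2). EH_error N q) \<le> c * norm (real N / ln (real N) powr A) \<and> ln (real N) \<ge> 3"
    unfolding eventually_at_top_linorder by blast
  \<comment> \<open>The 3 comes from \<open>EH_weighted_pointwise\<close> and \<open>2 ^ M2\<close>
    from \<open>ln Q + 3 \<le> 2 * L\<close>; the root undoes the squaring in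
    Cauchy-Schwarz.\<close>
  define C where "C = sqrt (3 * c * 2 ^ M2)"
  show ?thesis
  proof (rule that)
    show "C > 0" using c(1) by (simp add: C_def)
    fix N PP Q assume N: "N \<ge> N0" and PP: "finite PP" "\<And>p. p \<in> PP \<Longrightarrow> prime p" "\<And>p. p \<in> PP \<Longrightarrow> coprime p W"
      and Q: "1 \<le> Q" "real W * Q \<le> real N powr (1/2)"
    define L where "L = ln (real N)"
    have L: "L \<ge> 3" using N0[OF N] by (simp add: L_def)
    have N1: "real N > 1"
    proof (rule ccontr)
      assume "\<not> real N > 1"
      hence "N = 0 \<or> N = 1" by auto
      thus False using L by (auto simp: L_def)
    qed
    define T where "T = prime_sets PP Q"
    have fT: "finite T" using PP(1) by (auto simp: T_def prime_sets_def)
    have sub: "B \<subseteq> PP" "real (\<Prod>B) \<le> Q" "finite B" if "B \<in> T" for B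
      using that PP(1) finite_subset by (auto simp: T_def prime_sets_def)
    have pos: "\<Prod>B > 0" if "B \<in> T" for B using sub[OF that] PP prime_gt_0_nat by (intro prod_pos) auto
    have sz: "real (W * \<Prod>B) \<le> real N powr (1/2)" if "B \<in> T" for B
    proof -
      have "real (W * \<Prod>B) \<le> real W * Q" using sub[OF that] W by (simp add: mult_left_mono del: of_nat_prod)
      thus ?thesis using Q(2) by linarith
    qed
    have szN: "W * \<Prod>B \<le> N" if "B \<in> T" for B
    proof -
      have "real N powr (1/2) \<le> real N powr 1" using N1 by (intro powr_mono) auto
      hence "real (W * \<Prod>B) \<le> real N" using sz[OF that] N1 by simp
      thus ?thesis by (simp only: of_nat_le_iff)
    qed
    define E where "E B = EH_error N (W * \<Prod>B)" for B
    have E0: "E B \<ge> 0" if "B \<in> T" for B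
      unfolding E_def using W pos[OF that] by (intro EH_error_nonneg) (auto simp: Suc_le_eq)
    have s1: "(\<Sum>B\<in>T. E B) \<le> c * real N / L powr A"
    proof -
      have inj: "inj_on (\<lambda>B. W * \<Prod>B) T"
      proof (rule inj_onI)
        fix B C assume BC: "B \<in> T" "C \<in> T" "W * \<Prod>B = W * \<Prod>C"
        hence "\<Prod>B = \<Prod>C" using W by simp
        thus "B = C" using BC sub PP(2) by (intro inj_onD[OF inj_on_prod_primes]) blast+
      qed
      have "(\<Sum>B\<in>T. E B) = (\<Sum>q\<in>(\<lambda>B. W * \<Prod>B) ` T. EH_error N q)" using inj by (simp add: sum.reindex E_def)
      also have "\<dots> \<le> (\<Sum>q | 1 \<le> q \<and> real q \<le> real N powr (1 - 1/2). EH_error N q)"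
      proof (rule sum_mono2)
        show "finite {q. 1 \<le> q \<and> real q \<le> real N powr (1 - 1/2)}"
          by (rule finite_subset[of _ "{..nat \<lfloor>real N powr (1 - 1/2)\<rfloor>}"]) (auto simp: le_nat_floor)
        show "(\<lambda>B. W * \<Prod>B) ` T \<subseteq> {q. 1 \<le> q \<and> real q \<le> real N powr (1 - 1/2)}"
          using sz pos W by (auto simp: Suc_le_eq simp del: of_nat_mult of_nat_prod)
      qed (auto intro: EH_error_nonneg)
      also have "\<dots> \<le> c * real N / L powr A"
        using N0[OF N] by (auto simp: L_def)
      finally show ?thesis .
    qed
    have s2: "(\<Sum>B\<in>T. (real M ^ card B)\<^sup>2 * E B) \<le> 3 * real N * L * (2 * L) ^ M2"
    proof -
      have "(\<Sum>B\<in>T. (real M ^ card B)\<^sup>2 * E B) \<le> (\<Sum>B\<in>T. (real M ^ card B)\<^sup>2 * (3 * real N * L * 2 ^ card B / real (\<Prod>B)))"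
        unfolding E_def L_def using sub szN W PP L
        by (intro sum_mono mult_left_mono EH_weighted_pointwise[OF PP]) (auto simp: L_def)
      also have "\<dots> = 3 * real N * L * (\<Sum>B\<in>T. real M2 ^ card B / real (\<Prod>B))"
        unfolding sum_distrib_left M2_def
        by (intro sum.cong refl) (simp add: power_mult_distrib power_mult[symmetric] mult_ac del: of_nat_prod)
      also have "\<dots> \<le> 3 * real N * L * (ln Q + 3) ^ M2"
        unfolding T_def using sum_prime_sets_le[OF PP(1,2) Q(1)] L by (intro mult_left_mono) auto
      also have "\<dots> \<le> 3 * real N * L * (2 * L) ^ M2"
      proof (intro mult_left_mono power_mono)
        have "Q \<le> real W * Q" using W Q(1) by (simp add: mult_le_cancel_right1)
        also have "\<dots> \<le> real N powr (1/2)" by (rule Q)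
        also have "\<dots> \<le> real N powr 1" using N1 by (intro powr_mono) auto
        finally have "Q \<le> real N" using N1 by simp
        hence "ln Q \<le> L" using Q(1) by (simp add: L_def)
        thus "ln Q + 3 \<le> 2 * L" using L by simp
      qed (use Q(1) L in auto)
      finally show ?thesis .
    qed
    have "(\<Sum>B\<in>T. real M ^ card B * E B)\<^sup>2 = (\<Sum>B\<in>T. (real M ^ card B * sqrt (E B)) * sqrt (E B))\<^sup>2"
      using E0 by (intro arg_cong[where f = "\<lambda>x. x\<^sup>2"] sum.cong) (auto simp: mult.assoc)
    also have "\<dots> \<le> (\<Sum>B\<in>T. (real M ^ card B * sqrt (E B))\<^sup>2) * (\<Sum>B\<in>T. (sqrt (E B))\<^sup>2)"
      by (rule Cauchy_Schwarz_ineq_sum)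
    also have "\<dots> = (\<Sum>B\<in>T. (real M ^ card B)\<^sup>2 * E B) * (\<Sum>B\<in>T. E B)"
      using E0 by (intro arg_cong2[where f = "(*)"] sum.cong) (auto simp: power_mult_distrib)
    also have "\<dots> \<le> (3 * real N * L * (2 * L) ^ M2) * (c * real N / L powr A)"
      using s1 s2 E0 L by (intro mult_mono) (auto intro: sum_nonneg)
    also have "\<dots> = 3 * c * 2 ^ M2 * (real N)\<^sup>2 * (L * L ^ M2 / L powr A)"
      by (simp add: power_mult_distrib power2_eq_square mult_ac)
    also have "L * L ^ M2 / L powr A = 1 / (L powr b)\<^sup>2"
    proof -
      have "L * L ^ M2 = L powr (real M2 + 1)" using L by (simp add: powr_add powr_realpow)
      moreover have "(L powr b)\<^sup>2 = L powr (2 * b)" by (simp add: power2_eq_square powr_add[symmetric])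
      moreover have "L powr (real M2 + 1) / L powr A = 1 / L powr (2 * b)"
        using L by (simp add: powr_diff[symmetric] A_def powr_minus_divide)
      ultimately show ?thesis by simp
    qed
    also have "3 * c * 2 ^ M2 * (real N)\<^sup>2 * (1 / (L powr b)\<^sup>2) = (C * real N / L powr b)\<^sup>2"
      using c(1) by (simp add: C_def power_divide power_mult_distrib)
    finally have "(\<Sum>B\<in>T. real M ^ card B * E B)\<^sup>2 \<le> (C * real N / L powr b)\<^sup>2" .
    moreover have "C * real N / L powr b \<ge> 0" using c(1) by (simp add: C_def)
    ultimately show "(\<Sum>B\<in>prime_sets PP Q. real M ^ card B * EH_error N (W * \<Prod>B)) \<le> C * real N / ln (real N) powr b"
      unfolding T_def E_def L_def by (rule power2_le_imp_le)
  qed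
qed

section \<open>Size of the sieve coefficients and of the total error\<close>

context tuple_sieve
begin

lemma part_pos [simp]: "part r h > 0"
  unfolding part_def using prime_gt_0_nat[OF prime_PP] by (intro prod_pos) auto

lemma siz_eq_prod_part:
  assumes "r \<in> Om"
  shows "siz r = (\<Prod>h\<in>H. part r h)"
proof -
  have "supp r = (\<Union>h\<in>H. {p\<in>PP. r p = Some h})"
    using Om_cases[OF assms] by (fastforce simp: supp_def)
  hence "siz r = (\<Prod>p\<in>(\<Union>h\<in>H. {p\<in>PP. r p = Some h}). p)" by (simp add: siz_supp)
  also have "\<dots> = (\<Prod>h\<in>H. \<Prod>p\<in>{p\<in>PP. r p = Some h}. p)"
    using finite_H finite_PP by (intro prod.UNION_disjoint) auto
  finally show ?thesis by (simp add: part_def)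
qed

lemma inj_on_part: "inj_on (\<lambda>r. \<lambda>h\<in>H. part r h) Om"
proof (rule inj_onI)
  fix r s assume r: "r \<in> Om" and s: "s \<in> Om" and eq: "(\<lambda>h\<in>H. part r h) = (\<lambda>h\<in>H. part s h)"
  have e: "{p\<in>PP. r p = Some h} = {p\<in>PP. s p = Some h}" if "h \<in> H" for h
  proof (rule inj_onD[OF inj_on_prod_primes])
    show "\<Prod>{p\<in>PP. r p = Some h} = \<Prod>{p\<in>PP. s p = Some h}"
      using fun_cong[OF eq, of h] that by (simp add: part_def)
  qed (use finite_PP prime_PP in auto)
  show "r = s"
  proof (rule PiE_ext[of _ PP "\<lambda>_. St"])
    show "r \<in> PP \<rightarrow>\<^sub>E St" "s \<in> PP \<rightarrow>\<^sub>E St" using r s by (auto simp: Om_def)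
    fix p assume p: "p \<in> PP"
    show "r p = s p" using Om_cases[OF r p] Om_cases[OF s p] e p by (metis (mono_tags, lifting) mem_Collect_eq)
  qed
qed

text \<open>The tuple of parts determines \<open>r\<close>, so dropping the conditions of being
  squarefree and pairwise coprime only adds nonnegative terms and lets the sum factor over
  \<open>H\<close>.\<close>

lemma sum_Om_prod_part_le:
  assumes T: "finite T" "\<And>m. m \<in> T \<Longrightarrow> 0 \<le> a m" and X: "X \<subseteq> Om" "\<And>r h. r \<in> X \<Longrightarrow> h \<in> H \<Longrightarrow> part r h \<in> T"
  shows "(\<Sum>r\<in>X. \<Prod>h\<in>H. a (part r h)) \<le> (\<Sum>m\<in>T. a m :: real) ^ card H"
proof -
  define \<phi> where "\<phi> = (\<lambda>r. \<lambda>h\<in>H. part r h)"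
  have inj: "inj_on \<phi> X" unfolding \<phi>_def using inj_on_subset[OF inj_on_part X(1)] .
  have "(\<Sum>r\<in>X. \<Prod>h\<in>H. a (part r h)) = (\<Sum>m\<in>\<phi> ` X. \<Prod>h\<in>H. a (m h))"
    using inj by (subst sum.reindex) (auto simp: \<phi>_def)
  also have "\<dots> \<le> (\<Sum>m\<in>H \<rightarrow>\<^sub>E T. \<Prod>h\<in>H. a (m h))"
    using X T by (intro sum_mono2 finite_PiE finite_H) (auto simp: \<phi>_def PiE_iff intro!: prod_nonneg)
  also have "\<dots> = (\<Prod>h\<in>H. \<Sum>m\<in>T. a m)" using finite_H T by (subst prod_sum_PiE) auto
  finally show ?thesis by simp
qed

lemma part_le_siz:
  assumes "r \<in> Om" "h \<in> H"
  shows "part r h \<le> siz r"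
proof -
  have "part r h dvd siz r" unfolding siz_eq_prod_part[OF assms(1)] using assms(2) finite_H by (intro dvd_prodI)
  thus ?thesis by (intro dvd_imp_le) auto
qed

lemma sum_inverse_siz_le:
  assumes "R \<ge> 1"
  shows "(\<Sum>r | r \<in> Om \<and> real (siz r) \<le> R. 1 / real (siz r)) \<le> (ln R + 3) ^ card H"
proof -
  define X where "X = {r. r \<in> Om \<and> real (siz r) \<le> R}"
  have "(\<Sum>r\<in>X. 1 / real (siz r)) = (\<Sum>r\<in>X. \<Prod>h\<in>H. 1 / real (part r h))"
    by (intro sum.cong refl) (auto simp: X_def siz_eq_prod_part prod_dividef)
  also have "\<dots> \<le> (\<Sum>m\<in>cops 1 R. 1 / real m) ^ card H"
  proof (rule sum_Om_prod_part_le)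
    fix r h assume "r \<in> X" "h \<in> H"
    thus "part r h \<in> cops 1 R"
      using part_le_siz[of r h] part_pos[of r h] by (auto simp: cops_def X_def Suc_le_eq simp del: part_pos)
  qed (auto simp: X_def)
  also have "\<dots> \<le> (ln R + 3) ^ card H" using harmonic_le[OF assms] by (intro power_mono) (auto simp: sum_nonneg)
  finally show ?thesis by (simp add: X_def)
qed

lemma Bt_abs: "\<bar>Bt p s t\<bar> = (if s = None then (if t = None then 1 else 1 / real p) else if s = t then 1 else 0)"
  by (auto simp: Bt_def split: option.splits)

text \<open>\<open>Bt\<close> vanishes unless \<open>r\<close> agrees with \<open>d\<close> on the
  support of \<open>d\<close>; there it contributes signs, and elsewhere a factor
  \<open>1 / p\<close> for each further prime. What is left of \<open>r\<close> outside that
  support, called \<open>\<phi> r\<close>, determines \<open>r\<close>, so the sum is at most the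
  sum of all \<open>1 / siz\<close>. Moreover \<open>siz d \<le> siz r\<close>, which transfers the
  support bound.\<close>

lemma lam_bounds:
  assumes y: "\<And>r. r \<in> Om \<Longrightarrow> 0 \<le> y r \<and> y r \<le> 1" "\<And>r. r \<in> Om \<Longrightarrow> y r \<noteq> 0 \<Longrightarrow> real (siz r) \<le> R"
    and R: "R \<ge> 1" and d: "d \<in> Om"
  shows "\<bar>lam y d\<bar> \<le> (ln R + 3) ^ card H" "lam y d \<noteq> 0 \<Longrightarrow> real (siz d) \<le> R"
proof -
  define X where "X = {r\<in>Om. (\<forall>p\<in>PP. d p \<noteq> None \<longrightarrow> r p = d p) \<and> y r \<noteq> 0}"
  define \<phi> where "\<phi> r = (\<lambda>p\<in>PP. if d p = None then r p else None)" for r :: "nat \<Rightarrow> nat option"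
  have zero: "(\<Prod>p\<in>PP. Bt p (d p) (r p)) * y r = 0" if r: "r \<in> Om - X" for r
  proof (cases "y r = 0")
    case False
    then obtain p where p: "p \<in> PP" "d p \<noteq> None" "r p \<noteq> d p" using r by (auto simp: X_def)
    hence "Bt p (d p) (r p) = 0" by (auto simp: Bt_def split: option.splits)
    thus ?thesis using p finite_PP by (auto intro!: prod_zero)
  qed simp
  have lamX: "lam y d = (\<Sum>r\<in>X. (\<Prod>p\<in>PP. Bt p (d p) (r p)) * y r)"
    unfolding lam_def using zero by (intro sum.mono_neutral_right) (auto simp: X_def)
  have sizle: "siz d \<le> siz r" if "r \<in> X" for r
  proof -
    have "supp d \<subseteq> supp r" using that by (auto simp: supp_def X_def)
    hence "siz d dvd siz r" unfolding siz_supp by (intro prod_dvd_prod_subset) auto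
    thus ?thesis by (intro dvd_imp_le) auto
  qed
  show "real (siz d) \<le> R" if "lam y d \<noteq> 0"
  proof -
    have "X \<noteq> {}" using that lamX by auto
    then obtain r where "r \<in> X" by blast
    hence "siz d \<le> siz r" "real (siz r) \<le> R" using sizle y(2)[of r] by (auto simp: X_def)
    thus ?thesis by (meson of_nat_mono order_trans)
  qed
  have prodabs: "\<bar>\<Prod>p\<in>PP. Bt p (d p) (r p)\<bar> = 1 / real (siz (\<phi> r))" if "r \<in> X" for r
  proof -
    have "\<bar>\<Prod>p\<in>PP. Bt p (d p) (r p)\<bar> = (\<Prod>p\<in>PP. D1 p (\<phi> r p))"
      unfolding abs_prod using that by (intro prod.cong refl) (auto simp: Bt_abs X_def \<phi>_def D1_def split: option.splits)
    thus ?thesis by (simp add: prod_D1)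
  qed
  have \<phi>Om: "\<phi> r \<in> Om" if "r \<in> Om" for r using that by (auto simp: \<phi>_def Om_def St_def PiE_iff)
  have inj: "inj_on \<phi> X"
  proof (rule inj_onI)
    fix r s assume rs: "r \<in> X" "s \<in> X" "\<phi> r = \<phi> s"
    show "r = s"
    proof (rule PiE_ext[of _ PP "\<lambda>_. St"])
      show "r \<in> PP \<rightarrow>\<^sub>E St" "s \<in> PP \<rightarrow>\<^sub>E St" using rs by (auto simp: Om_def X_def)
      fix p assume p: "p \<in> PP"
      have "r p = s p" if "d p = None" using fun_cong[OF rs(3), of p] p that by (simp add: \<phi>_def)
      moreover have "r p = s p" if "d p \<noteq> None" using rs(1,2) p that by (auto simp: X_def)
      ultimately show "r p = s p" by blast
    qed
  qed
  have "\<bar>lam y d\<bar> \<le> (\<Sum>r\<in>X. \<bar>(\<Prod>p\<in>PP. Bt p (d p) (r p)) * y r\<bar>)"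
    unfolding lamX by (rule sum_abs)
  also have "\<dots> \<le> (\<Sum>r\<in>X. 1 / real (siz (\<phi> r)))"
  proof (rule sum_mono)
    fix r assume r: "r \<in> X"
    hence "0 \<le> y r" "y r \<le> 1" using y(1)[of r] by (auto simp: X_def)
    thus "\<bar>(\<Prod>p\<in>PP. Bt p (d p) (r p)) * y r\<bar> \<le> 1 / real (siz (\<phi> r))"
      unfolding abs_mult prodabs[OF r] by (simp add: divide_right_mono)
  qed
  also have "\<dots> = (\<Sum>r\<in>\<phi> ` X. 1 / real (siz r))" using inj by (simp add: sum.reindex)
  also have "\<dots> \<le> (\<Sum>r | r \<in> Om \<and> real (siz r) \<le> R. 1 / real (siz r))"
  proof (rule sum_mono2)
    show "\<phi> ` X \<subseteq> {r. r \<in> Om \<and> real (siz r) \<le> R}"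
    proof (intro image_subsetI)
      fix r assume r: "r \<in> X"
      have "supp (\<phi> r) \<subseteq> supp r" by (auto simp: supp_def \<phi>_def split: if_splits)
      hence "siz (\<phi> r) dvd siz r" unfolding siz_supp by (intro prod_dvd_prod_subset) auto
      hence "siz (\<phi> r) \<le> siz r" by (intro dvd_imp_le) auto
      moreover have "real (siz r) \<le> R" using r y(2)[of r] by (auto simp: X_def)
      ultimately have "real (siz (\<phi> r)) \<le> R" by (meson of_nat_mono order_trans)
      thus "\<phi> r \<in> {r. r \<in> Om \<and> real (siz r) \<le> R}" using \<phi>Om r by (auto simp: X_def)
    qed
  qed auto
  also have "\<dots> \<le> (ln R + 3) ^ card H" by (rule sum_inverse_siz_le[OF R])
  finally show "\<bar>lam y d\<bar> \<le> (ln R + 3) ^ card H" .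
qed

text \<open>Rankin's device: on the support \<open>1 \<le> R / siz d\<close>, which reduces the
  count to a sum of reciprocals.\<close>

lemma sum_abs_lam_le:
  assumes l: "\<And>d. d \<in> Om \<Longrightarrow> \<bar>l d\<bar> \<le> Lam" "\<And>d. d \<in> Om \<Longrightarrow> l d \<noteq> 0 \<Longrightarrow> real (siz d) \<le> R" and R: "R \<ge> 1"
  shows "(\<Sum>d\<in>Om. \<bar>l d\<bar>) \<le> Lam * R * (ln R + 3) ^ card H"
proof -
  define X where "X = {d. d \<in> Om \<and> real (siz d) \<le> R}"
  have Lam: "Lam \<ge> 0 \<or> Om = {}" using l(1) by (metis abs_ge_zero ex_in_conv order_trans)
  have "(\<Sum>d\<in>Om. \<bar>l d\<bar>) = (\<Sum>d\<in>X. \<bar>l d\<bar>)"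
    using l(2) by (intro sum.mono_neutral_right) (auto simp: X_def)
  also have "\<dots> \<le> (\<Sum>d\<in>X. Lam * R * (1 / real (siz d)))"
  proof (rule sum_mono)
    fix d assume d: "d \<in> X"
    hence "Lam \<ge> 0" using Lam by (auto simp: X_def)
    moreover have "1 \<le> R / real (siz d)" using d siz_pos[of d] by (simp add: X_def)
    ultimately have "Lam * 1 \<le> Lam * (R / real (siz d))" by (intro mult_left_mono)
    thus "\<bar>l d\<bar> \<le> Lam * R * (1 / real (siz d))" using l(1)[of d] d by (simp add: X_def)
  qed
  also have "\<dots> = Lam * R * (\<Sum>d\<in>X. 1 / real (siz d))" by (simp add: sum_distrib_left)
  also have "\<dots> \<le> Lam * R * (ln R + 3) ^ card H"
  proof (cases "Om = {}")
    case False
    thus ?thesis using sum_inverse_siz_le[OF R] Lam R unfolding X_def by (intro mult_left_mono) auto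
  next
    case True
    have "(\<lambda>p\<in>PP. None) \<in> Om" by (auto simp: Om_def St_def)
    thus ?thesis using True by auto
  qed
  finally show ?thesis .
qed

text \<open>Pairs \<open>(d, e)\<close> are grouped by the union \<open>B\<close> of their supports,
  which determines the modulus \<open>siz (join d e)\<close>. Both members live on \<open>B\<close>,
  so a group has at most \<open>(card H + 1) ^ (2 * card B)\<close> pairs.\<close>

lemma pair_error_le:
  assumes l: "\<And>d. d \<in> Om \<Longrightarrow> \<bar>l d\<bar> \<le> Lam" "\<And>d. d \<in> Om \<Longrightarrow> l d \<noteq> 0 \<Longrightarrow> real (siz d) \<le> R"
    and E: "\<And>q. q \<ge> 1 \<Longrightarrow> E q \<ge> (0::real)" and R: "R \<ge> 0"
  shows "(\<Sum>d\<in>Om. \<Sum>e\<in>Om. \<bar>l d\<bar> * \<bar>l e\<bar> * (if compat d e then E (siz (join d e)) else 0))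
    \<le> Lam\<^sup>2 * (\<Sum>B\<in>prime_sets PP (R\<^sup>2). real ((card H + 1)\<^sup>2) ^ card B * E (\<Prod>B))"
proof -
  define X where "X = {(d, e). d \<in> Om \<and> e \<in> Om \<and> l d \<noteq> 0 \<and> l e \<noteq> 0}"
  define u where "u = (\<lambda>(d, e). supp d \<union> supp e)"
  define T where "T = prime_sets PP (R\<^sup>2)"
  have fX: "finite X" by (rule finite_subset[of _ "Om \<times> Om"]) (auto simp: X_def)
  have fT: "finite T" using finite_PP by (auto simp: T_def prime_sets_def)
  have pos: "\<Prod>B \<ge> 1" if "B \<subseteq> PP" for B
    using that prime_gt_0_nat[OF prime_PP] by (intro prod_ge_1) (auto simp: Suc_le_eq)
  have joinsupp: "supp (join d e) = supp d \<union> supp e" for d e by (auto simp: supp_def join_def)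
  have uT: "u ` X \<subseteq> T"
  proof (intro image_subsetI)
    fix x assume "x \<in> X"
    then obtain d e where de: "x = (d, e)" "d \<in> Om" "e \<in> Om" "l d \<noteq> 0" "l e \<noteq> 0" by (auto simp: X_def)
    have "\<Prod>(supp d \<union> supp e) \<le> siz d * siz e"
    proof -
      have "\<Prod>(supp d \<union> supp e) dvd siz d * siz e"
      proof -
        have "\<Prod>(supp d \<union> supp e) * \<Prod>(supp d \<inter> supp e) = siz d * siz e"
          unfolding siz_supp by (rule prod.union_inter) auto
        thus ?thesis by (metis dvd_triv_left)
      qed
      thus ?thesis by (intro dvd_imp_le) auto
    qed
    hence "real (\<Prod>(supp d \<union> supp e)) \<le> real (siz d * siz e)" by (simp only: of_nat_le_iff)
    also have "\<dots> \<le> R * R" using l(2)[of d] l(2)[of e] de R by (auto intro!: mult_mono)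
    finally show "u x \<in> T" by (auto simp: u_def de T_def prime_sets_def power2_eq_square supp_def)
  qed
  have "(\<Sum>d\<in>Om. \<Sum>e\<in>Om. \<bar>l d\<bar> * \<bar>l e\<bar> * (if compat d e then E (siz (join d e)) else 0))
      = (\<Sum>(d, e)\<in>Om \<times> Om. \<bar>l d\<bar> * \<bar>l e\<bar> * (if compat d e then E (siz (join d e)) else 0))"
    by (simp add: sum.cartesian_product)
  also have "\<dots> = (\<Sum>(d, e)\<in>X. \<bar>l d\<bar> * \<bar>l e\<bar> * (if compat d e then E (siz (join d e)) else 0))"
    by (intro sum.mono_neutral_right) (auto simp: X_def)
  also have "\<dots> \<le> (\<Sum>x\<in>X. Lam\<^sup>2 * E (\<Prod>(u x)))"
  proof (rule sum_mono)
    fix x assume "x \<in> X"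
    then obtain d e where de: "x = (d, e)" "d \<in> Om" "e \<in> Om" by (auto simp: X_def)
    have e: "siz (join d e) = \<Prod>(u x)" by (simp add: siz_supp joinsupp u_def de)
    have E0: "E (\<Prod>(u x)) \<ge> 0" using pos[of "u x"] by (intro E) (auto simp: u_def de supp_def)
    have "\<bar>l d\<bar> * \<bar>l e\<bar> \<le> Lam\<^sup>2"
      unfolding power2_eq_square using l(1)[OF de(2)] l(1)[OF de(3)] by (intro mult_mono) auto
    hence "\<bar>l d\<bar> * \<bar>l e\<bar> * E (\<Prod>(u x)) \<le> Lam\<^sup>2 * E (\<Prod>(u x))" using E0 by (intro mult_right_mono)
    moreover have "0 \<le> Lam\<^sup>2 * E (\<Prod>(u x))" using E0 by simp
    ultimately show "(case x of (d, e) \<Rightarrow> \<bar>l d\<bar> * \<bar>l e\<bar> * (if compat d e then E (siz (join d e)) else 0))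
        \<le> Lam\<^sup>2 * E (\<Prod>(u x))" by (simp add: de(1) e[unfolded de(1)])
  qed
  also have "\<dots> = (\<Sum>B\<in>T. \<Sum>x\<in>{x\<in>X. u x = B}. Lam\<^sup>2 * E (\<Prod>(u x)))"
    by (rule sum.group[symmetric, OF fX fT uT])
  also have "\<dots> = (\<Sum>B\<in>T. real (card {x\<in>X. u x = B}) * (Lam\<^sup>2 * E (\<Prod>B)))"
    by (intro sum.cong refl) simp
  also have "\<dots> \<le> (\<Sum>B\<in>T. real ((card H + 1)\<^sup>2) ^ card B * (Lam\<^sup>2 * E (\<Prod>B)))"
  proof (rule sum_mono, rule mult_right_mono)
    fix B assume B: "B \<in> T"
    hence BP: "B \<subseteq> PP" "finite B" using finite_PP finite_subset by (auto simp: T_def prime_sets_def)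
    have S: "card {d\<in>Om. supp d \<subseteq> B} \<le> (card H + 1) ^ card B"
    proof -
      have "inj_on (\<lambda>d. restrict d B) {d\<in>Om. supp d \<subseteq> B}"
      proof (rule inj_onI)
        fix d e assume de: "d \<in> {d\<in>Om. supp d \<subseteq> B}" "e \<in> {d\<in>Om. supp d \<subseteq> B}" "restrict d B = restrict e B"
        show "d = e"
        proof (rule PiE_ext[of _ PP "\<lambda>_. St"])
          show "d \<in> PP \<rightarrow>\<^sub>E St" "e \<in> PP \<rightarrow>\<^sub>E St" using de by (auto simp: Om_def)
          fix p assume p: "p \<in> PP"
          have "d p = e p" if "p \<in> B" using fun_cong[OF de(3), of p] that by simp
          moreover have "d p = None \<and> e p = None" if "p \<notin> B" using de(1,2) p that by (auto simp: supp_def)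
          ultimately show "d p = e p" by (cases "p \<in> B") auto
        qed
      qed
      moreover have "(\<lambda>d. restrict d B) ` {d\<in>Om. supp d \<subseteq> B} \<subseteq> B \<rightarrow>\<^sub>E St"
        using BP by (auto simp: Om_def)
      ultimately have "card {d\<in>Om. supp d \<subseteq> B} \<le> card (B \<rightarrow>\<^sub>E St)"
        using BP by (intro card_inj_on_le) (auto intro: finite_PiE)
      also have "\<dots> = card St ^ card B" using BP by (simp add: card_PiE)
      also have "card St = card H + 1" unfolding St_def using finite_H by (simp add: card_insert_disjoint card_image)
      finally show ?thesis .
    qed
    have "card {x\<in>X. u x = B} \<le> card ({d\<in>Om. supp d \<subseteq> B} \<times> {d\<in>Om. supp d \<subseteq> B})"
      by (intro card_mono) (auto simp: X_def u_def)
    also have "\<dots> \<le> (card H + 1) ^ card B * (card H + 1) ^ card B"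
      unfolding card_cartesian_product using S by (intro mult_le_mono)
    also have "\<dots> = ((card H + 1)\<^sup>2) ^ card B" by (simp only: power2_eq_square power_mult_distrib)
    finally have "real (card {x\<in>X. u x = B}) \<le> real (((card H + 1)\<^sup>2) ^ card B)" by (simp only: of_nat_le_iff)
    thus "real (card {x\<in>X. u x = B}) \<le> real ((card H + 1)\<^sup>2) ^ card B" by simp
    show "0 \<le> Lam\<^sup>2 * E (\<Prod>B)" using E[OF pos[OF BP(1)]] by simp
  qed
  also have "\<dots> = Lam\<^sup>2 * (\<Sum>B\<in>T. real ((card H + 1)\<^sup>2) ^ card B * E (\<Prod>B))"
    unfolding sum_distrib_left by (intro sum.cong refl) (simp add: mult_ac)
  finally show ?thesis unfolding T_def .
qed

end

subsection \<open>The weights of Maynard\<close>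

lemma prod_if_one:
  fixes X G :: real
  assumes "finite I" "j \<in> I"
  shows "(\<Prod>i\<in>I. if i = j then X else G) = X * G ^ (card I - 1)"
proof -
  have "(\<Prod>i\<in>I. if i = j then X else G) = X * (\<Prod>i\<in>I - {j}. if i = j then X else G)"
    using assms by (subst prod.remove[of I j]) auto
  also have "(\<Prod>i\<in>I - {j}. if i = j then X else G) = (\<Prod>i\<in>I - {j}. G)" by (intro prod.cong) auto
  finally show ?thesis using assms by simp
qed

text \<open>A union bound under the product weight. A penalty on one component costs
  \<open>zb\<close> on average. A prime shared by two components costs \<open>1 / p^2\<close>,
  because divisibility by \<open>p\<close> costs \<open>1 / p\<close> in each independently.\<close>

lemma penalty_sum:
  fixes a \<zeta> :: "nat \<Rightarrow> real"
  assumes I: "finite I" and T: "finite T" "\<And>u. u \<in> T \<Longrightarrow> 0 \<le> a u" and S: "finite S" "0 \<notin> S"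
    and G: "G = (\<Sum>u\<in>T. a u)" and z: "(\<Sum>u\<in>T. a u * \<zeta> u) \<le> zb * G"
    and mult: "\<And>p. p \<in> S \<Longrightarrow> (\<Sum>u | u \<in> T \<and> p dvd u. a u) \<le> 1 / real p * G"
    and \<delta>: "(\<Sum>p\<in>S. 1 / (real p)\<^sup>2) \<le> \<delta>"
  shows "(\<Sum>m\<in>I \<rightarrow>\<^sub>E T. (\<Prod>i\<in>I. a (m i)) *
      (1 - ((\<Sum>i\<in>I. \<zeta> (m i)) + (\<Sum>i\<in>I. \<Sum>j\<in>I - {i}. \<Sum>p\<in>S. of_bool (p dvd m i \<and> p dvd m j)))))
    \<ge> G ^ card I * (1 - (real (card I) * zb + (real (card I))\<^sup>2 * \<delta>))"
proof -
  have G0: "G \<ge> 0" unfolding G using T by (intro sum_nonneg) auto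
  have P: "(\<Sum>m\<in>I \<rightarrow>\<^sub>E T. (\<Prod>i\<in>I. b i (m i))) = (\<Prod>i\<in>I. \<Sum>u\<in>T. b i u)" for b :: "_ \<Rightarrow> nat \<Rightarrow> real"
    using I T by (subst prod_sum_PiE) auto
  have one: "(\<Sum>m\<in>I \<rightarrow>\<^sub>E T. (\<Prod>i\<in>I. a (m i)) * \<zeta> (m j)) \<le> zb * G ^ card I" if j: "j \<in> I" for j
  proof -
    have "(\<Sum>m\<in>I \<rightarrow>\<^sub>E T. (\<Prod>i\<in>I. a (m i)) * \<zeta> (m j)) = (\<Sum>m\<in>I \<rightarrow>\<^sub>E T. (\<Prod>i\<in>I. a (m i) * (if i = j then \<zeta> (m i) else 1)))"
      using I j by (intro sum.cong refl) (simp add: prod.distrib)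
    also have "\<dots> = (\<Prod>i\<in>I. \<Sum>u\<in>T. a u * (if i = j then \<zeta> u else 1))" by (rule P)
    also have "\<dots> = (\<Prod>i\<in>I. if i = j then (\<Sum>u\<in>T. a u * \<zeta> u) else G)" by (intro prod.cong) (auto simp: G)
    also have "\<dots> = (\<Sum>u\<in>T. a u * \<zeta> u) * G ^ (card I - 1)" by (rule prod_if_one[OF I j])
    also have "\<dots> \<le> zb * G * G ^ (card I - 1)" using z G0 by (intro mult_right_mono) auto
    also have "zb * G * G ^ (card I - 1) = zb * G ^ card I"
      using I j card_gt_0_iff[of I] by (cases "card I") auto
    finally show ?thesis .
  qed
  have two: "(\<Sum>m\<in>I \<rightarrow>\<^sub>E T. (\<Prod>i\<in>I. a (m i)) * of_bool (p dvd m j \<and> p dvd m l)) \<le> 1 / (real p)\<^sup>2 * G ^ card I"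
    if j: "j \<in> I" "l \<in> I" "j \<noteq> l" and p: "p \<in> S" for j l p
  proof -
    have p0: "real p > 0" using p S(2) by (cases p) auto
    have "(\<Sum>m\<in>I \<rightarrow>\<^sub>E T. (\<Prod>i\<in>I. a (m i)) * of_bool (p dvd m j \<and> p dvd m l))
       = (\<Sum>m\<in>I \<rightarrow>\<^sub>E T. (\<Prod>i\<in>I. a (m i) * ((if i = j then of_bool (p dvd m i) else 1) * (if i = l then of_bool (p dvd m i) else 1))))"
      using I j by (intro sum.cong refl) (simp add: prod.distrib of_bool_conj)
    also have "\<dots> = (\<Prod>i\<in>I. \<Sum>u\<in>T. a u * ((if i = j then of_bool (p dvd u) else 1) * (if i = l then of_bool (p dvd u) else 1)))" by (rule P)
    also have "\<dots> \<le> (\<Prod>i\<in>I. G * (if i = j then 1 / real p else 1) * (if i = l then 1 / real p else 1))"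
    proof (rule prod_mono, rule conjI)
      fix i assume "i \<in> I"
      show "0 \<le> (\<Sum>u\<in>T. a u * ((if i = j then of_bool (p dvd u) else 1) * (if i = l then of_bool (p dvd u) else 1)))"
        using T by (intro sum_nonneg) auto
      have "(\<Sum>u\<in>T. a u * of_bool (p dvd u)) = (\<Sum>u | u \<in> T \<and> p dvd u. a u)"
        using T(1) by (simp add: Int_def)
      also have "\<dots> \<le> G * (1 / real p)" using mult[OF p] by (simp add: mult.commute)
      finally show "(\<Sum>u\<in>T. a u * ((if i = j then of_bool (p dvd u) else 1) * (if i = l then of_bool (p dvd u) else 1)))
          \<le> G * (if i = j then 1 / real p else 1) * (if i = l then 1 / real p else 1)"
        using j by (auto simp: G)
    qed
    also have "\<dots> = G ^ card I * (\<Prod>i\<in>I. if i = j then 1 / real p else 1) * (\<Prod>i\<in>I. if i = l then 1 / real p else 1)"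
      by (simp only: prod.distrib prod_constant)
    also have "\<dots> = 1 / (real p)\<^sup>2 * G ^ card I"
      using j prod_if_one[OF I j(1), of "1 / real p" 1] prod_if_one[OF I j(2), of "1 / real p" 1]
      by (simp add: power2_eq_square)
    finally show ?thesis .
  qed
  define Z1 where "Z1 = (\<Sum>m\<in>I \<rightarrow>\<^sub>E T. (\<Prod>i\<in>I. a (m i)) * (\<Sum>i\<in>I. \<zeta> (m i)))"
  define Z2 where "Z2 = (\<Sum>m\<in>I \<rightarrow>\<^sub>E T. (\<Prod>i\<in>I. a (m i)) * (\<Sum>i\<in>I. \<Sum>j\<in>I - {i}. \<Sum>p\<in>S. of_bool (p dvd m i \<and> p dvd m j)))"
  have "Z1 = (\<Sum>j\<in>I. \<Sum>m\<in>I \<rightarrow>\<^sub>E T. (\<Prod>i\<in>I. a (m i)) * \<zeta> (m j))"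
    unfolding Z1_def sum_distrib_left by (rule sum.swap)
  also have "\<dots> \<le> (\<Sum>j\<in>I. zb * G ^ card I)" by (intro sum_mono one)
  finally have Z1: "Z1 \<le> real (card I) * zb * G ^ card I" by simp
  have "Z2 = (\<Sum>i\<in>I. \<Sum>m\<in>I \<rightarrow>\<^sub>E T. \<Sum>j\<in>I - {i}. \<Sum>p\<in>S. (\<Prod>i\<in>I. a (m i)) * of_bool (p dvd m i \<and> p dvd m j))"
    unfolding Z2_def sum_distrib_left by (rule sum.swap)
  also have "\<dots> = (\<Sum>i\<in>I. \<Sum>j\<in>I - {i}. \<Sum>m\<in>I \<rightarrow>\<^sub>E T. \<Sum>p\<in>S. (\<Prod>i\<in>I. a (m i)) * of_bool (p dvd m i \<and> p dvd m j))"
    by (intro sum.cong refl sum.swap)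
  also have "\<dots> = (\<Sum>i\<in>I. \<Sum>j\<in>I - {i}. \<Sum>p\<in>S. \<Sum>m\<in>I \<rightarrow>\<^sub>E T. (\<Prod>i\<in>I. a (m i)) * of_bool (p dvd m i \<and> p dvd m j))"
    by (intro sum.cong refl sum.swap)
  also have "\<dots> \<le> (\<Sum>i\<in>I. \<Sum>j\<in>I - {i}. \<Sum>p\<in>S. 1 / (real p)\<^sup>2 * G ^ card I)"
    by (intro sum_mono two) auto
  also have "\<dots> \<le> (\<Sum>i\<in>I. \<Sum>j\<in>I - {i}. \<delta> * G ^ card I)"
    unfolding sum_distrib_right[symmetric] using \<delta> G0 by (intro sum_mono mult_right_mono) auto
  also have "\<dots> \<le> (\<Sum>i\<in>I. \<Sum>j\<in>I. \<delta> * G ^ card I)"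
  proof (intro sum_mono sum_mono2)
    fix i j :: 'a
    have "\<delta> \<ge> 0" using \<delta> sum_nonneg[of S "\<lambda>p. 1 / (real p)\<^sup>2"] by auto
    thus "0 \<le> \<delta> * G ^ card I" using G0 by simp
  qed (use I in auto)
  finally have Z2: "Z2 \<le> (real (card I))\<^sup>2 * \<delta> * G ^ card I" by (simp add: power2_eq_square mult_ac)
  have "(\<Sum>m\<in>I \<rightarrow>\<^sub>E T. (\<Prod>i\<in>I. a (m i)) *
      (1 - ((\<Sum>i\<in>I. \<zeta> (m i)) + (\<Sum>i\<in>I. \<Sum>j\<in>I - {i}. \<Sum>p\<in>S. of_bool (p dvd m i \<and> p dvd m j)))))
      = (\<Sum>m\<in>I \<rightarrow>\<^sub>E T. (\<Prod>i\<in>I. a (m i))) - (Z1 + Z2)"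
    unfolding Z1_def Z2_def by (simp add: right_diff_distrib distrib_left sum_subtractf sum.distrib)
  also have "(\<Sum>m\<in>I \<rightarrow>\<^sub>E T. (\<Prod>i\<in>I. a (m i))) = G ^ card I" using P[of "\<lambda>_. a"] by (simp add: G)
  finally show ?thesis using Z1 Z2 by (simp add: algebra_simps)
qed

lemma prod_prime_divisors_squarefree:
  fixes m :: nat
  assumes "m \<ge> 1" "finite S" "\<And>p. p \<in> S \<Longrightarrow> prime p"
    and "\<And>p. prime p \<Longrightarrow> p dvd m \<Longrightarrow> p \<in> S \<and> \<not> p\<^sup>2 dvd m"
  shows "\<Prod>{p\<in>S. p dvd m} = m"
proof -
  have e: "{p\<in>S. p dvd m} = prime_factors m"
    using assms by (auto simp: prime_factors_dvd)
  have "m = (\<Prod>p\<in>prime_factors m. p ^ multiplicity p m)"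
    using assms(1) by (subst prime_factorization_nat[symmetric]) auto
  also have "\<dots> = (\<Prod>p\<in>prime_factors m. p)"
  proof (rule prod.cong[OF refl])
    fix p assume "p \<in> prime_factors m"
    hence p: "prime p" "p dvd m" by (auto simp: prime_factors_dvd)
    have "multiplicity p m < 2" using p assms(1,4) by (intro multiplicity_lessI) (auto simp: prime_gt_1_nat)
    moreover have "multiplicity p m > 0" using p assms(1) by (simp add: prime_multiplicity_gt_zero_iff)
    ultimately have "multiplicity p m = 1" by linarith
    thus "p ^ multiplicity p m = p" by simp
  qed
  finally show ?thesis using e by simp
qed

section \<open>Tuples of integers as elements of \<open>Om\<close>\<close>

context tuple_sieve
begin

text \<open>Inverse of taking parts. For a \<open>nice\<close> tuple the choice made by
  \<open>SOME\<close> is unique, because components share no sieving prime.\<close>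

definition tup :: "nat set \<Rightarrow> (nat \<Rightarrow> nat) \<Rightarrow> nat \<Rightarrow> nat option" where
  "tup H' m = (\<lambda>p\<in>PP. if \<exists>h\<in>H'. p dvd m h then Some (SOME h. h \<in> H' \<and> p dvd m h) else None)"

text \<open>For \<open>H' \<subseteq> H\<close> these are exactly the tuples of parts of elements of
  \<open>Om\<close> whose components outside \<open>H'\<close> are trivial.\<close>

definition nice :: "nat set \<Rightarrow> (nat \<Rightarrow> nat) \<Rightarrow> bool" where
  "nice H' m \<longleftrightarrow> (\<forall>h\<in>H'. m h \<ge> 1 \<and> (\<forall>p. prime p \<longrightarrow> p dvd m h \<longrightarrow> p \<in> PP \<and> \<not> p\<^sup>2 dvd m h)) \<and>
     (\<forall>h\<in>H'. \<forall>h'\<in>H'. \<forall>p\<in>PP. p dvd m h \<longrightarrow> p dvd m h' \<longrightarrow> h = h')"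

lemma tup_eq:
  assumes "nice H' m" "p \<in> PP"
  shows "tup H' m p = Some h \<longleftrightarrow> h \<in> H' \<and> p dvd m h"
proof (cases "\<exists>h\<in>H'. p dvd m h")
  case True
  define h1 where "h1 = (SOME h. h \<in> H' \<and> p dvd m h)"
  have h1: "h1 \<in> H' \<and> p dvd m h1" unfolding h1_def by (rule someI_ex) (use True in blast)
  have "tup H' m p = Some h1" using True assms(2) by (simp add: tup_def h1_def)
  thus ?thesis using h1 assms unfolding nice_def by (metis option.inject)
next
  case False
  thus ?thesis using assms(2) by (auto simp: tup_def)
qed

lemma tup_in_Om:
  assumes "nice H' m" "H' \<subseteq> H"
  shows "tup H' m \<in> Om"
proof -
  have "tup H' m p \<in> St" if "p \<in> PP" for p
    using tup_eq[OF assms(1) that] assms(2) by (cases "tup H' m p") (auto simp: St_def)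
  thus ?thesis by (auto simp: Om_def tup_def PiE_iff)
qed

lemma part_tup:
  assumes "nice H' m"
  shows "part (tup H' m) h = (if h \<in> H' then m h else 1)"
proof (cases "h \<in> H'")
  case True
  hence "{p\<in>PP. tup H' m p = Some h} = {p\<in>PP. p dvd m h}" using tup_eq[OF assms] by auto
  moreover have "\<Prod>{p\<in>PP. p dvd m h} = m h"
    using assms True finite_PP prime_PP unfolding nice_def by (intro prod_prime_divisors_squarefree) auto
  ultimately show ?thesis using True by (simp add: part_def)
next
  case False
  hence "{p\<in>PP. tup H' m p = Some h} = {}" using tup_eq[OF assms] by auto
  thus ?thesis using False unfolding part_def by (simp only:) simp
qed

lemma siz_tup:
  assumes "nice H' m" "H' \<subseteq> H"
  shows "siz (tup H' m) = (\<Prod>h\<in>H'. m h)"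
proof -
  have "siz (tup H' m) = (\<Prod>h\<in>H. if h \<in> H' then m h else 1)"
    unfolding siz_eq_prod_part[OF tup_in_Om[OF assms]] by (simp add: part_tup[OF assms(1)])
  also have "\<dots> = (\<Prod>h\<in>H'. m h)" using assms(2) finite_H by (simp add: prod.inter_restrict[symmetric] Int_absorb1)
  finally show ?thesis .
qed

lemma inj_on_tup: "inj_on (tup H') {m \<in> H' \<rightarrow>\<^sub>E T. nice H' m}"
proof (rule inj_onI)
  fix m n assume m: "m \<in> {m \<in> H' \<rightarrow>\<^sub>E T. nice H' m}" and n: "n \<in> {m \<in> H' \<rightarrow>\<^sub>E T. nice H' m}" and eq: "tup H' m = tup H' n"
  show "m = n"
  proof (rule PiE_ext[of _ H' "\<lambda>_. T"])
    fix h assume h: "h \<in> H'"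
    have "part (tup H' m) h = part (tup H' n) h" using eq by simp
    thus "m h = n h" using part_tup[of H' m h] part_tup[of H' n h] m n h by simp
  qed (use m n in auto)
qed

end

text \<open>\<open>exp L\<close> is the sieve level, \<open>A\<close> shapes the profile
  \<open>g\<close>, and \<open>W\<close> absorbs all primes up to \<open>D\<close>.\<close>

locale maynard_weights = tuple_sieve PP H for PP H +
  fixes L A :: real and W D :: nat
  assumes L_pos: "L > 0" and A_pos: "A > 0" and W_pos: "W \<ge> 1" and D_pos: "D \<ge> 1"
    and coprime_W: "\<And>p. p \<in> PP \<Longrightarrow> coprime p W"
    and small_dvd_W: "\<And>p. prime p \<Longrightarrow> p \<le> D \<Longrightarrow> p dvd W"
    and PP_range: "\<And>p. p \<in> PP \<Longrightarrow> D < p \<and> real p \<le> exp L"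
begin

text \<open>All primes eligible by size. The difference \<open>PR - PP\<close> will consist of
  primes dividing a difference of two shifts, and only the sum of their reciprocals matters.\<close>

definition PR :: "nat set" where "PR = {p. prime p \<and> D < p \<and> real p \<le> exp L}"

text \<open>Maynard's profile \<open>1 / (1 + A * t)\<close> at \<open>t = ln x / L\<close>. Both
  \<open>g x / x\<close> and \<open>(g x)^2 / x\<close> have elementary antiderivatives.\<close>

definition g :: "real \<Rightarrow> real" where "g x = 1 / (1 + A * ln x / L)"

text \<open>Mass of one component under the squared profile; the total weight is compared with its
  \<open>k\<close>-th power.\<close>

definition GG :: real where "GG = (\<Sum>m\<in>cops W (exp L). (g (real m))\<^sup>2 / real m)"

text \<open>First moment of the profile in the component of the prime. The cut at
  \<open>exp (L / 4)\<close> leaves room: with \<open>L / 2\<close> on the logarithmic scale used by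
  the other components, the taper in \<open>y\<close> is still at least
  \<open>1 / 4\<close>.\<close>

definition L0 :: real where "L0 = (\<Sum>m\<in>cops W (exp (L / 4)). g (real m) / real m)"

text \<open>A sharp cutoff at the level would make \<open>y\<close> jump. The linear taper makes it
  Lipschitz in \<open>ln siz\<close>, which is what bounds the weight on \<open>n\<close> with a
  small prime factor.\<close>

definition y :: "(nat \<Rightarrow> nat option) \<Rightarrow> real" where
  "y r = max 0 (1 - ln (real (siz r)) / L) * (\<Prod>h\<in>H. g (real (part r h)))"

lemma finite_PR: "finite PR"
  by (rule finite_subset[of _ "{..nat \<lfloor>exp L\<rfloor>}"]) (auto simp: PR_def le_nat_floor)

lemma PP_subset_PR: "PP \<subseteq> PR" using PP_range prime_PP by (auto simp: PR_def)

lemma PR_pos: "p \<in> PR \<Longrightarrow> real p > 0" using prime_gt_0_nat by (auto simp: PR_def)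

lemma sum_PR_inverse_squares: "(\<Sum>p\<in>PR. 1 / (real p)\<^sup>2) \<le> 1 / real D"
  by (rule sum_inverse_squares_le) (use finite_PR D_pos in \<open>auto simp: PR_def\<close>)

lemma prime_dvd_cops: "prime p \<Longrightarrow> p dvd m \<Longrightarrow> m \<in> cops W x \<Longrightarrow> x \<le> exp L \<Longrightarrow> p \<in> PR"
proof -
  assume p: "prime p" "p dvd m" and m: "m \<in> cops W x" and x: "x \<le> exp L"
  have "\<not> p dvd W"
  proof
    assume "p dvd W"
    moreover have "coprime m W" using m by (simp add: cops_def)
    ultimately have "p dvd 1" using p(2) by (metis coprime_common_divisor)
    thus False using p(1) by simp
  qed
  hence "D < p" using small_dvd_W[OF p(1)] by fastforce
  moreover have "p \<le> m" using p(2) m by (intro dvd_imp_le) (auto simp: cops_def)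
  hence "real p \<le> real m" by simp
  hence "real p \<le> exp L" using m x by (simp add: cops_def)
  ultimately show "p \<in> PR" using p by (simp add: PR_def)
qed

lemma g_pos: "x \<ge> 1 \<Longrightarrow> g x > 0"
  unfolding g_def using A_pos L_pos by (intro divide_pos_pos add_pos_nonneg) auto

lemma g_antimono: "1 \<le> x \<Longrightarrow> x \<le> z \<Longrightarrow> g z \<le> g x"
  unfolding g_def using A_pos L_pos
  by (intro divide_left_mono add_left_mono divide_right_mono mult_left_mono mult_pos_pos add_pos_nonneg) auto

lemma g_le_1: "x \<ge> 1 \<Longrightarrow> g x \<le> 1"
  using g_antimono[of 1 x] by (simp add: g_def)

lemma part_ge_1: "real (part r h) \<ge> 1"
  using part_pos[of r h] by (simp add: Suc_leI)

lemma siz_ge_1: "real (siz r) \<ge> 1"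
  using siz_pos[of r] by (simp add: Suc_leI)

lemma prod_g_bounds: "0 < (\<Prod>h\<in>J. g (real (part r h)))" "(\<Prod>h\<in>J. g (real (part r h))) \<le> 1"
proof -
  show "0 < (\<Prod>h\<in>J. g (real (part r h)))" using g_pos part_ge_1 by (intro prod_pos) auto
  show "(\<Prod>h\<in>J. g (real (part r h))) \<le> 1"
    using g_pos g_le_1 part_ge_1 by (intro prod_le_1) (auto intro: less_imp_le)
qed

lemma y_bounds: "0 \<le> y r" "y r \<le> (\<Prod>h\<in>H. g (real (part r h)))" "y r \<le> 1"
proof -
  have c: "0 \<le> max 0 (1 - ln (real (siz r)) / L)" "max 0 (1 - ln (real (siz r)) / L) \<le> 1"
    using L_pos siz_ge_1[of r] by auto
  show "0 \<le> y r" unfolding y_def using c prod_g_bounds(1)[of r H] by simp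
  show 1: "y r \<le> (\<Prod>h\<in>H. g (real (part r h)))" unfolding y_def using c prod_g_bounds(1)[of r H]
    by (simp add: mult_le_cancel_right2)
  show "y r \<le> 1" using 1 prod_g_bounds(2)[of r H] by linarith
qed

lemma y_support: "y r \<noteq> 0 \<Longrightarrow> real (siz r) \<le> exp L"
proof -
  assume "y r \<noteq> 0"
  hence "max 0 (1 - ln (real (siz r)) / L) \<noteq> 0" by (auto simp: y_def)
  hence "1 - ln (real (siz r)) / L > 0" by (metis max.absorb1 not_less)
  hence "ln (real (siz r)) < L" using L_pos by (simp add: field_simps)
  thus ?thesis using siz_ge_1[of r] by (metis exp_ln exp_le_cancel_iff less_imp_le less_le_trans zero_less_one)
qed

lemma part_in_cops:
  assumes "r \<in> Om" "h \<in> H" "real (siz r) \<le> exp L"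
  shows "part r h \<in> cops W (exp L)"
proof -
  have "real (part r h) \<le> real (siz r)" using part_le_siz[OF assms(1,2)] by simp
  moreover have "coprime (part r h) W" unfolding part_def using coprime_W by (intro prod_coprime_left) auto
  ultimately show ?thesis using assms(3) part_ge_1[of r h] by (simp add: cops_def)
qed

lemma sum_g_squares_le:
  "(\<Sum>r | r \<in> Om \<and> real (siz r) \<le> exp L. (\<Prod>h\<in>H. g (real (part r h)))\<^sup>2 / real (siz r)) \<le> GG ^ card H"
proof -
  define X where "X = {r. r \<in> Om \<and> real (siz r) \<le> exp L}"
  have "(\<Sum>r\<in>X. (\<Prod>h\<in>H. g (real (part r h)))\<^sup>2 / real (siz r)) = (\<Sum>r\<in>X. \<Prod>h\<in>H. (g (real (part r h)))\<^sup>2 / real (part r h))"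
    by (intro sum.cong refl) (auto simp: X_def siz_eq_prod_part prod_dividef prod_power_distrib)
  also have "\<dots> \<le> GG ^ card H" unfolding GG_def
    using part_in_cops by (intro sum_Om_prod_part_le) (auto simp: X_def)
  finally show ?thesis by (simp add: X_def)
qed

theorem form_P1_y_le: "form P1 (lam y) \<le> GG ^ card H"
proof -
  have "form P1 (lam y) \<le> (\<Sum>r\<in>Om. (y r)\<^sup>2 / real (siz r))" by (rule form_P1_le)
  also have "\<dots> = (\<Sum>r | r \<in> Om \<and> real (siz r) \<le> exp L. (y r)\<^sup>2 / real (siz r))"
    using y_support by (intro sum.mono_neutral_right) auto
  also have "\<dots> \<le> (\<Sum>r | r \<in> Om \<and> real (siz r) \<le> exp L. (\<Prod>h\<in>H. g (real (part r h)))\<^sup>2 / real (siz r))"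
    using y_bounds by (intro sum_mono divide_right_mono power_mono) auto
  also have "\<dots> \<le> GG ^ card H" by (rule sum_g_squares_le)
  finally show ?thesis .
qed

lemma part_upd:
  assumes "p0 \<in> PP" "r p0 = None"
  shows "part (r(p0 := Some h1)) h = (if h = h1 then p0 * part r h else part r h)"
proof (cases "h = h1")
  case True
  have "{p\<in>PP. (r(p0 := Some h1)) p = Some h1} = insert p0 {p\<in>PP. r p = Some h1}" using assms by auto
  thus ?thesis using True assms finite_PP by (simp add: part_def)
next
  case False
  have "{p\<in>PP. (r(p0 := Some h1)) p = Some h} = {p\<in>PP. r p = Some h}" using assms False by auto
  thus ?thesis using False by (simp add: part_def)
qed

lemma siz_upd:
  assumes "p0 \<in> PP" "r p0 = None"
  shows "siz (r(p0 := Some h1)) = p0 * siz r"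
proof -
  have "supp (r(p0 := Some h1)) = insert p0 (supp r)" using assms by (auto simp: supp_def)
  moreover have "p0 \<notin> supp r" using assms by (auto simp: supp_def)
  ultimately show ?thesis by (simp add: siz_supp)
qed

text \<open>Inserting \<open>p0\<close> moves the taper by at most \<open>ln p0 / L\<close> and
  increases \<open>1 / g\<close> in one component by exactly \<open>A * ln p0 / L\<close>, so
  \<open>y\<close> drops by at most \<open>1 + A\<close> times \<open>ln p0 / L\<close>, relative to
  the product of the profiles.\<close>

lemma y_upd_bounds:
  assumes p0: "p0 \<in> PP" "r p0 = None" and h1: "h1 \<in> H"
  shows "y (r(p0 := Some h1)) \<le> y r" "y r - y (r(p0 := Some h1)) \<le> (1 + A) * (ln (real p0) / L) * (\<Prod>h\<in>H. g (real (part r h)))"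
proof -
  define c c' where "c = max 0 (1 - ln (real (siz r)) / L)" and "c' = max 0 (1 - ln (real (siz (r(p0 := Some h1)))) / L)"
  define d where "d = ln (real p0) / L"
  define Q where "Q = (\<Prod>h\<in>H - {h1}. g (real (part r h)))"
  define u where "u = g (real (part r h1))"
  define u' where "u' = g (real (p0 * part r h1))"
  have p1: "real p0 \<ge> 1" using PP_range[OF p0(1)] by simp
  have d0: "d \<ge> 0" using p1 L_pos by (simp add: d_def)
  have l: "ln (real (siz (r(p0 := Some h1)))) / L = ln (real (siz r)) / L + d"
    using siz_upd[of p0 r, OF p0] p1 siz_ge_1[of r] L_pos by (simp add: ln_mult d_def add_divide_distrib)
  have t0: "0 \<le> ln (real (siz r)) / L" using L_pos siz_ge_1[of r] by (intro divide_nonneg_nonneg ln_ge_zero) auto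
  have c: "0 \<le> c'" "c' \<le> c" "c - c' \<le> d" "c' \<le> 1" 
    unfolding c_def c'_def l using d0 t0 by (auto simp: max_def)
  have Q: "Q > 0" unfolding Q_def by (rule prod_g_bounds)
  have ge: "real (p0 * part r h1) \<ge> real (part r h1)" using p1 part_ge_1[of r h1] by (simp add: mult_le_cancel_right1)
  have u: "u > 0" "u' > 0" "u' \<le> u" "u' \<le> 1"
    using g_pos g_antimono[of "real (part r h1)" "real (p0 * part r h1)"] part_ge_1[of r h1] ge g_le_1[of "real (p0 * part r h1)"]
    by (auto simp: u_def u'_def simp del: of_nat_mult)
  have uu: "u - u' \<le> A * d * u"
  proof -
    have "real (part r h1) \<ge> 1" by (rule part_ge_1)
    hence iu: "1 / u' = 1 / u + A * d" unfolding u_def u'_def g_def d_def using p1 L_pos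
      by (simp add: ln_mult add_divide_distrib distrib_left)
    have "u - u' = (1 / u' - 1 / u) * (u * u')" using u by (simp add: field_simps)
    also have "\<dots> = (A * d * u) * u'" using iu by simp
    also have "\<dots> \<le> (A * d * u) * 1" using u A_pos d0 by (intro mult_left_mono) auto
    finally show ?thesis by simp
  qed
  have y1: "y r = c * (u * Q)" unfolding y_def c_def u_def Q_def using h1 finite_H by (simp add: prod.remove)
  have y2: "y (r(p0 := Some h1)) = c' * (u' * Q)"
  proof -
    have "(\<Prod>h\<in>H. g (real (part (r(p0 := Some h1)) h))) = u' * (\<Prod>h\<in>H - {h1}. g (real (part (r(p0 := Some h1)) h)))"
      using h1 finite_H by (subst prod.remove[of H h1]) (auto simp: part_upd[of p0 r, OF p0] u'_def)
    also have "(\<Prod>h\<in>H - {h1}. g (real (part (r(p0 := Some h1)) h))) = Q"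
      unfolding Q_def by (intro prod.cong refl) (auto simp: part_upd[of p0 r, OF p0])
    finally show ?thesis unfolding y_def c'_def by (simp only:)
  qed
  show "y (r(p0 := Some h1)) \<le> y r" unfolding y1 y2 using c u Q by (intro mult_mono) auto
  have pg: "(\<Prod>h\<in>H. g (real (part r h))) = u * Q" unfolding u_def Q_def using h1 finite_H by (simp add: prod.remove)
  have "c * u - c' * u' = (c - c') * u + c' * (u - u')" by (simp add: algebra_simps)
  also have "\<dots> \<le> d * u + 1 * (A * d * u)" using c u uu A_pos d0 by (intro add_mono mult_mono) auto
  finally have "(c * u - c' * u') * Q \<le> (d * u + A * d * u) * Q" using Q by (intro mult_right_mono) auto
  thus "y r - y (r(p0 := Some h1)) \<le> (1 + A) * (ln (real p0) / L) * (\<Prod>h\<in>H. g (real (part r h)))"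
    unfolding y1 y2 pg d_def[symmetric] by (simp add: algebra_simps)
qed

text \<open>The cancellation in \<open>form_P1c_le\<close> enters squared. Compared with the bound
  for the full form there is a factor \<open>1 / p0\<close> times a square of order
  \<open>(ln p0 / L)^2\<close>, apart from the harmless \<open>card H / p0\<close>.\<close>

theorem form_P1c_y_le:
  assumes p0: "p0 \<in> PP" and h0: "h0 \<in> H"
  shows "form (P1c p0 h0) (lam y) \<le> 1 / real p0 * ((1 + A) * (ln (real p0) / L) + real (card H) / real p0)\<^sup>2 * GG ^ card H"
proof -
  define K where "K = (1 + A) * (ln (real p0) / L) + real (card H) / real p0"
  define Y where "Y r = y r + (\<Sum>h\<in>H. y (r(p0 := Some h))) / real p0 - y (r(p0 := Some h0))" for r
  have p1: "real p0 \<ge> 1" using PP_range[OF p0] by simp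
  have b: "0 \<le> Y r" "Y r \<le> K * (\<Prod>h\<in>H. g (real (part r h)))" "real (siz r) > exp L \<Longrightarrow> Y r = 0" if r: "r p0 = None" for r
  proof -
    note u = y_upd_bounds[of p0 r, OF p0 r]
    have "(\<Sum>h\<in>H. y (r(p0 := Some h))) \<ge> 0" using y_bounds by (intro sum_nonneg)
    hence "(\<Sum>h\<in>H. y (r(p0 := Some h))) / real p0 \<ge> 0" by simp
    thus "0 \<le> Y r" using u(1)[OF h0] unfolding Y_def by linarith
    have "(\<Sum>h\<in>H. y (r(p0 := Some h))) \<le> (\<Sum>h\<in>H. \<Prod>h\<in>H. g (real (part r h)))"
      using u(1) y_bounds(2)[of r] by (intro sum_mono) force
    hence "(\<Sum>h\<in>H. y (r(p0 := Some h))) / real p0 \<le> real (card H) * (\<Prod>h\<in>H. g (real (part r h))) / real p0"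
      using p1 by (intro divide_right_mono) auto
    thus "Y r \<le> K * (\<Prod>h\<in>H. g (real (part r h)))" using u(2)[OF h0] unfolding Y_def K_def by (simp add: algebra_simps)
    assume "real (siz r) > exp L"
    hence "y r = 0" using y_support[of r] by fastforce
    moreover have "y (r(p0 := Some h)) = 0" if "h \<in> H" for h
      using u(1)[OF that] y_bounds(1)[of "r(p0 := Some h)"] \<open>y r = 0\<close> by simp
    ultimately show "Y r = 0" using h0 by (simp add: Y_def)
  qed
  have K0: "K \<ge> 0" using p1 A_pos L_pos by (simp add: K_def)
  have "form (P1c p0 h0) (lam y) \<le> (\<Sum>r\<in>{r\<in>Om. r p0 = None}. 1 / real p0 / real (siz r) * (Y r)\<^sup>2)"
    unfolding Y_def by (rule form_P1c_le[OF p0 h0])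
  also have "\<dots> = (\<Sum>r\<in>{r\<in>Om. r p0 = None \<and> real (siz r) \<le> exp L}. 1 / real p0 / real (siz r) * (Y r)\<^sup>2)"
  proof (rule sum.mono_neutral_right)
    show "\<forall>r\<in>{r\<in>Om. r p0 = None} - {r\<in>Om. r p0 = None \<and> real (siz r) \<le> exp L}. 1 / real p0 / real (siz r) * (Y r)\<^sup>2 = 0"
    proof
      fix r assume "r \<in> {r\<in>Om. r p0 = None} - {r\<in>Om. r p0 = None \<and> real (siz r) \<le> exp L}"
      hence "r p0 = None" "exp L < real (siz r)" by auto
      thus "1 / real p0 / real (siz r) * (Y r)\<^sup>2 = 0" using b(3) by simp
    qed
  qed auto
  also have "\<dots> \<le> (\<Sum>r\<in>{r\<in>Om. r p0 = None \<and> real (siz r) \<le> exp L}. 1 / real p0 / real (siz r) * (K * (\<Prod>h\<in>H. g (real (part r h))))\<^sup>2)"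
    using b(1,2) by (intro sum_mono mult_left_mono power_mono) auto
  also have "\<dots> \<le> (\<Sum>r\<in>{r. r \<in> Om \<and> real (siz r) \<le> exp L}. 1 / real p0 / real (siz r) * (K * (\<Prod>h\<in>H. g (real (part r h))))\<^sup>2)"
    by (intro sum_mono2) auto
  also have "\<dots> = 1 / real p0 * K\<^sup>2 * (\<Sum>r | r \<in> Om \<and> real (siz r) \<le> exp L. (\<Prod>h\<in>H. g (real (part r h)))\<^sup>2 / real (siz r))"
    by (simp add: sum_distrib_left power_mult_distrib mult_ac)
  also have "\<dots> \<le> 1 / real p0 * K\<^sup>2 * GG ^ card H"
    using sum_g_squares_le p1 by (intro mult_left_mono) auto
  finally show ?thesis unfolding K_def .
qed

text \<open>The integers that can be placed in an empty component of \<open>r\<close> without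
  leaving \<open>Om\<close>, up to the cut used in \<open>L0\<close>.\<close>

definition UU :: "(nat \<Rightarrow> nat option) \<Rightarrow> nat set" where
  "UU r = {u \<in> cops W (exp (L / 4)). \<forall>p. prime p \<longrightarrow> p dvd u \<longrightarrow> p \<in> PP \<and> p \<notin> supp r \<and> \<not> p\<^sup>2 dvd u}"

text \<open>Inadmissible \<open>u\<close> are divisible by a square of some prime in
  \<open>PR\<close>, by a prime left out of the sieve, or by a prime of \<open>r\<close>. Multiples
  of \<open>q\<close> carry a share of at most \<open>1 / q\<close>, so the loss is at most
  \<open>1/20 + 1/20 + 1/5 = 3/10\<close>, less than half.\<close>

lemma sum_UU_ge:
  assumes "(\<Sum>p\<in>supp r. 1 / real p) \<le> 1 / 5" "(\<Sum>p\<in>PR - PP. 1 / real p) \<le> 1 / 20" "D \<ge> 20"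
  shows "(\<Sum>u\<in>UU r. g (real u) / real u) \<ge> L0 / 2"
proof -
  define T where "T = cops W (exp (L / 4))"
  define a where "a u = g (real u) / real u" for u :: nat
  have fT: "finite T" by (simp add: T_def)
  have Tge: "real u \<ge> 1" if "u \<in> T" for u using that by (simp add: T_def cops_def)
  have a0: "a u \<ge> 0" if "u \<in> T" for u unfolding a_def using g_pos[OF Tge[OF that]] by simp
  have L0: "L0 = (\<Sum>u\<in>T. a u)" by (simp add: L0_def T_def a_def)
  have L00: "L0 \<ge> 0" unfolding L0 using a0 by (intro sum_nonneg)
  define bad where "bad = (PR - PP) \<union> supp r"
  have fbad: "finite bad" using finite_PR by (simp add: bad_def)
  have posbad: "p \<ge> 1" if "p \<in> bad" for p
    using that prime_gt_0_nat[OF prime_PP] prime_gt_0_nat by (auto simp: bad_def PR_def supp_def Suc_le_eq)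
  have mult: "(\<Sum>u | u \<in> T \<and> q dvd u. a u) \<le> 1 / real q * L0" if "q \<ge> 1" for q
    unfolding L0 T_def a_def using that g_antimono g_pos
    by (intro sum_cops_multiples_le) (auto intro: less_imp_le)
  have sub: "T - UU r \<subseteq> (\<Union>p\<in>PR. {u \<in> T. p\<^sup>2 dvd u}) \<union> (\<Union>p\<in>bad. {u \<in> T. p dvd u})"
  proof
    fix u assume u: "u \<in> T - UU r"
    then obtain p where p: "prime p" "p dvd u" "p \<notin> PP \<or> p \<in> supp r \<or> p\<^sup>2 dvd u" by (auto simp: UU_def T_def)
    have "p \<in> PR" using p u L_pos by (intro prime_dvd_cops[of p u "exp (L / 4)"]) (auto simp: T_def)
    thus "u \<in> (\<Union>p\<in>PR. {u \<in> T. p\<^sup>2 dvd u}) \<union> (\<Union>p\<in>bad. {u \<in> T. p dvd u})"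
      using p u by (auto simp: bad_def)
  qed
  have un: "(\<Sum>u\<in>(\<Union>p\<in>S. F p). a u) \<le> (\<Sum>p\<in>S. \<Sum>u\<in>F p. a u)" if "finite S" "\<And>p. p \<in> S \<Longrightarrow> F p \<subseteq> T" for S and F :: "nat \<Rightarrow> nat set"
    using that
  proof (induction S rule: finite_induct)
    case (insert p S)
    have f: "finite (F p)" "finite (\<Union>p\<in>S. F p)" using insert fT finite_subset by (auto intro!: finite_subset[OF _ fT])
    have "(\<Sum>u\<in>F p \<union> (\<Union>p\<in>S. F p). a u) = (\<Sum>u\<in>F p. a u) + (\<Sum>u\<in>(\<Union>p\<in>S. F p). a u) - (\<Sum>u\<in>F p \<inter> (\<Union>p\<in>S. F p). a u)"
      using f by (simp add: sum_Un)
    moreover have "(\<Sum>u\<in>F p \<inter> (\<Union>p\<in>S. F p). a u) \<ge> 0" using insert.prems a0 by (intro sum_nonneg) blast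
    moreover have "(\<Sum>u\<in>(\<Union>p\<in>S. F p). a u) \<le> (\<Sum>p\<in>S. \<Sum>u\<in>F p. a u)" using insert by auto
    ultimately show ?case using insert.hyps by simp
  qed simp
  have "(\<Sum>u\<in>T - UU r. a u) \<le> (\<Sum>u\<in>(\<Union>p\<in>PR. {u \<in> T. p\<^sup>2 dvd u}) \<union> (\<Union>p\<in>bad. {u \<in> T. p dvd u}). a u)"
    using sub a0 finite_PR fbad fT by (intro sum_mono2) auto
  also have "\<dots> \<le> (\<Sum>u\<in>(\<Union>p\<in>PR. {u \<in> T. p\<^sup>2 dvd u}). a u) + (\<Sum>u\<in>(\<Union>p\<in>bad. {u \<in> T. p dvd u}). a u)"
    using a0 finite_PR fbad fT by (subst sum_Un) (auto intro!: sum_nonneg)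
  also have "\<dots> \<le> (\<Sum>p\<in>PR. \<Sum>u | u \<in> T \<and> p\<^sup>2 dvd u. a u) + (\<Sum>p\<in>bad. \<Sum>u | u \<in> T \<and> p dvd u. a u)"
    using finite_PR fbad by (intro add_mono un) auto
  also have "\<dots> \<le> (\<Sum>p\<in>PR. 1 / (real p)\<^sup>2 * L0) + (\<Sum>p\<in>bad. 1 / real p * L0)"
  proof (intro add_mono sum_mono)
    fix p assume "p \<in> PR"
    hence "p\<^sup>2 \<ge> 1" using PR_pos[of p] by (simp add: Suc_le_eq)
    thus "(\<Sum>u | u \<in> T \<and> p\<^sup>2 dvd u. a u) \<le> 1 / (real p)\<^sup>2 * L0" using mult[of "p\<^sup>2"] by simp
  next
    fix p assume "p \<in> bad"
    thus "(\<Sum>u | u \<in> T \<and> p dvd u. a u) \<le> 1 / real p * L0" using mult posbad by blast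
  qed
  also have "\<dots> = ((\<Sum>p\<in>PR. 1 / (real p)\<^sup>2) + (\<Sum>p\<in>bad. 1 / real p)) * L0"
    by (simp add: sum_distrib_right distrib_right)
  also have "\<dots> \<le> (1 / 20 + (1 / 20 + 1 / 5)) * L0"
  proof (intro mult_right_mono add_mono L00)
    have "1 / real D \<le> 1 / 20" using assms(3) by (intro divide_left_mono) auto
    thus "(\<Sum>p\<in>PR. 1 / (real p)\<^sup>2) \<le> 1 / 20" using sum_PR_inverse_squares by linarith
    have "(\<Sum>p\<in>bad. 1 / real p) = (\<Sum>p\<in>PR - PP. 1 / real p) + (\<Sum>p\<in>supp r. 1 / real p)"
      unfolding bad_def using finite_PR by (intro sum.union_disjoint finite_supp) (auto simp: supp_def)
    thus "(\<Sum>p\<in>bad. 1 / real p) \<le> 1 / 20 + 1 / 5" using assms(1,2) by linarith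
  qed
  finally have "(\<Sum>u\<in>T - UU r. a u) \<le> 3 / 10 * L0" by simp
  moreover have "(\<Sum>u\<in>T. a u) = (\<Sum>u\<in>T - UU r. a u) + (\<Sum>u\<in>UU r. a u)"
    using fT by (intro sum.subset_diff) (auto simp: UU_def T_def)
  ultimately show ?thesis using L00 L0 by (simp add: a_def)
qed

text \<open>The nonzero products of entries of \<open>C2\<close> have a common sign depending only
  on \<open>r\<close>, and \<open>y\<close> is nonnegative, so no cancellation occurs and the sum
  may be restricted to the elements \<open>\<psi> u\<close> obtained by placing \<open>u\<close> in
  the component \<open>h0\<close>. There \<open>ln siz \<le> 3 / 4 * L\<close>, which leaves
  \<open>1 / 4\<close> of the taper.\<close>

lemma sum_C2_y_ge:
  assumes h0: "h0 \<in> H" and r: "r \<in> Om" and no: "\<And>p. p \<in> PP \<Longrightarrow> r p \<noteq> Some h0" and sz: "ln (real (siz r)) \<le> L / 2"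
  shows "((\<Prod>h\<in>H - {h0}. g (real (part r h))) * (\<Sum>u\<in>UU r. g (real u) / real u) / 4)\<^sup>2
     \<le> (\<Sum>s\<in>Om. (\<Prod>p\<in>PP. C2 h0 p (r p) (s p)) * y s)\<^sup>2"
proof -
  define \<epsilon> where "\<epsilon> = (\<Prod>p\<in>PP. if r p = None then 1 else (-1::real))"
  have \<epsilon>2: "\<epsilon>\<^sup>2 = 1" unfolding \<epsilon>_def prod_power_distrib by (intro prod.neutral) auto
  define Q where "Q = (\<Prod>h\<in>H - {h0}. g (real (part r h)))"
  define \<psi> where "\<psi> u = (\<lambda>p\<in>PP. if p dvd u then Some h0 else r p)" for u
  have Uge: "u \<ge> 1" "real u \<le> exp (L / 4)" if "u \<in> UU r" for u using that by (auto simp: UU_def cops_def)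
  have Udvd: "r p = None" if "u \<in> UU r" "p \<in> PP" "p dvd u" for u p
    using that prime_PP[OF that(2)] by (auto simp: UU_def supp_def)
  have sq: "\<Prod>{p\<in>PP. p dvd u} = u" if "u \<in> UU r" for u
    using that Uge(1)[OF that] finite_PP prime_PP by (intro prod_prime_divisors_squarefree) (auto simp: UU_def)
  have \<psi>Om: "\<psi> u \<in> Om" for u using r h0 by (auto simp: \<psi>_def Om_def St_def PiE_iff)
  have part0: "part (\<psi> u) h0 = u" if "u \<in> UU r" for u
  proof -
    have "{p\<in>PP. \<psi> u p = Some h0} = {p\<in>PP. p dvd u}" using no by (auto simp: \<psi>_def)
    thus ?thesis using sq[OF that] by (simp add: part_def)
  qed
  have part1: "part (\<psi> u) h = part r h" if "u \<in> UU r" "h \<noteq> h0" for u h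
  proof -
    have "{p\<in>PP. \<psi> u p = Some h} = {p\<in>PP. r p = Some h}" using that Udvd[OF that(1)] by (auto simp: \<psi>_def)
    thus ?thesis by (simp add: part_def)
  qed
  have siz: "siz (\<psi> u) = u * siz r" if u: "u \<in> UU r" for u
  proof -
    have "part r h0 = 1" unfolding part_def using no by (intro prod.neutral) auto
    thus ?thesis unfolding siz_eq_prod_part[OF \<psi>Om] siz_eq_prod_part[OF r]
      using part0[OF u] part1[OF u] by (simp add: prod.remove[OF finite_H h0])
  qed
  have yge: "y (\<psi> u) \<ge> 1 / 4 * (g (real u) * Q)" if u: "u \<in> UU r" for u
  proof -
    have "ln (real u) \<le> ln (exp (L / 4))" using Uge[OF u] by (subst ln_le_cancel_iff) auto
    hence "ln (real u) \<le> L / 4" by simp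
    hence "ln (real (siz (\<psi> u))) \<le> 3 / 4 * L"
      using siz[OF u] Uge(1)[OF u] siz_ge_1[of r] sz by (simp add: ln_mult)
    hence "ln (real (siz (\<psi> u))) / L \<le> 3 / 4" using L_pos by (simp add: field_simps)
    hence c: "1 / 4 \<le> max 0 (1 - ln (real (siz (\<psi> u))) / L)"
      by (intro order.trans[OF _ max.cobounded2]) linarith
    have "(\<Prod>h\<in>H. g (real (part (\<psi> u) h))) = g (real u) * Q"
      unfolding Q_def prod.remove[OF finite_H h0] using part0[OF u] part1[OF u] by simp
    moreover have "g (real u) * Q \<ge> 0" using g_pos[of "real u"] Uge(1)[OF u] prod_g_bounds(1)[of r "H - {h0}"] by (simp add: Q_def)
    ultimately show ?thesis unfolding y_def using c by (metis mult_right_mono)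
  qed
  have C: "\<epsilon> * (\<Prod>p\<in>PP. C2 h0 p (r p) (s p)) = (\<Prod>p\<in>PP. \<bar>C2 h0 p (r p) (s p)\<bar>)" for s
    unfolding \<epsilon>_def prod.distrib[symmetric] by (intro prod.cong refl) (auto simp: C2_def split: option.splits)
  have C\<psi>: "(\<Prod>p\<in>PP. \<bar>C2 h0 p (r p) (\<psi> u p)\<bar>) = 1 / real u" if u: "u \<in> UU r" for u
  proof -
    have "(\<Prod>p\<in>PP. \<bar>C2 h0 p (r p) (\<psi> u p)\<bar>) = (\<Prod>p\<in>PP. if p dvd u then 1 / real p else 1)"
      using Udvd[OF u] by (intro prod.cong refl) (auto simp: C2_def \<psi>_def split: option.splits)
    also have "\<dots> = (\<Prod>p\<in>{p\<in>PP. p dvd u}. 1 / real p)" using finite_PP by (simp add: prod.inter_filter)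
    also have "\<dots> = 1 / real (\<Prod>{p\<in>PP. p dvd u})" by (simp add: prod_dividef)
    finally show ?thesis using sq[OF u] by simp
  qed
  have inj: "inj_on \<psi> (UU r)" by (rule inj_onI) (metis part0)
  have "Q * (\<Sum>u\<in>UU r. g (real u) / real u) / 4 = (\<Sum>u\<in>UU r. 1 / real u * (1 / 4 * (g (real u) * Q)))"
    by (simp add: sum_distrib_left sum_divide_distrib mult_ac)
  also have "\<dots> \<le> (\<Sum>u\<in>UU r. (\<Prod>p\<in>PP. \<bar>C2 h0 p (r p) (\<psi> u p)\<bar>) * y (\<psi> u))"
  proof (rule sum_mono)
    fix u assume u: "u \<in> UU r"
    show "1 / real u * (1 / 4 * (g (real u) * Q)) \<le> (\<Prod>p\<in>PP. \<bar>C2 h0 p (r p) (\<psi> u p)\<bar>) * y (\<psi> u)"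
      unfolding C\<psi>[OF u] by (intro mult_left_mono yge u) simp
  qed
  also have "\<dots> = (\<Sum>s\<in>\<psi> ` UU r. (\<Prod>p\<in>PP. \<bar>C2 h0 p (r p) (s p)\<bar>) * y s)" using inj by (simp add: sum.reindex)
  also have "\<dots> \<le> (\<Sum>s\<in>Om. (\<Prod>p\<in>PP. \<bar>C2 h0 p (r p) (s p)\<bar>) * y s)"
    using \<psi>Om y_bounds(1) by (intro sum_mono2) (auto intro!: mult_nonneg_nonneg prod_nonneg)
  also have "\<dots> = \<epsilon> * (\<Sum>s\<in>Om. (\<Prod>p\<in>PP. C2 h0 p (r p) (s p)) * y s)"
    unfolding C[symmetric] by (simp add: sum_distrib_left mult_ac)
  finally have le: "Q * (\<Sum>u\<in>UU r. g (real u) / real u) / 4 \<le> \<epsilon> * (\<Sum>s\<in>Om. (\<Prod>p\<in>PP. C2 h0 p (r p) (s p)) * y s)" .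
  have "0 \<le> (\<Sum>u\<in>UU r. g (real u) / real u)"
    using Uge(1) by (intro sum_nonneg divide_nonneg_nonneg less_imp_le[OF g_pos]) auto
  moreover have "Q > 0" using prod_g_bounds(1)[of r "H - {h0}"] by (simp add: Q_def)
  ultimately have "0 \<le> Q * (\<Sum>u\<in>UU r. g (real u) / real u) / 4" by simp
  hence "(Q * (\<Sum>u\<in>UU r. g (real u) / real u) / 4)\<^sup>2 \<le> (\<epsilon> * (\<Sum>s\<in>Om. (\<Prod>p\<in>PP. C2 h0 p (r p) (s p)) * y s))\<^sup>2"
    using le by (intro power_mono)
  thus ?thesis by (simp add: power_mult_distrib \<epsilon>2 Q_def)
qed

text \<open>The inequality \<open>\<Prod>(1 - a) \<ge> 1 - \<Sum>a\<close> keeps the loss linear in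
  the primes of \<open>r\<close>, so that it can be charged to the penalty.\<close>

lemma prod_D2_ge:
  assumes r: "r \<in> Om" and no: "\<And>p. p \<in> PP \<Longrightarrow> r p \<noteq> Some h0" and D: "D \<ge> 2"
  shows "1 / 2 * (1 / real (siz r)) * (1 - (\<Sum>p\<in>supp r. 5 * real (card H) / real p)) \<le> (\<Prod>p\<in>PP. D2 h0 p (r p))"
proof -
  have p10: "real p \<ge> 10 * (real (card H) + 1)" if "p \<in> PP" for p using real_card_less[OF that] .
  have small: "0 \<le> 5 * real (card H) / real p" "5 * real (card H) / real p \<le> 1" if "p \<in> PP" for p
    using p10[OF that] by (auto simp: divide_le_eq)
  have sq: "0 \<le> 1 / (real p)\<^sup>2" "1 / (real p)\<^sup>2 \<le> 1" if "p \<in> PP" for p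
  proof -
    have "1 ^ 2 \<le> (real p)\<^sup>2" using p10[OF that] by (intro power_mono) auto
    thus "1 / (real p)\<^sup>2 \<le> 1" by (auto simp: divide_le_eq)
  qed simp
  have "(\<Prod>p\<in>PP. D2 h0 p (r p)) = (\<Prod>p\<in>PP. (if r p = None then 1 - 1 / (real p)\<^sup>2 else 1) * D1 p (r p) *
      (if r p \<noteq> None then 1 - 5 * real (card H) / real p else 1))"
    using no by (intro prod.cong refl) (auto simp: D2_def D1_def split: option.splits)
  also have "\<dots> = (\<Prod>p\<in>PP. if r p = None then 1 - 1 / (real p)\<^sup>2 else 1) * (1 / real (siz r)) *
      (\<Prod>p\<in>PP. if r p \<noteq> None then 1 - 5 * real (card H) / real p else 1)"
    by (simp only: prod.distrib prod_D1)
  also have "(\<Prod>p\<in>PP. if r p \<noteq> None then 1 - 5 * real (card H) / real p else 1) = (\<Prod>p\<in>supp r. 1 - 5 * real (card H) / real p)"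
    unfolding supp_def using finite_PP by (simp add: prod.inter_filter)
  finally have e: "(\<Prod>p\<in>PP. D2 h0 p (r p)) = (\<Prod>p\<in>PP. if r p = None then 1 - 1 / (real p)\<^sup>2 else 1) * (1 / real (siz r)) *
      (\<Prod>p\<in>supp r. 1 - 5 * real (card H) / real p)" .
  have "1 - (\<Sum>p\<in>supp r. 5 * real (card H) / real p) \<le> (\<Prod>p\<in>supp r. 1 - 5 * real (card H) / real p)"
    using small by (intro Weierstrass_prod_ineq) (auto simp: supp_def)
  moreover have "0 \<le> (\<Prod>p\<in>supp r. 1 - 5 * real (card H) / real p)" using small(2) by (intro prod_nonneg) (auto simp: supp_def)
  moreover have "1 / 2 \<le> (\<Prod>p\<in>PP. if r p = None then 1 - 1 / (real p)\<^sup>2 else 1)"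
  proof -
    have "(\<Sum>p\<in>PP. 1 / (real p)\<^sup>2) \<le> (\<Sum>p\<in>PR. 1 / (real p)\<^sup>2)" using PP_subset_PR finite_PR by (intro sum_mono2) auto
    also have "\<dots> \<le> 1 / real D" by (rule sum_PR_inverse_squares)
    also have "\<dots> \<le> 1 / 2" using D by (intro divide_left_mono) auto
    finally have "1 / 2 \<le> 1 - (\<Sum>p\<in>PP. 1 / (real p)\<^sup>2)" by simp
    also have "\<dots> \<le> (\<Prod>p\<in>PP. 1 - 1 / (real p)\<^sup>2)" using sq by (intro Weierstrass_prod_ineq) auto
    also have "\<dots> \<le> (\<Prod>p\<in>PP. if r p = None then 1 - 1 / (real p)\<^sup>2 else 1)" using sq by (intro prod_mono) auto
    finally show ?thesis .
  qed
  ultimately show ?thesis unfolding e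
    by (smt (verit, ccfv_SIG) divide_nonneg_nonneg mult.assoc mult.commute mult_left_mono mult_right_mono mult_nonneg_nonneg of_nat_0_le_iff)
qed

end

section \<open>Lower bound for the prime form by the penalty method\<close>

context maynard_weights
begin

lemma D2_nonneg:
  assumes "p \<in> PP"
  shows "0 \<le> D2 h0 p s"
proof -
  have p: "real p \<ge> 10 * (real (card H) + 1)" using real_card_less[OF assms] .
  have "1 ^ 2 \<le> (real p)\<^sup>2" using p by (intro power_mono) auto
  hence "1 / (real p)\<^sup>2 \<le> 1" using p by (subst divide_le_eq_1_pos) auto
  moreover have "5 * real (card H) / real p \<le> 1" using p by (subst divide_le_eq_1_pos) auto
  ultimately show ?thesis by (auto simp: D2_def split: option.splits)
qed

text \<open>A term with \<open>Pen J m < 1\<close> comes from an admissible tuple inside the support of \<open>y\<close>. Bounding the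
  indicator of this by \<open>1 - Pen J m\<close> leaves full product sums, whose penalty is small on average.\<close>

definition pen :: "nat \<Rightarrow> real" where
  "pen u = 2 * (ln (real u) / L) + (\<Sum>p\<in>PR. of_bool (p\<^sup>2 dvd u)) + (\<Sum>p\<in>PR - PP. of_bool (p dvd u))
     + (\<Sum>p\<in>PR. of_bool (p dvd u) * (5 * real (card H) / real p))"

definition Pen :: "nat set \<Rightarrow> (nat \<Rightarrow> nat) \<Rightarrow> real" where
  "Pen J m = (\<Sum>h\<in>J. pen (m h)) + (\<Sum>i\<in>J. \<Sum>j\<in>J - {i}. \<Sum>p\<in>PR. of_bool (p dvd m i \<and> p dvd m j))"

lemma pen_terms_nonneg:
  assumes "u \<ge> 1"
  shows "0 \<le> 2 * (ln (real u) / L)" "0 \<le> (\<Sum>p\<in>PR. of_bool (p\<^sup>2 dvd u) :: real)"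
    "0 \<le> (\<Sum>p\<in>PR - PP. of_bool (p dvd u) :: real)" "0 \<le> (\<Sum>p\<in>PR. of_bool (p dvd u) * (5 * real (card H) / real p))"
  using assms L_pos by (auto intro!: sum_nonneg mult_nonneg_nonneg divide_nonneg_nonneg)

lemma sum_of_bool_ge_1: "finite S \<Longrightarrow> p \<in> S \<Longrightarrow> Q p \<Longrightarrow> (1::real) \<le> (\<Sum>p\<in>S. of_bool (Q p))"
  by (rule order.trans[OF _ member_le_sum[of p S "\<lambda>p. of_bool (Q p)"]]) auto

text \<open>Every forbidden divisibility alone contributes at least 1 to the penalty, so none
  occurs. The factor 2 at the logarithms turns \<open>Pen J m < 1\<close> into the size bound
  \<open>L / 2\<close>, and the factor 5 in the last part of \<open>pen\<close> gives the bound
  \<open>1 / 5\<close>.\<close>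

lemma Pen_small:
  assumes J: "J \<subseteq> H" "H \<noteq> {}" and m: "m \<in> J \<rightarrow>\<^sub>E cops W (exp L)" and small: "Pen J m < 1"
  shows "nice J m" "ln (real (\<Prod>h\<in>J. m h)) \<le> L / 2"
    "(\<Sum>p\<in>supp (tup J m). 5 * real (card H) / real p) \<le> Pen J m" "(\<Sum>p\<in>supp (tup J m). 1 / real p) \<le> 1 / 5"
proof -
  have fJ: "finite J" using J finite_H finite_subset by blast
  have mh: "m h \<in> cops W (exp L)" "m h \<ge> 1" if "h \<in> J" for h using m that by (auto simp: cops_def)
  have pen0: "0 \<le> pen (m h)" if "h \<in> J" for h using pen_terms_nonneg[OF mh(2)[OF that]] by (simp add: pen_def)
  have pair0: "0 \<le> (\<Sum>i\<in>J. \<Sum>j\<in>J - {i}. \<Sum>p\<in>PR. of_bool (p dvd m i \<and> p dvd m j) :: real)" by (intro sum_nonneg) auto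
  have s1: "(\<Sum>h\<in>J. pen (m h)) \<le> Pen J m" using pair0 by (simp add: Pen_def)
  have p1: "pen (m h) < 1" if "h \<in> J" for h
    using member_le_sum[of h J "\<lambda>h. pen (m h)"] that pen0 fJ s1 small by auto
  have sq: "\<not> p\<^sup>2 dvd m h" if "h \<in> J" "p \<in> PR" for h p
  proof
    assume "p\<^sup>2 dvd m h"
    hence "1 \<le> (\<Sum>p\<in>PR. of_bool (p\<^sup>2 dvd m h) :: real)" using sum_of_bool_ge_1[OF finite_PR that(2), of "\<lambda>p. p\<^sup>2 dvd m h"] by simp
    thus False using p1[OF that(1)] pen_terms_nonneg[OF mh(2)[OF that(1)]] by (simp add: pen_def)
  qed
  have inPP: "p \<in> PP" if "h \<in> J" "p \<in> PR" "p dvd m h" for h p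
  proof (rule ccontr)
    assume "p \<notin> PP"
    hence "1 \<le> (\<Sum>p\<in>PR - PP. of_bool (p dvd m h) :: real)"
      using sum_of_bool_ge_1[of "PR - PP" p "\<lambda>p. p dvd m h"] finite_PR that by simp
    thus False using p1[OF that(1)] pen_terms_nonneg[OF mh(2)[OF that(1)]] by (simp add: pen_def)
  qed
  have pr: "p \<in> PR" if "h \<in> J" "prime p" "p dvd m h" for h p
    using prime_dvd_cops[OF that(2,3) mh(1)[OF that(1)]] by simp
  have uniq: "i = j" if "i \<in> J" "j \<in> J" "p \<in> PP" "p dvd m i" "p dvd m j" for i j p
  proof (rule ccontr)
    assume "i \<noteq> j"
    have pPR: "p \<in> PR" using that PP_subset_PR by auto
    have "(1::real) \<le> (\<Sum>p\<in>PR. of_bool (p dvd m i \<and> p dvd m j))"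
      using sum_of_bool_ge_1[OF finite_PR pPR, of "\<lambda>p. p dvd m i \<and> p dvd m j"] that by simp
    also have "\<dots> \<le> (\<Sum>j\<in>J - {i}. \<Sum>p\<in>PR. of_bool (p dvd m i \<and> p dvd m j))"
      using that \<open>i \<noteq> j\<close> fJ by (intro member_le_sum[of j "J - {i}" "\<lambda>j. \<Sum>p\<in>PR. of_bool (p dvd m i \<and> p dvd m j)"]) (auto intro!: sum_nonneg)
    also have "\<dots> \<le> (\<Sum>i\<in>J. \<Sum>j\<in>J - {i}. \<Sum>p\<in>PR. of_bool (p dvd m i \<and> p dvd m j))"
      using that fJ by (intro member_le_sum[of i J "\<lambda>i. \<Sum>j\<in>J - {i}. \<Sum>p\<in>PR. of_bool (p dvd m i \<and> p dvd m j)"]) (auto intro!: sum_nonneg)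
    finally have "1 \<le> Pen J m" using pen0 by (simp add: Pen_def add_increasing sum_nonneg)
    thus False using small by simp
  qed
  show nice: "nice J m" unfolding nice_def using mh(2) inPP pr sq uniq by blast
  have "ln (real (\<Prod>h\<in>J. m h)) = (\<Sum>h\<in>J. ln (real (m h)))"
    using fJ mh(2) by (simp add: ln_prod Suc_le_eq)
  also have "\<dots> = L / 2 * (\<Sum>h\<in>J. 2 * (ln (real (m h)) / L))" using L_pos by (simp add: sum_distrib_left)
  also have "\<dots> \<le> L / 2 * (\<Sum>h\<in>J. pen (m h))"
    using L_pos pen_terms_nonneg[OF mh(2)] by (intro mult_left_mono sum_mono) (auto simp: pen_def)
  also have "\<dots> \<le> L / 2 * 1" using s1 small L_pos by (intro mult_left_mono) auto
  finally show "ln (real (\<Prod>h\<in>J. m h)) \<le> L / 2" by simp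
  have supp: "supp (tup J m) = (\<Union>h\<in>J. {p\<in>PP. p dvd m h})"
    unfolding supp_def using tup_eq[OF nice] by auto
  have "(\<Sum>p\<in>supp (tup J m). 5 * real (card H) / real p) = (\<Sum>h\<in>J. \<Sum>p\<in>{p\<in>PP. p dvd m h}. 5 * real (card H) / real p)"
    unfolding supp using fJ finite_PP uniq by (intro sum.UNION_disjoint) auto
  also have "\<dots> \<le> (\<Sum>h\<in>J. pen (m h))"
  proof (rule sum_mono)
    fix h assume h: "h \<in> J"
    have "(\<Sum>p\<in>{p\<in>PP. p dvd m h}. 5 * real (card H) / real p) = (\<Sum>p\<in>PP. of_bool (p dvd m h) * (5 * real (card H) / real p))"
      using finite_PP by (simp add: sum.inter_filter) (intro sum.cong, auto)
    also have "\<dots> \<le> (\<Sum>p\<in>PR. of_bool (p dvd m h) * (5 * real (card H) / real p))"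
      using PP_subset_PR finite_PR by (intro sum_mono2) auto
    finally show "(\<Sum>p\<in>{p\<in>PP. p dvd m h}. 5 * real (card H) / real p) \<le> pen (m h)"
      using pen_terms_nonneg[OF mh(2)[OF h]] by (simp add: pen_def)
  qed
  finally show 5: "(\<Sum>p\<in>supp (tup J m). 5 * real (card H) / real p) \<le> Pen J m" using s1 by simp
  have c1: "real (card H) \<ge> 1" using J finite_H by (simp add: Suc_le_eq card_gt_0_iff)
  have "5 * (\<Sum>p\<in>supp (tup J m). 1 / real p) \<le> (\<Sum>p\<in>supp (tup J m). 5 * real (card H) / real p)"
    unfolding sum_distrib_left using c1 by (intro sum_mono) (simp add: divide_right_mono)
  thus "(\<Sum>p\<in>supp (tup J m). 1 / real p) \<le> 1 / 5" using 5 small by linarith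
qed

lemma g_sq_antimono: "1 \<le> x \<Longrightarrow> x \<le> z \<Longrightarrow> (g z)\<^sup>2 \<le> (g x)\<^sup>2"
  using g_antimono[of x z] g_pos[of z] by (intro power_mono) auto

lemma GG_multiples:
  assumes "q \<ge> 1"
  shows "(\<Sum>u | u \<in> cops W (exp L) \<and> q dvd u. (g (real u))\<^sup>2 / real u) \<le> 1 / real q * GG"
  unfolding GG_def using assms g_sq_antimono
  by (intro sum_cops_multiples_le[of "\<lambda>u. (g (real u))\<^sup>2"]) auto

lemma GG_nonneg: "GG \<ge> 0" unfolding GG_def by (intro sum_nonneg) auto

text \<open>Under the weight \<open>g^2 / u\<close> multiples of \<open>q\<close> carry at most a
  share \<open>1 / q\<close>, so each indicator in \<open>pen\<close> turns into a reciprocal;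
  \<open>\<mu>\<close> bounds the mean of \<open>ln u / L\<close>.\<close>

lemma sum_pen_le:
  assumes mu: "(\<Sum>m\<in>cops W (exp L). (g (real m))\<^sup>2 / real m * (ln (real m) / L)) \<le> \<mu> * GG"
  shows "(\<Sum>u\<in>cops W (exp L). (g (real u))\<^sup>2 / real u * pen u)
    \<le> (2 * \<mu> + 1 / real D + (\<Sum>p\<in>PR - PP. 1 / real p) + 5 * real (card H) / real D) * GG"
proof -
  define T where "T = cops W (exp L)"
  define a where "a u = (g (real u))\<^sup>2 / real u" for u :: nat
  have G: "GG = (\<Sum>u\<in>T. a u)" by (simp add: GG_def T_def a_def)
  have fT: "finite T" by (simp add: T_def)
  have mult: "(\<Sum>u | u \<in> T \<and> q dvd u. a u) \<le> 1 / real q * GG" if "q \<ge> 1" for q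
    using GG_multiples[OF that] by (simp add: T_def a_def)
  have sw: "(\<Sum>u\<in>T. a u * (\<Sum>p\<in>S. of_bool (f p dvd u) * c p)) \<le> (\<Sum>p\<in>S. 1 / real (f p) * c p) * GG"
    if "\<And>p. p \<in> S \<Longrightarrow> f p \<ge> 1 \<and> c p \<ge> 0" for S and f :: "nat \<Rightarrow> nat" and c
  proof -
    have "(\<Sum>u\<in>T. a u * (\<Sum>p\<in>S. of_bool (f p dvd u) * c p)) = (\<Sum>p\<in>S. \<Sum>u\<in>T. a u * (of_bool (f p dvd u) * c p))"
      unfolding sum_distrib_left by (rule sum.swap)
    also have "\<dots> = (\<Sum>p\<in>S. c p * (\<Sum>u | u \<in> T \<and> f p dvd u. a u))"
    proof (rule sum.cong[OF refl])
      fix p assume "p \<in> S"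
      have "(\<Sum>u | u \<in> T \<and> f p dvd u. a u) = (\<Sum>u\<in>T. a u * of_bool (f p dvd u))" using fT by (simp add: Int_def)
      thus "(\<Sum>u\<in>T. a u * (of_bool (f p dvd u) * c p)) = c p * (\<Sum>u | u \<in> T \<and> f p dvd u. a u)"
        by (simp add: sum_distrib_left mult_ac)
    qed
    also have "\<dots> \<le> (\<Sum>p\<in>S. c p * (1 / real (f p) * GG))" using mult that by (intro sum_mono mult_left_mono) auto
    also have "\<dots> = (\<Sum>p\<in>S. 1 / real (f p) * c p) * GG" unfolding sum_distrib_right by (intro sum.cong refl) (simp add: mult_ac)
    finally show ?thesis .
  qed
  have PR1: "p \<ge> 1" if "p \<in> PR" for p using PR_pos[OF that] by simp
  have s1: "(\<Sum>u\<in>T. a u * (\<Sum>p\<in>PR. of_bool (p\<^sup>2 dvd u) * 1)) \<le> (\<Sum>p\<in>PR. 1 / real (p\<^sup>2) * 1) * GG"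
    using PR1 by (intro sw) auto
  have s2: "(\<Sum>u\<in>T. a u * (\<Sum>p\<in>PR - PP. of_bool (p dvd u) * 1)) \<le> (\<Sum>p\<in>PR - PP. 1 / real p * 1) * GG"
    using PR1 by (intro sw) auto
  have s3: "(\<Sum>u\<in>T. a u * (\<Sum>p\<in>PR. of_bool (p dvd u) * (5 * real (card H) / real p))) \<le> (\<Sum>p\<in>PR. 1 / real p * (5 * real (card H) / real p)) * GG"
    using PR1 by (intro sw) auto
  have e3: "(\<Sum>p\<in>PR. 1 / real p * (5 * real (card H) / real p)) = 5 * real (card H) * (\<Sum>p\<in>PR. 1 / (real p)\<^sup>2)"
    by (simp add: sum_distrib_left power2_eq_square)
  have b1: "(\<Sum>p\<in>PR. 1 / (real p)\<^sup>2) * GG \<le> 1 / real D * GG" using sum_PR_inverse_squares GG_nonneg by (intro mult_right_mono)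
  have b3: "5 * real (card H) * (\<Sum>p\<in>PR. 1 / (real p)\<^sup>2) * GG \<le> 5 * real (card H) * (1 / real D) * GG"
    using sum_PR_inverse_squares GG_nonneg by (intro mult_right_mono mult_left_mono) auto
  have "(\<Sum>u\<in>T. a u * pen u) = 2 * (\<Sum>u\<in>T. a u * (ln (real u) / L)) + (\<Sum>u\<in>T. a u * (\<Sum>p\<in>PR. of_bool (p\<^sup>2 dvd u) * 1))
     + (\<Sum>u\<in>T. a u * (\<Sum>p\<in>PR - PP. of_bool (p dvd u) * 1)) + (\<Sum>u\<in>T. a u * (\<Sum>p\<in>PR. of_bool (p dvd u) * (5 * real (card H) / real p)))"
    unfolding pen_def by (simp only: distrib_left sum.distrib sum_distrib_left[of 2] mult_1_right) (simp add: mult_ac)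
  also have "\<dots> \<le> 2 * (\<mu> * GG) + 1 / real D * GG + (\<Sum>p\<in>PR - PP. 1 / real p) * GG + 5 * real (card H) * (1 / real D) * GG"
    using mu s1 s2 s3 b1 b3 unfolding e3 T_def[symmetric] a_def[symmetric] by simp
  finally show ?thesis unfolding T_def a_def by (simp add: algebra_simps)
qed

text \<open>The constant is \<open>256 = 64 * 2 * 2\<close>: the squared inner sum is at least
  \<open>(L0 / 8)^2\<close> times the profiles, half from \<open>sum_UU_ge\<close> and a quarter
  from the taper; \<open>prod_D2_ge\<close> loses one factor 2 and the mean penalty another.\<close>

theorem form_P2_y_ge:
  assumes h0: "h0 \<in> H" and k: "k = card H"
    and mu: "(\<Sum>m\<in>cops W (exp L). (g (real m))\<^sup>2 / real m * (ln (real m) / L)) \<le> \<mu> * GG" "2 * real k * \<mu> \<le> 1 / 4"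
    and sig: "real k * (\<Sum>p\<in>PR - PP. 1 / real p) \<le> 1 / 20" and D: "D \<ge> 35 * k\<^sup>2"
  shows "form (P2 h0) (lam y) \<ge> L0\<^sup>2 * GG ^ (k - 1) / 256"
proof -
  define J where "J = H - {h0}"
  have J: "J \<subseteq> H" "finite J" "card J = k - 1" using finite_H h0 k by (auto simp: J_def)
  have Hne: "H \<noteq> {}" using h0 by auto
  have k1: "k \<ge> 1" using h0 k finite_H by (metis One_nat_def Suc_leI card_gt_0_iff Hne)
  have D': "real D \<ge> 35 * (real k)\<^sup>2" using of_nat_mono[OF D, where ?'a = real] by simp
  have "k\<^sup>2 \<ge> 1" using k1 by simp
  hence D20: "D \<ge> 20" using D by linarith
  have S0: "(\<Sum>p\<in>PR - PP. 1 / real p) \<ge> 0" by (intro sum_nonneg) auto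
  have sig1: "(\<Sum>p\<in>PR - PP. 1 / real p) \<le> 1 / 20"
  proof -
    have "1 * (\<Sum>p\<in>PR - PP. 1 / real p) \<le> real k * (\<Sum>p\<in>PR - PP. 1 / real p)" using k1 S0 by (intro mult_right_mono) auto
    thus ?thesis using sig by linarith
  qed
  define T where "T = cops W (exp L)"
  define a where "a u = (g (real u))\<^sup>2 / real u" for u :: nat
  define zb where "zb = 2 * \<mu> + 1 / real D + (\<Sum>p\<in>PR - PP. 1 / real p) + 5 * real k / real D"
  have G: "GG = (\<Sum>u\<in>T. a u)" by (simp add: GG_def T_def a_def)
  have a0: "a u \<ge> 0" for u by (simp add: a_def)
  have L00: "L0 \<ge> 0" unfolding L0_def by (intro sum_nonneg divide_nonneg_nonneg less_imp_le[OF g_pos]) (auto simp: cops_def)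
  have pen: "(\<Sum>m\<in>J \<rightarrow>\<^sub>E T. (\<Prod>i\<in>J. a (m i)) * (1 - Pen J m))
      \<ge> GG ^ card J * (1 - (real (card J) * zb + (real (card J))\<^sup>2 * (1 / real D)))"
    unfolding Pen_def
  proof (rule penalty_sum)
    show "(\<Sum>u\<in>T. a u * pen u) \<le> zb * GG"
      using sum_pen_le[OF mu(1)] unfolding T_def a_def zb_def k by simp
    fix p assume "p \<in> PR"
    hence "p \<ge> 1" using PR_pos[of p] by simp
    thus "(\<Sum>u | u \<in> T \<and> p dvd u. a u) \<le> 1 / real p * GG"
      using GG_multiples[of p] by (simp add: T_def a_def)
  qed (use J finite_PR a0 G sum_PR_inverse_squares PR_pos in \<open>auto simp: T_def\<close>)
  \<comment> \<open>The budget is \<open>1/4\<close> for the size term, \<open>1/20\<close> for the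
    omitted primes and \<open>1/5\<close> for all terms with \<open>1 / D\<close>; the last uses
    \<open>k + 6 * k^2 \<le> 7 * k^2\<close> and \<open>5 * 7 = 35\<close>.\<close>
  have half: "real (card J) * zb + (real (card J))\<^sup>2 * (1 / real D) \<le> 1 / 2"
  proof -
    have mu0: "\<mu> \<ge> 0 \<or> GG = 0"
    proof (rule ccontr)
      assume "\<not> ?thesis"
      hence "\<mu> * GG < 0" using GG_nonneg by (simp add: mult_neg_pos)
      moreover have "0 \<le> (\<Sum>m\<in>cops W (exp L). (g (real m))\<^sup>2 / real m * (ln (real m) / L))"
        using L_pos by (intro sum_nonneg mult_nonneg_nonneg divide_nonneg_nonneg) (auto simp: cops_def)
      ultimately show False using mu(1) by linarith
    qed
    have Gpos: "GG > 0"
    proof -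
      have "1 \<in> T" using L_pos by (simp add: T_def cops_def)
      hence "a 1 \<le> GG" unfolding G using a0 by (intro member_le_sum) (auto simp: T_def)
      moreover have "a 1 = 1" by (simp add: a_def g_def)
      ultimately show ?thesis by simp
    qed
    have m0: "\<mu> \<ge> 0" using mu0 Gpos by auto
    have kk: "real (card J) \<le> real k" using J by simp
    have zb0: "zb \<ge> 0" unfolding zb_def using m0 S0 by simp
    have Dp: "real D > 0" using D20 by simp
    have "real (card J) * zb + (real (card J))\<^sup>2 * (1 / real D) \<le> real k * zb + (real k)\<^sup>2 * (1 / real D)"
      using kk zb0 by (intro add_mono mult_right_mono power_mono) auto
    also have "\<dots> = 2 * real k * \<mu> + real k * (\<Sum>p\<in>PR - PP. 1 / real p) + (real k + 6 * (real k)\<^sup>2) / real D"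
      using Dp by (simp add: zb_def field_simps power2_eq_square)
    also have "(real k + 6 * (real k)\<^sup>2) / real D \<le> 1 / 5"
    proof -
      have "real k * 1 \<le> real k * real k" using k1 by (intro mult_left_mono) auto
      hence "real k \<le> (real k)\<^sup>2" by (simp add: power2_eq_square)
      moreover have "5 * (x + 6 * x2) \<le> d" if "x \<le> x2" "35 * x2 \<le> d" for x x2 d :: real using that by simp
      ultimately have "5 * (real k + 6 * (real k)\<^sup>2) \<le> real D" using D' by blast
      thus ?thesis using Dp by (simp add: divide_le_eq)
    qed
    finally show ?thesis using mu(2) sig by linarith
  qed
  define X where "X = {m \<in> J \<rightarrow>\<^sub>E T. Pen J m < 1}"
  have fX: "finite (J \<rightarrow>\<^sub>E T)" using J by (intro finite_PiE) (auto simp: T_def)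
  have Xm: "m \<in> J \<rightarrow>\<^sub>E cops W (exp L)" "Pen J m < 1" if "m \<in> X" for m using that by (auto simp: X_def T_def)
  note P = Pen_small[OF J(1) Hne Xm]
  have inj: "inj_on (tup J) X" by (rule inj_on_subset[OF inj_on_tup[of J T]]) (use P(1) in \<open>auto simp: X_def\<close>)
  define F where "F r = (\<Prod>p\<in>PP. D2 h0 p (r p)) * (\<Sum>s\<in>Om. (\<Prod>p\<in>PP. C2 h0 p (r p) (s p)) * y s)\<^sup>2" for r
  have F0: "F r \<ge> 0" for r unfolding F_def using D2_nonneg by (intro mult_nonneg_nonneg prod_nonneg) auto
  have key: "L0\<^sup>2 / 128 * ((\<Prod>i\<in>J. a (m i)) * (1 - Pen J m)) \<le> F (tup J m)" if m: "m \<in> X" for m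
  proof -
    define r where "r = tup J m"
    have nice: "nice J m" using P(1)[OF m m] .
    have r: "r \<in> Om" unfolding r_def by (rule tup_in_Om[OF nice J(1)])
    have no: "r p \<noteq> Some h0" if "p \<in> PP" for p using tup_eq[OF nice that, of h0] by (auto simp: r_def J_def)
    have siz: "siz r = (\<Prod>h\<in>J. m h)" unfolding r_def by (rule siz_tup[OF nice J(1)])
    have part: "part r h = m h" if "h \<in> J" for h using part_tup[OF nice, of h] that by (simp add: r_def)
    define Q where "Q = (\<Prod>h\<in>J. g (real (m h)))"
    have sz: "ln (real (siz r)) \<le> L / 2" using P(2)[OF m m] siz by simp
    have U: "(\<Sum>u\<in>UU r. g (real u) / real u) \<ge> L0 / 2"
      using sum_UU_ge[of r] P(4)[OF m m] sig1 D20 by (simp add: r_def)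
    have Q0: "Q > 0" using prod_g_bounds(1)[of r J] part by (simp add: Q_def)
    have "(Q * (L0 / 2) / 4)\<^sup>2 \<le> (Q * (\<Sum>u\<in>UU r. g (real u) / real u) / 4)\<^sup>2"
      using U Q0 L00 by (intro power_mono divide_right_mono mult_left_mono) auto
    also have "\<dots> \<le> (\<Sum>s\<in>Om. (\<Prod>p\<in>PP. C2 h0 p (r p) (s p)) * y s)\<^sup>2"
      using sum_C2_y_ge[OF h0 r no sz] part unfolding Q_def J_def[symmetric] by simp
    finally have c: "(Q * (L0 / 2) / 4)\<^sup>2 \<le> (\<Sum>s\<in>Om. (\<Prod>p\<in>PP. C2 h0 p (r p) (s p)) * y s)\<^sup>2" .
    have "1 / 2 * (1 / real (siz r)) * (1 - Pen J m) \<le> 1 / 2 * (1 / real (siz r)) * (1 - (\<Sum>p\<in>supp r. 5 * real (card H) / real p))"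
      using P(3)[OF m m] by (intro mult_left_mono) (auto simp: r_def)
    also have "\<dots> \<le> (\<Prod>p\<in>PP. D2 h0 p (r p))" using prod_D2_ge[OF r no] D20 by simp
    finally have d: "1 / 2 * (1 / real (siz r)) * (1 - Pen J m) \<le> (\<Prod>p\<in>PP. D2 h0 p (r p))" .
    have d0: "0 \<le> (\<Prod>p\<in>PP. D2 h0 p (r p))" using D2_nonneg by (intro prod_nonneg) auto
    have ap: "(\<Prod>i\<in>J. a (m i)) = Q\<^sup>2 / real (siz r)"
      unfolding a_def Q_def siz by (simp add: prod_dividef prod_power_distrib)
    have "L0\<^sup>2 / 128 * ((\<Prod>i\<in>J. a (m i)) * (1 - Pen J m)) = 1 / 2 * (1 / real (siz r)) * (1 - Pen J m) * (Q * (L0 / 2) / 4)\<^sup>2"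
      unfolding ap by (simp add: power_mult_distrib power_divide)
    also have "\<dots> \<le> F r" unfolding F_def by (intro mult_mono d c d0) auto
    finally show ?thesis unfolding r_def .
  qed
  have "L0\<^sup>2 * GG ^ (k - 1) / 256 = L0\<^sup>2 / 128 * (GG ^ card J * (1 / 2))" by (simp add: J)
  also have "\<dots> \<le> L0\<^sup>2 / 128 * (GG ^ card J * (1 - (real (card J) * zb + (real (card J))\<^sup>2 * (1 / real D))))"
    using half GG_nonneg by (intro mult_left_mono) auto
  also have "\<dots> \<le> L0\<^sup>2 / 128 * (\<Sum>m\<in>J \<rightarrow>\<^sub>E T. (\<Prod>i\<in>J. a (m i)) * (1 - Pen J m))"
    using pen by (intro mult_left_mono) auto
  \<comment> \<open>Outside \<open>X\<close> the factor \<open>1 - Pen J m\<close> is not positive,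
    so dropping those terms cannot decrease the sum. Inadmissible tuples disappear only here, after
    the full product sum has been evaluated.\<close>
  also have "\<dots> \<le> L0\<^sup>2 / 128 * (\<Sum>m\<in>X. (\<Prod>i\<in>J. a (m i)) * (1 - Pen J m))"
  proof (rule mult_left_mono)
    have "(\<Sum>m\<in>J \<rightarrow>\<^sub>E T. (\<Prod>i\<in>J. a (m i)) * (1 - Pen J m)) = (\<Sum>m\<in>(J \<rightarrow>\<^sub>E T) - X. (\<Prod>i\<in>J. a (m i)) * (1 - Pen J m)) + (\<Sum>m\<in>X. (\<Prod>i\<in>J. a (m i)) * (1 - Pen J m))"
      using fX by (intro sum.subset_diff) (auto simp: X_def)
    moreover have "(\<Sum>m\<in>(J \<rightarrow>\<^sub>E T) - X. (\<Prod>i\<in>J. a (m i)) * (1 - Pen J m)) \<le> 0"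
      using a0 by (intro sum_nonpos mult_nonneg_nonpos prod_nonneg) (auto simp: X_def)
    ultimately show "(\<Sum>m\<in>J \<rightarrow>\<^sub>E T. (\<Prod>i\<in>J. a (m i)) * (1 - Pen J m)) \<le> (\<Sum>m\<in>X. (\<Prod>i\<in>J. a (m i)) * (1 - Pen J m))" by linarith
  qed simp
  also have "\<dots> = (\<Sum>m\<in>X. L0\<^sup>2 / 128 * ((\<Prod>i\<in>J. a (m i)) * (1 - Pen J m)))" by (simp add: sum_distrib_left)
  also have "\<dots> \<le> (\<Sum>m\<in>X. F (tup J m))" by (intro sum_mono key)
  also have "\<dots> = (\<Sum>r\<in>tup J ` X. F r)" using inj by (simp add: sum.reindex)
  also have "\<dots> \<le> (\<Sum>r\<in>Om. F r)"
    using F0 P(1) tup_in_Om[OF _ J(1)] by (intro sum_mono2) auto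
  also have "\<dots> \<le> form (P2 h0) (lam y)" unfolding F_def by (rule form_P2_ge[OF h0])
  finally show ?thesis .
qed

end

section \<open>Evaluation of the one-variable sums over the profile\<close>

lemma real_deriv_g1:
  assumes "L > 0" "A > 0" "1 \<le> x"
  shows "((\<lambda>x. L / A * ln (1 + A * ln x / L)) has_real_derivative (1 / (1 + A * ln x / L)) / x) (at x)"
proof -
  have p: "1 + A * ln x / L > 0" using assms by (intro add_pos_nonneg) auto
  have "((\<lambda>x. L / A * ln (1 + A * ln x / L)) has_real_derivative L / A * ((A * (1 / x) / L) / (1 + A * ln x / L))) (at x)"
    using p assms by (auto intro!: derivative_eq_intros)
  moreover have "L / A * ((A * (1 / x) / L) / (1 + A * ln x / L)) = (1 / (1 + A * ln x / L)) / x"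
    using assms by simp
  ultimately show ?thesis by simp
qed

lemma real_deriv_g2:
  assumes "L > 0" "A > 0" "1 \<le> x"
  shows "((\<lambda>x. - (L / A) * (1 / (1 + A * ln x / L))) has_real_derivative (1 / (1 + A * ln x / L))\<^sup>2 / x) (at x)"
proof -
  have p: "1 + A * ln x / L > 0" using assms by (intro add_pos_nonneg) auto
  have "((\<lambda>x. - (L / A) * (1 / (1 + A * ln x / L))) has_real_derivative
      - (L / A) * (- (A * (1 / x) / L) / (1 + A * ln x / L)\<^sup>2)) (at x)"
    using p assms by (auto intro!: derivative_eq_intros simp: power2_eq_square)
  moreover have "- (L / A) * (- (A * (1 / x) / L) / (1 + A * ln x / L)\<^sup>2) = (1 / (1 + A * ln x / L))\<^sup>2 / x"
    using assms by (simp add: power_divide)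
  ultimately show ?thesis by simp
qed

context maynard_weights
begin

lemma sum_g_approx:
  assumes "s \<ge> 0"
  shows "\<bar>(\<Sum>m\<in>cops W (exp (s * L)). g (real m) / real m) - real (totient W) / real W * (L / A * ln (1 + A * s))\<bar> \<le> real W + 2"
proof -
  have "\<bar>(\<Sum>m\<in>cops W (exp (s * L)). g (real m) / real m)
      - real (totient W) / real W * (L / A * ln (1 + A * ln (exp (s * L)) / L) - L / A * ln (1 + A * ln 1 / L))\<bar> \<le> (real W + 2) * (g 1 / 1)"
  proof (rule sum_cops_approx[where f = "\<lambda>x. g x / x"])
    fix x z :: real assume "1 \<le> x" "x \<le> z"
    thus "g z / z \<le> g x / x" using g_antimono[of x z] g_pos[of x] by (intro frac_le) auto
  next
    fix x :: real assume "1 \<le> x"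
    thus "0 \<le> g x / x" using g_pos[of x] by simp
    show "((\<lambda>x. L / A * ln (1 + A * ln x / L)) has_real_derivative g x / x) (at x)"
      using real_deriv_g1[OF L_pos A_pos \<open>1 \<le> x\<close>] by (simp add: g_def)
  qed (use W_pos L_pos assms in auto)
  thus ?thesis using L_pos by (simp add: g_def)
qed

lemma GG_approx: "\<bar>GG - real (totient W) / real W * (L / (1 + A))\<bar> \<le> real W + 2"
proof -
  have "\<bar>(\<Sum>m\<in>cops W (exp L). (g (real m))\<^sup>2 / real m)
      - real (totient W) / real W * (- (L / A) * g (exp L) - - (L / A) * g 1)\<bar> \<le> (real W + 2) * ((g 1)\<^sup>2 / 1)"
  proof (rule sum_cops_approx[where f = "\<lambda>x. (g x)\<^sup>2 / x"])
    fix x z :: real assume "1 \<le> x" "x \<le> z"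
    thus "(g z)\<^sup>2 / z \<le> (g x)\<^sup>2 / x" using g_sq_antimono[of x z] by (intro frac_le) auto
  next
    fix x :: real assume "1 \<le> x"
    thus "0 \<le> (g x)\<^sup>2 / x" by simp
    show "((\<lambda>x. - (L / A) * g x) has_real_derivative (g x)\<^sup>2 / x) (at x)"
      using real_deriv_g2[OF L_pos A_pos \<open>1 \<le> x\<close>] by (simp add: g_def)
  qed (use W_pos L_pos in auto)
  moreover have "- (L / A) * g (exp L) - - (L / A) * g 1 = L / (1 + A)"
  proof -
    have "g (exp L) = 1 / (1 + A)" "g 1 = 1" using L_pos by (simp_all add: g_def)
    moreover have "1 - 1 / (1 + A) = A / (1 + A)" using A_pos by (simp add: field_simps)
    ultimately have "- (L / A) * g (exp L) - - (L / A) * g 1 = L / A * (A / (1 + A))"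
      by (metis add.commute diff_minus_eq_add minus_mult_commute mult.right_neutral right_diff_distrib uminus_add_conv_diff mult_minus_left)
    thus ?thesis using A_pos by simp
  qed
  ultimately show ?thesis by (simp add: GG_def g_def mult.commute)
qed

text \<open>With \<open>t = ln m / L\<close>, the equation \<open>g * (1 + A * t) = 1\<close> gives
  \<open>g^2 * t = (g - g^2) / A\<close>. The mean size of a component thus reduces to the two sums
  already evaluated.\<close>

lemma sum_g_ln: "(\<Sum>m\<in>cops W (exp L). (g (real m))\<^sup>2 / real m * (ln (real m) / L))
    = ((\<Sum>m\<in>cops W (exp L). g (real m) / real m) - GG) / A"
proof -
  have "(\<Sum>m\<in>cops W (exp L). (g (real m))\<^sup>2 / real m * (ln (real m) / L))
      = (\<Sum>m\<in>cops W (exp L). (g (real m) / real m - (g (real m))\<^sup>2 / real m) / A)"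
  proof (rule sum.cong[OF refl])
    fix m assume m: "m \<in> cops W (exp L)"
    define t where "t = ln (real m) / L"
    have t: "t \<ge> 0" using m L_pos by (simp add: t_def cops_def)
    define z where "z = g (real m)"
    have "1 + A * t > 0" using t A_pos by (intro add_pos_nonneg) auto
    hence "z * (1 + A * t) = 1" by (simp add: z_def g_def t_def)
    hence "z = z * (z * (1 + A * t))" by simp
    hence "z = z\<^sup>2 + A * (z\<^sup>2 * t)" by (simp add: algebra_simps power2_eq_square)
    hence "z\<^sup>2 * t = (z - z\<^sup>2) / A" using A_pos by (simp add: field_simps)
    hence "z\<^sup>2 / real m * t = (z - z\<^sup>2) / A / real m" by simp
    also have "\<dots> = (z / real m - z\<^sup>2 / real m) / A" by (simp add: diff_divide_distrib mult.commute)
    finally show "(g (real m))\<^sup>2 / real m * (ln (real m) / L) = (g (real m) / real m - (g (real m))\<^sup>2 / real m) / A"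
      unfolding z_def t_def .
  qed
  thus ?thesis by (simp add: GG_def sum_divide_distrib sum_subtractf diff_divide_distrib)
qed

end

section \<open>Removing integers with small prime factors\<close>

context tuple_sieve
begin

text \<open>The requirement \<open>p0 dvd n + h0\<close> is encoded as a third element
  \<open>x\<close> of \<open>Om\<close>, supported at \<open>p0\<close> alone, so the joint density
  is that of a join of three conditions.\<close>

lemma prod_kap_P1c:
  assumes d: "d \<in> Om" and e: "e \<in> Om" and p0: "p0 \<in> PP" and h0: "h0 \<in> H"
    and x: "x = (\<lambda>p\<in>PP. if p = p0 then Some h0 else None)"
  shows "(\<Prod>p\<in>PP. kap (P1c p0 h0) p (d p) (e p)) =
    (if compat d e \<and> compat (join d e) x then 1 / real (siz (join (join d e) x)) else 0)"
proof -
  have s: "d p \<in> St" "e p \<in> St" if "p \<in> PP" for p using d e that by (auto simp: Om_def)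
  have tot0: "P1c p0 h0 p0 None + (\<Sum>h\<in>H. P1c p0 h0 p0 (Some h)) = 1 / real p0"
    using h0 finite_H by (simp add: P1c_def)
  have tot: "P1c p0 h0 p None + (\<Sum>h\<in>H. P1c p0 h0 p (Some h)) = 1" if "p \<in> PP" "p \<noteq> p0" for p
    using P1_total[OF that(1)] that by (simp add: P1c_def)
  show ?thesis
  proof (cases "compat d e \<and> compat (join d e) x")
    case True
    have "(\<Prod>p\<in>PP. kap (P1c p0 h0) p (d p) (e p)) = (\<Prod>p\<in>PP. D1 p (join (join d e) x p))"
    proof (rule prod.cong[OF refl])
      fix p assume p: "p \<in> PP"
      have c: "d p = None \<or> e p = None \<or> d p = e p" using True p by (auto simp: compat_def)
      have j: "join d e p = (if d p = None then e p else d p)" using p by (simp add: join_def)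
      show "kap (P1c p0 h0) p (d p) (e p) = D1 p (join (join d e) x p)"
      proof (cases "p = p0")
        case True
        have "join d e p = None \<or> join d e p = Some h0"
          using \<open>compat d e \<and> compat (join d e) x\<close> p True p0 by (auto simp: compat_def x)
        hence "(if d p = None then e p else d p) = None \<or> (if d p = None then e p else d p) = Some h0" using j by simp
        moreover have "join (join d e) x p = Some h0"
          using \<open>join d e p = None \<or> join d e p = Some h0\<close> p True by (auto simp: join_def x split: if_splits)
        ultimately show ?thesis unfolding kap_eq[OF s[OF p]] using c True tot0
          by (auto simp: D1_def P1c_def split: option.splits)
      next
        case False
        have "join (join d e) x p = (if d p = None then e p else d p)" using p False by (auto simp: join_def x)
        thus ?thesis unfolding kap_eq[OF s[OF p]] using c False tot[OF p False]
          by (auto simp: D1_def P1c_def P1_def split: option.splits)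
      qed
    qed
    thus ?thesis using True by (simp add: prod_D1)
  next
    case False
    have "\<exists>p\<in>PP. kap (P1c p0 h0) p (d p) (e p) = 0"
    proof (cases "compat d e")
      case False
      then obtain p where p: "p \<in> PP" "d p \<noteq> None" "e p \<noteq> None" "d p \<noteq> e p" by (auto simp: compat_def)
      hence "kap (P1c p0 h0) p (d p) (e p) = 0" unfolding kap_eq[OF s[OF p(1)]] by simp
      thus ?thesis using p(1) by blast
    next
      case True
      hence "\<not> compat (join d e) x" using False by simp
      then obtain p where p: "p \<in> PP" "join d e p \<noteq> None" "x p \<noteq> None" "join d e p \<noteq> x p" by (auto simp: compat_def)
      have "p = p0" using p by (auto simp: x split: if_splits)
      hence "join d e p0 \<noteq> None" "join d e p0 \<noteq> Some h0" using p by (auto simp: x)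
      hence "(if d p0 = None then e p0 else d p0) \<noteq> None" "(if d p0 = None then e p0 else d p0) \<noteq> Some h0"
        using p0 by (auto simp: join_def)
      hence "kap (P1c p0 h0) p0 (d p0) (e p0) = 0" unfolding kap_eq[OF s[OF p0]]
        by (auto simp: P1c_def split: option.splits)
      thus ?thesis using p0 by blast
    qed
    thus ?thesis using False finite_PP by (auto intro!: prod_zero)
  qed
qed

theorem sum_weight_dvd_approx:
  assumes W: "\<And>p. p \<in> PP \<Longrightarrow> coprime p W" "W > 0" and p0: "p0 \<in> PP" and h0: "h0 \<in> H"
  shows "\<bar>(\<Sum>n | n \<in> {N<..2*N} \<and> [n = a] (mod W) \<and> p0 dvd n + h0. weight l n)
     - real N / real W * form (P1c p0 h0) l\<bar> \<le> (\<Sum>d\<in>Om. \<bar>l d\<bar>)\<^sup>2"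
proof -
  define X where "X = {n. n \<in> {N<..2*N} \<and> [n = a] (mod W) \<and> p0 dvd n + h0}"
  define x where "x = (\<lambda>p\<in>PP. if p = p0 then Some h0 else None)"
  have x: "x \<in> Om" using h0 by (auto simp: x_def Om_def St_def)
  have dx: "p0 dvd n + h0 \<longleftrightarrow> dvs x n" for n using p0 by (auto simp: dvs_def x_def)
  have fX: "finite X" unfolding X_def by simp
  have "\<bar>(\<Sum>n\<in>X. 1 * weight l n) - real N / real W * form (P1c p0 h0) l\<bar> \<le> (\<Sum>d\<in>Om. \<Sum>e\<in>Om. \<bar>l d\<bar> * \<bar>l e\<bar> * 1)"
  proof (rule weighted_sum_approx)
    fix d e assume de: "d \<in> Om" "e \<in> Om"
    define J where "J = join (join d e) x"
    have J: "J \<in> Om" unfolding J_def by (intro join_in_Om de x)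
    have "(\<Sum>n\<in>X. 1 * of_bool (dvs d n \<and> dvs e n)) = real (card (X \<inter> {n. dvs d n \<and> dvs e n}))"
      using fX by simp
    also have "X \<inter> {n. dvs d n \<and> dvs e n} = (if compat d e \<and> compat (join d e) x then {n\<in>{N<..2*N}. [n = a] (mod W) \<and> dvs J n} else {})"
      using dvs_join[OF de] dvs_join[OF join_in_Om[OF de] x] dx by (auto simp: X_def J_def)
    finally have c: "(\<Sum>n\<in>X. 1 * of_bool (dvs d n \<and> dvs e n)) = (if compat d e \<and> compat (join d e) x then
        real (card {n\<in>{N<..2*N}. [n = a] (mod W) \<and> dvs J n}) else 0)" by simp
    show "\<bar>(\<Sum>n\<in>X. 1 * of_bool (dvs d n \<and> dvs e n)) - real N / real W * (\<Prod>p\<in>PP. kap (P1c p0 h0) p (d p) (e p))\<bar> \<le> 1"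
      unfolding c prod_kap_P1c[OF de p0 h0 x_def] J_def[symmetric]
      using card_dvs[OF J W, of N a] by (simp add: mult.commute)
  qed
  also have "(\<Sum>d\<in>Om. \<Sum>e\<in>Om. \<bar>l d\<bar> * \<bar>l e\<bar> * 1) = (\<Sum>d\<in>Om. \<bar>l d\<bar>)\<^sup>2"
    by (simp add: power2_eq_square sum_product)
  finally show ?thesis by (simp add: X_def)
qed

text \<open>Each \<open>n + h\<close> has at most \<open>q\<close> prime factors in
  \<open>PP\<close>, as they all exceed \<open>z\<close> and \<open>n + h \<le> z ^ q\<close>. An
  element \<open>d\<close> with \<open>dvs d n\<close> is determined by its support, a subset of
  these at most \<open>q * card H\<close> primes, which bounds the number of terms in the
  weight.\<close>

lemma weight_rough_le:
  assumes l: "\<And>d. d \<in> Om \<Longrightarrow> \<bar>l d\<bar> \<le> Lam" "Lam \<ge> 0"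
    and rough: "\<And>p h. p \<in> PP \<Longrightarrow> h \<in> H \<Longrightarrow> p dvd n + h \<Longrightarrow> z < real p"
    and z: "z > 1" "\<And>h. h \<in> H \<Longrightarrow> 0 < n + h \<and> real (n + h) \<le> z ^ q"
  shows "weight l n \<le> (2 ^ (q * card H) * Lam)\<^sup>2"
proof -
  define B where "B h = {p\<in>PP. p dvd n + h}" for h
  define BB where "BB = (\<Union>h\<in>H. B h)"
  have fB: "finite (B h)" for h using finite_PP by (simp add: B_def)
  have fBB: "finite BB" using finite_H fB by (simp add: BB_def)
  have cB: "card (B h) \<le> q" if h: "h \<in> H" for h
  proof -
    have "\<Prod>(B h) dvd n + h" using fB prime_PP by (intro prod_primes_dvd) (auto simp: B_def)
    hence "\<Prod>(B h) \<le> n + h" using z(2)[OF h] by (intro dvd_imp_le) auto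
    hence "real (\<Prod>(B h)) \<le> real (n + h)" by (simp only: of_nat_le_iff)
    moreover have "(\<Prod>p\<in>B h. z) \<le> (\<Prod>p\<in>B h. real p)"
      using z(1) rough h by (intro prod_mono) (auto simp: B_def intro: less_imp_le)
    ultimately have "z ^ card (B h) \<le> z ^ q" using z(2)[OF h] by simp
    thus ?thesis using z(1) by simp
  qed
  have cBB: "card BB \<le> q * card H"
  proof -
    have "card BB \<le> (\<Sum>h\<in>H. card (B h))" unfolding BB_def using finite_H by (rule card_UN_le)
    also have "\<dots> \<le> (\<Sum>h\<in>H. q)" by (intro sum_mono cB)
    finally show ?thesis by (simp add: mult.commute)
  qed
  define V where "V = {d\<in>Om. dvs d n}"
  have "inj_on supp V"
  proof (rule inj_onI)
    fix d e assume de: "d \<in> V" "e \<in> V" "supp d = supp e"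
    have O: "d \<in> Om" "e \<in> Om" "dvs d n" "dvs e n" using de by (auto simp: V_def)
    have "compat d e" using dvs_join[OF O(1,2), of n] O by blast
    show "d = e"
    proof (rule PiE_ext[of _ PP "\<lambda>_. St"])
      show "d \<in> PP \<rightarrow>\<^sub>E St" "e \<in> PP \<rightarrow>\<^sub>E St" using O by (auto simp: Om_def)
      fix p assume p: "p \<in> PP"
      have "p \<in> supp d \<longleftrightarrow> p \<in> supp e" using de(3) by simp
      thus "d p = e p" using \<open>compat d e\<close> p by (auto simp: supp_def compat_def)
    qed
  qed
  moreover have "supp ` V \<subseteq> Pow BB"
  proof (intro image_subsetI PowI subsetI)
    fix d p assume d: "d \<in> V" and p: "p \<in> supp d"
    obtain h where "d p = Some h" "h \<in> H" "p \<in> PP" using p d Om_cases[of d p] by (auto simp: supp_def V_def)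
    thus "p \<in> BB" using d by (auto simp: BB_def B_def V_def dvs_def)
  qed
  ultimately have "card V \<le> card (Pow BB)" using fBB by (intro card_inj_on_le) auto
  also have "\<dots> = 2 ^ card BB" using fBB by (simp add: card_Pow)
  also have "\<dots> \<le> 2 ^ (q * card H)" using cBB by (intro power_increasing) auto
  finally have "real (card V) \<le> real (2 ^ (q * card H))" by (simp only: of_nat_le_iff)
  hence cV: "real (card V) \<le> 2 ^ (q * card H)" by simp
  have "\<bar>\<Sum>d\<in>Om. of_bool (dvs d n) * l d\<bar> = \<bar>\<Sum>d\<in>V. l d\<bar>"
    unfolding V_def by (intro arg_cong[where f = abs]) (simp add: Int_def)
  also have "\<dots> \<le> (\<Sum>d\<in>V. \<bar>l d\<bar>)" by (rule sum_abs)
  also have "\<dots> \<le> (\<Sum>d\<in>V. Lam)" using l by (intro sum_mono) (auto simp: V_def)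
  also have "\<dots> = real (card V) * Lam" by simp
  also have "\<dots> \<le> 2 ^ (q * card H) * Lam" using cV l(2) by (intro mult_right_mono)
  finally show ?thesis unfolding weight_def by (subst power2_abs[symmetric]) (intro power_mono, auto)
qed

text \<open>One small prime factor already subtracts \<open>card H\<close>, more than all primes in
  the tuple can contribute. So the left side is positive only for tuples free of \<open>Z\<close>
  with at least three primes, and it is then at most \<open>card H\<close>.\<close>

lemma three_primes_pointwise:
  assumes H: "H \<noteq> {}" and Z: "finite Z"
  shows "real (card {h\<in>H. prime (n + h)}) - 2 - real (card H) * (\<Sum>p\<in>Z. \<Sum>h\<in>H. of_bool (p dvd n + h))
    \<le> real (card H) * of_bool ((\<forall>p\<in>Z. \<forall>h\<in>H. \<not> p dvd n + h) \<and> 3 \<le> card {h\<in>H. prime (n + h)})"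
proof (cases "\<forall>p\<in>Z. \<forall>h\<in>H. \<not> p dvd n + h")
  case True
  have "card {h\<in>H. prime (n + h)} \<le> card H" using finite_H by (intro card_mono) auto
  thus ?thesis using True by (cases "3 \<le> card {h\<in>H. prime (n + h)}") (auto simp: not_le)
next
  case False
  then obtain p h where ph: "p \<in> Z" "h \<in> H" "p dvd n + h" by blast
  have "(1::real) \<le> (\<Sum>h\<in>H. of_bool (p dvd n + h))"
    by (rule order.trans[OF _ member_le_sum[of h H "\<lambda>h. of_bool (p dvd n + h)"]]) (use ph finite_H in auto)
  also have "\<dots> \<le> (\<Sum>p\<in>Z. \<Sum>h\<in>H. of_bool (p dvd n + h))"
    by (rule member_le_sum[of p Z "\<lambda>p. \<Sum>h\<in>H. of_bool (p dvd n + h)"]) (use ph Z in \<open>auto intro!: sum_nonneg\<close>)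
  finally have "real (card H) * 1 \<le> real (card H) * (\<Sum>p\<in>Z. \<Sum>h\<in>H. of_bool (p dvd n + h))" by (intro mult_left_mono) auto
  moreover have "card {h\<in>H. prime (n + h)} \<le> card H" using finite_H by (intro card_mono) auto
  hence "real (card {h\<in>H. prime (n + h)}) \<le> real (card H)" by simp
  ultimately have "real (card {h\<in>H. prime (n + h)}) - 2 - real (card H) * (\<Sum>p\<in>Z. \<Sum>h\<in>H. of_bool (p dvd n + h)) \<le> 0"
    by argo
  thus ?thesis by (rule order.trans) simp
qed

lemma three_primes_weighted:
  assumes H: "H \<noteq> {}" and Z: "finite Z" and X: "finite X"
  shows "real (card H) * (\<Sum>n | n \<in> X \<and> (\<forall>p\<in>Z. \<forall>h\<in>H. \<not> p dvd n + h) \<and> 3 \<le> card {h\<in>H. prime (n + h)}. weight l n)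
    \<ge> (\<Sum>h\<in>H. \<Sum>n | n \<in> X \<and> prime (n + h). weight l n) - 2 * (\<Sum>n\<in>X. weight l n)
      - real (card H) * (\<Sum>p\<in>Z. \<Sum>h\<in>H. \<Sum>n | n \<in> X \<and> p dvd n + h. weight l n)"
proof -
  have f: "(\<Sum>n\<in>X. weight l n * of_bool (Q n)) = (\<Sum>n | n \<in> X \<and> Q n. weight l n)" for Q
    using X by (simp add: Int_def)
  have 1: "(\<Sum>n\<in>X. weight l n * real (card {h\<in>H. prime (n + h)})) = (\<Sum>h\<in>H. \<Sum>n | n \<in> X \<and> prime (n + h). weight l n)"
  proof -
    have "real (card {h\<in>H. prime (n + h)}) = (\<Sum>h\<in>H. of_bool (prime (n + h)))" for n
      using finite_H by (simp add: Int_def)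
    hence "(\<Sum>n\<in>X. weight l n * real (card {h\<in>H. prime (n + h)})) = (\<Sum>n\<in>X. \<Sum>h\<in>H. weight l n * of_bool (prime (n + h)))"
      by (simp only: sum_distrib_left)
    also have "\<dots> = (\<Sum>h\<in>H. \<Sum>n\<in>X. weight l n * of_bool (prime (n + h)))" by (rule sum.swap)
    finally show ?thesis unfolding f .
  qed
  have 2: "(\<Sum>n\<in>X. weight l n * (\<Sum>p\<in>Z. \<Sum>h\<in>H. of_bool (p dvd n + h))) = (\<Sum>p\<in>Z. \<Sum>h\<in>H. \<Sum>n | n \<in> X \<and> p dvd n + h. weight l n)"
  proof -
    have "(\<Sum>n\<in>X. weight l n * (\<Sum>p\<in>Z. \<Sum>h\<in>H. of_bool (p dvd n + h))) = (\<Sum>p\<in>Z. \<Sum>n\<in>X. \<Sum>h\<in>H. weight l n * of_bool (p dvd n + h))"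
      unfolding sum_distrib_left by (rule sum.swap)
    also have "\<dots> = (\<Sum>p\<in>Z. \<Sum>h\<in>H. \<Sum>n\<in>X. weight l n * of_bool (p dvd n + h))" by (intro sum.cong refl sum.swap)
    finally show ?thesis unfolding f .
  qed
  have "(\<Sum>n\<in>X. weight l n * (real (card {h\<in>H. prime (n + h)}) - 2 - real (card H) * (\<Sum>p\<in>Z. \<Sum>h\<in>H. of_bool (p dvd n + h))))
     \<le> (\<Sum>n\<in>X. weight l n * (real (card H) * of_bool ((\<forall>p\<in>Z. \<forall>h\<in>H. \<not> p dvd n + h) \<and> 3 \<le> card {h\<in>H. prime (n + h)})))"
    by (intro sum_mono mult_left_mono three_primes_pointwise[OF H Z] weight_nonneg)
  also have "\<dots> = real (card H) * (\<Sum>n\<in>X. weight l n * of_bool ((\<forall>p\<in>Z. \<forall>h\<in>H. \<not> p dvd n + h) \<and> 3 \<le> card {h\<in>H. prime (n + h)}))"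
    unfolding sum_distrib_left by (intro sum.cong refl) (simp only: mult.left_commute)
  also have "(\<Sum>n\<in>X. weight l n * of_bool ((\<forall>p\<in>Z. \<forall>h\<in>H. \<not> p dvd n + h) \<and> 3 \<le> card {h\<in>H. prime (n + h)}))
      = (\<Sum>n | n \<in> X \<and> (\<forall>p\<in>Z. \<forall>h\<in>H. \<not> p dvd n + h) \<and> 3 \<le> card {h\<in>H. prime (n + h)}. weight l n)" by (rule f)
  also have "(\<Sum>n\<in>X. weight l n * (real (card {h\<in>H. prime (n + h)}) - 2 - real (card H) * (\<Sum>p\<in>Z. \<Sum>h\<in>H. of_bool (p dvd n + h))))
     = (\<Sum>n\<in>X. weight l n * real (card {h\<in>H. prime (n + h)})) - 2 * (\<Sum>n\<in>X. weight l n)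
      - real (card H) * (\<Sum>n\<in>X. weight l n * (\<Sum>p\<in>Z. \<Sum>h\<in>H. of_bool (p dvd n + h)))"
    by (simp only: right_diff_distrib sum_subtractf sum_distrib_left mult.left_commute mult.commute[of _ 2])
  finally show ?thesis unfolding 1 2 .
qed

end

section \<open>The weighted lower bound for three primes\<close>

context maynard_weights
begin

text \<open>With \<open>B = N / W * GG ^ k\<close> the balance is \<open>4 - 1/4\<close> from the
  primes, \<open>2\<close> for the total weight, \<open>1/2\<close> for small prime factors and
  \<open>1/4\<close> for the remaining errors, which leaves exactly \<open>B\<close>. The 1024 is
  this 4 times the 256 of \<open>form_P2_y_ge\<close>.\<close>

theorem sum_weight_three_primes:
  fixes N :: nat and z E2 E1 :: real
  assumes k: "k = card H" "k \<ge> 1" and W2: "W \<ge> 2" and Wh: "\<And>h. h \<in> H \<Longrightarrow> W dvd h \<and> h \<le> N" and N: "N \<ge> 1" "exp L \<le> real N"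
    and mu: "(\<Sum>m\<in>cops W (exp L). (g (real m))\<^sup>2 / real m * (ln (real m) / L)) \<le> \<mu> * GG" "2 * real k * \<mu> \<le> 1 / 4"
    and sig: "real k * (\<Sum>p\<in>PR - PP. 1 / real p) \<le> 1 / 20" and D: "D \<ge> 35 * k\<^sup>2"
    and main: "real k * L0\<^sup>2 * real W \<ge> 1024 * real (totient W) * GG * ln (3 * real N)"
    and loss: "(real k)\<^sup>2 * (\<Sum>p | p \<in> PP \<and> real p \<le> z. 1 / real p * ((1 + A) * (ln (real p) / L) + real k / real p)\<^sup>2) \<le> 1 / 2"
    and E2: "\<And>h0. h0 \<in> H \<Longrightarrow> (\<Sum>d\<in>Om. \<Sum>e\<in>Om. \<bar>lam y d\<bar> * \<bar>lam y e\<bar> * (if compat d e then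
        EH_error (2 * N + h0) (W * siz (join d e)) + EH_error (N + h0) (W * siz (join d e)) else 0)) \<le> E2"
    and E2': "real k * E2 \<le> real N / (4 * real W)"
    and E1: "(\<Sum>d\<in>Om. \<bar>lam y d\<bar>)\<^sup>2 \<le> E1" and E1': "(2 + (real k)\<^sup>2 * z) * E1 \<le> real N / (4 * real W)" and z: "z \<ge> 0"
    and N3: "ln (3 * real N) \<ge> 1"
  shows "real k * (\<Sum>n | (n \<in> {N<..2*N} \<and> [n = 1] (mod W)) \<and> (\<forall>p\<in>{p. p \<in> PP \<and> real p \<le> z}. \<forall>h\<in>H. \<not> p dvd n + h)
      \<and> 3 \<le> card {h\<in>H. prime (n + h)}. weight (lam y) n) \<ge> real N / real W * GG ^ k"
proof -
  define X where "X = {n. n \<in> {N<..2*N} \<and> [n = 1] (mod W)}"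
  define Z where "Z = {p. p \<in> PP \<and> real p \<le> z}"
  define w where "w = weight (lam y)"
  have fX: "finite X" by (simp add: X_def)
  have fZ: "finite Z" using finite_PP by (simp add: Z_def)
  have Hne: "H \<noteq> {}" using k by auto
  have w0: "w n \<ge> 0" for n by (simp add: w_def weight_nonneg)
  have l3: "ln (3 * real N) > 0" using N3 by simp
  have G1: "GG \<ge> 1"
  proof -
    have "1 \<in> cops W (exp L)" using L_pos by (simp add: cops_def)
    hence "(g (real 1))\<^sup>2 / real 1 \<le> GG" unfolding GG_def
      by (rule member_le_sum[of 1 _ "\<lambda>m. (g (real m))\<^sup>2 / real m"]) auto
    thus ?thesis by (simp add: g_def)
  qed
  have Gk: "GG ^ k \<ge> 1" using G1 by simp
  define B where "B = real N / real W * GG ^ k"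
  have Wp: "real W > 0" using W2 by simp
  have NB: "real N / (4 * real W) \<le> B / 4"
  proof -
    have "real N / (4 * real W) = real N / real W * 1 / 4" by simp
    also have "\<dots> \<le> real N / real W * GG ^ k / 4" using Gk by (intro divide_right_mono mult_left_mono) auto
    finally show ?thesis by (simp add: B_def)
  qed
  have S1: "(\<Sum>n\<in>X. w n) \<le> B + E1"
  proof -
    have "\<bar>(\<Sum>n\<in>X. w n) - real N / real W * form P1 (lam y)\<bar> \<le> (\<Sum>d\<in>Om. \<bar>lam y d\<bar>)\<^sup>2"
      unfolding X_def w_def using W2 by (intro sum_weight_approx coprime_W) auto
    moreover have "real N / real W * form P1 (lam y) \<le> B" unfolding B_def k(1)
      by (intro mult_left_mono form_P1_y_le) auto
    ultimately show ?thesis using E1 by linarith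
  qed
  have S1c: "(\<Sum>n | n \<in> X \<and> p dvd n + h. w n) \<le> B * (1 / real p * ((1 + A) * (ln (real p) / L) + real k / real p)\<^sup>2) + E1"
    if "p \<in> Z" "h \<in> H" for p h
  proof -
    have p: "p \<in> PP" using that by (simp add: Z_def)
    have "{n. n \<in> X \<and> p dvd n + h} = {n. n \<in> {N<..2*N} \<and> [n = 1] (mod W) \<and> p dvd n + h}" by (auto simp: X_def)
    hence "\<bar>(\<Sum>n | n \<in> X \<and> p dvd n + h. w n) - real N / real W * form (P1c p h) (lam y)\<bar> \<le> (\<Sum>d\<in>Om. \<bar>lam y d\<bar>)\<^sup>2"
      unfolding w_def using W2 p that(2) by (simp only:) (intro sum_weight_dvd_approx coprime_W, auto)
    moreover have "real N / real W * form (P1c p h) (lam y)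
        \<le> real N / real W * (1 / real p * ((1 + A) * (ln (real p) / L) + real (card H) / real p)\<^sup>2 * GG ^ card H)"
      by (intro mult_left_mono form_P1c_y_le p that(2)) auto
    ultimately show ?thesis using E1 unfolding B_def k(1) by (simp add: mult_ac)
  qed
  have S2: "(\<Sum>n | n \<in> X \<and> prime (n + h). w n) \<ge> (real N / real (totient W) * (L0\<^sup>2 * GG ^ (k - 1) / 256) - E2) / ln (3 * real N)"
    if h: "h \<in> H" for h
  proof -
    have hh: "W dvd h" "h \<le> N" using Wh[OF h] by auto
    have e: "{n. n \<in> X \<and> prime (n + h)} = {n. n \<in> {N<..2*N} \<and> [n = 1] (mod W) \<and> prime (n + h)}" by (auto simp: X_def)
    have cop: "coprime (1 + h) W"
      using hh(1) by (metis coprime_1_left coprime_commute dvdE gcd_add_mult add.commute coprime_iff_gcd_eq_1 mult.commute)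
    have "\<bar>(\<Sum>n | n \<in> X \<and> prime (n + h). ln (real (n + h)) * w n) - real N / real (totient W) * form (P2 h) (lam y)\<bar> \<le> E2"
      unfolding e w_def
    proof (rule order.trans[OF sum_weight_prime_approx[OF coprime_W _ h cop] E2[OF h]])
      fix p assume "p \<in> PP"
      hence "real p \<le> real N" using PP_range[of p] N(2) by linarith
      thus "p \<le> N" by simp
    qed (use W2 in auto)
    moreover have "real N / real (totient W) * (L0\<^sup>2 * GG ^ (k - 1) / 256) \<le> real N / real (totient W) * form (P2 h) (lam y)"
      by (intro mult_left_mono form_P2_y_ge[OF h k(1) mu sig D]) auto
    ultimately have "real N / real (totient W) * (L0\<^sup>2 * GG ^ (k - 1) / 256) - E2 \<le> (\<Sum>n | n \<in> X \<and> prime (n + h). ln (real (n + h)) * w n)"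
      by linarith
    also have "\<dots> \<le> (\<Sum>n | n \<in> X \<and> prime (n + h). ln (3 * real N) * w n)"
    proof (intro sum_mono mult_right_mono w0)
      fix n assume n: "n \<in> {n. n \<in> X \<and> prime (n + h)}"
      hence "real (n + h) \<le> 3 * real N" "real (n + h) > 0" using hh(2) by (auto simp: X_def)
      thus "ln (real (n + h)) \<le> ln (3 * real N)" by (intro ln_mono)
    qed
    also have "\<dots> = ln (3 * real N) * (\<Sum>n | n \<in> X \<and> prime (n + h). w n)" by (simp add: sum_distrib_left)
    finally show ?thesis using l3 by (simp add: divide_le_eq mult.commute)
  qed
  have tot: "real (totient W) > 0" using W2 by simp
  have S2sum: "(\<Sum>h\<in>H. \<Sum>n | n \<in> X \<and> prime (n + h). w n) \<ge> 4 * B - B / 4"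
  proof -
    have "4 * B - B / 4 \<le> real k * ((real N / real (totient W) * (L0\<^sup>2 * GG ^ (k - 1) / 256) - E2) / ln (3 * real N))"
    proof -
      have Gkk: "GG ^ k = GG * GG ^ (k - 1)" using k(2) by (cases k) auto
      have "4 * B * ln (3 * real N) \<le> real k * (real N / real (totient W) * (L0\<^sup>2 * GG ^ (k - 1) / 256))"
      proof -
        have "1024 * real (totient W) * GG * ln (3 * real N) * (real N * GG ^ (k - 1)) \<le> real k * L0\<^sup>2 * real W * (real N * GG ^ (k - 1))"
          using main G1 by (intro mult_right_mono) auto
        thus ?thesis unfolding B_def Gkk using tot Wp by (simp add: field_simps)
      qed
      moreover have "real k * E2 \<le> B / 4 * ln (3 * real N)"
      proof -
        have "B / 4 * 1 \<le> B / 4 * ln (3 * real N)" using N3 Gk by (intro mult_left_mono) (auto simp: B_def)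
        thus ?thesis using E2' NB by linarith
      qed
      ultimately have "(4 * B - B / 4) * ln (3 * real N) \<le> real k * (real N / real (totient W) * (L0\<^sup>2 * GG ^ (k - 1) / 256) - E2)"
        by (simp add: algebra_simps)
      thus ?thesis using l3 by (simp add: pos_le_divide_eq)
    qed
    also have "\<dots> = (\<Sum>h\<in>H. (real N / real (totient W) * (L0\<^sup>2 * GG ^ (k - 1) / 256) - E2) / ln (3 * real N))" by (simp add: k(1))
    also have "\<dots> \<le> (\<Sum>h\<in>H. \<Sum>n | n \<in> X \<and> prime (n + h). w n)" by (intro sum_mono S2)
    finally show ?thesis .
  qed
  have E10: "E1 \<ge> 0" using E1 by (meson order_trans zero_le_power2)
  have loss': "real k * (\<Sum>p\<in>Z. \<Sum>h\<in>H. \<Sum>n | n \<in> X \<and> p dvd n + h. w n) \<le> B / 2 + (real k)\<^sup>2 * z * E1"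
  proof -
    define K where "K p = 1 / real p * ((1 + A) * (ln (real p) / L) + real k / real p)\<^sup>2" for p :: nat
    have "(\<Sum>p\<in>Z. \<Sum>h\<in>H. \<Sum>n | n \<in> X \<and> p dvd n + h. w n) \<le> (\<Sum>p\<in>Z. \<Sum>h\<in>H. B * K p + E1)"
      unfolding K_def by (intro sum_mono S1c)
    also have "\<dots> = real k * (B * (\<Sum>p\<in>Z. K p) + real (card Z) * E1)"
      by (simp add: k(1) sum.distrib sum_distrib_left distrib_left mult_ac)
    finally have "real k * (\<Sum>p\<in>Z. \<Sum>h\<in>H. \<Sum>n | n \<in> X \<and> p dvd n + h. w n) \<le> real k * (real k * (B * (\<Sum>p\<in>Z. K p) + real (card Z) * E1))"
      by (intro mult_left_mono) auto
    also have "\<dots> = B * ((real k)\<^sup>2 * (\<Sum>p\<in>Z. K p)) + (real k)\<^sup>2 * (real (card Z) * E1)"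
      by (simp add: algebra_simps power2_eq_square)
    also have "\<dots> \<le> B * (1 / 2) + (real k)\<^sup>2 * (z * E1)"
    proof (intro add_mono mult_left_mono mult_right_mono)
      show "(real k)\<^sup>2 * (\<Sum>p\<in>Z. K p) \<le> 1 / 2" using loss by (simp add: Z_def K_def)
      have "Z \<subseteq> {1..nat \<lfloor>z\<rfloor>}" using prime_gt_0_nat[OF prime_PP] by (auto simp: Z_def le_nat_floor Suc_le_eq)
      hence "card Z \<le> nat \<lfloor>z\<rfloor>" using card_mono[of "{1..nat \<lfloor>z\<rfloor>}" Z] by simp
      thus "real (card Z) \<le> z" using z by linarith
    qed (use E10 Gk in \<open>auto simp: B_def\<close>)
    finally show ?thesis by simp
  qed
  have "real k * (\<Sum>n | n \<in> X \<and> (\<forall>p\<in>Z. \<forall>h\<in>H. \<not> p dvd n + h) \<and> 3 \<le> card {h\<in>H. prime (n + h)}. w n)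
     \<ge> (\<Sum>h\<in>H. \<Sum>n | n \<in> X \<and> prime (n + h). w n) - 2 * (\<Sum>n\<in>X. w n) - real k * (\<Sum>p\<in>Z. \<Sum>h\<in>H. \<Sum>n | n \<in> X \<and> p dvd n + h. w n)"
    using three_primes_weighted[OF Hne fZ fX, of "lam y"] unfolding w_def k(1) .
  moreover have "2 * E1 + (real k)\<^sup>2 * z * E1 \<le> B / 4" using E1' NB by (simp add: algebra_simps)
  moreover have "B \<ge> 0" using Gk by (simp add: B_def)
  ultimately have "B \<le> real k * (\<Sum>n | n \<in> X \<and> (\<forall>p\<in>Z. \<forall>h\<in>H. \<not> p dvd n + h) \<and> 3 \<le> card {h\<in>H. prime (n + h)}. w n)"
    using S1 S2sum loss' by linarith
  thus ?thesis unfolding B_def X_def Z_def w_def by simp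
qed

end

subsection \<open>Rough integers with three primes in a tuple\<close>

text \<open>Modulo these primes two shifts coincide, so they have to be left out of the sieve for
  \<open>H\<close>.\<close>

definition badp :: "nat \<Rightarrow> nat set \<Rightarrow> nat set" where
  "badp D H = {p. prime p \<and> D < p \<and> (\<exists>h\<in>H. \<exists>h'\<in>H. h < h' \<and> p dvd h' - h)}"

definition rough :: "nat \<Rightarrow> real \<Rightarrow> nat set \<Rightarrow> nat \<Rightarrow> bool" where
  "rough D z H n \<longleftrightarrow> (\<forall>p. prime p \<longrightarrow> D < p \<longrightarrow> real p \<le> z \<longrightarrow> p \<notin> badp D H \<longrightarrow> (\<forall>h\<in>H. \<not> p dvd n + h))"

definition primorial :: "nat \<Rightarrow> nat" where "primorial D = \<Prod>{p. prime p \<and> p \<le> D}"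

lemma finite_primes_le [simp]: "finite {p::nat. prime p \<and> p \<le> D}"
  by (rule finite_subset[of _ "{..D}"]) auto

lemma primorial_pos: "primorial D \<ge> 1"
  unfolding primorial_def using prime_gt_0_nat by (intro prod_ge_1) (auto simp: Suc_le_eq)

lemma primorial_ge_2: "D \<ge> 2 \<Longrightarrow> primorial D \<ge> 2"
proof -
  assume "D \<ge> 2"
  hence "2 dvd primorial D" unfolding primorial_def by (intro dvd_prodI) auto
  thus ?thesis using primorial_pos[of D] by (intro dvd_imp_le) auto
qed

lemma dvd_primorial: "prime p \<Longrightarrow> p \<le> D \<Longrightarrow> p dvd primorial D"
  unfolding primorial_def by (intro dvd_prodI) auto

lemma coprime_primorial: "prime p \<Longrightarrow> D < p \<Longrightarrow> coprime p (primorial D)"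
  unfolding primorial_def by (intro prod_coprime_right) (auto intro!: primes_coprime)

lemma tuple_sieve_badp:
  assumes H: "finite H" and D: "10 * (card H + 1) \<le> D"
  shows "tuple_sieve ({p. prime p \<and> D < p \<and> real p \<le> x} - badp D H) H"
proof
  show "finite ({p. prime p \<and> D < p \<and> real p \<le> x} - badp D H)"
    by (rule finite_subset[of _ "{..nat \<lfloor>x\<rfloor>}"]) (auto simp: le_nat_floor)
  have *: False if "p \<in> {p. prime p \<and> D < p \<and> real p \<le> x} - badp D H" "h \<in> H" "h' \<in> H" "[h = h'] (mod p)" "h < h'" for p h h'
  proof -
    have "p dvd h' - h" using that(4,5) by (metis cong_sym cong_altdef_nat less_imp_le)
    thus False using that by (auto simp: badp_def)
  qed
  fix p h h' assume p: "p \<in> {p. prime p \<and> D < p \<and> real p \<le> x} - badp D H" "h \<in> H" "h' \<in> H" "[h = h'] (mod p)"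
  show "h = h'" using *[of p h h'] *[of p h' h] p by (metis cong_sym linorder_neqE_nat)
qed (use H D in auto)

text \<open>The bound \<open>(u + v)^2 \<le> 2 * u^2 + 2 * v^2\<close> separates the two terms. In
  the first, one logarithm is bounded by \<open>ln z\<close> and the other is summed by Chebyshev's
  estimate, so the result is quadratic in \<open>ln z / L\<close>.\<close>

lemma sum_loss_le:
  assumes PP: "finite PP" "\<And>p. p \<in> PP \<Longrightarrow> prime p \<and> D < p" and D: "D \<ge> 1" and z: "z \<ge> 1" and L: "L > 0" and a: "a \<ge> 0"
  shows "(\<Sum>p | p \<in> PP \<and> real p \<le> z. 1 / real p * (a * (ln (real p) / L) + b / real p)\<^sup>2) \<le> 4 * a\<^sup>2 * (ln z / L)\<^sup>2 + 2 * b\<^sup>2 / (real D)\<^sup>2"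
proof -
  define Z where "Z = {p. p \<in> PP \<and> real p \<le> z}"
  have fZ: "finite Z" using PP by (simp add: Z_def)
  define n where "n = nat \<lfloor>z\<rfloor>"
  have n: "n \<ge> 1" "real n \<le> z" using z by (auto simp: n_def le_nat_floor)
  have Zp: "p \<ge> 1" "D < p" "real p \<le> z" "prime p" if "p \<in> Z" for p using that PP(2) prime_ge_1_nat by (auto simp: Z_def)
  have lz: "ln z \<ge> 0" using z by simp
  have "(\<Sum>p\<in>Z. 1 / real p * (a * (ln (real p) / L) + b / real p)\<^sup>2)
      \<le> (\<Sum>p\<in>Z. 2 * a\<^sup>2 / L\<^sup>2 * ln z * (ln (real p) / real p) + 2 * b\<^sup>2 / real D * (1 / (real p)\<^sup>2))"
  proof (rule sum_mono)
    fix p assume p: "p \<in> Z"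
    have rp: "real p \<ge> 1" using Zp(1)[OF p] by simp
    have lp: "ln (real p) \<ge> 0" "ln (real p) \<le> ln z" using rp Zp(3)[OF p] by auto
    have "(u + v)\<^sup>2 \<le> 2 * u\<^sup>2 + 2 * v\<^sup>2" for u v :: real
      using zero_le_power2[of "u - v"] by (simp add: power2_eq_square algebra_simps)
    hence "1 / real p * (a * (ln (real p) / L) + b / real p)\<^sup>2 \<le> 1 / real p * (2 * (a * (ln (real p) / L))\<^sup>2 + 2 * (b / real p)\<^sup>2)"
      by (intro mult_left_mono) auto
    also have "\<dots> = 2 * a\<^sup>2 / L\<^sup>2 * ln (real p) * (ln (real p) / real p) + 2 * b\<^sup>2 / real p * (1 / (real p)\<^sup>2)"
      by (simp add: power2_eq_square distrib_left mult_ac)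
    also have "\<dots> \<le> 2 * a\<^sup>2 / L\<^sup>2 * ln z * (ln (real p) / real p) + 2 * b\<^sup>2 / real D * (1 / (real p)\<^sup>2)"
    proof (intro add_mono mult_right_mono mult_left_mono)
      show "2 * b\<^sup>2 / real p \<le> 2 * b\<^sup>2 / real D" using Zp(2)[OF p] D by (intro divide_left_mono) auto
    qed (use lp rp in auto)
    finally show "1 / real p * (a * (ln (real p) / L) + b / real p)\<^sup>2
      \<le> 2 * a\<^sup>2 / L\<^sup>2 * ln z * (ln (real p) / real p) + 2 * b\<^sup>2 / real D * (1 / (real p)\<^sup>2)" .
  qed
  also have "\<dots> = 2 * a\<^sup>2 / L\<^sup>2 * ln z * (\<Sum>p\<in>Z. ln (real p) / real p) + 2 * b\<^sup>2 / real D * (\<Sum>p\<in>Z. 1 / (real p)\<^sup>2)"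
    by (simp only: sum.distrib sum_distrib_left)
  also have "\<dots> \<le> 2 * a\<^sup>2 / L\<^sup>2 * ln z * (2 * ln z) + 2 * b\<^sup>2 / real D * (1 / real D)"
  proof (intro add_mono mult_left_mono)
    have "(\<Sum>p\<in>Z. ln (real p) / real p) \<le> (\<Sum>p | prime p \<and> p \<le> n. ln (real p) / real p)"
    proof (rule sum_mono2)
      show "0 \<le> ln (real b) / real b" for b :: nat by (cases b) auto
    qed (use Zp in \<open>auto simp: n_def le_nat_floor\<close>)
    also have "\<dots> \<le> 2 * ln (real n)" by (rule sum_ln_div_primes_le[OF n(1)])
    also have "\<dots> \<le> 2 * ln z" using n by simp
    finally show "(\<Sum>p\<in>Z. ln (real p) / real p) \<le> 2 * ln z" .
    show "(\<Sum>p\<in>Z. 1 / (real p)\<^sup>2) \<le> 1 / real D" using fZ Zp(2) D by (intro sum_inverse_squares_le) auto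
  qed (use lz in auto)
  finally show ?thesis unfolding Z_def by (simp add: power2_eq_square mult_ac)
qed

text \<open>The weighted bound is divided by the largest weight of a rough \<open>n\<close>:
  \<open>GG ^ k\<close> is at least of order \<open>l ^ k\<close> and that weight at most of order
  \<open>l ^ (2 * k)\<close>, which leaves \<open>N / l ^ k\<close>. Condition \<open>c1\<close>
  controls the mean size penalty, \<open>c2\<close> the ratio of prime mass to total mass.\<close>

lemma maynard_finite:
  fixes A :: real and k D N q :: nat
  assumes A: "A > 0" and k: "k \<ge> 1" and c1: "24 * real k * (1 + A) * ln (1 + A) \<le> A\<^sup>2"
    and c2: "98304 * A\<^sup>2 \<le> real k * (1 + A) * (ln (1 + A / 4))\<^sup>2"
    and D: "D \<ge> 35 * k\<^sup>2" "D \<ge> 10 * (k + 1)" and W: "W = primorial D" and \<kappa>: "\<kappa> = real (totient W) / real W"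
    and \<xi>: "\<xi> = 1 / (32 * real k * (1 + A))" and q: "real q * \<xi> \<ge> 2"
    and EH: "\<And>N' PP Q. N' \<ge> N \<Longrightarrow> finite PP \<Longrightarrow> (\<And>p. p \<in> PP \<Longrightarrow> prime p) \<Longrightarrow>
     (\<And>p. p \<in> PP \<Longrightarrow> coprime p W) \<Longrightarrow> 1 \<le> Q \<Longrightarrow> real W * Q \<le> real N' powr (1/2) \<Longrightarrow>
     (\<Sum>B\<in>prime_sets PP Q. real ((k + 1)\<^sup>2) ^ card B * EH_error N' (W * \<Prod>B)) \<le> C * real N' / ln (real N') powr (2 * real k + 1)" and C: "C > 0"
    and l: "l = ln (real N)" "l \<ge> 24"
    and N1: "real W + 2 \<le> 1 / 2 * (\<kappa> * (l / 8 / (1 + A)))" "real W + 2 \<le> 1 / 2 * (\<kappa> * (l / 8 / A * ln (1 + A / 4)))"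
    and N2: "real W * real N powr (1/4) \<le> real N powr (1/2)" and N3: "l \<ge> 20 * real k * C * real W"
    and N4: "4 * real W * (2 + (real k)\<^sup>2) * l ^ (4 * k) \<le> real N powr (1/2)"
    and H: "finite H" "card H = k" "\<And>h. h \<in> H \<Longrightarrow> W dvd h \<and> real h \<le> l" "real k * (\<Sum>p\<in>badp D H. 1 / real p) \<le> 1 / 20"
  shows "real (card {n\<in>{N<..2*N}. [n = 1] (mod W) \<and> rough D (real N powr \<xi>) H n \<and> 3 \<le> card {h\<in>H. prime (n + h)}})
     \<ge> (\<kappa> / (8 * (1 + A))) ^ k / (real k * real W * (2 ^ (q * k))\<^sup>2) * real N / l ^ k"
proof -
  \<comment> \<open>The sieve level is \<open>N powr (1/8)\<close>, so the moduli
    \<open>W * siz (join d e)\<close> are at most \<open>W * N powr (1/4)\<close>, within the range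
    of \<open>EH\<close> by \<open>N2\<close>.\<close>
  define L where "L = l / 8"
  have L3: "L \<ge> 3" using l by (simp add: L_def)
  have Npos: "N > 0" using l by (cases N) auto
  have Nl: "real N = exp l" using Npos l by simp
  have lN: "l \<le> real N" unfolding Nl using exp_ge_add_one_self[of l] by linarith
  define z where "z = real N powr \<xi>"
  have k0: "real k \<ge> 1" using k by simp
  have \<xi>0: "\<xi> > 0" unfolding \<xi> using A k0 by simp
  have \<xi>32: "\<xi> \<le> 1 / 32"
  proof -
    have "1 * 1 \<le> real k * (1 + A)" using k0 A by (intro mult_mono) auto
    thus ?thesis unfolding \<xi> by (intro divide_left_mono) auto
  qed
  have zexp: "z = exp (\<xi> * l)" using Npos l by (simp add: z_def powr_def)
  have z1: "z > 1" unfolding zexp using \<xi>0 l by simp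
  have lnz: "ln z = \<xi> * l" by (simp add: zexp)
  define PP where "PP = {p. prime p \<and> D < p \<and> real p \<le> exp L} - badp D H"
  have D20: "D \<ge> 20" using D(2) k by simp
  have W2: "W \<ge> 2" unfolding W using primorial_ge_2 D20 by simp
  have ts: "tuple_sieve PP H" unfolding PP_def using H D by (intro tuple_sieve_badp) auto
  interpret maynard_weights PP H L A W D
  proof (intro maynard_weights.intro[OF ts] maynard_weights_axioms.intro)
    show "L > 0" "A > 0" "W \<ge> 1" "D \<ge> 1" using L3 A W2 D20 by auto
    show "coprime p W" if "p \<in> PP" for p using that coprime_primorial by (auto simp: PP_def W)
    show "p dvd W" if "prime p" "p \<le> D" for p using that dvd_primorial by (simp add: W)
    show "D < p \<and> real p \<le> exp L" if "p \<in> PP" for p using that by (auto simp: PP_def)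
  qed
  have \<kappa>0: "\<kappa> > 0" unfolding \<kappa> using W2 by simp
  have \<kappa>W: "\<kappa> * real W = real (totient W)" unfolding \<kappa> using W2 by simp
  define l4 where "l4 = ln (1 + A / 4)"
  have l40: "l4 > 0" using A by (simp add: l4_def)
  define l1 where "l1 = ln (1 + A)"
  have l1: "l4 \<le> l1" "l1 > 0" using A by (auto simp: l4_def l1_def)
  have n1: "real W + 2 \<le> 1 / 2 * (\<kappa> * (L / (1 + A)))" using N1(1) by (simp add: L_def)
  have n2: "real W + 2 \<le> 1 / 2 * (\<kappa> * (L / A * l4))" using N1(2) by (simp add: L_def l4_def)
  have lin: "1 / 2 * u \<le> x \<and> x \<le> 3 / 2 * u" if "\<bar>x - u\<bar> \<le> w" "w \<le> 1 / 2 * u" for x u w :: real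
    using that by auto
  have G: "GG \<ge> 1 / 2 * (\<kappa> * (L / (1 + A)))" "GG \<le> 3 / 2 * (\<kappa> * (L / (1 + A)))"
    using lin[OF GG_approx[folded \<kappa>] n1] by blast+
  have "\<bar>L0 - \<kappa> * (L / A * l4)\<bar> \<le> real W + 2"
    using sum_g_approx[of "1 / 4"] unfolding \<kappa>[symmetric] L0_def l4_def by simp
  hence L0: "L0 \<ge> 1 / 2 * (\<kappa> * (L / A * l4))" using lin[OF _ n2] by blast
  have "\<bar>(\<Sum>m\<in>cops W (exp L). g (real m) / real m) - \<kappa> * (L / A * l1)\<bar> \<le> real W + 2"
    using sum_g_approx[of 1] unfolding \<kappa>[symmetric] l1_def by simp
  moreover have "\<kappa> * (L / A * l4) \<le> \<kappa> * (L / A * l1)" using \<kappa>0 L3 A l1 by (intro mult_left_mono) auto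
  hence "1 / 2 * (\<kappa> * (L / A * l4)) \<le> 1 / 2 * (\<kappa> * (L / A * l1))" by (rule mult_left_mono) simp
  hence "real W + 2 \<le> 1 / 2 * (\<kappa> * (L / A * l1))" by (rule order.trans[OF n2])
  ultimately have Sg: "(\<Sum>m\<in>cops W (exp L). g (real m) / real m) \<le> 3 / 2 * (\<kappa> * (L / A * l1))" using lin by blast
  define \<mu> where "\<mu> = 3 * (1 + A) * l1 / A\<^sup>2"
  have mu1: "(\<Sum>m\<in>cops W (exp L). (g (real m))\<^sup>2 / real m * (ln (real m) / L)) \<le> \<mu> * GG"
  proof -
    have "(\<Sum>m\<in>cops W (exp L). (g (real m))\<^sup>2 / real m * (ln (real m) / L)) \<le> (3 / 2 * (\<kappa> * (L / A * l1))) / A"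
      unfolding sum_g_ln using Sg GG_nonneg A by (intro divide_right_mono) auto
    also have "\<dots> = \<mu> * (1 / 2 * (\<kappa> * (L / (1 + A))))"
    proof -
      have "3 / 2 * (\<kappa> * (L / A * l1)) / A = 3 * B * l1 / A\<^sup>2 * (1 / 2 * (\<kappa> * (L / B)))" if "B \<noteq> 0" for B
        using that by (simp add: power2_eq_square mult_ac)
      from this[of "1 + A"] show ?thesis using A unfolding \<mu>_def by linarith
    qed
    also have "\<dots> \<le> \<mu> * GG" using G(1) A l1 by (intro mult_left_mono) (auto simp: \<mu>_def)
    finally show ?thesis .
  qed
  have mu2: "2 * real k * \<mu> \<le> 1 / 4"
  proof -
    have "2 * real k * \<mu> = (24 * real k * (1 + A) * l1) / A\<^sup>2 / 4" by (simp add: \<mu>_def)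
    also have "\<dots> \<le> 1 / 4" using c1 A by (simp add: l1_def divide_le_eq)
    finally show ?thesis .
  qed
  have fbad: "finite (badp D H)"
  proof (rule finite_subset)
    show "badp D H \<subseteq> {..Max H}"
    proof
      fix p assume "p \<in> badp D H"
      then obtain h h' where h: "h \<in> H" "h' \<in> H" "h < h'" "p dvd h' - h" by (auto simp: badp_def)
      hence "p \<le> h' - h" by (intro dvd_imp_le) auto
      moreover have "h' \<le> Max H" using h H by simp
      ultimately show "p \<in> {..Max H}" by simp
    qed
  qed simp
  have sig: "real k * (\<Sum>p\<in>PR - PP. 1 / real p) \<le> 1 / 20"
  proof -
    have "(\<Sum>p\<in>PR - PP. 1 / real p) \<le> (\<Sum>p\<in>badp D H. 1 / real p)"
      using fbad by (intro sum_mono2) (auto simp: PR_def PP_def)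
    hence "real k * (\<Sum>p\<in>PR - PP. 1 / real p) \<le> real k * (\<Sum>p\<in>badp D H. 1 / real p)" by (intro mult_left_mono) auto
    thus ?thesis using H(4) by linarith
  qed
  have ln3: "ln (3 * real N) = ln 3 + l" using Npos l by (simp add: ln_mult)
  have "ln (3::real) \<le> 3 - 1" by (rule ln_le_minus_one) simp
  hence ln3b1: "ln (3 * real N) \<le> 16 * L" unfolding ln3 L_def using l(2) by linarith
  have "0 \<le> ln (3::real)" by simp
  hence ln3b2: "ln (3 * real N) \<ge> 1" unfolding ln3 using l(2) by linarith
  note ln3b = ln3b1 ln3b2
  \<comment> \<open>Here \<open>24576 = 1024 * (3/2) * 16\<close> collects the upper bounds for
    \<open>GG\<close> and \<open>ln (3 * N)\<close>. The square of the factor \<open>1/2\<close> in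
    the lower bound for \<open>L0\<close> turns it into the \<open>98304\<close> of
    \<open>c2\<close>.\<close>
  have main: "real k * L0\<^sup>2 * real W \<ge> 1024 * real (totient W) * GG * ln (3 * real N)"
  proof -
    define t where "t = real (totient W)"
    have t0: "t > 0" using W2 by (simp add: t_def)
    have "1024 * t * GG * ln (3 * real N) \<le> 1024 * t * (3 / 2 * (\<kappa> * (L / (1 + A)))) * (16 * L)"
      using G(2) ln3b t0 GG_nonneg L3 \<kappa>0 A by (intro mult_mono) auto
    also have "\<dots> = 24576 * t * \<kappa> * L\<^sup>2 * (1 / (1 + A))"
    proof -
      have "1024 * t * (3 / 2 * (\<kappa> * (L / B))) * (16 * L) = 24576 * t * \<kappa> * L\<^sup>2 * (1 / B)" for B
        by (simp add: power2_eq_square)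
      thus ?thesis .
    qed
    also have "\<dots> \<le> 24576 * t * \<kappa> * L\<^sup>2 * (real k * l4\<^sup>2 / (98304 * A\<^sup>2))"
    proof (intro mult_left_mono)
      have "98304 * A\<^sup>2 \<le> real k * l4\<^sup>2 * (1 + A)" using c2 by (simp add: l4_def mult_ac)
      thus "1 / (1 + A) \<le> real k * l4\<^sup>2 / (98304 * A\<^sup>2)" using A by (simp add: divide_simps)
    qed (use t0 \<kappa>0 in auto)
    also have "\<dots> = real k * (1 / 2 * (\<kappa> * (L / A * l4)))\<^sup>2 * real W"
    proof -
      have "t = \<kappa> * real W" using \<kappa>W by (simp add: t_def)
      thus ?thesis by (simp add: power_mult_distrib power_divide power2_eq_square)
    qed
    also have "\<dots> \<le> real k * L0\<^sup>2 * real W"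
      using L0 \<kappa>0 L3 A l40 by (intro mult_right_mono mult_left_mono power_mono) auto
    finally show ?thesis by (simp add: t_def)
  qed
  \<comment> \<open>By the choice of \<open>\<xi>\<close> one has
    \<open>8 * \<xi> * (1 + A) = 1 / (4 * k)\<close>, so the logarithmic part is
    \<open>1 / (4 * k^2)\<close>; \<open>D \<ge> 35 * k^2\<close> gives the same bound for the other
    part.\<close>
  have loss: "(real k)\<^sup>2 * (\<Sum>p | p \<in> PP \<and> real p \<le> z. 1 / real p * ((1 + A) * (ln (real p) / L) + real k / real p)\<^sup>2) \<le> 1 / 2"
  proof -
    have "(\<Sum>p | p \<in> PP \<and> real p \<le> z. 1 / real p * ((1 + A) * (ln (real p) / L) + real k / real p)\<^sup>2)
       \<le> 4 * (1 + A)\<^sup>2 * (ln z / L)\<^sup>2 + 2 * (real k)\<^sup>2 / (real D)\<^sup>2"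
      using finite_PP z1 L3 A D20 by (intro sum_loss_le) (auto simp: PP_def)
    also have "ln z / L = 8 * \<xi>" using lnz l by (simp add: L_def)
    also have "4 * (1 + A)\<^sup>2 * (8 * \<xi>)\<^sup>2 = 1 / (4 * (real k)\<^sup>2)"
      unfolding \<xi> using A k0 by (simp add: power_mult_distrib power_divide)
    also have "2 * (real k)\<^sup>2 / (real D)\<^sup>2 \<le> 1 / (4 * (real k)\<^sup>2)"
    proof -
      have d: "35 * (real k)\<^sup>2 \<le> real D" using of_nat_mono[OF D(1), where ?'a = real] by simp
      have "(35 * (real k)\<^sup>2)\<^sup>2 \<le> (real D)\<^sup>2" using d by (intro power_mono) auto
      moreover have "8 * ((real k)\<^sup>2 * (real k)\<^sup>2) \<le> (35 * (real k)\<^sup>2)\<^sup>2"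
      proof -
        have "8 * (x * x) \<le> (35 * x)\<^sup>2" for x :: real by (simp add: power_mult_distrib power2_eq_square)
        thus ?thesis .
      qed
      ultimately have "8 * ((real k)\<^sup>2 * (real k)\<^sup>2) \<le> (real D)\<^sup>2" by linarith
      moreover have "(real D)\<^sup>2 > 0" "(real k)\<^sup>2 > 0" using D20 k0 by auto
      ultimately show ?thesis by (simp add: divide_simps mult_ac)
    qed
    finally have "(real k)\<^sup>2 * (\<Sum>p | p \<in> PP \<and> real p \<le> z. 1 / real p * ((1 + A) * (ln (real p) / L) + real k / real p)\<^sup>2)
       \<le> (real k)\<^sup>2 * (1 / (4 * (real k)\<^sup>2) + 1 / (4 * (real k)\<^sup>2))" by (intro mult_left_mono) auto
    also have "\<dots> = 1 / 2" using k0 by simp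
    finally show ?thesis .
  qed
  define Lam where "Lam = (L + 3) ^ k"
  have Lam0: "Lam \<ge> 0" using L3 by (simp add: Lam_def)
  have Ll: "L + 3 \<le> l" using l by (simp add: L_def)
  have lamb: "\<bar>lam y d\<bar> \<le> Lam" "lam y d \<noteq> 0 \<Longrightarrow> real (siz d) \<le> exp L" if "d \<in> Om" for d
    using lam_bounds[of y "exp L" d] y_bounds y_support that L3 H(2) by (auto simp: Lam_def)
  define E1 where "E1 = (Lam * exp L * (L + 3) ^ k)\<^sup>2"
  have E1: "(\<Sum>d\<in>Om. \<bar>lam y d\<bar>)\<^sup>2 \<le> E1" unfolding E1_def
  proof (rule power_mono)
    show "(\<Sum>d\<in>Om. \<bar>lam y d\<bar>) \<le> Lam * exp L * (L + 3) ^ k"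
      using sum_abs_lam_le[of "lam y" Lam "exp L"] lamb L3 H(2) by simp
  qed (auto intro: sum_nonneg)
  have R2: "(exp L)\<^sup>2 = real N powr (1/4)"
    using Npos l by (simp add: powr_def L_def power2_eq_square exp_add[symmetric])
  have E1b: "E1 \<le> real N powr (1/4) * l ^ (4 * k)"
  proof -
    have "E1 = (exp L)\<^sup>2 * (L + 3) ^ (4 * k)"
      unfolding E1_def Lam_def by (simp add: power_mult_distrib power_mult[symmetric] power_add[symmetric] mult_ac)
    also have "\<dots> \<le> real N powr (1/4) * l ^ (4 * k)" unfolding R2 using Ll L3 by (intro mult_left_mono power_mono) auto
    finally show ?thesis .
  qed
  have NW: "real N = real N powr (1/2) * real N powr (1/2)" using Npos by (simp add: powr_add[symmetric])
  have E1': "(2 + (real k)\<^sup>2 * z) * E1 \<le> real N / (4 * real W)"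
  proof -
    have N1': "real N \<ge> 1" using Npos by simp
    have z4: "z \<le> real N powr (1/4)" unfolding z_def using N1' \<xi>32 by (intro powr_mono) auto
    have o: "1 \<le> real N powr (1/4)" using N1' by (simp add: ge_one_powr_ge_zero)
    have "2 * 1 \<le> 2 * real N powr (1/4)" using o by (intro mult_left_mono) auto
    moreover have "(real k)\<^sup>2 * z \<le> (real k)\<^sup>2 * real N powr (1/4)" using z4 by (intro mult_left_mono) auto
    ultimately have a: "2 + (real k)\<^sup>2 * z \<le> (2 + (real k)\<^sup>2) * real N powr (1/4)" by (simp add: distrib_right)
    have "(2 + (real k)\<^sup>2 * z) * E1 \<le> ((2 + (real k)\<^sup>2) * real N powr (1/4)) * (real N powr (1/4) * l ^ (4 * k))"
      using a E1b z1 by (intro mult_mono) (auto simp: E1_def)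
    also have "\<dots> = (2 + (real k)\<^sup>2) * l ^ (4 * k) * (real N powr (1/4) * real N powr (1/4))" by (simp only: mult_ac)
    also have "real N powr (1/4) * real N powr (1/4) = real N powr (1/2)" by (simp add: powr_add[symmetric])
    finally have b: "(2 + (real k)\<^sup>2 * z) * E1 \<le> (2 + (real k)\<^sup>2) * l ^ (4 * k) * real N powr (1/2)" .
    have "(2 + (real k)\<^sup>2 * z) * E1 * (4 * real W) \<le> (2 + (real k)\<^sup>2) * l ^ (4 * k) * real N powr (1/2) * (4 * real W)"
      using b by (intro mult_right_mono) auto
    also have "\<dots> = (4 * real W * (2 + (real k)\<^sup>2) * l ^ (4 * k)) * real N powr (1/2)" by (simp only: mult_ac)
    also have "\<dots> \<le> real N powr (1/2) * real N powr (1/2)" using N4 by (intro mult_right_mono) auto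
    also have "\<dots> = real N" using NW by simp
    finally show ?thesis using W2 by (simp add: pos_le_divide_eq)
  qed
  \<comment> \<open>\<open>5 * N\<close> bounds \<open>(2 * N + h0) + (N + h0)\<close>. The exponent
    \<open>2 * k + 1\<close> still saves one logarithm after \<open>Lam^2 \<le> l ^ (2 * k)\<close>
    has been paid.\<close>
  define E2 where "E2 = Lam\<^sup>2 * (C * (5 * real N) / l powr (2 * real k + 1))"
  have E2: "(\<Sum>d\<in>Om. \<Sum>e\<in>Om. \<bar>lam y d\<bar> * \<bar>lam y e\<bar> * (if compat d e then
        EH_error (2 * N + h0) (W * siz (join d e)) + EH_error (N + h0) (W * siz (join d e)) else 0)) \<le> E2" if h0: "h0 \<in> H" for h0
  proof -
    define E where "E q = EH_error (2 * N + h0) (W * q) + EH_error (N + h0) (W * q)" for q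
    have E0: "E q \<ge> 0" if "q \<ge> 1" for q unfolding E_def using that W2 by (intro add_nonneg_nonneg EH_error_nonneg) auto
    have hN: "h0 \<le> N" using H(3)[OF h0] lN by simp
    have "(\<Sum>d\<in>Om. \<Sum>e\<in>Om. \<bar>lam y d\<bar> * \<bar>lam y e\<bar> * (if compat d e then E (siz (join d e)) else 0))
       \<le> Lam\<^sup>2 * (\<Sum>B\<in>prime_sets PP ((exp L)\<^sup>2). real ((card H + 1)\<^sup>2) ^ card B * E (\<Prod>B))"
      using lamb E0 by (intro pair_error_le) auto
    also have "\<dots> \<le> E2"
      unfolding E2_def
    proof (rule mult_left_mono)
      have b: "(\<Sum>B\<in>prime_sets PP ((exp L)\<^sup>2). real ((k + 1)\<^sup>2) ^ card B * EH_error N' (W * \<Prod>B)) \<le> C * real N' / l powr (2 * real k + 1)"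
        if N': "N' \<ge> N" for N'
      proof -
        have ll: "l \<le> ln (real N')" using N' Npos l by simp
        have "real N powr (1/2) \<le> real N' powr (1/2)" using N' by (intro powr_mono2) auto
        hence "real W * (exp L)\<^sup>2 \<le> real N' powr (1/2)" unfolding R2 using N2 by linarith
        hence "(\<Sum>B\<in>prime_sets PP ((exp L)\<^sup>2). real ((k + 1)\<^sup>2) ^ card B * EH_error N' (W * \<Prod>B)) \<le> C * real N' / ln (real N') powr (2 * real k + 1)"
          using N' finite_PP prime_PP coprime_W L3 by (intro EH) auto
        also have "\<dots> \<le> C * real N' / l powr (2 * real k + 1)"
        proof (rule divide_left_mono)
          show "l powr (2 * real k + 1) \<le> ln (real N') powr (2 * real k + 1)" using l ll by (intro powr_mono2) auto
        qed (use C l(2) ll in \<open>auto intro!: mult_pos_pos\<close>)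
        finally show ?thesis .
      qed
      have "(\<Sum>B\<in>prime_sets PP ((exp L)\<^sup>2). real ((card H + 1)\<^sup>2) ^ card B * E (\<Prod>B))
          \<le> C * real (2 * N + h0) / l powr (2 * real k + 1) + C * real (N + h0) / l powr (2 * real k + 1)"
        unfolding E_def distrib_left sum.distrib H(2) by (intro add_mono b) auto
      also have "\<dots> = C * (real (2 * N + h0) + real (N + h0)) / l powr (2 * real k + 1)"
        by (simp add: add_divide_distrib[symmetric] distrib_left)
      also have "\<dots> \<le> C * (5 * real N) / l powr (2 * real k + 1)"
        using hN C by (intro divide_right_mono mult_left_mono) auto
      finally show "(\<Sum>B\<in>prime_sets PP ((exp L)\<^sup>2). real ((card H + 1)\<^sup>2) ^ card B * E (\<Prod>B)) \<le> C * (5 * real N) / l powr (2 * real k + 1)" .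
    qed simp
    finally show ?thesis unfolding E_def .
  qed
  have E2': "real k * E2 \<le> real N / (4 * real W)"
  proof -
    have l0: "l > 0" using l by simp
    have "Lam\<^sup>2 \<le> l ^ (2 * k)"
      unfolding Lam_def power_mult[symmetric] using Ll L3 by (subst mult.commute) (intro power_mono, auto)
    moreover have lp: "l powr (2 * real k + 1) = l ^ (2 * k) * l"
      using l0 by (simp add: powr_add powr_realpow[symmetric])
    ultimately have "E2 \<le> l ^ (2 * k) * (C * (5 * real N) / (l ^ (2 * k) * l))"
      unfolding E2_def lp using C l0 by (intro mult_right_mono) auto
    also have "\<dots> = 5 * C * real N / l" using l0 by simp
    finally have "real k * E2 \<le> real k * (5 * C * real N / l)" by (intro mult_left_mono) auto
    also have "\<dots> \<le> real N / (4 * real W)"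
    proof -
      have "20 * real k * C * real W * real N \<le> l * real N" using N3 by (intro mult_right_mono) auto
      thus ?thesis using l0 W2 by (simp add: field_simps)
    qed
    finally show ?thesis .
  qed
  have expLN: "exp L \<le> real N" unfolding Nl using l by (simp add: L_def)
  define Xg where "Xg = {n\<in>{N<..2*N}. [n = 1] (mod W) \<and> rough D z H n \<and> 3 \<le> card {h\<in>H. prime (n + h)}}"
  have zL: "z \<le> exp L" unfolding zexp L_def using \<xi>32 l by simp
  have roughPP: "rough D z H n \<longleftrightarrow> (\<forall>p\<in>{p. p \<in> PP \<and> real p \<le> z}. \<forall>h\<in>H. \<not> p dvd n + h)" for n
    unfolding rough_def PP_def using zL by auto
  have "real N / real W * GG ^ k \<le> real k * (\<Sum>n | (n \<in> {N<..2*N} \<and> [n = 1] (mod W)) \<and> (\<forall>p\<in>{p. p \<in> PP \<and> real p \<le> z}. \<forall>h\<in>H. \<not> p dvd n + h)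
      \<and> 3 \<le> card {h\<in>H. prime (n + h)}. weight (lam y) n)"
  proof (rule sum_weight_three_primes)
    show "W dvd h \<and> h \<le> N" if "h \<in> H" for h
      using H(3)[OF that] lN by (metis of_nat_le_iff order_trans)
  qed (use H k W2 Npos expLN mu1 mu2 sig D main loss E2 E2' E1 E1' z1 ln3b in \<open>auto\<close>)
  also have "{n. (n \<in> {N<..2*N} \<and> [n = 1] (mod W)) \<and> (\<forall>p\<in>{p. p \<in> PP \<and> real p \<le> z}. \<forall>h\<in>H. \<not> p dvd n + h)
      \<and> 3 \<le> card {h\<in>H. prime (n + h)}} = Xg"
    unfolding Xg_def roughPP by auto
  also have "(\<Sum>n\<in>Xg. weight (lam y) n) \<le> (\<Sum>n\<in>Xg. (2 ^ (q * k) * Lam)\<^sup>2)"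
  proof (rule sum_mono)
    fix n assume n: "n \<in> Xg"
    show "weight (lam y) n \<le> (2 ^ (q * k) * Lam)\<^sup>2"
      unfolding H(2)[symmetric]
    proof (rule weight_rough_le[where z = z])
      show "z < real p" if "p \<in> PP" "h \<in> H" "p dvd n + h" for p h
        using that n unfolding Xg_def roughPP by (metis (no_types, lifting) linorder_not_less mem_Collect_eq)
      fix h assume h: "h \<in> H"
      have "real h \<le> real N" using H(3)[OF h] lN by linarith
      hence "real (n + h) \<le> 3 * real N" using n by (auto simp: Xg_def)
      \<comment> \<open>The crude bound \<open>N^2\<close> suffices, since
        \<open>q * \<xi> \<ge> 2\<close> makes \<open>z ^ q\<close> at least
        \<open>N^2\<close>.\<close>
      also have "\<dots> \<le> real N * real N"
      proof (rule mult_right_mono)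
        show "3 \<le> real N" using lN l by linarith
      qed simp
      also have "\<dots> = exp (2 * l)" unfolding Nl by (simp add: exp_add[symmetric])
      also have "\<dots> \<le> exp (real q * \<xi> * l)" using q l by simp
      also have "\<dots> = z ^ q" unfolding zexp by (simp add: exp_of_nat_mult[symmetric] mult.assoc)
      finally show "0 < n + h \<and> real (n + h) \<le> z ^ q" using n by (auto simp: Xg_def)
    qed (use lamb z1 Lam0 in auto)
  qed
  also have "(\<Sum>n\<in>Xg. (2 ^ (q * k) * Lam)\<^sup>2) = real (card Xg) * (2 ^ (q * k) * Lam)\<^sup>2" by simp
  finally have fin: "real N / real W * GG ^ k \<le> real k * (real (card Xg) * (2 ^ (q * k) * Lam)\<^sup>2)" using k0 by (simp add: mult_left_mono)
  have Gk: "GG ^ k \<ge> (\<kappa> / (8 * (1 + A))) ^ k * Lam\<^sup>2 / l ^ k"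
  proof -
    have "(\<kappa> / (8 * (1 + A))) ^ k * Lam\<^sup>2 / l ^ k \<le> (\<kappa> / (8 * (1 + A))) ^ k * ((2 * L) ^ k)\<^sup>2 / L ^ k"
    proof (intro frac_le mult_left_mono power_mono)
      show "Lam \<le> (2 * L) ^ k" unfolding Lam_def using L3 by (intro power_mono) auto
    qed (use Lam0 \<kappa>0 A L3 l in \<open>auto simp: L_def\<close>)
    also have "\<dots> = (1 / 2 * (\<kappa> * (L / (1 + A)))) ^ k"
    proof -
      have "((2 * L) ^ k)\<^sup>2 / L ^ k = (4 * L) ^ k" using L3
        by (simp add: power_mult_distrib power2_eq_square power_mult[symmetric] mult_ac)
           (metis (no_types, opaque_lifting) numeral_Bit0 numeral_code(1) mult_numeral_1 mult_2 power_mult_distrib num_double numeral_times_numeral)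
      hence "(\<kappa> / (8 * (1 + A))) ^ k * ((2 * L) ^ k)\<^sup>2 / L ^ k = (\<kappa> / (8 * (1 + A)) * (4 * L)) ^ k"
        by (simp only: times_divide_eq_right[symmetric] power_mult_distrib)
      also have "\<kappa> / (8 * (1 + A)) * (4 * L) = 1 / 2 * (\<kappa> * (L / (1 + A)))"
      proof -
        have "\<kappa> / (8 * B) * (4 * L) = 1 / 2 * (\<kappa> * (L / B))" for B by simp
        thus ?thesis .
      qed
      finally show ?thesis .
    qed
    also have "\<dots> \<le> GG ^ k" using G(1) \<kappa>0 L3 A by (intro power_mono) auto
    finally show ?thesis .
  qed
  have Lp: "Lam\<^sup>2 > 0" using L3 by (simp add: Lam_def)
  have "real N / real W * ((\<kappa> / (8 * (1 + A))) ^ k * Lam\<^sup>2 / l ^ k) \<le> real N / real W * GG ^ k"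
    using Gk by (intro mult_left_mono) auto
  also have "\<dots> \<le> real k * (real (card Xg) * (2 ^ (q * k) * Lam)\<^sup>2)" by (rule fin)
  finally have "(real N / real W * ((\<kappa> / (8 * (1 + A))) ^ k / l ^ k)) * Lam\<^sup>2 \<le> (real k * (real (card Xg) * (2 ^ (q * k))\<^sup>2)) * Lam\<^sup>2"
    by (simp add: power_mult_distrib mult_ac)
  hence "real N / real W * ((\<kappa> / (8 * (1 + A))) ^ k / l ^ k) \<le> real k * (real (card Xg) * (2 ^ (q * k))\<^sup>2)"
    using Lp by (simp only: mult_le_cancel_right_pos)
  moreover have "real k * (2 ^ (q * k))\<^sup>2 > (0::real)" using k0 by simp
  moreover have "X / (a * b) \<le> c" if "X \<le> a * (c * b)" "a * b > 0" for X a b c :: real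
    using that by (subst pos_divide_le_eq) (auto simp only: mult_ac)
  ultimately have "real N / real W * ((\<kappa> / (8 * (1 + A))) ^ k / l ^ k) / (real k * (2 ^ (q * k))\<^sup>2) \<le> real (card Xg)"
    by blast
  thus ?thesis unfolding Xg_def z_def by (simp add: mult_ac)
qed

subsection \<open>An upper bound for rough integers\<close>

lemma sum_times_of_bool:
  fixes a :: "'a \<Rightarrow> real"
  assumes "finite T"
  shows "(\<Sum>u\<in>T. a u * of_bool (Q u)) = (\<Sum>u | u \<in> T \<and> Q u. a u)"
proof -
  have "(\<Sum>u\<in>T. a u * of_bool (Q u)) = (\<Sum>u\<in>T. if Q u then a u else 0)" by (intro sum.cong) auto
  thus ?thesis using assms by (simp add: sum.inter_filter)
qed

text \<open>Coprimality to \<open>E\<close> is imposed one prime at a time, each costing at most a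
  factor \<open>1 - 1 / p\<close>. In contrast to \<open>sum_cops_approx\<close> for the modulus
  \<open>W * \<Prod>E\<close>, no error depends on \<open>E\<close>, so the bound is uniform over
  all tuples and their bad primes.\<close>

lemma sum_cops_remove_primes:
  assumes "finite E" "\<And>p. p \<in> E \<Longrightarrow> prime p"
  shows "(\<Prod>p\<in>E. 1 - 1 / real p) * (\<Sum>u\<in>cops W x. 1 / real u) \<le> (\<Sum>u\<in>cops (W * \<Prod>E) x. 1 / real u)"
  using assms
proof (induction E rule: finite_induct)
  case (insert p E)
  define T where "T = cops (W * \<Prod>E) x"
  have p: "prime p" using insert by auto
  have p1: "1 / real p \<le> 1" "p \<ge> 1" using prime_ge_1_nat[OF p] by auto
  have split: "cops (W * \<Prod>(insert p E)) x = T - {u. u \<in> T \<and> p dvd u}"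
  proof -
    have "W * \<Prod>(insert p E) = W * \<Prod>E * p" using insert.hyps by (simp add: mult_ac)
    moreover have "coprime u p \<longleftrightarrow> \<not> p dvd u" for u
    proof
      assume "coprime u p"
      show "\<not> p dvd u"
      proof
        assume "p dvd u"
        hence "p dvd 1" using \<open>coprime u p\<close> by (metis coprime_common_divisor dvd_refl)
        thus False using p by simp
      qed
    next
      assume "\<not> p dvd u"
      thus "coprime u p" using p prime_imp_coprime[of p u] by (simp add: coprime_commute)
    qed
    ultimately have "coprime u (W * \<Prod>(insert p E)) \<longleftrightarrow> coprime u (W * \<Prod>E) \<and> \<not> p dvd u" for u
      by (simp only: coprime_mult_right_iff)
    thus ?thesis unfolding cops_def T_def by blast
  qed
  have IH: "(\<Prod>p\<in>E. 1 - 1 / real p) * (\<Sum>u\<in>cops W x. 1 / real u) \<le> (\<Sum>u\<in>T. 1 / real u)"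
    unfolding T_def by (rule insert.IH) (use insert.prems in blast)
  have "(\<Sum>u\<in>cops (W * \<Prod>(insert p E)) x. 1 / real u) = (\<Sum>u\<in>T. 1 / real u) - (\<Sum>u | u \<in> T \<and> p dvd u. 1 / real u)"
    unfolding split by (rule sum_diff) (auto simp: T_def)
  moreover have "(\<Sum>u | u \<in> T \<and> p dvd u. 1 / real u) \<le> 1 / real p * (\<Sum>u\<in>T. 1 / real u)"
    unfolding T_def using sum_cops_multiples_le[of "\<lambda>_. 1" p] p1 by simp
  ultimately have a: "(1 - 1 / real p) * (\<Sum>u\<in>T. 1 / real u) \<le> (\<Sum>u\<in>cops (W * \<Prod>(insert p E)) x. 1 / real u)"
    by (simp only: left_diff_distrib mult_1)
  have "(\<Prod>p\<in>insert p E. 1 - 1 / real p) * (\<Sum>u\<in>cops W x. 1 / real u) = (1 - 1 / real p) * ((\<Prod>p\<in>E. 1 - 1 / real p) * (\<Sum>u\<in>cops W x. 1 / real u))"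
    unfolding prod.insert[OF insert.hyps] by (rule mult.assoc)
  also have "\<dots> \<le> (1 - 1 / real p) * (\<Sum>u\<in>T. 1 / real u)"
    by (rule mult_left_mono[OF IH]) (use p1 in simp)
  also note a
  finally show ?case .
qed simp

context tuple_sieve
begin

text \<open>The penalty method with weights \<open>1 / u\<close>: repeated and shared prime factors
  together cost at most half of the full product sum.\<close>

lemma sum_inverse_siz_ge:
  assumes T: "T = cops W' x" "\<And>u p. u \<in> T \<Longrightarrow> prime p \<Longrightarrow> p dvd u \<Longrightarrow> p \<in> PP"
    and x: "x ^ card H \<le> z" and D: "\<And>p. p \<in> PP \<Longrightarrow> D < p" "2 * (card H + (card H)\<^sup>2) \<le> D" "D \<ge> 1"
  shows "(\<Sum>u\<in>T. 1 / real u) ^ card H / 2 \<le> (\<Sum>r | r \<in> Om \<and> real (siz r) \<le> z. 1 / real (siz r))"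
proof -
  define G where "G = (\<Sum>u\<in>T. 1 / real u)"
  define \<zeta> where "\<zeta> u = (\<Sum>p\<in>PP. of_bool (p\<^sup>2 dvd u) :: real)" for u :: nat
  define Z where "Z m = (\<Sum>i\<in>H. \<zeta> (m i)) + (\<Sum>i\<in>H. \<Sum>j\<in>H - {i}. \<Sum>p\<in>PP. of_bool (p dvd m i \<and> p dvd m j))" for m
  have fT: "finite T" by (simp add: T)
  have G0: "G \<ge> 0" by (simp add: G_def sum_nonneg)
  have sq: "(\<Sum>p\<in>PP. 1 / (real p)\<^sup>2) \<le> 1 / real D" using finite_PP D by (intro sum_inverse_squares_le) auto
  have PP1: "p \<ge> 1" if "p \<in> PP" for p using prime_ge_1_nat[OF prime_PP[OF that]] .
  have mult: "(\<Sum>u | u \<in> T \<and> q dvd u. 1 / real u) \<le> 1 / real q * G" if "q \<ge> 1" for q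
    unfolding G_def T using sum_cops_multiples_le[of "\<lambda>_. 1" q] that by simp
  have z: "(\<Sum>u\<in>T. 1 / real u * \<zeta> u) \<le> 1 / real D * G"
  proof -
    have "(\<Sum>u\<in>T. 1 / real u * \<zeta> u) = (\<Sum>p\<in>PP. \<Sum>u\<in>T. 1 / real u * of_bool (p\<^sup>2 dvd u))"
      unfolding \<zeta>_def sum_distrib_left by (rule sum.swap)
    also have "\<dots> = (\<Sum>p\<in>PP. \<Sum>u | u \<in> T \<and> p\<^sup>2 dvd u. 1 / real u)"
      by (simp only: sum_times_of_bool[OF fT])
    also have "\<dots> \<le> (\<Sum>p\<in>PP. 1 / (real p)\<^sup>2 * G)"
    proof (rule sum_mono)
      fix p assume "p \<in> PP"
      hence "p\<^sup>2 \<ge> 1" using PP1 by simp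
      thus "(\<Sum>u | u \<in> T \<and> p\<^sup>2 dvd u. 1 / real u) \<le> 1 / (real p)\<^sup>2 * G" using mult[of "p\<^sup>2"] by simp
    qed
    also have "\<dots> = (\<Sum>p\<in>PP. 1 / (real p)\<^sup>2) * G" by (simp add: sum_distrib_right)
    also have "\<dots> \<le> 1 / real D * G" using sq G0 by (intro mult_right_mono)
    finally show ?thesis .
  qed
  have pen: "G ^ card H * (1 - (real (card H) * (1 / real D) + (real (card H))\<^sup>2 * (1 / real D))) \<le> (\<Sum>m\<in>H \<rightarrow>\<^sub>E T. (\<Prod>i\<in>H. 1 / real (m i)) * (1 - Z m))"
    unfolding Z_def
  proof (rule penalty_sum[OF finite_H fT _ finite_PP _ G_def z _ sq])
    show "0 \<notin> PP" using PP1 by force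
    show "(\<Sum>u | u \<in> T \<and> p dvd u. 1 / real u) \<le> 1 / real p * G" if "p \<in> PP" for p by (rule mult[OF PP1[OF that]])
  qed simp
  have half: "1 / 2 \<le> 1 - (real (card H) * (1 / real D) + (real (card H))\<^sup>2 * (1 / real D))"
  proof -
    have "2 * (real (card H) + (real (card H))\<^sup>2) \<le> real D" using of_nat_mono[OF D(2), where ?'a = real] by simp
    hence "(real (card H) + (real (card H))\<^sup>2) / real D \<le> 1 / 2" using D(3) by (simp add: divide_le_eq)
    moreover have "real (card H) * (1 / real D) + (real (card H))\<^sup>2 * (1 / real D) = (real (card H) + (real (card H))\<^sup>2) / real D"
      by (simp add: add_divide_distrib)
    ultimately show ?thesis by linarith
  qed
  define X where "X = {m \<in> H \<rightarrow>\<^sub>E T. Z m < 1}"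
  have fX: "finite (H \<rightarrow>\<^sub>E T)" using finite_H fT by (intro finite_PiE) auto
  have nice: "nice H m" if m: "m \<in> X" for m
  proof -
    have mT: "m h \<in> T" "m h \<ge> 1" if "h \<in> H" for h using m that by (auto simp: X_def T cops_def)
    have Zm: "Z m < 1" using m by (simp add: X_def)
    have z0: "0 \<le> \<zeta> u" for u unfolding \<zeta>_def by (intro sum_nonneg) auto
    have pr0: "0 \<le> (\<Sum>i\<in>H. \<Sum>j\<in>H - {i}. \<Sum>p\<in>PP. of_bool (p dvd m i \<and> p dvd m j) :: real)" by (intro sum_nonneg) auto
    have ge1: "(1::real) \<le> (\<Sum>p\<in>PP. of_bool (Q p))" if "p \<in> PP" "Q p" for p Q
      by (rule order.trans[OF _ member_le_sum[of p PP "\<lambda>p. of_bool (Q p)"]]) (use that finite_PP in auto)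
    have sqf: "\<not> p\<^sup>2 dvd m h" if "h \<in> H" "p \<in> PP" for p h
    proof
      assume "p\<^sup>2 dvd m h"
      hence "1 \<le> \<zeta> (m h)" unfolding \<zeta>_def using ge1[of p "\<lambda>p. p\<^sup>2 dvd m h"] that by simp
      also have "\<zeta> (m h) \<le> (\<Sum>i\<in>H. \<zeta> (m i))" using that finite_H z0 by (intro member_le_sum) auto
      finally show False using Zm pr0 by (simp add: Z_def)
    qed
    have uniq: "i = j" if "i \<in> H" "j \<in> H" "p \<in> PP" "p dvd m i" "p dvd m j" for i j p
    proof (rule ccontr)
      assume "i \<noteq> j"
      have "(1::real) \<le> (\<Sum>p\<in>PP. of_bool (p dvd m i \<and> p dvd m j))" using ge1[of p "\<lambda>p. p dvd m i \<and> p dvd m j"] that by simp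
      also have "\<dots> \<le> (\<Sum>j\<in>H - {i}. \<Sum>p\<in>PP. of_bool (p dvd m i \<and> p dvd m j))"
        using that \<open>i \<noteq> j\<close> finite_H by (intro member_le_sum[of j "H - {i}" "\<lambda>j. \<Sum>p\<in>PP. of_bool (p dvd m i \<and> p dvd m j)"]) (auto intro!: sum_nonneg)
      also have "\<dots> \<le> (\<Sum>i\<in>H. \<Sum>j\<in>H - {i}. \<Sum>p\<in>PP. of_bool (p dvd m i \<and> p dvd m j))"
        using that finite_H by (intro member_le_sum[of i H "\<lambda>i. \<Sum>j\<in>H - {i}. \<Sum>p\<in>PP. of_bool (p dvd m i \<and> p dvd m j)"]) (auto intro!: sum_nonneg)
      finally have "1 \<le> Z m" unfolding Z_def using z0 by (simp add: add_increasing sum_nonneg)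
      thus False using Zm by simp
    qed
    show ?thesis unfolding nice_def using mT T(2) sqf uniq by blast
  qed
  have inj: "inj_on (tup H) X" by (rule inj_on_subset[OF inj_on_tup[of H T]]) (use nice in \<open>auto simp: X_def\<close>)
  have "G ^ card H / 2 = G ^ card H * (1 / 2)" by simp
  also have "\<dots> \<le> G ^ card H * (1 - (real (card H) * (1 / real D) + (real (card H))\<^sup>2 * (1 / real D)))"
    using half G0 by (intro mult_left_mono) auto
  also have "\<dots> \<le> (\<Sum>m\<in>H \<rightarrow>\<^sub>E T. (\<Prod>i\<in>H. 1 / real (m i)) * (1 - Z m))" by (rule pen)
  also have "\<dots> = (\<Sum>m\<in>(H \<rightarrow>\<^sub>E T) - X. (\<Prod>i\<in>H. 1 / real (m i)) * (1 - Z m)) + (\<Sum>m\<in>X. (\<Prod>i\<in>H. 1 / real (m i)) * (1 - Z m))"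
    using fX by (intro sum.subset_diff) (auto simp: X_def)
  also have "\<dots> \<le> 0 + (\<Sum>m\<in>X. (\<Prod>i\<in>H. 1 / real (m i)) * 1)"
  proof (rule add_mono)
    show "(\<Sum>m\<in>(H \<rightarrow>\<^sub>E T) - X. (\<Prod>i\<in>H. 1 / real (m i)) * (1 - Z m)) \<le> 0"
      by (intro sum_nonpos mult_nonneg_nonpos prod_nonneg) (auto simp: X_def)
    show "(\<Sum>m\<in>X. (\<Prod>i\<in>H. 1 / real (m i)) * (1 - Z m)) \<le> (\<Sum>m\<in>X. (\<Prod>i\<in>H. 1 / real (m i)) * 1)"
    proof (intro sum_mono mult_left_mono prod_nonneg)
      fix m
      have "0 \<le> Z m" unfolding Z_def \<zeta>_def by (intro add_nonneg_nonneg sum_nonneg) auto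
      thus "1 - Z m \<le> 1" by simp
    qed auto
  qed
  also have "\<dots> = (\<Sum>m\<in>X. 1 / real (siz (tup H m)))"
  proof -
    have "(\<Prod>i\<in>H. 1 / real (m i)) * 1 = 1 / real (siz (tup H m))" if "m \<in> X" for m
      unfolding siz_tup[OF nice[OF that] subset_refl] by (simp add: prod_dividef)
    thus ?thesis by (simp cong: sum.cong)
  qed
  also have "\<dots> = (\<Sum>r\<in>tup H ` X. 1 / real (siz r))" using inj by (simp add: sum.reindex)
  also have "\<dots> \<le> (\<Sum>r | r \<in> Om \<and> real (siz r) \<le> z. 1 / real (siz r))"
  proof (rule sum_mono2)
    show "tup H ` X \<subseteq> {r. r \<in> Om \<and> real (siz r) \<le> z}"
    proof (intro image_subsetI CollectI conjI)
      fix m assume m: "m \<in> X"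
      show "tup H m \<in> Om" by (rule tup_in_Om[OF nice[OF m]]) simp
      have "real (siz (tup H m)) = (\<Prod>h\<in>H. real (m h))" using siz_tup[OF nice[OF m]] by simp
      also have "\<dots> \<le> (\<Prod>h\<in>H. x)" using m by (intro prod_mono) (auto simp: X_def T cops_def)
      finally show "real (siz (tup H m)) \<le> z" using x by simp
    qed
  qed auto
  finally show ?thesis by (simp add: G_def)
qed

text \<open>Selberg's sieve in the same variables, with \<open>y\<close> the indicator of
  \<open>siz r \<le> z\<close>. For an unsieved \<open>n\<close> only the trivial divisor tuple
  contributes, so its weight is \<open>V^2\<close>, while the form is at most \<open>V\<close>; the
  quotient is \<open>1 / V\<close>.\<close>

lemma card_rough_le:
  assumes W: "\<And>p. p \<in> PP \<Longrightarrow> coprime p W" "W > 0" and z: "z \<ge> 1"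
    and V: "V = (\<Sum>r | r \<in> Om \<and> real (siz r) \<le> z. 1 / real (siz r))"
  shows "real (card {n\<in>{N<..2*N}. [n = a] (mod W) \<and> (\<forall>p\<in>PP. \<forall>h\<in>H. \<not> p dvd n + h)})
    \<le> real N / (real W * V) + ((ln z + 3) ^ card H * z * (ln z + 3) ^ card H)\<^sup>2"
proof -
  define y where "y r = (of_bool (real (siz r) \<le> z) :: real)" for r
  define b where "b = (\<lambda>p\<in>PP. None :: nat option)"
  have b: "b \<in> Om" by (auto simp: b_def Om_def St_def)
  have sb: "siz b = 1" by (simp add: siz_def b_def)
  have Vy: "(\<Sum>r\<in>Om. 1 / real (siz r) * y r) = V" unfolding V y_def by (simp only: sum_times_of_bool[OF finite_Om])
  have lamb: "lam y b = V"
  proof -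
    have "lam y b = (\<Sum>r\<in>Om. 1 / real (siz r) * y r)"
      unfolding lam_def prod_D1[symmetric]
      by (intro sum.cong refl arg_cong2[where f = "(*)"] prod.cong) (auto simp: b_def Bt_def D1_def split: option.splits)
    thus ?thesis unfolding Vy .
  qed
  have V1: "V \<ge> 1"
  proof -
    have "1 / real (siz b) \<le> V" unfolding V
      by (rule member_le_sum[of b _ "\<lambda>r. 1 / real (siz r)"]) (use b sb z in auto)
    thus ?thesis by (simp add: sb)
  qed
  define Lam where "Lam = (ln z + 3) ^ card H"
  have y01: "0 \<le> y r \<and> y r \<le> 1" and ysup: "y r \<noteq> 0 \<Longrightarrow> real (siz r) \<le> z" for r by (auto simp: y_def)
  have lb: "\<bar>lam y d\<bar> \<le> Lam" "lam y d \<noteq> 0 \<Longrightarrow> real (siz d) \<le> z" if "d \<in> Om" for d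
    using lam_bounds[of y z d, OF y01 ysup z that] by (simp_all add: Lam_def)
  define E where "E = (Lam * z * (ln z + 3) ^ card H)\<^sup>2"
  have E: "(\<Sum>d\<in>Om. \<bar>lam y d\<bar>)\<^sup>2 \<le> E" unfolding E_def
    using sum_abs_lam_le[of "lam y" Lam z, OF lb z] by (intro power_mono) (auto intro: sum_nonneg)
  have fm: "form P1 (lam y) \<le> V"
  proof -
    have "form P1 (lam y) \<le> (\<Sum>r\<in>Om. (y r)\<^sup>2 / real (siz r))" by (rule form_P1_le)
    also have "\<dots> = (\<Sum>r\<in>Om. 1 / real (siz r) * y r)" by (intro sum.cong refl) (auto simp: y_def)
    also have "\<dots> = V" by (rule Vy)
    finally show ?thesis .
  qed
  define X where "X = {n. n \<in> {N<..2*N} \<and> [n = a] (mod W)}"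
  define Y where "Y = {n\<in>{N<..2*N}. [n = a] (mod W) \<and> (\<forall>p\<in>PP. \<forall>h\<in>H. \<not> p dvd n + h)}"
  have wY: "weight (lam y) n = V\<^sup>2" if n: "n \<in> Y" for n
  proof -
    have "dvs d n \<longleftrightarrow> d = b" if d: "d \<in> Om" for d
    proof
      assume dv: "dvs d n"
      show "d = b"
      proof (rule PiE_ext[of _ PP "\<lambda>_. St"])
        show "d \<in> PP \<rightarrow>\<^sub>E St" "b \<in> PP \<rightarrow>\<^sub>E St" using d b by (auto simp: Om_def)
        fix p assume p: "p \<in> PP"
        show "d p = b p" using Om_cases[OF d p] dv p n by (auto simp: dvs_def b_def Y_def)
      qed
    qed (auto simp: dvs_def b_def)
    hence "(\<Sum>d\<in>Om. of_bool (dvs d n) * lam y d) = (\<Sum>d\<in>Om. if d = b then lam y d else 0)"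
      by (intro sum.cong refl) auto
    also have "\<dots> = lam y b" using b by simp
    finally show ?thesis by (simp add: weight_def lamb)
  qed
  have "real (card Y) * V\<^sup>2 = (\<Sum>n\<in>Y. weight (lam y) n)" using wY by simp
  also have "\<dots> \<le> (\<Sum>n\<in>X. weight (lam y) n)" by (intro sum_mono2) (auto simp: X_def Y_def weight_nonneg)
  also have "\<dots> \<le> real N / real W * form P1 (lam y) + E"
    using sum_weight_approx[where N = N and a = a and l = "lam y", OF W] E unfolding X_def by linarith
  also have "\<dots> \<le> real N / real W * V + E" using fm by (intro add_right_mono mult_left_mono) auto
  finally have "real (card Y) * V\<^sup>2 \<le> real N / real W * V + E" .
  hence "real (card Y) \<le> (real N / real W * V + E) / V\<^sup>2" using V1 by (simp add: pos_le_divide_eq)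
  also have "\<dots> = real N / (real W * V) + E / V\<^sup>2" using V1 by (simp add: add_divide_distrib power2_eq_square)
  also have "E / V\<^sup>2 \<le> E / 1" using V1 by (intro divide_left_mono) (auto simp: E_def one_le_power)
  finally show ?thesis unfolding Y_def E_def Lam_def by simp
qed

end

lemma finite_badp: "finite H \<Longrightarrow> finite (badp D H)"
proof (rule finite_subset)
  assume "finite H"
  show "badp D H \<subseteq> {..Max H}"
  proof
    fix p assume "p \<in> badp D H"
    then obtain h h' where h: "h \<in> H" "h' \<in> H" "h < h'" "p dvd h' - h" by (auto simp: badp_def)
    hence "p \<le> h' - h" by (intro dvd_imp_le) auto
    moreover have "h' \<le> Max H" using h \<open>finite H\<close> by simp
    ultimately show "p \<in> {..Max H}" by simp
  qed
qed simp

text \<open>\<open>V\<close> is at least half the \<open>m\<close>-th power of a harmonic sum, from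
  which the bad primes are removed at the cost of the factor \<open>S\<close>. The resulting
  \<open>(1 / S) ^ m\<close> is a crude but uniform substitute for the singular series of
  \<open>H\<close>.\<close>

lemma rough_upper_finite:
  fixes m D N :: nat and \<xi> l \<kappa> :: real
  assumes m: "m \<ge> 1" and D: "D \<ge> 10 * (m + 1)" "2 * (m + m\<^sup>2) \<le> D" and W: "W = primorial D" and \<kappa>: "\<kappa> = real (totient W) / real W"
    and \<xi>: "0 < \<xi>" "\<xi> \<le> 1 / 8" and l: "l = ln (real N)" "l \<ge> 24"
    and N1: "real W + 2 \<le> \<kappa> / 2 * (\<xi> * l / real m)" and N2: "real N powr (1/4) * l ^ (5 * m) \<le> real N"
    and H: "finite H" "card H = m"
  shows "real (card {n\<in>{N<..2*N}. [n = 1] (mod W) \<and> rough D (real N powr \<xi>) H n})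
     \<le> (2 / real W * (2 * real m / (\<kappa> * \<xi>)) ^ m + 1) * (\<Prod>p\<in>badp D H. 1 / (1 - 1 / real p)) ^ m * real N / l ^ m"
proof -
  define z where "z = real N powr \<xi>"
  have Npos: "N > 0" using l by (cases N) auto
  have zexp: "z = exp (\<xi> * l)" using Npos l by (simp add: z_def powr_def)
  have z1: "z \<ge> 1" unfolding zexp using \<xi> l by simp
  define PP where "PP = {p. prime p \<and> D < p \<and> real p \<le> z} - badp D H"
  have D20: "D \<ge> 20" using D(1) m by simp
  have W2: "W \<ge> 2" unfolding W using primorial_ge_2 D20 by simp
  interpret tuple_sieve PP H unfolding PP_def using H D by (intro tuple_sieve_badp) auto
  define V where "V = (\<Sum>r | r \<in> Om \<and> real (siz r) \<le> z. 1 / real (siz r))"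
  \<comment> \<open>The \<open>m\<close>-th root of \<open>z\<close>, so that \<open>m\<close>
    components up to \<open>x\<close> multiply to at most \<open>z\<close>.\<close>
  define x where "x = exp (\<xi> * l / real m)"
  have x1: "x \<ge> 1" unfolding x_def using \<xi> l by simp
  have xm: "x ^ m = z" unfolding x_def zexp using m by (simp add: exp_of_nat_mult[symmetric])
  define W' where "W' = W * \<Prod>(badp D H)"
  have fb: "finite (badp D H)" "\<And>p. p \<in> badp D H \<Longrightarrow> prime p" using finite_badp[OF H(1)] by (auto simp: badp_def)
  define S where "S = (\<Prod>p\<in>badp D H. 1 - 1 / real p)"
  have S01: "0 < 1 - 1 / real p" "1 - 1 / real p \<le> 1" if "p \<in> badp D H" for p
    using prime_gt_1_nat[OF fb(2)[OF that]] by auto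
  have "0 < S" unfolding S_def using S01 by (intro prod_pos) blast
  moreover have "S \<le> 1" unfolding S_def using less_imp_le[OF S01(1)] S01(2) by (intro prod_le_1) blast
  ultimately have S: "0 < S" "S \<le> 1" by auto
  define G where "G = (\<Sum>u\<in>cops W' x. 1 / real u)"
  have "G ^ m / 2 \<le> V"
    unfolding V_def G_def H(2)[symmetric]
  proof (rule sum_inverse_siz_ge[OF refl])
    fix u p assume u: "u \<in> cops W' x" and p: "prime p" "p dvd u"
    have np: "\<not> p dvd W'"
    proof
      assume "p dvd W'"
      hence "p dvd 1" using p(2) u unfolding cops_def by (metis (mono_tags, lifting) coprime_common_divisor mem_Collect_eq)
      thus False using p(1) by simp
    qed
    hence "\<not> p dvd W" by (auto simp: W'_def)
    hence "D < p" using dvd_primorial[OF p(1), of D] W by fastforce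
    moreover have "p \<notin> badp D H"
    proof
      assume "p \<in> badp D H"
      hence "p dvd \<Prod>(badp D H)" using fb by (intro dvd_prodI) auto
      thus False using np by (auto simp: W'_def)
    qed
    moreover have "p \<le> u" using p u by (intro dvd_imp_le) (auto simp: cops_def)
    hence "real p \<le> x" using u by (auto simp: cops_def)
    hence "real p \<le> z" using xm m x1 self_le_power[of x m] by simp
    ultimately show "p \<in> PP" using p by (auto simp: PP_def)
  qed (use H D xm D20 in \<open>auto simp: PP_def\<close>)
  note GV = this
  have Gge: "G \<ge> S * (\<kappa> / 2 * (\<xi> * l / real m))"
  proof -
    have "\<bar>(\<Sum>u\<in>cops W x. 1 / real u) - real (totient W) / real W * (ln x - ln 1)\<bar> \<le> (real W + 2) * (1 / 1)"
      using W2 x1 by (intro sum_cops_approx) (auto intro!: derivative_eq_intros simp: frac_le)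
    hence "\<bar>(\<Sum>u\<in>cops W x. 1 / real u) - \<kappa> * (\<xi> * l / real m)\<bar> \<le> real W + 2" by (simp add: \<kappa> x_def)
    moreover have "v / 2 * w \<le> s" if "\<bar>s - v * w\<bar> \<le> t" "t \<le> v / 2 * w" for s v w t :: real using that by (simp add: abs_le_iff)
    ultimately have "\<kappa> / 2 * (\<xi> * l / real m) \<le> (\<Sum>u\<in>cops W x. 1 / real u)" using N1 by blast
    hence "S * (\<kappa> / 2 * (\<xi> * l / real m)) \<le> S * (\<Sum>u\<in>cops W x. 1 / real u)" using S by (intro mult_left_mono) auto
    also have "\<dots> \<le> G" unfolding S_def G_def W'_def by (rule sum_cops_remove_primes[OF fb])
    finally show ?thesis .
  qed
  have \<kappa>0: "\<kappa> > 0" unfolding \<kappa> using W2 by simp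
  have "(S * (\<kappa> / 2 * (\<xi> * l / real m))) ^ m / 2 \<le> G ^ m / 2"
    using Gge S \<xi> l \<kappa>0 by (intro divide_right_mono power_mono) auto
  hence V: "V \<ge> (S * (\<kappa> / 2 * (\<xi> * l / real m))) ^ m / 2" using GV by linarith
  define B where "B = (S * (\<kappa> / 2 * (\<xi> * l / real m))) ^ m / 2"
  have B0: "B > 0" unfolding B_def using S \<kappa>0 \<xi> l m by simp
  have roughPP: "rough D z H n \<longleftrightarrow> (\<forall>p\<in>PP. \<forall>h\<in>H. \<not> p dvd n + h)" for n
    unfolding rough_def PP_def by auto
  have "real (card {n\<in>{N<..2*N}. [n = 1] (mod W) \<and> rough D z H n}) \<le> real N / (real W * V) + ((ln z + 3) ^ card H * z * (ln z + 3) ^ card H)\<^sup>2"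
    unfolding roughPP using W2 z1 coprime_primorial by (intro card_rough_le V_def) (auto simp: PP_def W)
  also have "real N / (real W * V) \<le> real N / (real W * B)"
    using V B0 W2 unfolding B_def[symmetric] by (intro divide_left_mono mult_left_mono mult_pos_pos) auto
  also have "real N / (real W * B) = 2 / real W * (2 * real m / (\<kappa> * \<xi>)) ^ m * (1 / S) ^ m * real N / l ^ m"
    unfolding B_def using S \<kappa>0 \<xi> l m by (simp add: power_mult_distrib power_divide mult_ac)
  also have "((ln z + 3) ^ card H * z * (ln z + 3) ^ card H)\<^sup>2 \<le> real N / l ^ m"
  proof -
    have lz: "ln z + 3 \<le> l" "0 \<le> ln z + 3"
    proof -
      have "\<xi> * l \<le> 1 / 8 * l" using \<xi> l by (intro mult_right_mono) auto
      thus "ln z + 3 \<le> l" unfolding zexp ln_exp using l(2) by linarith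
      show "0 \<le> ln z + 3" using z1 by simp
    qed
    have z8: "z\<^sup>2 \<le> real N powr (1/4)"
    proof -
      have "z \<le> real N powr (1/8)" unfolding z_def using \<xi> Npos by (intro powr_mono) auto
      hence "z\<^sup>2 \<le> (real N powr (1/8))\<^sup>2" using z1 by (intro power_mono) auto
      also have "\<dots> = real N powr (1/4)" by (simp add: power2_eq_square powr_add[symmetric])
      finally show ?thesis .
    qed
    have "((ln z + 3) ^ card H * z * (ln z + 3) ^ card H)\<^sup>2 = (ln z + 3) ^ (4 * m) * z\<^sup>2"
      by (simp add: power_mult_distrib power_mult[symmetric] power_add[symmetric] H mult_ac)
    also have "\<dots> \<le> l ^ (4 * m) * real N powr (1/4)" using lz z8 by (intro mult_mono power_mono) auto
    also have "\<dots> \<le> real N / l ^ m"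
    proof -
      have "l ^ (5 * m) = l ^ (4 * m) * l ^ m" by (simp add: power_add[symmetric])
      hence "l ^ (4 * m) * real N powr (1/4) * l ^ m = real N powr (1/4) * l ^ (5 * m)" by (simp only: mult_ac)
      hence "l ^ (4 * m) * real N powr (1/4) * l ^ m \<le> real N" using N2 by (simp only:)
      moreover have "l ^ m > 0" using l by simp
      ultimately show ?thesis by (simp only: pos_le_divide_eq)
    qed
    finally show ?thesis .
  qed
  also have "real N / l ^ m \<le> 1 * (1 / S) ^ m * real N / l ^ m"
  proof -
    have "1 \<le> (1 / S) ^ m" using S by (intro one_le_power) simp
    hence "1 * (real N / l ^ m) \<le> (1 / S) ^ m * (real N / l ^ m)" using l by (intro mult_right_mono) auto
    thus ?thesis by simp
  qed
  finally have "real (card {n\<in>{N<..2*N}. [n = 1] (mod W) \<and> rough D z H n}) \<le>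
    2 / real W * (2 * real m / (\<kappa> * \<xi>)) ^ m * (1 / S) ^ m * real N / l ^ m + 1 * (1 / S) ^ m * real N / l ^ m" by simp
  also have "\<dots> = (2 / real W * (2 * real m / (\<kappa> * \<xi>)) ^ m + 1) * (1 / S) ^ m * real N / l ^ m"
    by (simp only: add_divide_distrib[symmetric] distrib_right)
  also have "1 / S = (\<Prod>p\<in>badp D H. 1 / (1 - 1 / real p))" unfolding S_def by (simp add: prod_dividef)
  finally show ?thesis unfolding z_def .
qed

subsection \<open>Asymptotic forms of the sieve bounds\<close>

lemma eventually_ln_ge: "eventually (\<lambda>N::nat. K \<le> ln (real N)) sequentially"
proof -
  have "filterlim (\<lambda>N::nat. ln (real N)) at_top sequentially" by real_asymp
  thus ?thesis by (simp add: filterlim_at_top)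
qed

lemma eventually_log_power_le:
  assumes a: "a > 0"
  shows "eventually (\<lambda>N::nat. K * ln (real N) ^ m \<le> real N powr a) sequentially"
proof -
  define K' where "K' = \<bar>K\<bar> + 1"
  have K': "K' > 0" "K \<le> K'" by (auto simp: K'_def)
  have "filterlim (\<lambda>N::nat. a * ln (real N)) at_top sequentially" using a by real_asymp
  hence "((\<lambda>N::nat. (a * ln (real N)) ^ m / exp (a * ln (real N))) \<longlongrightarrow> 0) sequentially"
    by (rule filterlim_compose[OF tendsto_power_div_exp_0])
  hence "eventually (\<lambda>N::nat. (a * ln (real N)) ^ m / exp (a * ln (real N)) < a ^ m / K') sequentially"
    using a K' by (intro order_tendstoD(2)) auto
  thus ?thesis using eventually_gt_at_top[of 1]
  proof eventually_elim
    case (elim N)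
    have l: "ln (real N) \<ge> 0" using elim(2) by simp
    have "(a * ln (real N)) ^ m < a ^ m / K' * exp (a * ln (real N))" using elim(1) by (simp add: pos_divide_less_eq)
    hence "a ^ m * (K' * ln (real N) ^ m) < a ^ m * exp (a * ln (real N))"
      using K' by (simp add: power_mult_distrib field_simps)
    hence "K' * ln (real N) ^ m \<le> exp (a * ln (real N))" using a by simp
    moreover have "K * ln (real N) ^ m \<le> K' * ln (real N) ^ m" using K' l by (intro mult_right_mono) auto
    ultimately have "K * ln (real N) ^ m \<le> exp (a * ln (real N))" by (rule order.trans[rotated])
    thus ?case using elim(2) by (simp add: powr_def)
  qed
qed

text \<open>\<open>k\<close> is taken essentially as large as the first condition permits. The
  second then says that \<open>ln (1 + A / 4)\<close> squared exceeds a multiple of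
  \<open>ln (1 + A)\<close>, true for large \<open>A\<close>; \<open>4718592 = 48 * 98304\<close>,
  where rounding down loses at most a factor 2 because \<open>t \<ge> 2\<close>.\<close>

lemma exists_maynard_parameters:
  obtains A :: real and k :: nat where "A > 0" "k \<ge> 2" "24 * real k * (1 + A) * ln (1 + A) \<le> A\<^sup>2"
    "98304 * A\<^sup>2 \<le> real k * (1 + A) * (ln (1 + A / 4))\<^sup>2"
proof -
  have "eventually (\<lambda>A::real. A > 0) at_top" by real_asymp
  moreover have "eventually (\<lambda>A::real. A\<^sup>2 / (24 * ((1 + A) * ln (1 + A))) \<ge> 2) at_top" by real_asymp
  moreover have "eventually (\<lambda>A::real. (ln (1 + A / 4))\<^sup>2 \<ge> 4718592 * ln (1 + A)) at_top" by real_asymp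
  ultimately have "eventually (\<lambda>A::real. A > 0 \<and> A\<^sup>2 / (24 * ((1 + A) * ln (1 + A))) \<ge> 2 \<and> (ln (1 + A / 4))\<^sup>2 \<ge> 4718592 * ln (1 + A)) at_top"
    by eventually_elim auto
  then obtain A :: real where A: "A > 0" "A\<^sup>2 / (24 * ((1 + A) * ln (1 + A))) \<ge> 2" "(ln (1 + A / 4))\<^sup>2 \<ge> 4718592 * ln (1 + A)"
    by (auto dest: eventually_happens'[OF trivial_limit_at_top_linorder])
  define q where "q = (1 + A) * ln (1 + A)"
  have q: "q > 0" unfolding q_def using A(1) by simp
  define t where "t = A\<^sup>2 / (24 * q)"
  have t1: "t \<ge> 2" using A(2) unfolding t_def q_def .
  have tq: "t * (24 * q) = A\<^sup>2" using q by (simp add: t_def)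
  define k where "k = nat \<lfloor>t\<rfloor>"
  have k: "k \<ge> 2" "real k \<le> t" "t < real k + 1" using t1 by (auto simp: k_def le_nat_floor)
  have k2: "t / 2 \<le> real k" using k by linarith
  have 1: "24 * real k * (1 + A) * ln (1 + A) \<le> A\<^sup>2"
  proof -
    have "real k * (24 * q) \<le> A\<^sup>2" unfolding tq[symmetric] using k q by (intro mult_right_mono) auto
    thus ?thesis unfolding q_def by (simp only: mult_ac)
  qed
  have 2: "98304 * A\<^sup>2 \<le> real k * (1 + A) * (ln (1 + A / 4))\<^sup>2"
  proof -
    have "98304 * A\<^sup>2 = t / 2 * (1 + A) * (4718592 * ln (1 + A))" unfolding tq[symmetric] q_def by (simp add: mult_ac)
    also have "\<dots> \<le> real k * (1 + A) * (ln (1 + A / 4))\<^sup>2"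
      using k2 A t1 by (intro mult_mono) auto
    finally show ?thesis .
  qed
  show ?thesis by (rule that[OF A(1) k(1) 1 2])
qed

text \<open>The quantifiers matter: \<open>c\<close> is fixed before \<open>N\<close>, and the
  threshold for \<open>N\<close> is uniform in \<open>H\<close>, because \<open>H\<close> will range
  over subsets of a grid that grows with \<open>N\<close>.\<close>

theorem maynard_count:
  fixes A :: real and k D :: nat
  assumes EH: Elliott_Halberstam and A: "A > 0" and k: "k \<ge> 1" and c1: "24 * real k * (1 + A) * ln (1 + A) \<le> A\<^sup>2"
    and c2: "98304 * A\<^sup>2 \<le> real k * (1 + A) * (ln (1 + A / 4))\<^sup>2"
    and D: "D \<ge> 35 * k\<^sup>2" "D \<ge> 10 * (k + 1)" and \<xi>: "\<xi> = 1 / (32 * real k * (1 + A))"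
  obtains c where "c > 0" "eventually (\<lambda>N. \<forall>H. finite H \<longrightarrow> card H = k \<longrightarrow> (\<forall>h\<in>H. primorial D dvd h \<and> real h \<le> ln (real N)) \<longrightarrow>
     real k * (\<Sum>p\<in>badp D H. 1 / real p) \<le> 1 / 20 \<longrightarrow>
     c * real N / ln (real N) ^ k \<le> real (card {n\<in>{N<..2*N}. [n = 1] (mod primorial D) \<and> rough D (real N powr \<xi>) H n \<and> 3 \<le> card {h\<in>H. prime (n + h)}})) sequentially"
proof -
  define W where "W = primorial D"
  have W1: "W \<ge> 1" using primorial_pos by (simp add: W_def)
  define \<kappa> where "\<kappa> = real (totient W) / real W"
  have \<kappa>0: "\<kappa> > 0" using W1 by (simp add: \<kappa>_def)
  have \<xi>0: "\<xi> > 0" unfolding \<xi> using A k by simp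
  define q where "q = nat \<lceil>2 / \<xi>\<rceil>"
  have q: "real q * \<xi> \<ge> 2"
  proof -
    have "2 / \<xi> \<le> real q" unfolding q_def by linarith
    thus ?thesis using \<xi>0 by (simp add: pos_divide_le_eq)
  qed
  have bpos: "2 * real k + 1 > 0" by simp
  obtain C N1 where C: "C > 0" "\<And>N PP Q. N \<ge> N1 \<Longrightarrow> finite PP \<Longrightarrow> (\<And>p. p \<in> PP \<Longrightarrow> prime p) \<Longrightarrow>
     (\<And>p. p \<in> PP \<Longrightarrow> coprime p W) \<Longrightarrow> 1 \<le> Q \<Longrightarrow> real W * Q \<le> real N powr (1/2) \<Longrightarrow>
     (\<Sum>B\<in>prime_sets PP Q. real ((k + 1)\<^sup>2) ^ card B * EH_error N (W * \<Prod>B)) \<le> C * real N / ln (real N) powr (2 * real k + 1)"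
    using EH_weighted[OF EH W1 bpos, where M = "(k + 1)\<^sup>2"] by blast
  define l4 where "l4 = ln (1 + A / 4)"
  have l4: "l4 > 0" using A by (simp add: l4_def)
  define c where "c = (\<kappa> / (8 * (1 + A))) ^ k / (real k * real W * (2 ^ (q * k))\<^sup>2)"
  have c0: "c > 0" unfolding c_def using \<kappa>0 A k W1 by (intro divide_pos_pos mult_pos_pos zero_less_power) auto
  show ?thesis
  proof (rule that[OF c0])
    have e1: "eventually (\<lambda>N::nat. 1 / 2 * (\<kappa> * (ln (real N) / 8 / (1 + A))) \<ge> real W + 2) sequentially"
      using eventually_ln_ge[of "(real W + 2) * 16 * (1 + A) / \<kappa>"]
    proof eventually_elim
      case (elim N)
      thus ?case using \<kappa>0 A by (simp add: field_simps)
    qed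
    have e2: "eventually (\<lambda>N::nat. 1 / 2 * (\<kappa> * (ln (real N) / 8 / A * l4)) \<ge> real W + 2) sequentially"
      using eventually_ln_ge[of "(real W + 2) * 16 * A / (\<kappa> * l4)"]
    proof eventually_elim
      case (elim N)
      thus ?case using \<kappa>0 A l4 by (simp add: field_simps)
    qed
    have e3: "eventually (\<lambda>N::nat. real W * real N powr (1/4) \<le> real N powr (1/2)) sequentially"
      using eventually_log_power_le[of "1/4" "real W" 0, simplified]
    proof eventually_elim
      case (elim N)
      have "real W * real N powr (1/4) \<le> real N powr (1/4) * real N powr (1/4)" using elim by (intro mult_right_mono) auto
      thus ?case by (simp add: powr_add[symmetric])
    qed
    show "eventually (\<lambda>N. \<forall>H. finite H \<longrightarrow> card H = k \<longrightarrow> (\<forall>h\<in>H. primorial D dvd h \<and> real h \<le> ln (real N)) \<longrightarrow>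
     real k * (\<Sum>p\<in>badp D H. 1 / real p) \<le> 1 / 20 \<longrightarrow>
     c * real N / ln (real N) ^ k \<le> real (card {n\<in>{N<..2*N}. [n = 1] (mod primorial D) \<and> rough D (real N powr \<xi>) H n \<and> 3 \<le> card {h\<in>H. prime (n + h)}})) sequentially"
      using e1 e2 e3 eventually_ln_ge[of 24] eventually_ln_ge[of "20 * real k * C * real W"] eventually_ge_at_top[of N1]
        eventually_log_power_le[of "1/2" "4 * real W * (2 + (real k)\<^sup>2)" "4 * k", simplified]
    proof eventually_elim
      case (elim N)
      show ?case
      proof (intro allI impI)
        fix H assume H: "finite H" "card H = k" "\<forall>h\<in>H. primorial D dvd h \<and> real h \<le> ln (real N)" "real k * (\<Sum>p\<in>badp D H. 1 / real p) \<le> 1 / 20"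
        show "c * real N / ln (real N) ^ k \<le> real (card {n\<in>{N<..2*N}. [n = 1] (mod primorial D) \<and> rough D (real N powr \<xi>) H n \<and> 3 \<le> card {h\<in>H. prime (n + h)}})"
          unfolding c_def W_def[symmetric]
        proof (rule maynard_finite[OF A k c1 c2 D W_def \<kappa>_def \<xi> q C(2) C(1) refl])
          show "N \<le> N' \<Longrightarrow> N1 \<le> N'" for N' using elim(6) by simp
          show "4 * real W * (2 + (real k)\<^sup>2) * ln (real N) ^ (4 * k) \<le> real N powr (1 / 2)" using elim(7) by (simp add: mult_ac)
        qed (use elim H in \<open>auto simp: W_def l4_def\<close>)
      qed
    qed
  qed
qed

theorem rough_upper:
  fixes m D :: nat and \<xi> :: real
  assumes m: "m \<ge> 1" and D: "D \<ge> 10 * (m + 1)" "2 * (m + m\<^sup>2) \<le> D" and \<xi>: "0 < \<xi>" "\<xi> \<le> 1 / 8"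
  shows "\<exists>C>0. eventually (\<lambda>N. \<forall>H. finite H \<longrightarrow> card H = m \<longrightarrow>
     real (card {n\<in>{N<..2*N}. [n = 1] (mod primorial D) \<and> rough D (real N powr \<xi>) H n})
     \<le> C * (\<Prod>p\<in>badp D H. 1 / (1 - 1 / real p)) ^ m * real N / ln (real N) ^ m) sequentially"
proof -
  define W where "W = primorial D"
  have W1: "W \<ge> 1" using primorial_pos by (simp add: W_def)
  define \<kappa> where "\<kappa> = real (totient W) / real W"
  have \<kappa>0: "\<kappa> > 0" using W1 by (simp add: \<kappa>_def)
  define C where "C = 2 / real W * (2 * real m / (\<kappa> * \<xi>)) ^ m + 1"
  have C0: "C > 0" unfolding C_def using \<kappa>0 \<xi> W1 by (intro add_nonneg_pos mult_nonneg_nonneg) auto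
  have e1: "eventually (\<lambda>N::nat. \<kappa> / 2 * (\<xi> * ln (real N) / real m) \<ge> real W + 2) sequentially"
    using eventually_ln_ge[of "(real W + 2) * 2 * real m / (\<kappa> * \<xi>)"]
  proof eventually_elim
    case (elim N)
    thus ?case using \<kappa>0 \<xi> m by (simp add: field_simps)
  qed
  have e2: "eventually (\<lambda>N::nat. real N powr (1/4) * ln (real N) ^ (5 * m) \<le> real N) sequentially"
    using eventually_log_power_le[of "3/4" 1 "5 * m", simplified] eventually_gt_at_top[of 0]
  proof eventually_elim
    case (elim N)
    have "real N powr (1/4) * ln (real N) ^ (5 * m) \<le> real N powr (1/4) * real N powr (3/4)" using elim by (intro mult_left_mono) auto
    also have "\<dots> = real N" using elim by (simp add: powr_add[symmetric])
    finally show ?case .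
  qed
  have "eventually (\<lambda>N. \<forall>H. finite H \<longrightarrow> card H = m \<longrightarrow>
     real (card {n\<in>{N<..2*N}. [n = 1] (mod primorial D) \<and> rough D (real N powr \<xi>) H n})
     \<le> C * (\<Prod>p\<in>badp D H. 1 / (1 - 1 / real p)) ^ m * real N / ln (real N) ^ m) sequentially"
    using e1 e2 eventually_ln_ge[of 24]
  proof eventually_elim
    case (elim N)
    show ?case
    proof (intro allI impI)
      fix H :: "nat set" assume H: "finite H" "card H = m"
      show "real (card {n\<in>{N<..2*N}. [n = 1] (mod primorial D) \<and> rough D (real N powr \<xi>) H n})
         \<le> C * (\<Prod>p\<in>badp D H. 1 / (1 - 1 / real p)) ^ m * real N / ln (real N) ^ m"
        unfolding C_def W_def[symmetric]
        by (rule rough_upper_finite[OF m D W_def \<kappa>_def \<xi> refl elim(3,1,2) H])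
    qed
  qed
  thus ?thesis using C0 by blast
qed

subsection \<open>Averages over tuples\<close>

definition PD :: "nat \<Rightarrow> nat \<Rightarrow> nat set" where "PD D d = {p. prime p \<and> D < p \<and> p dvd d}"

lemma finite_PD: "d > 0 \<Longrightarrow> finite (PD D d)"
  by (rule finite_subset[of _ "{..d}"]) (auto simp: PD_def dvd_imp_le)

lemma card_multiples_le:
  assumes "q > 0"
  shows "real (card {d\<in>{1..n}. q dvd d}) \<le> real n / real q"
proof -
  have "{d\<in>{1..n}. q dvd d} \<subseteq> (\<lambda>k. q * k) ` {1..n div q}"
  proof
    fix m assume m: "m \<in> {d\<in>{1..n}. q dvd d}"
    then obtain k where k: "m = q * k" by (auto simp: dvd_def)
    have "k \<ge> 1" using m k by (cases k) auto
    moreover have "k \<le> n div q" using m k assms by (simp add: less_eq_div_iff_mult_less_eq mult.commute)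
    ultimately show "m \<in> (\<lambda>k. q * k) ` {1..n div q}" using k by auto
  qed
  hence "card {d\<in>{1..n}. q dvd d} \<le> card ((\<lambda>k. q * k) ` {1..n div q})" by (intro card_mono) auto
  also have "\<dots> \<le> n div q" using card_image_le[of "{1..n div q}" "\<lambda>k. q * k"] by simp
  finally have "real (card {d\<in>{1..n}. q dvd d}) \<le> real (n div q)" by simp
  also have "\<dots> \<le> real n / real q"
  proof -
    have "n div q * q \<le> n" by simp
    hence "real (n div q * q) \<le> real n" by (simp only: of_nat_le_iff)
    thus ?thesis using assms by (simp add: pos_le_divide_eq)
  qed
  finally show ?thesis .
qed

text \<open>After exchanging the sums, a prime \<open>p\<close> divides at most \<open>n / p\<close>
  of the \<open>d\<close>, which turns \<open>1 / p\<close> into the summable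
  \<open>1 / p^2\<close>.\<close>

lemma sum_PD_inverse_le:
  assumes "D \<ge> 1"
  shows "(\<Sum>d=1..n. \<Sum>p\<in>PD D d. 1 / real p) \<le> real n / real D"
proof -
  define S where "S = {p. prime p \<and> D < p \<and> p \<le> n}"
  have fS: "finite S" by (rule finite_subset[of _ "{..n}"]) (auto simp: S_def)
  have "(\<Sum>d=1..n. \<Sum>p\<in>PD D d. 1 / real p) = (\<Sum>d=1..n. \<Sum>p\<in>S. 1 / real p * of_bool (p dvd d))"
  proof (rule sum.cong[OF refl])
    fix d assume d: "d \<in> {1..n}"
    have "PD D d = {p\<in>S. p dvd d}" using d by (auto simp: PD_def S_def dest: dvd_imp_le)
    thus "(\<Sum>p\<in>PD D d. 1 / real p) = (\<Sum>p\<in>S. 1 / real p * of_bool (p dvd d))"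
      unfolding sum_times_of_bool[OF fS] by simp
  qed
  also have "\<dots> = (\<Sum>p\<in>S. \<Sum>d=1..n. 1 / real p * of_bool (p dvd d))" by (rule sum.swap)
  also have "\<dots> \<le> (\<Sum>p\<in>S. real n * (1 / (real p)\<^sup>2))"
  proof (rule sum_mono)
    fix p assume p: "p \<in> S"
    hence p0: "p > 0" using prime_gt_0_nat by (auto simp: S_def)
    have "(\<Sum>d=1..n. 1 / real p * of_bool (p dvd d)) = 1 / real p * real (card {d\<in>{1..n}. p dvd d})"
      unfolding sum_distrib_left[symmetric] by (simp add: Int_def)
    also have "\<dots> \<le> 1 / real p * (real n / real p)" by (intro mult_left_mono card_multiples_le p0) auto
    finally show "(\<Sum>d=1..n. 1 / real p * of_bool (p dvd d)) \<le> real n * (1 / (real p)\<^sup>2)" by (simp add: power2_eq_square)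
  qed
  also have "\<dots> = real n * (\<Sum>p\<in>S. 1 / (real p)\<^sup>2)" by (simp add: sum_distrib_left)
  also have "\<dots> \<le> real n * (1 / real D)" using fS assms by (intro mult_left_mono sum_inverse_squares_le) (auto simp: S_def)
  finally show ?thesis by simp
qed

text \<open>The product is expanded over subsets \<open>B\<close> of the primes dividing
  \<open>d\<close>. At most \<open>n / \<Prod>B\<close> of the \<open>d\<close> are multiples of
  \<open>\<Prod>B\<close>, so the expansion reassembles into a product of
  \<open>1 + c / p^2\<close>, which is bounded for primes beyond \<open>D\<close>.\<close>

lemma sum_PD_prod_le:
  assumes c: "c \<ge> 0" and D: "D \<ge> 1"
  shows "(\<Sum>d=1..n. \<Prod>p\<in>PD D d. 1 + c / real p) \<le> real n * exp (c / real D)"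
proof -
  define S where "S = {p. prime p \<and> D < p \<and> p \<le> n}"
  have fS: "finite S" by (rule finite_subset[of _ "{..n}"]) (auto simp: S_def)
  have fP: "finite (Pow S)" using fS by simp
  have S0: "p > 0" if "p \<in> S" for p using that prime_gt_0_nat by (auto simp: S_def)
  have "(\<Sum>d=1..n. \<Prod>p\<in>PD D d. 1 + c / real p) = (\<Sum>d=1..n. \<Sum>B\<in>Pow S. (\<Prod>p\<in>B. c / real p) * of_bool (\<Prod>B dvd d))"
  proof (rule sum.cong[OF refl])
    fix d assume d: "d \<in> {1..n}"
    have e: "PD D d = {p\<in>S. p dvd d}" using d by (auto simp: PD_def S_def dest: dvd_imp_le)
    have fPD: "finite (PD D d)" unfolding e using fS by simp
    have "(\<Prod>p\<in>PD D d. 1 + c / real p) = (\<Prod>p\<in>PD D d. c / real p + 1)" by (simp add: add.commute)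
    also have "\<dots> = (\<Sum>B\<in>Pow (PD D d). \<Prod>p\<in>B. c / real p)"
      using prod_add[OF fPD, of "\<lambda>p. c / real p" "\<lambda>_. 1"] by simp
    also have "Pow (PD D d) = {B. B \<in> Pow S \<and> \<Prod>B dvd d}"
    proof (intro equalityI subsetI)
      fix B assume "B \<in> Pow (PD D d)"
      hence B: "B \<subseteq> S" "\<And>p. p \<in> B \<Longrightarrow> p dvd d \<and> prime p" unfolding e by (auto simp: S_def)
      have "\<Prod>B dvd d" using B finite_subset[OF B(1) fS] by (intro prod_primes_dvd) auto
      thus "B \<in> {B. B \<in> Pow S \<and> \<Prod>B dvd d}" using B by auto
    next
      fix B assume B: "B \<in> {B. B \<in> Pow S \<and> \<Prod>B dvd d}"
      hence fB: "finite B" using fS finite_subset by blast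
      have "p dvd d" if "p \<in> B" for p using dvd_prodI[OF fB that, of "\<lambda>x. x"] B by (auto intro: dvd_trans)
      thus "B \<in> Pow (PD D d)" unfolding e using B by auto
    qed
    also have "(\<Sum>B | B \<in> Pow S \<and> \<Prod>B dvd d. \<Prod>p\<in>B. c / real p) = (\<Sum>B\<in>Pow S. (\<Prod>p\<in>B. c / real p) * of_bool (\<Prod>B dvd d))"
      by (rule sum_times_of_bool[OF fP, symmetric])
    finally show "(\<Prod>p\<in>PD D d. 1 + c / real p) = (\<Sum>B\<in>Pow S. (\<Prod>p\<in>B. c / real p) * of_bool (\<Prod>B dvd d))" .
  qed
  also have "\<dots> = (\<Sum>B\<in>Pow S. \<Sum>d=1..n. (\<Prod>p\<in>B. c / real p) * of_bool (\<Prod>B dvd d))" by (rule sum.swap)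
  also have "\<dots> \<le> (\<Sum>B\<in>Pow S. real n * (\<Prod>p\<in>B. c / (real p)\<^sup>2))"
  proof (rule sum_mono)
    fix B assume B: "B \<in> Pow S"
    have pB: "\<Prod>B > 0" using B S0 by (intro prod_pos) auto
    have "(\<Sum>d=1..n. (\<Prod>p\<in>B. c / real p) * of_bool (\<Prod>B dvd d)) = (\<Prod>p\<in>B. c / real p) * real (card {d\<in>{1..n}. \<Prod>B dvd d})"
      unfolding sum_distrib_left[symmetric] by (simp add: Int_def)
    also have "\<dots> \<le> (\<Prod>p\<in>B. c / real p) * (real n / real (\<Prod>B))"
      using c by (intro mult_left_mono card_multiples_le pB prod_nonneg) auto
    also have "\<dots> = real n * (\<Prod>p\<in>B. c / (real p)\<^sup>2)"
    proof -
      have "(\<Prod>p\<in>B. c / (real p)\<^sup>2) = (\<Prod>p\<in>B. c / real p * (1 / real p))"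
        by (intro prod.cong refl) (simp add: power2_eq_square)
      also have "\<dots> = (\<Prod>p\<in>B. c / real p) * (1 / real (\<Prod>B))" unfolding prod.distrib by (simp add: prod_dividef)
      finally show ?thesis by (simp only: mult_ac times_divide_eq_right mult_1_right)
    qed
    finally show "(\<Sum>d=1..n. (\<Prod>p\<in>B. c / real p) * of_bool (\<Prod>B dvd d)) \<le> real n * (\<Prod>p\<in>B. c / (real p)\<^sup>2)" .
  qed
  also have "\<dots> = real n * (\<Prod>p\<in>S. c / (real p)\<^sup>2 + 1)"
    using prod_add[OF fS, of "\<lambda>p. c / (real p)\<^sup>2" "\<lambda>_. 1"] by (simp add: sum_distrib_left)
  also have "\<dots> \<le> real n * exp (c / real D)"
  proof (rule mult_left_mono)
    have "(\<Prod>p\<in>S. c / (real p)\<^sup>2 + 1) \<le> (\<Prod>p\<in>S. exp (c / (real p)\<^sup>2))"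
    proof (rule prod_mono)
      fix p
      show "0 \<le> c / (real p)\<^sup>2 + 1 \<and> c / (real p)\<^sup>2 + 1 \<le> exp (c / (real p)\<^sup>2)"
        using c exp_ge_add_one_self[of "c / (real p)\<^sup>2"] by (simp add: add_nonneg_nonneg add.commute)
    qed
    also have "\<dots> = exp (\<Sum>p\<in>S. c / (real p)\<^sup>2)" by (simp add: exp_sum[OF fS])
    also have "(\<Sum>p\<in>S. c / (real p)\<^sup>2) = c * (\<Sum>p\<in>S. 1 / (real p)\<^sup>2)" by (simp add: sum_distrib_left)
    also have "exp (c * (\<Sum>p\<in>S. 1 / (real p)\<^sup>2)) \<le> exp (c * (1 / real D))"
      using c sum_inverse_squares_le[of S D] fS D by (simp only: exp_le_cancel_iff) (intro mult_left_mono, auto simp: S_def)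
    finally show "(\<Prod>p\<in>S. c / (real p)\<^sup>2 + 1) \<le> exp (c / real D)" by simp
  qed simp
  finally show ?thesis .
qed

lemma prod_UNION_le:
  fixes x :: "'a \<Rightarrow> real"
  assumes "finite I" "\<And>i. i \<in> I \<Longrightarrow> finite (F i)" "\<And>i p. i \<in> I \<Longrightarrow> p \<in> F i \<Longrightarrow> x p \<ge> 1"
  shows "(\<Prod>p\<in>(\<Union>i\<in>I. F i). x p) \<le> (\<Prod>i\<in>I. \<Prod>p\<in>F i. x p)"
  using assms
proof (induction I rule: finite_induct)
  case (insert i I)
  define U where "U = (\<Union>i\<in>I. F i)"
  have fU: "finite U" "finite (F i)" using insert by (auto simp: U_def)
  have xU: "x p \<ge> 1" if "p \<in> F i \<union> U" for p using that insert.prems(2) by (auto simp: U_def)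
  have "(\<Prod>p\<in>F i \<union> U. x p) = (\<Prod>p\<in>F i. x p) * (\<Prod>p\<in>U - F i. x p)"
    using fU by (metis Un_Diff_cancel Diff_disjoint finite_Diff prod.union_disjoint)
  also have "\<dots> \<le> (\<Prod>p\<in>F i. x p) * (\<Prod>p\<in>U. x p)"
  proof (rule mult_left_mono)
    have "(\<Prod>p\<in>U. x p) = (\<Prod>p\<in>U - F i. x p) * (\<Prod>p\<in>U \<inter> F i. x p)"
      using fU by (metis Diff_Diff_Int Diff_subset mult.commute prod.subset_diff)
    moreover have "(\<Prod>p\<in>U \<inter> F i. x p) \<ge> 1" using xU by (intro prod_ge_1) auto
    moreover have "(\<Prod>p\<in>U - F i. x p) \<ge> 0" using xU by (intro prod_nonneg) force
    ultimately show "(\<Prod>p\<in>U - F i. x p) \<le> (\<Prod>p\<in>U. x p)" by (simp add: mult_le_cancel_left1)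
    show "(\<Prod>p\<in>F i. x p) \<ge> 0" using xU by (intro prod_nonneg) force
  qed
  also have "\<dots> \<le> (\<Prod>p\<in>F i. x p) * (\<Prod>i\<in>I. \<Prod>p\<in>F i. x p)"
  proof (rule mult_left_mono)
    show "(\<Prod>p\<in>U. x p) \<le> (\<Prod>i\<in>I. \<Prod>p\<in>F i. x p)" unfolding U_def using insert by auto
    show "(\<Prod>p\<in>F i. x p) \<ge> 0" using xU by (intro prod_nonneg) force
  qed
  finally show ?case using insert.hyps by (simp add: U_def)
qed simp

definition pairs :: "nat set \<Rightarrow> (nat \<times> nat) set" where
  "pairs M = {(h, h'). h \<in> M \<and> h' \<in> M \<and> h < h'}"

lemma finite_pairs: "finite M \<Longrightarrow> finite (pairs M)"
  by (rule finite_subset[of _ "M \<times> M"]) (auto simp: pairs_def)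

lemma badp_eq: "badp D M = (\<Union>(h, h')\<in>pairs M. PD D (h' - h))"
  by (auto simp: badp_def pairs_def PD_def)

lemma inverse_one_minus_power_le:
  assumes "prime p" "2 * e \<le> p"
  shows "1 \<le> 1 / (1 - 1 / real p)" "(1 / (1 - 1 / real p)) ^ e \<le> 1 + 2 * real e / real p"
proof -
  have p1: "real p > 1" using prime_gt_1_nat[OF assms(1)] by simp
  show "1 \<le> 1 / (1 - 1 / real p)" using p1 by (simp add: field_simps)
  have ep: "2 * real e \<le> real p" using of_nat_mono[OF assms(2), where ?'a = real] by simp
  have b: "1 - real e / real p \<le> (1 - 1 / real p) ^ e"
    using Bernoulli_inequality[of "- (1 / real p)" e] p1 by simp
  have h: "real e / real p \<le> 1 / 2" using ep p1 by (simp add: divide_le_eq)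
  have "(1 / (1 - 1 / real p)) ^ e = 1 / (1 - 1 / real p) ^ e" by (simp add: power_one_over)
  also have "\<dots> \<le> 1 / (1 - real e / real p)"
  proof (rule divide_left_mono[OF b])
    have "0 < 1 - real e / real p" using h by linarith
    thus "0 < (1 - 1 / real p) ^ e * (1 - real e / real p)" using b by (intro mult_pos_pos) linarith+
  qed simp
  also have "\<dots> \<le> 1 + 2 * (real e / real p)"
  proof -
    have "1 / (1 - t) \<le> 1 + 2 * t" if "0 \<le> t" "t \<le> 1 / 2" for t :: real
    proof -
      have "0 \<le> t * (1 - 2 * t)" using that by simp
      hence "1 \<le> (1 + 2 * t) * (1 - t)" by (simp add: algebra_simps)
      thus ?thesis using that by (simp add: pos_divide_le_eq)
    qed
    from this[of "real e / real p"] show ?thesis using h p1 by simp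
  qed
  finally show "(1 / (1 - 1 / real p)) ^ e \<le> 1 + 2 * real e / real p" by simp
qed

text \<open>The product over bad primes is at most the product of the factors of the single
  differences, hence at most the largest of them to the power \<open>m^2\<close>; raising to the
  power \<open>m\<close> gives \<open>m^3\<close>. Replacing the largest by the sum over all pairs
  reduces the average over \<open>M\<close> to one over differences.\<close>

lemma singular_series_le:
  assumes M: "finite M" "card M = m" and e: "m ^ 3 \<le> e" and D: "2 * e \<le> D"
  shows "(\<Prod>p\<in>badp D M. 1 / (1 - 1 / real p)) ^ m \<le> 1 + (\<Sum>(h, h')\<in>pairs M. \<Prod>p\<in>PD D (h' - h). 1 + 2 * real e / real p)"
proof (cases "pairs M = {}")
  case True
  hence "badp D M = {}" by (simp add: badp_eq)
  thus ?thesis using True by simp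
next
  case False
  define x where "x p = 1 / (1 - 1 / real p)" for p :: nat
  define \<zeta> where "\<zeta> i = (\<Prod>p\<in>PD D (snd i - fst i). x p)" for i :: "nat \<times> nat"
  have fp: "finite (pairs M)" by (rule finite_pairs[OF M(1)])
  have x1: "x p \<ge> 1" "x p ^ e \<le> 1 + 2 * real e / real p" if "prime p" "D < p" for p
    using inverse_one_minus_power_le[of p e] that D by (auto simp: x_def)
  have z1: "\<zeta> i \<ge> 1" for i
    unfolding \<zeta>_def using x1(1) by (intro prod_ge_1) (auto simp: PD_def)
  have fin: "finite (\<zeta> ` pairs M)" using fp by simp
  have "Max (\<zeta> ` pairs M) \<in> \<zeta> ` pairs M" using fin False by (intro Max_in) auto
  then obtain i where i: "i \<in> pairs M" "\<zeta> i = Max (\<zeta> ` pairs M)" by auto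
  have imax: "\<zeta> j \<le> \<zeta> i" if "j \<in> pairs M" for j unfolding i(2) using fin that by (intro Max_ge) auto
  have cp: "card (pairs M) \<le> m ^ 2"
  proof -
    have "card (pairs M) \<le> card (M \<times> M)" using M(1) by (intro card_mono) (auto simp: pairs_def)
    thus ?thesis using M by (simp add: card_cartesian_product power2_eq_square)
  qed
  have "(\<Prod>p\<in>badp D M. x p) \<le> (\<Prod>j\<in>pairs M. \<zeta> j)"
  proof -
    have "(\<Prod>p\<in>(\<Union>j\<in>pairs M. PD D (snd j - fst j)). x p) \<le> (\<Prod>j\<in>pairs M. \<Prod>p\<in>PD D (snd j - fst j). x p)"
      using fp x1(1) by (intro prod_UNION_le finite_PD) (auto simp: pairs_def PD_def)
    thus ?thesis unfolding badp_eq \<zeta>_def by (simp add: case_prod_unfold)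
  qed
  also have "\<dots> \<le> (\<Prod>j\<in>pairs M. \<zeta> i)"
  proof (rule prod_mono)
    fix j assume "j \<in> pairs M"
    hence "\<zeta> j \<le> \<zeta> i" by (rule imax)
    thus "0 \<le> \<zeta> j \<and> \<zeta> j \<le> \<zeta> i" using z1[of j] by linarith
  qed
  also have "\<dots> = \<zeta> i ^ card (pairs M)" by simp
  also have "\<dots> \<le> \<zeta> i ^ (m ^ 2)" using cp z1[of i] by (intro power_increasing)
  finally have b1: "(\<Prod>p\<in>badp D M. x p) \<le> \<zeta> i ^ (m ^ 2)" .
  have b0: "(\<Prod>p\<in>badp D M. x p) \<ge> 0" 
  proof (rule prod_nonneg)
    fix p assume "p \<in> badp D M"
    hence "1 \<le> x p" using x1(1) by (simp add: badp_def)
    thus "0 \<le> x p" by linarith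
  qed
  have "(\<Prod>p\<in>badp D M. x p) ^ m \<le> (\<zeta> i ^ (m ^ 2)) ^ m" using b0 b1 by (intro power_mono)
  also have "\<dots> = \<zeta> i ^ (m ^ 3)" 
  proof -
    have "m ^ 2 * m = m ^ 3" by (simp add: power3_eq_cube power2_eq_square)
    thus ?thesis by (simp only: power_mult[symmetric])
  qed
  also have "\<dots> \<le> \<zeta> i ^ e" using e z1[of i] by (intro power_increasing)
  also have "\<dots> = (\<Prod>p\<in>PD D (snd i - fst i). x p ^ e)" by (simp add: \<zeta>_def prod_power_distrib)
  also have "\<dots> \<le> (\<Prod>p\<in>PD D (snd i - fst i). 1 + 2 * real e / real p)"
  proof (rule prod_mono)
    fix p assume "p \<in> PD D (snd i - fst i)"
    hence p: "prime p" "D < p" by (auto simp: PD_def)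
    have "0 \<le> x p" using x1(1)[OF p] by linarith
    thus "0 \<le> x p ^ e \<and> x p ^ e \<le> 1 + 2 * real e / real p" using x1(2)[OF p] by simp
  qed
  also have "\<dots> \<le> (\<Sum>i\<in>pairs M. \<Prod>p\<in>PD D (snd i - fst i). 1 + 2 * real e / real p)"
    by (rule member_le_sum[OF i(1) _ fp]) (auto intro!: prod_nonneg add_nonneg_nonneg)
  finally show ?thesis unfolding x_def case_prod_unfold by linarith
qed

lemma sum_UNION_le:
  fixes a :: "'a \<Rightarrow> real"
  assumes "finite I" "\<And>i. i \<in> I \<Longrightarrow> finite (F i)" "\<And>i p. i \<in> I \<Longrightarrow> p \<in> F i \<Longrightarrow> a p \<ge> 0"
  shows "(\<Sum>p\<in>(\<Union>i\<in>I. F i). a p) \<le> (\<Sum>i\<in>I. \<Sum>p\<in>F i. a p)"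
  using assms
proof (induction I rule: finite_induct)
  case (insert i I)
  define U where "U = (\<Union>i\<in>I. F i)"
  have fU: "finite U" "finite (F i)" using insert by (auto simp: U_def)
  have "(\<Sum>p\<in>F i \<union> U. a p) = (\<Sum>p\<in>F i. a p) + (\<Sum>p\<in>U. a p) - (\<Sum>p\<in>F i \<inter> U. a p)"
    using fU by (simp add: sum_Un)
  moreover have "(\<Sum>p\<in>F i \<inter> U. a p) \<ge> 0" using insert.prems(2) by (intro sum_nonneg) auto
  moreover have "(\<Sum>p\<in>U. a p) \<le> (\<Sum>i\<in>I. \<Sum>p\<in>F i. a p)" unfolding U_def by (rule insert.IH) (use insert.prems in auto)
  ultimately have "(\<Sum>p\<in>F i \<union> U. a p) \<le> (\<Sum>p\<in>F i. a p) + (\<Sum>i\<in>I. \<Sum>p\<in>F i. a p)" by linarith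
  thus ?case using insert.hyps by (simp add: U_def)
qed simp

section \<open>Averages over the subsets of a grid\<close>

definition subsets :: "nat set \<Rightarrow> nat \<Rightarrow> nat set set" where
  "subsets S m = {M. M \<subseteq> S \<and> card M = m}"

lemma finite_subsets: "finite S \<Longrightarrow> finite (subsets S m)"
  by (rule finite_subset[of _ "Pow S"]) (auto simp: subsets_def)

lemma card_subsets: "finite S \<Longrightarrow> card (subsets S m) = card S choose m"
  unfolding subsets_def by (rule n_subsets)

lemma choose_le_power: "n choose m \<le> n ^ m"
  by (cases "m \<le> n") (auto simp: binomial_le_pow binomial_eq_0)

text \<open>A set containing a given pair is determined by its other \<open>m - 2\<close> elements,
  so a pair occurs at most \<open>n ^ (m - 2)\<close> times.\<close>

lemma sum_subsets_pairs_le: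
  fixes F :: "nat \<times> nat \<Rightarrow> real"
  assumes S: "finite S" "card S = n" and F: "\<And>i. i \<in> pairs S \<Longrightarrow> F i \<ge> 0"
  shows "(\<Sum>M\<in>subsets S m. \<Sum>i\<in>pairs M. F i) \<le> real n ^ (m - 2) * (\<Sum>i\<in>pairs S. F i)"
proof -
  have fin: "finite (subsets S m)" "finite (pairs S)" using S finite_subsets finite_pairs by auto
  have "(\<Sum>M\<in>subsets S m. \<Sum>i\<in>pairs M. F i) = (\<Sum>M\<in>subsets S m. \<Sum>i\<in>pairs S. F i * of_bool (i \<in> pairs M))"
  proof (rule sum.cong[OF refl])
    fix M assume M: "M \<in> subsets S m"
    have "{i. i \<in> pairs S \<and> i \<in> pairs M} = pairs M" using M by (auto simp: subsets_def pairs_def)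
    thus "(\<Sum>i\<in>pairs M. F i) = (\<Sum>i\<in>pairs S. F i * of_bool (i \<in> pairs M))"
      using sum_times_of_bool[OF fin(2), of F "\<lambda>i. i \<in> pairs M"] by simp
  qed
  also have "\<dots> = (\<Sum>i\<in>pairs S. \<Sum>M\<in>subsets S m. F i * of_bool (i \<in> pairs M))" by (rule sum.swap)
  also have "\<dots> \<le> (\<Sum>i\<in>pairs S. F i * real n ^ (m - 2))"
  proof (rule sum_mono)
    fix i assume i: "i \<in> pairs S"
    obtain h h' where hh: "i = (h, h')" "h \<in> S" "h' \<in> S" "h < h'" using i by (auto simp: pairs_def)
    have "(\<Sum>M\<in>subsets S m. F i * of_bool (i \<in> pairs M)) = F i * real (card {M\<in>subsets S m. i \<in> pairs M})"
      unfolding sum_distrib_left[symmetric] using fin by (simp add: Int_def)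
    also have "\<dots> \<le> F i * real n ^ (m - 2)"
    proof (intro mult_left_mono F i)
      have "inj_on (\<lambda>M. M - {h, h'}) {M\<in>subsets S m. i \<in> pairs M}"
      proof (rule inj_onI)
        fix M M' assume MM: "M \<in> {M\<in>subsets S m. i \<in> pairs M}" "M' \<in> {M\<in>subsets S m. i \<in> pairs M}" "M - {h, h'} = M' - {h, h'}"
        have "h \<in> M" "h' \<in> M" "h \<in> M'" "h' \<in> M'" using MM(1,2) by (auto simp: hh pairs_def)
        thus "M = M'" using MM(3) by blast
      qed
      moreover have "(\<lambda>M. M - {h, h'}) ` {M\<in>subsets S m. i \<in> pairs M} \<subseteq> subsets S (m - 2)"
      proof (intro image_subsetI)
        fix M assume "M \<in> {M\<in>subsets S m. i \<in> pairs M}"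
        hence M: "M \<subseteq> S" "card M = m" "h \<in> M" "h' \<in> M" by (auto simp: hh pairs_def subsets_def)
        have "card (M - {h, h'}) = card M - card {h, h'}" using M S finite_subset by (intro card_Diff_subset) auto
        thus "M - {h, h'} \<in> subsets S (m - 2)" using M hh by (auto simp: subsets_def)
      qed
      ultimately have "card {M\<in>subsets S m. i \<in> pairs M} \<le> card (subsets S (m - 2))"
        using S by (intro card_inj_on_le finite_subsets) auto
      also have "\<dots> \<le> n ^ (m - 2)" using card_subsets[OF S(1)] S(2) choose_le_power by simp
      finally have "real (card {M\<in>subsets S m. i \<in> pairs M}) \<le> real (n ^ (m - 2))" by (simp only: of_nat_le_iff)
      thus "real (card {M\<in>subsets S m. i \<in> pairs M}) \<le> real n ^ (m - 2)" by simp
    qed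
    finally show "(\<Sum>M\<in>subsets S m. F i * of_bool (i \<in> pairs M)) \<le> F i * real n ^ (m - 2)" .
  qed
  also have "\<dots> = real n ^ (m - 2) * (\<Sum>i\<in>pairs S. F i)" by (simp add: sum_distrib_right[symmetric] mult.commute)
  finally show ?thesis .
qed

definition grid :: "nat \<Rightarrow> nat \<Rightarrow> nat set" where "grid W n = (\<lambda>a. W * a) ` {1..n}"

lemma grid_card: "W \<ge> 1 \<Longrightarrow> finite (grid W n) \<and> card (grid W n) = n"
  unfolding grid_def by (auto simp: card_image inj_on_def)

text \<open>A difference \<open>W * d\<close> is attained at most once for each choice of the
  smaller element.\<close>

lemma sum_pairs_grid_le:
  fixes F :: "nat \<Rightarrow> real"
  assumes W: "W \<ge> 1" and F: "\<And>d. d \<ge> 1 \<Longrightarrow> F (W * d) \<ge> 0"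
  shows "(\<Sum>(h, h')\<in>pairs (grid W n). F (h' - h)) \<le> real n * (\<Sum>d=1..n. F (W * d))"
proof -
  define \<phi> where "\<phi> = (\<lambda>(a, d). (W * a, W * (a + d)))"
  have inj: "inj_on \<phi> ({1..n} \<times> {1..n})" using W by (auto simp: inj_on_def \<phi>_def)
  have sub: "pairs (grid W n) \<subseteq> \<phi> ` ({1..n} \<times> {1..n})"
  proof
    fix i assume "i \<in> pairs (grid W n)"
    then obtain a b where ab: "i = (W * a, W * b)" "a \<in> {1..n}" "b \<in> {1..n}" "W * a < W * b" by (auto simp: pairs_def grid_def)
    hence "a < b" by simp
    hence "i = \<phi> (a, b - a)" "b - a \<in> {1..n}" using ab by (auto simp: \<phi>_def)
    thus "i \<in> \<phi> ` ({1..n} \<times> {1..n})" using ab by blast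
  qed
  have val: "snd (\<phi> x) - fst (\<phi> x) = W * snd x" for x by (simp add: \<phi>_def case_prod_unfold distrib_left)
  have "(\<Sum>(h, h')\<in>pairs (grid W n). F (h' - h)) = (\<Sum>i\<in>pairs (grid W n). F (snd i - fst i))" by (simp add: case_prod_unfold)
  also have "\<dots> \<le> (\<Sum>i\<in>\<phi> ` ({1..n} \<times> {1..n}). F (snd i - fst i))"
  proof (rule sum_mono2[OF _ sub])
    fix i assume "i \<in> \<phi> ` ({1..n} \<times> {1..n}) - pairs (grid W n)"
    then obtain a d where "i = \<phi> (a, d)" "d \<ge> 1" by auto
    thus "F (snd i - fst i) \<ge> 0" using val F by simp
  qed simp
  also have "\<dots> = (\<Sum>x\<in>{1..n} \<times> {1..n}. F (W * snd x))" using inj by (simp add: sum.reindex val)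
  also have "\<dots> = (\<Sum>a\<in>{1..n}. \<Sum>d\<in>{1..n}. F (W * d))" unfolding sum.cartesian_product by (simp only: case_prod_unfold)
  finally show ?thesis by simp
qed

lemma PD_primorial: "PD D (primorial D * d) = PD D d"
proof -
  have "p dvd primorial D * d \<longleftrightarrow> p dvd d" if "prime p" "D < p" for p
    using coprime_primorial[OF that] coprime_dvd_mult_right_iff by blast
  thus ?thesis by (auto simp: PD_def)
qed

lemma exp_half_le: "exp (1/2::real) \<le> 2"
proof -
  have "exp (1/2::real) ^ 2 = exp 1" by (simp add: power2_eq_square exp_add[symmetric])
  also have "\<dots> \<le> 2 ^ 2" using exp_le by simp
  finally show ?thesis by (rule power2_le_imp_le) simp
qed

text \<open>On average the singular series is bounded: the sets themselves contribute
  \<open>n ^ m\<close>, and the pair sums at most \<open>2 * n ^ m\<close>, since \<open>D\<close>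
  keeps the exponential below 2.\<close>

lemma sum_singular_series_le:
  assumes m: "m \<ge> 2" "m ^ 3 \<le> e" and D: "4 * e \<le> D" "D \<ge> 1"
  shows "(\<Sum>M\<in>subsets (grid (primorial D) n) m. (\<Prod>p\<in>badp D M. 1 / (1 - 1 / real p)) ^ m) \<le> 3 * real n ^ m"
proof -
  define S where "S = grid (primorial D) n"
  define F where "F d = (\<Prod>p\<in>PD D d. 1 + 2 * real e / real p)" for d
  have S: "finite S" "card S = n" using grid_card[OF primorial_pos] by (auto simp: S_def)
  have F0: "F d \<ge> 0" for d unfolding F_def by (intro prod_nonneg) auto
  have "(\<Sum>M\<in>subsets S m. (\<Prod>p\<in>badp D M. 1 / (1 - 1 / real p)) ^ m) \<le> (\<Sum>M\<in>subsets S m. 1 + (\<Sum>(h, h')\<in>pairs M. F (h' - h)))"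
    unfolding F_def using S m D
    by (intro sum_mono singular_series_le) (auto simp: subsets_def intro: finite_subset)
  also have "\<dots> = real (card (subsets S m)) + (\<Sum>M\<in>subsets S m. \<Sum>(h, h')\<in>pairs M. F (h' - h))"
    by (simp add: sum.distrib)
  also have "\<dots> \<le> real n ^ m + real n ^ (m - 2) * (\<Sum>(h, h')\<in>pairs S. F (h' - h))"
  proof (rule add_mono)
    have "card (subsets S m) \<le> n ^ m" using card_subsets[OF S(1)] S(2) choose_le_power by simp
    hence "real (card (subsets S m)) \<le> real (n ^ m)" by (simp only: of_nat_le_iff)
    thus "real (card (subsets S m)) \<le> real n ^ m" by simp
    show "(\<Sum>M\<in>subsets S m. \<Sum>(h, h')\<in>pairs M. F (h' - h)) \<le> real n ^ (m - 2) * (\<Sum>(h, h')\<in>pairs S. F (h' - h))"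
      using F0 by (intro sum_subsets_pairs_le S) auto
  qed
  also have "(\<Sum>(h, h')\<in>pairs S. F (h' - h)) \<le> real n * (\<Sum>d=1..n. F (primorial D * d))"
    unfolding S_def using F0 by (intro sum_pairs_grid_le primorial_pos)
  also have "(\<Sum>d=1..n. F (primorial D * d)) \<le> real n * exp (2 * real e / real D)"
    unfolding F_def PD_primorial using D by (intro sum_PD_prod_le) auto
  also have "exp (2 * real e / real D) \<le> 2"
  proof -
    have "4 * real e \<le> real D" using of_nat_mono[OF D(1), where ?'a = real] by simp
    hence "2 * real e / real D \<le> 1 / 2" using D(2) by (simp add: divide_le_eq)
    hence "exp (2 * real e / real D) \<le> exp (1/2)" by simp
    thus ?thesis using exp_half_le by linarith
  qed
  also have "real n ^ m + real n ^ (m - 2) * (real n * (real n * 2)) = 3 * real n ^ m"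
  proof -
    have "real n ^ m = real n ^ (m - 2) * (real n * real n)"
      using m(1) by (metis le_add_diff_inverse2 power_add power2_eq_square)
    thus ?thesis by simp
  qed
  finally show ?thesis unfolding S_def by (simp add: mult_left_mono)
qed

text \<open>Markov's inequality: the mean of the reciprocal sum over bad primes is at most of order
  \<open>1 / D\<close>. The factor \<open>k ^ k\<close> in \<open>D\<close> compares the total
  \<open>n ^ k\<close> with the lower bound \<open>(n / k) ^ k\<close> for the number of subsets, of
  which at most half is lost.\<close>

lemma card_good_subsets_ge:
  assumes k: "k \<ge> 2" "k \<le> n" and D: "40 * k * k ^ k \<le> D" "D \<ge> 1"
  shows "real (card {H\<in>subsets (grid (primorial D) n) k. real k * (\<Sum>p\<in>badp D H. 1 / real p) \<le> 1 / 20}) \<ge> (real n / real k) ^ k / 2"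
proof -
  define S where "S = grid (primorial D) n"
  define s where "s H = (\<Sum>p\<in>badp D H. 1 / real p)" for H
  have S: "finite S" "card S = n" using grid_card[OF primorial_pos] by (auto simp: S_def)
  have fs: "finite (subsets S k)" using S by (intro finite_subsets)
  define Bd where "Bd = {H\<in>subsets S k. \<not> real k * s H \<le> 1 / 20}"
  have s0: "s H \<ge> 0" for H unfolding s_def by (intro sum_nonneg) auto
  have "real (card Bd) = (\<Sum>H\<in>Bd. 1)" by simp
  also have "\<dots> \<le> (\<Sum>H\<in>Bd. 20 * real k * s H)" by (intro sum_mono) (auto simp: Bd_def)
  also have "\<dots> \<le> (\<Sum>H\<in>subsets S k. 20 * real k * s H)" using fs s0 by (intro sum_mono2) (auto simp: Bd_def)
  also have "\<dots> = 20 * real k * (\<Sum>H\<in>subsets S k. s H)" by (simp add: sum_distrib_left)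
  also have "(\<Sum>H\<in>subsets S k. s H) \<le> (\<Sum>H\<in>subsets S k. \<Sum>(h, h')\<in>pairs H. \<Sum>p\<in>PD D (h' - h). 1 / real p)"
  proof (rule sum_mono)
    fix H assume "H \<in> subsets S k"
    hence fH: "finite H" using S finite_subset by (auto simp: subsets_def)
    have "(\<Sum>p\<in>(\<Union>i\<in>pairs H. PD D (snd i - fst i)). 1 / real p) \<le> (\<Sum>i\<in>pairs H. \<Sum>p\<in>PD D (snd i - fst i). 1 / real p)"
      using finite_pairs[OF fH] by (intro sum_UNION_le finite_PD) (auto simp: pairs_def)
    thus "s H \<le> (\<Sum>(h, h')\<in>pairs H. \<Sum>p\<in>PD D (h' - h). 1 / real p)" unfolding s_def badp_eq by (simp add: case_prod_unfold)
  qed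
  also have "\<dots> \<le> real n ^ (k - 2) * (\<Sum>(h, h')\<in>pairs S. \<Sum>p\<in>PD D (h' - h). 1 / real p)"
    by (intro sum_subsets_pairs_le S) (auto intro!: sum_nonneg)
  also have "(\<Sum>(h, h')\<in>pairs S. \<Sum>p\<in>PD D (h' - h). 1 / real p) \<le> real n * (\<Sum>d=1..n. \<Sum>p\<in>PD D (primorial D * d). 1 / real p)"
    unfolding S_def by (intro sum_pairs_grid_le primorial_pos sum_nonneg) auto
  also have "(\<Sum>d=1..n. \<Sum>p\<in>PD D (primorial D * d). 1 / real p) \<le> real n / real D"
    unfolding PD_primorial by (rule sum_PD_inverse_le[OF D(2)])
  finally have "real (card Bd) \<le> 20 * real k * (real n ^ (k - 2) * (real n * (real n / real D)))"
    by (simp add: mult_left_mono)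
  also have "\<dots> = 20 * real k / real D * real n ^ k"
  proof -
    have "real n ^ k = real n ^ (k - 2) * (real n * real n)"
      using k(1) by (metis le_add_diff_inverse2 power_add power2_eq_square)
    thus ?thesis by simp
  qed
  also have "\<dots> \<le> 1 / (2 * real k ^ k) * real n ^ k"
  proof (rule mult_right_mono)
    have "40 * real k * real k ^ k \<le> real D" using of_nat_mono[OF D(1), where ?'a = real] by simp
    moreover have "real D > 0" "real k ^ k > 0" using D k by auto
    ultimately show "20 * real k / real D \<le> 1 / (2 * real k ^ k)" by (simp add: divide_simps mult_ac)
  qed simp
  also have "\<dots> = (real n / real k) ^ k / 2" by (simp add: power_divide)
  finally have bd: "real (card Bd) \<le> (real n / real k) ^ k / 2" .
  have "card (subsets S k) = card Bd + card {H\<in>subsets S k. real k * s H \<le> 1 / 20}"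
  proof -
    have "subsets S k = Bd \<union> {H\<in>subsets S k. real k * s H \<le> 1 / 20}" by (auto simp: Bd_def)
    moreover have "card (Bd \<union> {H\<in>subsets S k. real k * s H \<le> 1 / 20}) = card Bd + card {H\<in>subsets S k. real k * s H \<le> 1 / 20}"
      using fs by (intro card_Un_disjoint) (auto simp: Bd_def)
    ultimately show ?thesis by simp
  qed
  moreover have "(real n / real k) ^ k \<le> real (card (subsets S k))"
    unfolding card_subsets[OF S(1)] S(2) using binomial_ge_n_over_k_pow_k[OF k(2), where ?'a = real] by simp
  ultimately show ?thesis using bd unfolding S_def s_def by simp
qed

text \<open>With \<open>u n\<close> the number of \<open>H\<close> rough at \<open>n\<close>, the
  left side is at most the squared sum of \<open>u\<close> over \<open>XX\<close>. Cauchy-Schwarz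
  gives the factor \<open>card XX\<close>, and the sum of \<open>u^2\<close> counts pairs of tuples
  rough at the same \<open>n\<close>.\<close>

lemma double_counting:
  fixes R T :: "'h \<Rightarrow> nat \<Rightarrow> bool"
  assumes G: "finite G" and Y: "finite Y" "XX \<subseteq> Y" "\<And>n H. n \<in> Y \<Longrightarrow> H \<in> G \<Longrightarrow> T H n \<Longrightarrow> n \<in> XX"
  shows "(\<Sum>H\<in>G. real (card {n\<in>Y. R H n \<and> T H n}))\<^sup>2 \<le> real (card XX) * (\<Sum>H\<in>G. \<Sum>H'\<in>G. real (card {n\<in>Y. R H n \<and> R H' n}))"
proof -
  define u where "u n = (\<Sum>H\<in>G. of_bool (R H n) :: real)" for n
  have c: "real (card {n\<in>Y. Q n}) = (\<Sum>n\<in>Y. of_bool (Q n))" for Q using Y(1) by (simp add: Int_def)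
  have fXX: "finite XX" using Y finite_subset by blast
  have u0: "u n \<ge> 0" for n unfolding u_def by (intro sum_nonneg) auto
  have "(\<Sum>H\<in>G. real (card {n\<in>Y. R H n \<and> T H n})) = (\<Sum>n\<in>Y. \<Sum>H\<in>G. of_bool (R H n \<and> T H n))"
    unfolding c by (rule sum.swap)
  also have "\<dots> \<le> (\<Sum>n\<in>Y. if n \<in> XX then u n else 0)"
  proof (rule sum_mono)
    fix n assume n: "n \<in> Y"
    show "(\<Sum>H\<in>G. of_bool (R H n \<and> T H n)) \<le> (if n \<in> XX then u n else 0)"
    proof (cases "n \<in> XX")
      case True
      thus ?thesis unfolding u_def by (auto intro!: sum_mono)
    next
      case False
      hence "of_bool (R H n \<and> T H n) = (0::real)" if "H \<in> G" for H using Y(3)[OF n that] by auto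
      thus ?thesis using False by (simp add: sum.neutral)
    qed
  qed
  also have "\<dots> = (\<Sum>n\<in>XX. 1 * u n)" using Y by (simp add: sum.inter_restrict[symmetric] Int_absorb1)
  finally have "(\<Sum>H\<in>G. real (card {n\<in>Y. R H n \<and> T H n}))\<^sup>2 \<le> (\<Sum>n\<in>XX. 1 * u n)\<^sup>2"
    by (intro power_mono sum_nonneg) auto
  also have "\<dots> \<le> (\<Sum>n\<in>XX. 1\<^sup>2) * (\<Sum>n\<in>XX. (u n)\<^sup>2)" by (rule Cauchy_Schwarz_ineq_sum)
  also have "\<dots> \<le> real (card XX) * (\<Sum>n\<in>Y. (u n)\<^sup>2)" using Y by (simp add: mult_left_mono sum_mono2)
  also have "(\<Sum>n\<in>Y. (u n)\<^sup>2) = (\<Sum>H\<in>G. \<Sum>H'\<in>G. real (card {n\<in>Y. R H n \<and> R H' n}))"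
  proof -
    have "(\<Sum>n\<in>Y. (u n)\<^sup>2) = (\<Sum>n\<in>Y. \<Sum>H\<in>G. \<Sum>H'\<in>G. of_bool (R H n \<and> R H' n))"
      unfolding u_def power2_eq_square sum_product by (simp add: of_bool_conj)
    also have "\<dots> = (\<Sum>H\<in>G. \<Sum>n\<in>Y. \<Sum>H'\<in>G. of_bool (R H n \<and> R H' n))" by (rule sum.swap)
    also have "\<dots> = (\<Sum>H\<in>G. \<Sum>H'\<in>G. \<Sum>n\<in>Y. of_bool (R H n \<and> R H' n))" by (intro sum.cong refl sum.swap)
    finally show ?thesis unfolding c .
  qed
  finally show ?thesis .
qed

text \<open>A set with at most \<open>2 * k\<close> elements is the union of at most
  \<open>4 ^ (2 * k) = 16 ^ k\<close> ordered pairs of its subsets.\<close>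

lemma sum_unions_le:
  fixes f :: "nat set \<Rightarrow> real"
  assumes S: "finite S" and f: "\<And>M. f M \<ge> 0" and G: "G \<subseteq> subsets S k"
  shows "(\<Sum>H\<in>G. \<Sum>H'\<in>G. f (H \<union> H')) \<le> 16 ^ k * (\<Sum>m=k..2*k. \<Sum>M\<in>subsets S m. f M)"
proof -
  define T where "T = (\<Union>m\<in>{k..2*k}. subsets S m)"
  have fG: "finite G" using finite_subset[OF G finite_subsets[OF S]] .
  have fT: "finite T" using S by (auto simp: T_def finite_subsets)
  have sub: "(\<lambda>(H, H'). H \<union> H') ` (G \<times> G) \<subseteq> T"
  proof
    fix M assume "M \<in> (\<lambda>(H, H'). H \<union> H') ` (G \<times> G)"
    then obtain H H' where HG: "M = H \<union> H'" "H \<in> G" "H' \<in> G" by auto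
    have H: "M = H \<union> H'" "H \<subseteq> S" "H' \<subseteq> S" "card H = k" "card H' = k" using HG G unfolding subsets_def by blast+
    have fH: "finite H" "finite H'" using H S finite_subset by auto
    have "card M \<ge> k" using H fH card_mono[of M H] by auto
    moreover have "card M \<le> 2 * k" using H card_Un_le[of H H'] by simp
    ultimately show "M \<in> T" using H by (auto simp: T_def subsets_def)
  qed
  have "(\<Sum>H\<in>G. \<Sum>H'\<in>G. f (H \<union> H')) = (\<Sum>x\<in>G \<times> G. f ((\<lambda>(H, H'). H \<union> H') x))"
    by (simp add: sum.cartesian_product case_prod_unfold)
  also have "\<dots> = (\<Sum>M\<in>T. \<Sum>x\<in>{x\<in>G \<times> G. (\<lambda>(H, H'). H \<union> H') x = M}. f ((\<lambda>(H, H'). H \<union> H') x))"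
    using fG fT sub by (intro sum.group[symmetric]) auto
  also have "\<dots> = (\<Sum>M\<in>T. real (card {x\<in>G \<times> G. (\<lambda>(H, H'). H \<union> H') x = M}) * f M)"
    by (intro sum.cong refl) simp
  also have "\<dots> \<le> (\<Sum>M\<in>T. 16 ^ k * f M)"
  proof (intro sum_mono mult_right_mono f)
    fix M assume "M \<in> T"
    hence M: "finite M" "card M \<le> 2 * k" using S finite_subset by (auto simp: T_def subsets_def)
    have "card {x\<in>G \<times> G. (\<lambda>(H, H'). H \<union> H') x = M} \<le> card (Pow M \<times> Pow M)" using M by (intro card_mono) auto
    also have "\<dots> = 2 ^ card M * 2 ^ card M" using M by (simp add: card_cartesian_product card_Pow)
    also have "\<dots> = 4 ^ card M" by (simp add: power_mult_distrib[symmetric])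
    also have "\<dots> \<le> 4 ^ (2 * k)" using M by (intro power_increasing) auto
    also have "\<dots> = 16 ^ k" by (simp add: power_mult)
    finally have "real (card {x\<in>G \<times> G. (\<lambda>(H, H'). H \<union> H') x = M}) \<le> real (16 ^ k)" by (simp only: of_nat_le_iff)
    thus "real (card {x\<in>G \<times> G. (\<lambda>(H, H'). H \<union> H') x = M}) \<le> 16 ^ k" by simp
  qed
  also have "\<dots> = 16 ^ k * (\<Sum>M\<in>T. f M)" by (simp add: sum_distrib_left)
  also have "(\<Sum>M\<in>T. f M) = (\<Sum>m=k..2*k. \<Sum>M\<in>subsets S m. f M)"
    unfolding T_def using S by (intro sum.UNION_disjoint) (auto simp: finite_subsets subsets_def)
  finally show ?thesis by simp
qed

text \<open>Bad primes only accumulate under unions, so the union imposes no condition beyond those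
  of its two parts.\<close>

lemma rough_Un: "rough D z H n \<and> rough D z H' n \<Longrightarrow> rough D z (H \<union> H') n"
  unfolding rough_def badp_def by auto

subsection \<open>Prime triples in short intervals\<close>

text \<open>The first moment is at least of order \<open>\<delta> ^ k * N\<close>, as there are
  about \<open>(\<delta> * l) ^ k\<close> tuples each giving \<open>N / l ^ k\<close>. The second
  moment is at most of order \<open>N\<close>, by \<open>n ^ m \<le> l ^ m\<close> and the averaged
  singular series. Their quotient yields \<open>\<delta> ^ (2 * k) * N\<close>.\<close>

lemma second_moment_bound:
  fixes D k n :: nat and Y XX :: "nat set" and N l c C \<delta> z :: real and T :: "nat set \<Rightarrow> nat \<Rightarrow> bool"
  defines "S \<equiv> grid (primorial D) n"
  defines "G \<equiv> {H\<in>subsets S k. real k * (\<Sum>p\<in>badp D H. 1 / real p) \<le> 1 / 20}"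
  assumes k: "k \<ge> 2" "k \<le> n" and D: "40 * k * k ^ k \<le> D" "4 * (2 * k) ^ 3 \<le> D" "D \<ge> 1"
    and pos: "c > 0" "C > 0" "N > 0" "l > 0" and \<delta>: "\<delta> > 0" "\<delta> * l \<le> real n" "real n \<le> l"
    and Y: "finite Y" "XX \<subseteq> Y" "\<And>x H. x \<in> Y \<Longrightarrow> H \<in> G \<Longrightarrow> T H x \<Longrightarrow> x \<in> XX"
    and lower: "\<And>H. H \<in> G \<Longrightarrow> c * N / l ^ k \<le> real (card {x\<in>Y. rough D z H x \<and> T H x})"
    and upper: "\<And>m M. m \<in> {k..2*k} \<Longrightarrow> M \<in> subsets S m \<Longrightarrow>
      real (card {x\<in>Y. rough D z M x}) \<le> C * (\<Prod>p\<in>badp D M. 1 / (1 - 1 / real p)) ^ m * N / l ^ m"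
  shows "c\<^sup>2 / (12 * real (k + 1) * 16 ^ k * C * real k ^ (2 * k)) * \<delta> ^ (2 * k) * N \<le> real (card XX)"
proof -
  have S: "finite S" using grid_card[OF primorial_pos] by (auto simp: S_def)
  have fG: "finite G" unfolding G_def using finite_subsets[OF S] by simp
  have GS: "G \<subseteq> subsets S k" by (auto simp: G_def)
  have cG: "(real n / real k) ^ k / 2 \<le> real (card G)"
    unfolding G_def S_def by (rule card_good_subsets_ge[OF k D(1,3)])
  define L where "L = (\<Sum>H\<in>G. real (card {x\<in>Y. rough D z H x \<and> T H x}))"
  define U where "U = (\<Sum>H\<in>G. \<Sum>H'\<in>G. real (card {x\<in>Y. rough D z H x \<and> rough D z H' x}))"
  have L: "(\<delta> / real k) ^ k * c * N / 2 \<le> L"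
  proof -
    have "(\<delta> / real k) ^ k * c * N / 2 = (\<delta> * l / real k) ^ k / 2 * (c * N / l ^ k)"
      using pos by (simp add: power_mult_distrib power_divide)
    also have "\<dots> \<le> (real n / real k) ^ k / 2 * (c * N / l ^ k)"
      using \<delta> pos by (intro mult_right_mono divide_right_mono power_mono) auto
    also have "\<dots> \<le> real (card G) * (c * N / l ^ k)" using cG pos by (intro mult_right_mono) auto
    also have "\<dots> = (\<Sum>H\<in>G. c * N / l ^ k)" by simp
    also have "\<dots> \<le> L" unfolding L_def by (intro sum_mono lower)
    finally show ?thesis .
  qed
  have U: "U \<le> 16 ^ k * (real (k + 1) * (3 * C * N))"
  proof -
    define f where "f M = real (card {x\<in>Y. rough D z M x})" for M
    have "U \<le> (\<Sum>H\<in>G. \<Sum>H'\<in>G. f (H \<union> H'))"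
      unfolding U_def f_def using Y(1) rough_Un by (intro sum_mono of_nat_mono card_mono) auto
    also have "\<dots> \<le> 16 ^ k * (\<Sum>m=k..2*k. \<Sum>M\<in>subsets S m. f M)"
      by (rule sum_unions_le[OF S _ GS]) (simp add: f_def)
    also have "\<dots> \<le> 16 ^ k * (\<Sum>m=k..2*k. 3 * C * N)"
    proof (intro mult_left_mono sum_mono)
      fix m assume m: "m \<in> {k..2*k}"
      have "(\<Sum>M\<in>subsets S m. f M) \<le> (\<Sum>M\<in>subsets S m. C * N / l ^ m * (\<Prod>p\<in>badp D M. 1 / (1 - 1 / real p)) ^ m)"
      proof (rule sum_mono)
        fix M assume M: "M \<in> subsets S m"
        show "f M \<le> C * N / l ^ m * (\<Prod>p\<in>badp D M. 1 / (1 - 1 / real p)) ^ m"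
          using upper[OF m M] unfolding f_def by (simp only: mult_ac times_divide_eq_right times_divide_eq_left)
      qed
      also have "\<dots> = C * N / l ^ m * (\<Sum>M\<in>subsets S m. (\<Prod>p\<in>badp D M. 1 / (1 - 1 / real p)) ^ m)"
        by (rule sum_distrib_left[symmetric])
      also have "\<dots> \<le> C * N / l ^ m * (3 * real n ^ m)"
      proof (rule mult_left_mono)
        have m3: "m ^ 3 \<le> (2 * k) ^ 3" using m by (intro power_mono) auto
        show "(\<Sum>M\<in>subsets S m. (\<Prod>p\<in>badp D M. 1 / (1 - 1 / real p)) ^ m) \<le> 3 * real n ^ m"
          unfolding S_def using m k by (intro sum_singular_series_le[OF _ m3 D(2,3)]) auto
        show "0 \<le> C * N / l ^ m" using pos by auto
      qed
      also have "\<dots> \<le> C * N / l ^ m * (3 * l ^ m)"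
        using pos \<delta> by (intro mult_left_mono power_mono) auto
      also have "\<dots> = 3 * C * N" using pos by simp
      finally show "(\<Sum>M\<in>subsets S m. f M) \<le> 3 * C * N" .
    qed simp
    also have "(\<Sum>m=k..2*k. 3 * C * N) = real (k + 1) * (3 * C * N)"
    proof -
      have "card {k..2*k} = k + 1" by simp
      thus ?thesis by (simp only: sum_constant)
    qed
    finally show ?thesis .
  qed
  define X where "X = real (card XX)"
  define Q where "Q = 16 ^ k * (real (k + 1) * (3 * C))"
  have Q0: "Q > 0" unfolding Q_def using pos by simp
  have k0: "real k > 0" using k by simp
  have "((\<delta> / real k) ^ k * c * N / 2)\<^sup>2 \<le> L\<^sup>2"
    using L pos \<delta> k0 by (intro power_mono) auto
  also have "\<dots> \<le> X * U" unfolding L_def U_def X_def by (rule double_counting[OF fG Y])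
  also have "\<dots> \<le> X * (Q * N)" using U unfolding X_def Q_def by (intro mult_left_mono) (auto simp: mult_ac)
  finally have "((\<delta> / real k) ^ k * c * N / 2)\<^sup>2 \<le> X * Q * N" by (simp only: mult.assoc)
  moreover have "(a * c * N / 2)\<^sup>2 = (a * c / 2)\<^sup>2 * N * N" for a by (simp add: power2_eq_square)
  ultimately have "((\<delta> / real k) ^ k * c / 2)\<^sup>2 * N * N \<le> X * Q * N" by (simp only:)
  hence 1: "((\<delta> / real k) ^ k * c / 2)\<^sup>2 * N \<le> X * Q" using pos by simp
  have "((\<delta> / real k) ^ k * c / 2)\<^sup>2 = c\<^sup>2 * \<delta> ^ (2 * k) / (4 * real k ^ (2 * k))"
    by (simp add: power_mult_distrib power_divide power_mult[symmetric] mult.commute)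
  hence "c\<^sup>2 * \<delta> ^ (2 * k) / (4 * real k ^ (2 * k)) * N \<le> X * Q" using 1 by (simp only:)
  hence "c\<^sup>2 * \<delta> ^ (2 * k) / (4 * real k ^ (2 * k)) * N / Q \<le> X" using Q0 by (simp only: pos_divide_le_eq)
  also have "c\<^sup>2 * \<delta> ^ (2 * k) / (4 * real k ^ (2 * k)) * N / Q
      = c\<^sup>2 / (12 * real (k + 1) * 16 ^ k * C * real k ^ (2 * k)) * \<delta> ^ (2 * k) * N"
  proof -
    have "c2 * d / (4 * K) * N / (s * (r * (3 * C))) = c2 / (12 * r * s * C * K) * d * N" for c2 d K s r :: real
      by (simp add: divide_divide_eq_left mult_ac)
    thus ?thesis unfolding Q_def .
  qed
  finally show ?thesis unfolding X_def .
qed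

text \<open>\<open>k\<close>, \<open>D\<close> and \<open>c\<close> are fixed before
  \<open>\<eta>\<close>; only the threshold for \<open>N\<close> may depend on
  \<open>\<eta>\<close>. This separation is what makes the final exponent \<open>2 * k\<close> a
  constant.\<close>

lemma prime_triples_density:
  assumes EH: Elliott_Halberstam
  obtains k :: nat and c :: real where "c > 0"
    "\<And>\<eta>. 0 < \<eta> \<Longrightarrow> \<eta> < 1 \<Longrightarrow> eventually (\<lambda>N. c * \<eta> ^ (2 * k) * real N \<le>
       real (card {x\<in>{N<..2*N}. 3 \<le> card {q. prime q \<and> x < q \<and> real q \<le> real x + \<eta> * ln (real N)}})) sequentially"
proof -
  obtain A :: real and k :: nat where A: "A > 0" and k: "k \<ge> 2" and c1: "24 * real k * (1 + A) * ln (1 + A) \<le> A\<^sup>2"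
    and c2: "98304 * A\<^sup>2 \<le> real k * (1 + A) * (ln (1 + A / 4))\<^sup>2" by (rule exists_maynard_parameters)
  \<comment> \<open>One \<open>D\<close> serves all sieve dimensions up to \<open>2 * k\<close>; the
    summands are the lower bounds demanded by the preceding estimates.\<close>
  define D where "D = 35 * k\<^sup>2 + 10 * (2 * k + 1) + 2 * (2 * k + (2 * k)\<^sup>2) + 4 * (2 * k) ^ 3 + 40 * k * k ^ k"
  have D: "D \<ge> 35 * k\<^sup>2" "D \<ge> 10 * (k + 1)" "40 * k * k ^ k \<le> D" "4 * (2 * k) ^ 3 \<le> D" "D \<ge> 1"
    "D \<ge> 10 * (2 * k + 1)" "D \<ge> 2 * (2 * k + (2 * k)\<^sup>2)"
    unfolding D_def by simp_all
  define W where "W = primorial D"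
  have W: "W \<ge> 1" "real W \<ge> 1" using primorial_pos by (auto simp: W_def)
  define \<xi> where "\<xi> = 1 / (32 * real k * (1 + A))"
  have \<xi>: "0 < \<xi>" "\<xi> \<le> 1 / 8"
  proof -
    show "0 < \<xi>" using A k by (simp add: \<xi>_def)
    have "8 * 1 \<le> 32 * real k * (1 + A)" using A k by (intro mult_mono) auto
    hence "8 \<le> 32 * real k * (1 + A)" by simp
    thus "\<xi> \<le> 1 / 8" unfolding \<xi>_def by (intro divide_left_mono) auto
  qed
  define bound where "bound C m N \<longleftrightarrow> (\<forall>H. finite H \<longrightarrow> card H = m \<longrightarrow>
     real (card {n\<in>{N<..2*N}. [n = 1] (mod primorial D) \<and> rough D (real N powr \<xi>) H n})
     \<le> C * (\<Prod>p\<in>badp D H. 1 / (1 - 1 / real p)) ^ m * real N / ln (real N) ^ m)" for C :: real and m N :: nat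
  \<comment> \<open>A union of two \<open>k\<close>-subsets has between \<open>k\<close> and
    \<open>2 * k\<close> elements. Summing the finitely many constants gives one \<open>C\<close>
    for all of them.\<close>
  have "\<forall>m\<in>{k..2*k}. \<exists>C>0. eventually (bound C m) sequentially"
  proof
    fix m assume m: "m \<in> {k..2*k}"
    have m2: "m\<^sup>2 \<le> (2 * k)\<^sup>2" using m by (intro power_mono) auto
    have "m \<ge> 1" "D \<ge> 10 * (m + 1)" using m k D(6) by auto
    moreover have "2 * (m + m\<^sup>2) \<le> D" using m m2 D(7) by (simp del: power_mult_distrib)
    ultimately show "\<exists>C>0. eventually (bound C m) sequentially" unfolding bound_def using rough_upper[OF _ _ _ \<xi>] by blast
  qed
  then obtain Cf where Cf: "\<forall>m\<in>{k..2*k}. Cf m > 0 \<and> eventually (bound (Cf m) m) sequentially"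
    using bchoice[of "{k..2*k}" "\<lambda>m C. C > 0 \<and> eventually (bound C m) sequentially"] by blast
  define C where "C = (\<Sum>m\<in>{k..2*k}. Cf m)"
  have CfC: "Cf m \<le> C" if "m \<in> {k..2*k}" for m
  proof -
    have "0 \<le> Cf i" if "i \<in> {k..2*k}" for i using Cf that less_imp_le by blast
    thus ?thesis unfolding C_def using that by (intro member_le_sum) simp_all
  qed
  have kk2: "k \<in> {k..2*k}" by simp
  have "Cf k > 0" using Cf kk2 by blast
  hence C0: "C > 0" using CfC[OF kk2] by linarith
  have evU: "eventually (\<lambda>N. \<forall>m\<in>{k..2*k}. bound (Cf m) m N) sequentially"
    using Cf by (intro eventually_ball_finite) auto
  have k1: "k \<ge> 1" using k by simp
  obtain c where c: "c > 0" "eventually (\<lambda>N. \<forall>H. finite H \<longrightarrow> card H = k \<longrightarrow> (\<forall>h\<in>H. primorial D dvd h \<and> real h \<le> ln (real N)) \<longrightarrow>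
     real k * (\<Sum>p\<in>badp D H. 1 / real p) \<le> 1 / 20 \<longrightarrow>
     c * real N / ln (real N) ^ k \<le> real (card {n\<in>{N<..2*N}. [n = 1] (mod primorial D) \<and> rough D (real N powr \<xi>) H n \<and> 3 \<le> card {h\<in>H. prime (n + h)}})) sequentially"
    by (rule maynard_count[OF EH A k1 c1 c2 D(1,2) \<xi>_def])
  define c' where "c' = c\<^sup>2 / (12 * real (k + 1) * 16 ^ k * C * real k ^ (2 * k)) / (2 * real W) ^ (2 * k)"
  show ?thesis
  proof (rule that)
    show "c' > 0" unfolding c'_def using c(1) C0 k W by (intro divide_pos_pos mult_pos_pos zero_less_power) auto
    fix \<eta> :: real assume \<eta>: "0 < \<eta>" "\<eta> < 1"
    show "eventually (\<lambda>N. c' * \<eta> ^ (2 * k) * real N \<le>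
       real (card {x\<in>{N<..2*N}. 3 \<le> card {q. prime q \<and> x < q \<and> real q \<le> real x + \<eta> * ln (real N)}})) sequentially"
      using c(2) evU eventually_ln_ge[of "2 * real k * real W / \<eta>"] eventually_ln_ge[of 1] eventually_gt_at_top[of 0]
    proof eventually_elim
      case (elim N)
      define l where "l = ln (real N)"
      have l1: "l \<ge> 1" using elim(4) by (simp add: l_def)
      \<comment> \<open>With \<open>n\<close> the floor of \<open>x\<close>, the grid of
        \<open>n\<close> multiples of \<open>W\<close> lies in an interval of length
        \<open>\<eta> * l\<close>. The bound \<open>x \<ge> 2 * k\<close> ensures
        \<open>k \<le> n\<close> and \<open>x / 2 \<le> n\<close>, hence the choice
        \<open>\<eta> / (2 * W)\<close> for \<open>\<delta>\<close>.\<close>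
      define x where "x = \<eta> * l / real W"
      have x2k: "x \<ge> 2 * real k"
        using elim(3) \<eta> W unfolding x_def l_def by (simp add: pos_divide_le_eq pos_le_divide_eq mult.commute)
      define n where "n = nat \<lfloor>x\<rfloor>"
      have kk: "real k \<ge> 2" using k by simp
      have n: "real n \<le> x" "x < real n + 1" using x2k kk by (auto simp: n_def)
      have Wn: "real W * real n \<le> \<eta> * l" using n(1) W by (simp add: x_def pos_le_divide_eq mult.commute)
      have \<eta>l: "\<eta> * l \<le> l" using \<eta> l1 by simp
      have "real k < real n + 1" using n x2k kk by linarith
      hence kn: "k \<le> n" by linarith
      have xl: "x \<le> l"
      proof -
        have "\<eta> * l / real W \<le> \<eta> * l / 1" using W \<eta> l1 by (intro divide_left_mono) auto
        thus ?thesis using \<eta>l by (simp add: x_def)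
      qed
      define Y where "Y = {m\<in>{N<..2*N}. [m = 1] (mod primorial D)}"
      define XX where "XX = {m\<in>Y. 3 \<le> card {q. prime q \<and> m < q \<and> real q \<le> real m + \<eta> * l}}"
      define T where "T = (\<lambda>H m. 3 \<le> card {h\<in>H. prime (m + h :: nat)})"
      define G where "G = {H\<in>subsets (grid (primorial D) n) k. real k * (\<Sum>p\<in>badp D H. 1 / real p) \<le> 1 / 20}"
      have gr: "primorial D dvd h \<and> 1 \<le> h \<and> real h \<le> \<eta> * l" if h: "h \<in> grid (primorial D) n" for h
      proof -
        obtain a where a: "h = W * a" "1 \<le> a" "a \<le> n" using h unfolding grid_def W_def[symmetric] image_iff Bex_def atLeastAtMost_iff by blast
        have "real W * real a \<le> real W * real n" using a by (intro mult_left_mono) auto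
        hence "real h \<le> \<eta> * l" using Wn unfolding a(1) of_nat_mult by (rule order.trans)
        thus ?thesis using a W unfolding W_def[symmetric] by auto
      qed
      have GH: "finite H" "card H = k" "H \<subseteq> grid (primorial D) n" "real k * (\<Sum>p\<in>badp D H. 1 / real p) \<le> 1 / 20" if "H \<in> G" for H
        using that grid_card[OF primorial_pos, of D n] finite_subset by (auto simp: G_def subsets_def)
      have "c\<^sup>2 / (12 * real (k + 1) * 16 ^ k * C * real k ^ (2 * k)) * (\<eta> / (2 * real W)) ^ (2 * k) * real N \<le> real (card XX)"
      proof (rule second_moment_bound[where n = n and D = D and Y = Y and T = T and l = l and z = "real N powr \<xi>"])
        show "k \<ge> 2" "k \<le> n" "40 * k * k ^ k \<le> D" "4 * (2 * k) ^ 3 \<le> D" "D \<ge> 1" "c > 0" "C > 0" by fact+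
        show "real N > 0" using elim(5) by simp
        show "l > 0" using l1 by simp
        show "\<eta> / (2 * real W) > 0" using \<eta> W by simp
        have "\<eta> / (2 * real W) * l = x / 2" by (simp add: x_def)
        thus "\<eta> / (2 * real W) * l \<le> real n" using n x2k kk by linarith
        show "real n \<le> l" using n xl by linarith
        show "finite Y" "XX \<subseteq> Y" by (auto simp: Y_def XX_def)
        show "m \<in> XX" if "m \<in> Y" "H \<in> {H\<in>subsets (grid (primorial D) n) k. real k * (\<Sum>p\<in>badp D H. 1 / real p) \<le> 1 / 20}" "T H m" for m H
        proof -
          have H: "H \<in> G" using that by (simp add: G_def)
          have "finite {q. prime q \<and> m < q \<and> real q \<le> real m + \<eta> * l}"
          proof (rule finite_subset)
            show "{q. prime q \<and> m < q \<and> real q \<le> real m + \<eta> * l} \<subseteq> {..nat \<lfloor>real m + \<eta> * l\<rfloor>}"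
              using le_nat_floor by blast
          qed simp
          moreover have "(\<lambda>h. m + h) ` {h\<in>H. prime (m + h)} \<subseteq> {q. prime q \<and> m < q \<and> real q \<le> real m + \<eta> * l}"

          proof (intro image_subsetI CollectI)
            fix h assume "h \<in> {h\<in>H. prime (m + h)}"
            thus "prime (m + h) \<and> m < m + h \<and> real (m + h) \<le> real m + \<eta> * l" using gr[of h] GH(3)[OF H] by auto
          qed
          ultimately have "card ((\<lambda>h. m + h) ` {h\<in>H. prime (m + h)}) \<le> card {q. prime q \<and> m < q \<and> real q \<le> real m + \<eta> * l}"
            by (rule card_mono)
          also have "card ((\<lambda>h. m + h) ` {h\<in>H. prime (m + h)}) = card {h\<in>H. prime (m + h)}"
            by (rule card_image) (auto simp: inj_on_def)
          finally show "m \<in> XX" using that(1,3) by (simp add: XX_def T_def)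
        qed
        show "c * real N / l ^ k \<le> real (card {m\<in>Y. rough D (real N powr \<xi>) H m \<and> T H m})"
          if "H \<in> {H\<in>subsets (grid (primorial D) n) k. real k * (\<Sum>p\<in>badp D H. 1 / real p) \<le> 1 / 20}" for H
        proof -
          have H: "H \<in> G" using that by (simp add: G_def)
          have e: "{m\<in>Y. rough D (real N powr \<xi>) H m \<and> T H m} = {n\<in>{N<..2*N}. [n = 1] (mod primorial D) \<and> rough D (real N powr \<xi>) H n \<and> 3 \<le> card {h\<in>H. prime (n + h)}}"
            by (auto simp: Y_def T_def)
          have "\<forall>h\<in>H. primorial D dvd h \<and> real h \<le> ln (real N)"

          proof
            fix h assume "h \<in> H"
            thus "primorial D dvd h \<and> real h \<le> ln (real N)"
              using gr[of h] GH(3)[OF H] \<eta>l unfolding l_def by auto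
          qed
          thus ?thesis unfolding e l_def using elim(1) GH[OF H] by blast
        qed
        show "real (card {m\<in>Y. rough D (real N powr \<xi>) M m}) \<le> C * (\<Prod>p\<in>badp D M. 1 / (1 - 1 / real p)) ^ m * real N / l ^ m"
          if m: "m \<in> {k..2*k}" and M: "M \<in> subsets (grid (primorial D) n) m" for m M
        proof -
          have fM: "finite M" "card M = m" using M grid_card[OF primorial_pos, of D n] finite_subset by (auto simp: subsets_def)
          have e: "{j\<in>Y. rough D (real N powr \<xi>) M j} = {n\<in>{N<..2*N}. [n = 1] (mod primorial D) \<and> rough D (real N powr \<xi>) M n}"
            by (auto simp: Y_def)
          have P0: "(\<Prod>p\<in>badp D M. 1 / (1 - 1 / real p)) \<ge> 0"
          proof (rule prod_nonneg)
            fix p assume "p \<in> badp D M"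
            hence "p > 1" using prime_gt_1_nat by (auto simp: badp_def)
            thus "0 \<le> 1 / (1 - 1 / real p)" by simp
          qed
          have "real (card {j\<in>Y. rough D (real N powr \<xi>) M j}) \<le> Cf m * (\<Prod>p\<in>badp D M. 1 / (1 - 1 / real p)) ^ m * real N / l ^ m"
            unfolding e l_def using elim(2) m fM unfolding bound_def by blast
          also have "\<dots> \<le> C * (\<Prod>p\<in>badp D M. 1 / (1 - 1 / real p)) ^ m * real N / l ^ m"
            using CfC[OF m] P0 l1 by (intro divide_right_mono mult_right_mono zero_le_power) auto
          finally show ?thesis .
        qed
      qed
      also have "real (card XX) \<le> real (card {m\<in>{N<..2*N}. 3 \<le> card {q. prime q \<and> m < q \<and> real q \<le> real m + \<eta> * ln (real N)}})"
        unfolding of_nat_le_iff XX_def Y_def l_def by (intro card_mono) auto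
      finally show ?case unfolding c'_def by (simp add: power_divide)
    qed
  qed
qed

text \<open>If three primes lie in \<open>(x, x + t]\<close>, the first prime after \<open>x\<close>
  and the second prime following it differ by at most \<open>t\<close>. Each such first prime comes
  from at most \<open>t\<close> values of \<open>x\<close>; the additional 1 accounts for
  \<open>x\<close> whose next prime lies beyond \<open>2 * N\<close>.\<close>

lemma prime_triples_le_gaps:
  fixes t :: real and N :: nat
  assumes t: "t \<ge> 0"
  shows "real (card {x\<in>{N<..2*N}. 3 \<le> card {q. prime q \<and> x < q \<and> real q \<le> real x + t}}) \<le>
     (real (card {j. 1 \<le> j \<and> N < nth_prime j \<and> nth_prime j \<le> 2 * N \<and> real (nth_prime (j + 2)) - real (nth_prime j) \<le> t}) + 1) * t"
proof -
  define P where "P = {p::nat. prime p}"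
  have P: "infinite P" unfolding P_def by (rule primes_infinite)
  define J where "J = {j. 1 \<le> j \<and> N < nth_prime j \<and> nth_prime j \<le> 2 * N \<and> real (nth_prime (j + 2)) - real (nth_prime j) \<le> t}"
  have fJ: "finite J"
  proof (rule finite_subset[of _ "{..2 * N + 1}"])
    show "J \<subseteq> {..2 * N + 1}"
    proof
      fix j assume "j \<in> J"
      moreover have "j - 1 \<le> nth_prime j" unfolding nth_prime_def using le_enumerate[OF P] by (simp add: P_def)
      ultimately show "j \<in> {..2 * N + 1}" by (auto simp: J_def)
    qed
  qed simp
  define s where "s = nat \<lfloor>t\<rfloor>"
  have s: "real s \<le> t" using t by (simp add: s_def)
  \<comment> \<open>\<open>2 * N + 1\<close> stands in for a next prime beyond the interval: the
    corresponding \<open>x\<close> lie within distance \<open>t\<close> of it.\<close>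
  define V where "V = insert (2 * N + 1) (nth_prime ` J)"
  have "{x\<in>{N<..2*N}. 3 \<le> card {q. prime q \<and> x < q \<and> real q \<le> real x + t}} \<subseteq> (\<Union>v\<in>V. {v - s..<v})"
  proof
    fix x assume x: "x \<in> {x\<in>{N<..2*N}. 3 \<le> card {q. prime q \<and> x < q \<and> real q \<le> real x + t}}"
    define Q where "Q = {q. prime q \<and> x < q \<and> real q \<le> real x + t}"
    have Q3: "3 \<le> card Q" and xN: "N < x" "x \<le> 2 * N" using x by (auto simp: Q_def)
    have ex: "\<exists>i. x < enumerate P i"
      using le_enumerate[OF P, of "Suc x"] by (intro exI[of _ "Suc x"]) simp
    define i where "i = (LEAST i. x < enumerate P i)"
    have i: "x < enumerate P i" unfolding i_def by (rule LeastI_ex[OF ex])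
    have "\<not> Q \<subseteq> {enumerate P i, enumerate P (Suc i)}"
    proof
      assume "Q \<subseteq> {enumerate P i, enumerate P (Suc i)}"
      hence "card Q \<le> card {enumerate P i, enumerate P (Suc i)}" by (intro card_mono) auto
      also have "\<dots> \<le> 2" by (simp add: card_insert_if)
      finally show False using Q3 by simp
    qed
    then obtain q where q: "q \<in> Q" "q \<noteq> enumerate P i" "q \<noteq> enumerate P (Suc i)" by blast
    have "q \<in> P" using q by (simp add: Q_def P_def)
    then obtain r where r: "enumerate P r = q" using enumerate_Ex[OF P] by blast
    have "i \<le> r" unfolding i_def using q(1) r by (intro Least_le) (simp add: Q_def)
    moreover have "r \<noteq> i" "r \<noteq> Suc i" using q r by auto
    ultimately have "i + 2 \<le> r" by linarith
    hence e2: "enumerate P (i + 2) \<le> q" unfolding r[symmetric] using P by simp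
    have e1: "enumerate P i \<le> enumerate P (i + 2)" using P by simp
    have qt: "real q \<le> real x + t" using q by (simp add: Q_def)
    have "real (enumerate P (i + 2)) \<le> real x + t" "real (enumerate P i) \<le> real x + t" using e1 e2 qt by linarith+
    note e3 = this
    have mem: "x \<in> {v - s..<v}" if "x < v" "v \<le> enumerate P i" for v
    proof -
      have "real (v - x) \<le> t" using that e3(2) by linarith
      hence "v - x \<le> s" unfolding s_def by (rule le_nat_floor)
      thus ?thesis using that by auto
    qed
    show "x \<in> (\<Union>v\<in>V. {v - s..<v})"
    proof (cases "enumerate P i \<le> 2 * N")
      case True
      \<comment> \<open>\<open>nth_prime\<close> counts from 1 and \<open>enumerate\<close> from 0,
        hence the index \<open>i + 1\<close>.\<close>
      have "i + 1 \<in> J" unfolding J_def nth_prime_def P_def[symmetric] using True i xN e3(1) by (simp add: eval_nat_numeral)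
      hence "enumerate P i \<in> V" unfolding V_def nth_prime_def P_def[symmetric] by force
      thus ?thesis using mem[OF i] by blast
    next
      case False
      hence "x \<in> {2 * N + 1 - s..<2 * N + 1}" using xN by (intro mem) auto
      thus ?thesis unfolding V_def by blast
    qed
  qed
  hence "card {x\<in>{N<..2*N}. 3 \<le> card {q. prime q \<and> x < q \<and> real q \<le> real x + t}} \<le> card (\<Union>v\<in>V. {v - s..<v})"
    using fJ by (intro card_mono) (auto simp: V_def)
  also have "\<dots> \<le> (\<Sum>v\<in>V. card {v - s..<v})" using fJ by (intro card_UN_le) (auto simp: V_def)
  also have "\<dots> \<le> (\<Sum>v\<in>V. s)" by (intro sum_mono) simp
  also have "\<dots> = card V * s" by simp
  also have "\<dots> \<le> (card J + 1) * s"
  proof (rule mult_right_mono)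
    have "card V \<le> Suc (card (nth_prime ` J))" unfolding V_def using fJ by (simp add: card_insert_if)
    thus "card V \<le> card J + 1" using card_image_le[OF fJ, of nth_prime] by linarith
  qed simp
  finally have "real (card {x\<in>{N<..2*N}. 3 \<le> card {q. prime q \<and> x < q \<and> real q \<le> real x + t}}) \<le> real ((card J + 1) * s)"
    by (simp only: of_nat_le_iff)
  also have "\<dots> \<le> (real (card J) + 1) * t" using s by (simp only: of_nat_mult of_nat_add of_nat_1) (intro mult_left_mono, auto)
  finally show ?thesis unfolding J_def .
qed

theorem theorem5:
  assumes "Elliott_Halberstam"
  shows "\<exists>\<eta>\<^sub>0>0. \<forall>\<eta>::real. 0 < \<eta> \<and> \<eta> < \<eta>\<^sub>0 \<longrightarrow>
    liminf (\<lambda>N::nat. ereal (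
        real (card {j. 1 \<le> j \<and> N < nth_prime j \<and> nth_prime j \<le> 2 * N \<and>
                real (nth_prime (j + 2)) - real (nth_prime j) \<le> \<eta> * ln (real N)})
        / (real N / ln (real N))))
    \<ge> ereal (exp (5 * (1 / \<eta>\<^sup>2) * ln \<eta>))"
proof -
  obtain k :: nat and c :: real where c: "c > 0" and
    dens: "\<And>\<eta>. 0 < \<eta> \<Longrightarrow> \<eta> < 1 \<Longrightarrow> eventually (\<lambda>N. c * \<eta> ^ (2 * k) * real N \<le>
       real (card {x\<in>{N<..2*N}. 3 \<le> card {q. prime q \<and> x < q \<and> real q \<le> real x + \<eta> * ln (real N)}})) sequentially"
    by (rule prime_triples_density[OF assms]) blast
  \<comment> \<open>\<open>1 / 2\<close> keeps \<open>\<eta> < 1\<close>, \<open>c / 2\<close> lets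
    one factor \<open>\<eta>\<close> pay for the constant with half to spare, and
    \<open>1 / (2 * k + 1)\<close> gives
    \<open>2 * k + 1 \<le> 1 / \<eta> \<le> 5 / \<eta>^2\<close>; as \<open>ln \<eta>\<close> is
    negative, the larger exponent gives the smaller bound.\<close>
  define \<eta>\<^sub>0 where "\<eta>\<^sub>0 = min (1 / 2) (min (c / 2) (1 / real (2 * k + 1)))"
  have \<eta>0: "\<eta>\<^sub>0 > 0" unfolding \<eta>\<^sub>0_def using c by simp
  show ?thesis
  proof (intro exI[of _ \<eta>\<^sub>0] conjI allI impI \<eta>0)
    fix \<eta> :: real assume \<eta>: "0 < \<eta> \<and> \<eta> < \<eta>\<^sub>0"
    have h: "0 < \<eta>" "\<eta> < 1" "\<eta> \<le> c / 2" "\<eta> \<le> 1 / real (2 * k + 1)" using \<eta> by (auto simp: \<eta>\<^sub>0_def)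
    define J where "J N = card {j. 1 \<le> j \<and> N < nth_prime j \<and> nth_prime j \<le> 2 * N \<and>
                real (nth_prime (j + 2)) - real (nth_prime j) \<le> \<eta> * ln (real N)}" for N
    define g where "g = c * \<eta> ^ (2 * k)"
    have g: "g > 0" using c h by (simp add: g_def)
    have "exp (5 * (1 / \<eta>\<^sup>2) * ln \<eta>) \<le> exp (real (2 * k + 1) * ln \<eta>)"
    proof -
      have "real (2 * k + 1) \<le> 1 / \<eta>" using h by (simp add: pos_le_divide_eq mult.commute)
      also have "\<dots> \<le> 1 / \<eta>\<^sup>2" using h by (intro divide_left_mono) (auto simp: power2_eq_square)
      also have "\<dots> \<le> 5 * (1 / \<eta>\<^sup>2)" using zero_le_power2[of "1 / \<eta>"] by (simp only: power_one_over)
      finally have "5 * (1 / \<eta>\<^sup>2) * ln \<eta> \<le> real (2 * k + 1) * ln \<eta>" using h by (intro mult_right_mono_neg) auto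
      thus ?thesis by simp
    qed
    also have "\<dots> = exp (ln \<eta>) ^ (2 * k + 1)" by (rule exp_of_nat_mult)
    also have "\<dots> = \<eta> * \<eta> ^ (2 * k)" using h by simp
    also have "\<dots> \<le> g / 2" unfolding g_def using mult_right_mono[OF h(3), of "\<eta> ^ (2 * k)"] h by simp
    finally have e: "exp (5 * (1 / \<eta>\<^sup>2) * ln \<eta>) \<le> g / 2" .
    have "eventually (\<lambda>N. ereal (exp (5 * (1 / \<eta>\<^sup>2) * ln \<eta>)) \<le> ereal (real (J N) / (real N / ln (real N)))) sequentially"
      using dens[OF h(1,2)] eventually_log_power_le[of 1 "2 / g" 1, simplified] eventually_ln_ge[of 1] eventually_gt_at_top[of 0]
    proof eventually_elim
      case (elim N)
      define l where "l = ln (real N)"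
      have l: "l \<ge> 1" using elim(3) by (simp add: l_def)
      have "g * real N \<le> (real (J N) + 1) * (\<eta> * l)"
        using elim(1) prime_triples_le_gaps[of "\<eta> * l" N] h l unfolding J_def g_def l_def by simp
      also have "\<dots> \<le> (real (J N) + 1) * l" using h l by (intro mult_left_mono) auto
      finally have 1: "g * real N \<le> real (J N) * l + l" by (simp add: distrib_right)
      \<comment> \<open>For large \<open>N\<close> half of \<open>g * N\<close> absorbs the term
        \<open>l\<close> caused by the end of the interval, which is why only \<open>g / 2\<close>
        is claimed.\<close>
      have "2 * l \<le> g * real N" using elim(2) g unfolding l_def by (simp add: pos_divide_le_eq mult.commute)
      hence "g / 2 * real N \<le> real (J N) * l" using 1 by simp
      hence "g / 2 \<le> real (J N) * l / real N" using elim(4) by (simp add: pos_le_divide_eq)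
      hence "g / 2 \<le> real (J N) / (real N / ln (real N))" by (simp add: l_def)
      thus ?case using e unfolding ereal_less_eq by (rule order.trans[rotated])
    qed
    thus "liminf (\<lambda>N. ereal (real (card {j. 1 \<le> j \<and> N < nth_prime j \<and> nth_prime j \<le> 2 * N \<and>
                real (nth_prime (j + 2)) - real (nth_prime j) \<le> \<eta> * ln (real N)}) / (real N / ln (real N))))
       \<ge> ereal (exp (5 * (1 / \<eta>\<^sup>2) * ln \<eta>))"
      unfolding J_def by (rule Liminf_bounded)
  qed
qed

end
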